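(* Let $B\subset A$ be an inclusion of simple unital $C^*$-algebras admitting a conditional expectation $A\to B$ of finite index, with tower of $C^*$-basic constructions $B\subset A\subset A_1\subset A_2\subset\cdots$. Then the Fourier transform $$\mathcal{F}=\mathcal{F}_1:B'\cap A_1\to A'\cap A_2,\quad \mathcal{F}(x)=\tau^{-3/2}E^{B'\cap A_2}_{A'\cap A_2}(xe_2e_1),$$ and its inverse $\mathcal{F}^{-1}:A'\cap A_2\to B'\cap A_1$, $\mathcal{F}^{-1}(x)=\tau^{-3/2}E_2(xe_1e_2)$, are isometries with respect to the norm $\|x\|_2=\mathrm{tr}(x^*x)^{1/2}$.
   Context: Inclusions of unital $C^*$-algebras have common identity. A conditional expectation $E:A\to B$ is a positive norm-one projection onto $B$ with $E(axb)=aE(x)b$ for $a,b\in B$, $x\in A$. It has finite index if there is a finite set $\{\lambda_i\}\subset A$ (a quasi-basis) with $x=\sum_i\lambda_iE(\lambda_i^*x)=\sum_iE(x\lambda_i)\lambda_i^*$ for all $x\in A$; then $\mathrm{Ind}(E)=\sum_i\lambda_i\lambda_i^*$, independent of the quasi-basis. If $A,B$ are simple unital and a finite-index conditional expectation exists, all finite-index ones have scalar index and there is a unique one $E_0=E^A_B$ of minimal index; $[A:B]_0:=\mathrm{Ind}(E^A_B)$ and $\tau:=[A:B]_0^{-1}$. Basic construction: $A$ is a Hilbert $B$-module with $\langle x,y\rangle_B=E_0(x^*y)$; $A$ acts by left multiplication; $e_1$ is the projection $x\mapsto E_0(x)$; $A_1$ is the $C^*$-algebra of adjointable $B$-linear maps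 on $A$ generated by $A$ and $e_1$. It is simple and unital, with minimal (dual) conditional expectation $E_1:A_1\to A$, $E_1(xe_1y)=\tau xy$ for $x,y\in A$, and $[A_1:A]_0=[A:B]_0$. Iterating, with $A_{-1}=B$, $A_0=A$, one gets the tower with minimal conditional expectations $E_k:A_k\to A_{k-1}$ and Jones projections $e_k\in A_k$ implementing $E_{k-1}$. The relative commutants $B'\cap A_k$ are finite dimensional, and $\mathrm{tr}=(E_0\circ E_1\circ\cdots\circ E_k)|_{B'\cap A_k}$ are consistent faithful tracial states on them; $A'\cap A_2\subset B'\cap A_2$ carries the restriction of $\mathrm{tr}$. $E^{B'\cap A_2}_{A'\cap A_2}$ is the $\mathrm{tr}$-preserving conditional expectation. *)

theory Defs
  imports
    "HOL-Analysis.Abstract_Metric_Spaces"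
    "HOL-Algebra.Module"
    "HOL-Algebra.Ideal"
    "HOL-Algebra.Subrings"
    "HOL-Algebra.Algebraic_Closure_Type"
begin

section \<open>Unital C*-algebras\<close>

text \<open>The basic construction turns an algebra over \<open>'a\<close> into one over \<open>'a \<Rightarrow> 'a\<close>, so
  C*-algebras are explicit-carrier structures. The field \<open>smult\<close> inherited from
  \<^typ>\<open>(complex, 'a) module\<close> is the complex scalar multiplication; a subalgebra \<open>B\<close> of \<open>A\<close> is
  turned into an algebra in its own right by \<open>A\<lparr>carrier := B\<rparr>\<close>.\<close>

record 'a cstar = "(complex, 'a) module" +
  star :: "'a \<Rightarrow> 'a"
  nrm :: "'a \<Rightarrow> real"

text \<open>The value outside the carrier only serves to meet the unguarded axioms of
  \<^locale>\<open>Metric_space\<close>.\<close>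

definition cdist :: "'a cstar \<Rightarrow> 'a \<Rightarrow> 'a \<Rightarrow> real" where
  "cdist A x y = (if x \<in> carrier A \<and> y \<in> carrier A then nrm A (x \<ominus>\<^bsub>A\<^esub> y) else 0)"

definition norm_closed :: "'a cstar \<Rightarrow> 'a set \<Rightarrow> bool" where
  "norm_closed A D \<longleftrightarrow> closedin (Metric_space.mtopology (carrier A) (cdist A)) D"

locale unital_cstar_algebra =
  ring A + module "ring_of_type_algebra :: complex ring" A for A :: "'a cstar" (structure) +
  assumes smult_mult_left:
      "\<lbrakk>x \<in> carrier A; y \<in> carrier A\<rbrakk> \<Longrightarrow> (c \<odot> x) \<otimes> y = c \<odot> (x \<otimes> y)"
    and smult_mult_right:
      "\<lbrakk>x \<in> carrier A; y \<in> carrier A\<rbrakk> \<Longrightarrow> x \<otimes> (c \<odot> y) = c \<odot> (x \<otimes> y)"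
    and star_closed: "x \<in> carrier A \<Longrightarrow> star A x \<in> carrier A"
    and star_star: "x \<in> carrier A \<Longrightarrow> star A (star A x) = x"
    and star_add:
      "\<lbrakk>x \<in> carrier A; y \<in> carrier A\<rbrakk> \<Longrightarrow> star A (x \<oplus> y) = star A x \<oplus> star A y"
    and star_smult: "x \<in> carrier A \<Longrightarrow> star A (c \<odot> x) = cnj c \<odot> star A x"
    and star_mult:
      "\<lbrakk>x \<in> carrier A; y \<in> carrier A\<rbrakk> \<Longrightarrow> star A (x \<otimes> y) = star A y \<otimes> star A x"
    and nrm_nonneg: "x \<in> carrier A \<Longrightarrow> 0 \<le> nrm A x"
    and nrm_eq_0_iff: "x \<in> carrier A \<Longrightarrow> nrm A x = 0 \<longleftrightarrow> x = \<zero>"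
    and nrm_triangle:
      "\<lbrakk>x \<in> carrier A; y \<in> carrier A\<rbrakk> \<Longrightarrow> nrm A (x \<oplus> y) \<le> nrm A x + nrm A y"
    and nrm_smult: "x \<in> carrier A \<Longrightarrow> nrm A (c \<odot> x) = cmod c * nrm A x"
    and nrm_mult:
      "\<lbrakk>x \<in> carrier A; y \<in> carrier A\<rbrakk> \<Longrightarrow> nrm A (x \<otimes> y) \<le> nrm A x * nrm A y"
    and nrm_star_mult: "x \<in> carrier A \<Longrightarrow> nrm A (star A x \<otimes> x) = (nrm A x)\<^sup>2"
    and nrm_complete: "Metric_space.mcomplete (carrier A) (cdist A)"

text \<open>The locale \<^locale>\<open>subring\<close> makes subalgebras share the unit of \<open>A\<close>.\<close>

definition cstar_subalgebra :: "'a set \<Rightarrow> 'a cstar \<Rightarrow> bool" where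
  "cstar_subalgebra D A \<longleftrightarrow> subring D A \<and> (\<forall>c. \<forall>x\<in>D. c \<odot>\<^bsub>A\<^esub> x \<in> D) \<and>
     (\<forall>x\<in>D. star A x \<in> D) \<and> norm_closed A D"

definition cstar_generated :: "'a cstar \<Rightarrow> 'a set \<Rightarrow> 'a set" where
  "cstar_generated A S = \<Inter>{D. cstar_subalgebra D A \<and> S \<subseteq> D}"

definition simple_cstar :: "'a cstar \<Rightarrow> bool" where
  "simple_cstar A \<longleftrightarrow> carrier A \<noteq> {\<zero>\<^bsub>A\<^esub>} \<and>
     (\<forall>I. ideal I A \<and> norm_closed A I \<longrightarrow> I = {\<zero>\<^bsub>A\<^esub>} \<or> I = carrier A)"

definition linear_map :: "'a cstar \<Rightarrow> 'b cstar \<Rightarrow> ('a \<Rightarrow> 'b) \<Rightarrow> bool" where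
  "linear_map A C f \<longleftrightarrow> f \<in> carrier A \<rightarrow> carrier C \<and>
     (\<forall>x\<in>carrier A. \<forall>y\<in>carrier A. f (x \<oplus>\<^bsub>A\<^esub> y) = f x \<oplus>\<^bsub>C\<^esub> f y) \<and>
     (\<forall>c. \<forall>x\<in>carrier A. f (c \<odot>\<^bsub>A\<^esub> x) = c \<odot>\<^bsub>C\<^esub> f x)"

definition positive_elements :: "'a cstar \<Rightarrow> 'a set" where
  "positive_elements A = {star A x \<otimes>\<^bsub>A\<^esub> x | x. x \<in> carrier A}"

definition rel_commutant :: "'a cstar \<Rightarrow> 'a set \<Rightarrow> 'a set" where
  "rel_commutant A S = {x \<in> carrier A. \<forall>s\<in>S. x \<otimes>\<^bsub>A\<^esub> s = s \<otimes>\<^bsub>A\<^esub> x}"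

definition scalar_of :: "'a cstar \<Rightarrow> 'a \<Rightarrow> complex" where
  "scalar_of A x = (THE c. x = c \<odot>\<^bsub>A\<^esub> \<one>\<^bsub>A\<^esub>)"


section \<open>Conditional expectations and index\<close>

text \<open>Expectations are taken \<^const>\<open>extensional\<close> (in \<open>\<rightarrow>\<^sub>E\<close>), so that equality of functions is
  equality on the carrier. Norm one is expressed as contractivity; the norm is attained at the
  unit.\<close>

definition cond_exp :: "'a cstar \<Rightarrow> 'a set \<Rightarrow> ('a \<Rightarrow> 'a) \<Rightarrow> bool" where
  "cond_exp A B E \<longleftrightarrow> E \<in> carrier A \<rightarrow>\<^sub>E B \<and> linear_map A (A\<lparr>carrier := B\<rparr>) E \<and>
     (\<forall>b\<in>B. E b = b) \<and>
     (\<forall>x\<in>positive_elements A. E x \<in> positive_elements (A\<lparr>carrier := B\<rparr>)) \<and>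
     (\<forall>x\<in>carrier A. nrm A (E x) \<le> nrm A x) \<and>
     (\<forall>x\<in>carrier A. \<forall>a\<in>B. \<forall>b\<in>B. E (a \<otimes>\<^bsub>A\<^esub> x \<otimes>\<^bsub>A\<^esub> b) = a \<otimes>\<^bsub>A\<^esub> E x \<otimes>\<^bsub>A\<^esub> b)"

definition quasi_basis :: "'a cstar \<Rightarrow> ('a \<Rightarrow> 'a) \<Rightarrow> 'a set \<Rightarrow> bool" where
  "quasi_basis A E \<Lambda> \<longleftrightarrow> finite \<Lambda> \<and> \<Lambda> \<subseteq> carrier A \<and>
     (\<forall>x\<in>carrier A. x = (\<Oplus>\<^bsub>A\<^esub>l\<in>\<Lambda>. l \<otimes>\<^bsub>A\<^esub> E (star A l \<otimes>\<^bsub>A\<^esub> x)) \<and>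
                    x = (\<Oplus>\<^bsub>A\<^esub>l\<in>\<Lambda>. E (x \<otimes>\<^bsub>A\<^esub> l) \<otimes>\<^bsub>A\<^esub> star A l))"

definition finite_index_exp :: "'a cstar \<Rightarrow> 'a set \<Rightarrow> ('a \<Rightarrow> 'a) \<Rightarrow> bool" where
  "finite_index_exp A B E \<longleftrightarrow> cond_exp A B E \<and> (\<exists>\<Lambda>. quasi_basis A E \<Lambda>)"

definition Ind :: "'a cstar \<Rightarrow> ('a \<Rightarrow> 'a) \<Rightarrow> 'a" where
  "Ind A E = (THE w. \<exists>\<Lambda>. quasi_basis A E \<Lambda> \<and> w = (\<Oplus>\<^bsub>A\<^esub>l\<in>\<Lambda>. l \<otimes>\<^bsub>A\<^esub> star A l))"

text \<open>Over a simple algebra the index is a positive real multiple of the unit; this is the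
  multiple.\<close>

definition scalar_index :: "'a cstar \<Rightarrow> ('a \<Rightarrow> 'a) \<Rightarrow> real" where
  "scalar_index A E = Re (scalar_of A (Ind A E))"

text \<open>For such an \<open>E\<close>, \<open>scalar_index A E\<close> is the minimal index \<open>[A:B]\<^sub>0\<close>.\<close>

definition minimal_exp :: "'a cstar \<Rightarrow> 'a set \<Rightarrow> ('a \<Rightarrow> 'a) \<Rightarrow> bool" where
  "minimal_exp A B E \<longleftrightarrow> finite_index_exp A B E \<and>
     (\<forall>F. finite_index_exp A B F \<longrightarrow> scalar_index A E \<le> scalar_index A F)"


section \<open>The basic construction\<close>

text \<open>\<open>A\<close> as a Hilbert \<open>B\<close>-module, \<open>\<langle>x,y\<rangle> = E(x\<^sup>* y)\<close>.\<close>

definition mod_inner :: "'a cstar \<Rightarrow> ('a \<Rightarrow> 'a) \<Rightarrow> 'a \<Rightarrow> 'a \<Rightarrow> 'a" where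
  "mod_inner A E x y = E (star A x \<otimes>\<^bsub>A\<^esub> y)"

definition mod_norm :: "'a cstar \<Rightarrow> ('a \<Rightarrow> 'a) \<Rightarrow> 'a \<Rightarrow> real" where
  "mod_norm A E x = sqrt (nrm A (mod_inner A E x x))"

definition is_mod_adjoint ::
    "'a cstar \<Rightarrow> ('a \<Rightarrow> 'a) \<Rightarrow> ('a \<Rightarrow> 'a) \<Rightarrow> ('a \<Rightarrow> 'a) \<Rightarrow> bool" where
  "is_mod_adjoint A E T S \<longleftrightarrow> S \<in> carrier A \<rightarrow>\<^sub>E carrier A \<and>
     (\<forall>x\<in>carrier A. \<forall>y\<in>carrier A. mod_inner A E (T x) y = mod_inner A E x (S y))"

definition adjointable_maps :: "'a cstar \<Rightarrow> 'a set \<Rightarrow> ('a \<Rightarrow> 'a) \<Rightarrow> ('a \<Rightarrow> 'a) set" where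
  "adjointable_maps A B E = {T \<in> carrier A \<rightarrow>\<^sub>E carrier A. linear_map A A T \<and>
     (\<forall>x\<in>carrier A. \<forall>b\<in>B. T (x \<otimes>\<^bsub>A\<^esub> b) = T x \<otimes>\<^bsub>A\<^esub> b) \<and> (\<exists>S. is_mod_adjoint A E T S)}"

definition adjointable_algebra :: "'a cstar \<Rightarrow> 'a set \<Rightarrow> ('a \<Rightarrow> 'a) \<Rightarrow> ('a \<Rightarrow> 'a) cstar" where
  "adjointable_algebra A B E =
     \<lparr>carrier = adjointable_maps A B E,
      monoid.mult = compose (carrier A),
      one = (\<lambda>x\<in>carrier A. x),
      zero = (\<lambda>x\<in>carrier A. \<zero>\<^bsub>A\<^esub>),
      add = (\<lambda>S T. \<lambda>x\<in>carrier A. S x \<oplus>\<^bsub>A\<^esub> T x),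
      module.smult = (\<lambda>c T. \<lambda>x\<in>carrier A. c \<odot>\<^bsub>A\<^esub> T x),
      star = (\<lambda>T. THE S. is_mod_adjoint A E T S),
      nrm = (\<lambda>T. Sup {mod_norm A E (T x) | x. x \<in> carrier A \<and> mod_norm A E x \<le> 1})\<rparr>"

definition lmul :: "'a cstar \<Rightarrow> 'a \<Rightarrow> 'a \<Rightarrow> 'a" where
  "lmul A a = (\<lambda>x\<in>carrier A. a \<otimes>\<^bsub>A\<^esub> x)"

text \<open>The identification of the image of \<open>A\<close> in its basic construction with \<open>A\<close>.\<close>

definition lmul_inv :: "'a cstar \<Rightarrow> ('a \<Rightarrow> 'a) \<Rightarrow> 'a" where
  "lmul_inv A = the_inv_into (carrier A) (lmul A)"

definition jones_proj :: "'a cstar \<Rightarrow> ('a \<Rightarrow> 'a) \<Rightarrow> 'a \<Rightarrow> 'a" where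
  "jones_proj A E = (\<lambda>x\<in>carrier A. E x)"

definition basic_construction :: "'a cstar \<Rightarrow> 'a set \<Rightarrow> ('a \<Rightarrow> 'a) \<Rightarrow> ('a \<Rightarrow> 'a) cstar" where
  "basic_construction A B E = (adjointable_algebra A B E)
     \<lparr>carrier := cstar_generated (adjointable_algebra A B E)
                   (insert (jones_proj A E) (lmul A ` carrier A))\<rparr>"

text \<open>The dual expectation takes its values in the copy \<open>lmul A ` carrier A\<close> of \<open>A\<close>. Since the
  elements \<open>x e y\<close> span the basic construction, the formula determines it.\<close>

definition dual_exp ::
    "'a cstar \<Rightarrow> 'a set \<Rightarrow> ('a \<Rightarrow> 'a) \<Rightarrow> (('a \<Rightarrow> 'a) \<Rightarrow> ('a \<Rightarrow> 'a)) \<Rightarrow> bool" where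
  "dual_exp A B E E' \<longleftrightarrow> (let A' = basic_construction A B E in
     cond_exp A' (lmul A ` carrier A) E' \<and>
     (\<forall>x\<in>carrier A. \<forall>y\<in>carrier A.
        E' (lmul A x \<otimes>\<^bsub>A'\<^esub> jones_proj A E \<otimes>\<^bsub>A'\<^esub> lmul A y) =
        lmul A (complex_of_real (1 / scalar_index A E) \<odot>\<^bsub>A\<^esub> (x \<otimes>\<^bsub>A\<^esub> y))))"


section \<open>Traces and isometries\<close>

definition trace_preserving_exp ::
    "'a cstar \<Rightarrow> 'a set \<Rightarrow> ('a \<Rightarrow> complex) \<Rightarrow> ('a \<Rightarrow> 'a) \<Rightarrow> bool" where
  "trace_preserving_exp P Q tr E \<longleftrightarrow> cond_exp P Q E \<and> (\<forall>x\<in>carrier P. tr (E x) = tr x)"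

definition trace_norm :: "'a cstar \<Rightarrow> ('a \<Rightarrow> complex) \<Rightarrow> 'a \<Rightarrow> real" where
  "trace_norm A tr x = sqrt (Re (tr (star A x \<otimes>\<^bsub>A\<^esub> x)))"

definition linear_isometry ::
    "'a cstar \<Rightarrow> ('a \<Rightarrow> real) \<Rightarrow> 'b cstar \<Rightarrow> ('b \<Rightarrow> real) \<Rightarrow> ('a \<Rightarrow> 'b) \<Rightarrow> bool" where
  "linear_isometry P n Q m f \<longleftrightarrow> linear_map P Q f \<and> (\<forall>x\<in>carrier P. m (f x) = n x)"

end

theory Submission
  imports Defs
begin

text \<open>Write \<open>e\<^sub>1, e\<^sub>2\<close> for the Jones projections, \<open>\<phi> = E\<^sub>0 \<circ> E\<^sub>1 \<circ> E\<^sub>2\<close>, and let \<open>P = B' \<inter> A\<^sub>1\<close>, \<open>Q = A' \<inter> A\<^sub>2\<close>.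

The inverse transform \<open>G(w) = \<tau>\<^bsup>-3/2\<^esup> E\<^sub>2(w e\<^sub>1 e\<^sub>2)\<close> is treated first. The push-down identity
\<open>E\<^sub>2(y e\<^sub>2) e\<^sub>2 = \<tau> y e\<^sub>2\<close> gives \<open>G(w) e\<^sub>2 = \<tau>\<^bsup>-1/2\<^esup> w e\<^sub>1 e\<^sub>2\<close>, hence
\<open>\<phi>(G(w)\<^sup>* G(w)) = \<tau>\<^sup>-\<^sup>2 \<phi>(e\<^sub>2 e\<^sub>1 w\<^sup>*w e\<^sub>1 e\<^sub>2)\<close>. Both Jones projections lie in the centralizer of \<open>\<phi>\<close>, as one
checks on the spanning elements \<open>a e b\<close>; with \<open>e\<^sub>1 e\<^sub>2 e\<^sub>1 = \<tau> e\<^sub>1\<close> the right-hand side becomes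
\<open>\<tau>\<^sup>-\<^sup>1 \<phi>(w\<^sup>*w e\<^sub>1)\<close>. So \<open>G\<close> is isometric as soon as \<open>\<phi>(c e\<^sub>1) = \<tau> \<phi>(c)\<close> for \<open>c \<in> Q\<close>, and this is where
minimality of \<open>E\<^sub>0\<close> is used. For a quasi-basis \<open>\<Lambda>\<close> of \<open>E\<^sub>0\<close>, the identity \<open>1 = \<Sum> l e\<^sub>1 l\<^sup>*\<close> turns it into
\<open>\<Sum> l x l\<^sup>* = \<tau>\<^sup>-\<^sup>1 E\<^sub>0(x)\<close> for \<open>x \<in> B' \<inter> A\<close>. For self-adjoint \<open>h \<in> B' \<inter> A\<close> and \<open>k = 1 + \<epsilon>h\<close> the map
\<open>x \<mapsto> E\<^sub>0(k x k) / E\<^sub>0(k\<^sup>2)\<close> is again a conditional expectation onto \<open>B\<close>, of index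
\<open>E\<^sub>0(k\<^sup>2) \<Sum> l k\<^sup>-\<^sup>2 l\<^sup>*\<close>, and the vanishing of the derivative of this index at \<open>\<epsilon> = 0\<close> is the wanted
identity for \<open>h\<close>.

The same relation and the faithfulness of \<open>\<phi>\<close> give \<open>EC(e\<^sub>1) = \<tau>\<close> for the trace-preserving expectation
\<open>EC\<close>, and then \<open>F(G(w)) = \<tau>\<^sup>-\<^sup>1 w EC(e\<^sub>1) = w\<close>. Finally \<open>G\<close> is onto: up to a scalar, the element
\<open>\<Sum> l x e\<^sub>2 e\<^sub>1 l\<^sup>*\<close> of \<open>Q\<close> is a preimage of \<open>x \<in> P\<close>. Hence \<open>F\<close> is the inverse of the isometry \<open>G\<close>.

Underneath lies a development of C*-algebras from the axioms, without functional calculus or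
representations. A self-adjoint \<open>h\<close> has \<open>\<parallel>h\<parallel>\<close> or \<open>-\<parallel>h\<parallel>\<close> in its spectrum
(\<open>self_adjoint_norm_in_spectrum\<close>). Three facts follow: the centre of a simple algebra consists of
scalars (\<open>centre_of_simple\<close>), which makes \<open>\<phi>\<close> scalar valued on \<open>B' \<inter> A\<^sub>2\<close>; elements \<open>x\<^sup>*x\<close> have
non-negative spectrum (\<open>spec_nonneg_star_mult\<close>); and \<open>\<parallel>b\<parallel>\<^sup>2 \<le> \<parallel>b\<^sup>*b + k\<parallel>\<close> for positive \<open>k\<close>
(\<open>nrm_le_add_spec_nonneg\<close>). The last one yields the Cauchy-Schwarz inequality in the Hilbert module of
\<open>E\<close>; so the adjointable maps form a C*-algebra (\<open>adjointable_algebra_cstar\<close>), and they coincide with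
the basic construction (\<open>basic_construction_eq\<close>). The same argument for the dual expectation
\<open>E\<^sub>1\<close> identifies \<open>A\<^sub>2\<close>.\<close>

section \<open>Arithmetic and completeness in a unital C*-algebra\<close>

context unital_cstar_algebra
begin

text \<open>The additive, multiplicative and ring laws of \<open>A\<close>, under names that do not clash with those
  of the scalar ring.\<close>

lemmas A_ring = unital_cstar_algebra.axioms(1)[OF unital_cstar_algebra_axioms]
lemmas A_monoid = ringE(2)[OF A_ring]
lemmas A_group = ringE(1)[OF A_ring]
lemmas A_add_monoid = abelian_group.axioms(1)[OF A_group]

lemmas mul_closed = monoid.m_closed[OF A_monoid]
lemmas mul_assoc = monoid.m_assoc[OF A_monoid]
lemmas add_mul = ringE(3)[OF A_ring]
lemmas mul_add = ringE(4)[OF A_ring]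
lemmas add_assoc = abelian_monoid.a_assoc[OF A_add_monoid]
lemmas add_comm = abelian_monoid.a_comm[OF A_add_monoid]
lemmas add_lcomm = abelian_monoid.a_lcomm[OF A_add_monoid]
lemmas add_ac = add_assoc add_comm add_lcomm
lemmas l_neg = abelian_group.l_neg[OF A_group]
lemmas r_neg = abelian_group.r_neg[OF A_group]

lemma scalar_closed [simp, intro]: "x \<in> carrier A \<Longrightarrow> c \<odot> x \<in> carrier A"
  using smult_closed[of c x] by (simp add: ring_of_type_algebra_def)

lemma scalar_add: "x \<in> carrier A \<Longrightarrow> (c + d) \<odot> x = c \<odot> x \<oplus> d \<odot> x"
  using smult_l_distr[of c d x] by (simp add: ring_of_type_algebra_def)

lemma scalar_distr: "\<lbrakk>x \<in> carrier A; y \<in> carrier A\<rbrakk> \<Longrightarrow> c \<odot> (x \<oplus> y) = c \<odot> x \<oplus> c \<odot> y"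
  using smult_r_distr[of c x y] by (simp add: ring_of_type_algebra_def)

lemma scalar_scalar [simp]: "x \<in> carrier A \<Longrightarrow> c \<odot> (d \<odot> x) = (c * d) \<odot> x"
  using smult_assoc1[of c d x] by (simp add: ring_of_type_algebra_def)

lemma scalar_one [simp]: "x \<in> carrier A \<Longrightarrow> 1 \<odot> x = x"
  using smult_one[of x] by (simp add: ring_of_type_algebra_def)

lemma scalar_zero [simp]: "x \<in> carrier A \<Longrightarrow> 0 \<odot> x = \<zero>"
  using smult_l_null[of x] by (simp add: ring_of_type_algebra_def)

lemma scalar_of_zero [simp]: "c \<odot> \<zero> = \<zero>"
  using smult_r_null[of c] by (simp add: ring_of_type_algebra_def)

lemma neg_scalar: "x \<in> carrier A \<Longrightarrow> \<ominus> x = (- 1) \<odot> x"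
proof -
  assume x: "x \<in> carrier A"
  have "(- 1) \<odot> x \<oplus> x = \<zero>"
    using scalar_add[OF x, of "-1" 1] x by simp
  then show ?thesis
    using abelian_group.minus_equality[OF A_group] x by simp
qed

lemma minus_scalar: "\<lbrakk>x \<in> carrier A; y \<in> carrier A\<rbrakk> \<Longrightarrow> x \<ominus> y = x \<oplus> (- 1) \<odot> y"
  by (simp add: a_minus_def neg_scalar)

lemmas alg_simps = minus_scalar neg_scalar add_mul mul_add mul_assoc smult_mult_left
  smult_mult_right scalar_distr

lemma scalar_collect:
  "x \<in> carrier A \<Longrightarrow> c \<odot> x \<oplus> d \<odot> x = (c + d) \<odot> x"
  "x \<in> carrier A \<Longrightarrow> x \<oplus> d \<odot> x = (1 + d) \<odot> x"
  "x \<in> carrier A \<Longrightarrow> d \<odot> x \<oplus> x = (d + 1) \<odot> x"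
  "x \<in> carrier A \<Longrightarrow> x \<oplus> x = 2 \<odot> x"
  using scalar_add[of x c d] scalar_add[of x 1 d] scalar_add[of x d 1] scalar_add[of x 1 1]
  by simp_all

lemma diff_eq_zeroD: "\<lbrakk>x \<ominus> y = \<zero>; x \<in> carrier A; y \<in> carrier A\<rbrakk> \<Longrightarrow> x = y"
  using ring.r_right_minus_eq[OF A_ring] by blast

declare star_closed [simp, intro] star_star [simp]

lemma star_one [simp]: "star A \<one> = \<one>"
proof -
  have "star A \<one> = star A (star A \<one> \<otimes> \<one>)"
    by (subst star_mult) auto
  then show ?thesis by simp
qed

lemma star_zero [simp]: "star A \<zero> = \<zero>"
  using star_smult[of \<zero> 0] by simp

lemma star_diff:
  "\<lbrakk>x \<in> carrier A; y \<in> carrier A\<rbrakk> \<Longrightarrow> star A (x \<ominus> y) = star A x \<ominus> star A y"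
  by (simp add: alg_simps star_add star_smult)

lemmas star_simps = star_add star_smult star_mult star_diff

lemma nrm_zero [simp]: "nrm A \<zero> = 0"
  using nrm_eq_0_iff by auto

lemma nrm_diff_commute: "\<lbrakk>x \<in> carrier A; y \<in> carrier A\<rbrakk> \<Longrightarrow> nrm A (x \<ominus> y) = nrm A (y \<ominus> x)"
proof -
  assume xy: "x \<in> carrier A" "y \<in> carrier A"
  have "x \<ominus> y = (- 1) \<odot> (y \<ominus> x)"
    using xy by (simp add: alg_simps add_comm)
  then show ?thesis using nrm_smult[of "y \<ominus> x" "-1"] xy by simp
qed

lemma nrm_diff_le: "\<lbrakk>x \<in> carrier A; y \<in> carrier A\<rbrakk> \<Longrightarrow> nrm A (x \<ominus> y) \<le> nrm A x + nrm A y"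
  using nrm_triangle[of x "(-1) \<odot> y"] by (simp add: alg_simps nrm_smult)

lemma diff_split:
  assumes "x \<in> carrier A" "y \<in> carrier A" "z \<in> carrier A"
  shows "x \<ominus> z = (x \<ominus> y) \<oplus> (y \<ominus> z)"
proof -
  have "(x \<ominus> y) \<oplus> (y \<ominus> z) = x \<oplus> ((\<ominus> y \<oplus> y) \<oplus> \<ominus> z)"
    using assms by (simp add: a_minus_def add_assoc)
  then show ?thesis using assms by (simp add: l_neg a_minus_def)
qed

lemma nrm_diff_triangle:
  "\<lbrakk>x \<in> carrier A; y \<in> carrier A; z \<in> carrier A\<rbrakk>
    \<Longrightarrow> nrm A (x \<ominus> z) \<le> nrm A (x \<ominus> y) + nrm A (y \<ominus> z)"
  using nrm_triangle[of "x \<ominus> y" "y \<ominus> z"] diff_split[of x y z] by simp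

lemma nrm_le_diff:
  "\<lbrakk>x \<in> carrier A; y \<in> carrier A\<rbrakk> \<Longrightarrow> nrm A x \<le> nrm A y + nrm A (x \<ominus> y)"
  using nrm_diff_triangle[of x y \<zero>] by (simp add: a_minus_def)

lemma nrm_star [simp]: "x \<in> carrier A \<Longrightarrow> nrm A (star A x) = nrm A x"
proof -
  have le: "nrm A y \<le> nrm A (star A y)" if "y \<in> carrier A" for y
  proof (cases "nrm A y = 0")
    case False
    have "nrm A y * nrm A y \<le> nrm A (star A y) * nrm A y"
      using nrm_star_mult[OF that] nrm_mult[of "star A y" y] that by (simp add: power2_eq_square)
    then show ?thesis using False nrm_nonneg[OF that] by simp
  qed (use that nrm_nonneg in simp)
  assume "x \<in> carrier A"
  then show ?thesis using le[of x] le[of "star A x"] by simp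
qed

lemma nrm_mult_star: "x \<in> carrier A \<Longrightarrow> nrm A (x \<otimes> star A x) = (nrm A x)\<^sup>2"
  using nrm_star_mult[of "star A x"] by simp

lemma nrm_one: "\<one> \<noteq> \<zero> \<Longrightarrow> nrm A \<one> = 1"
  using nrm_star_mult[of \<one>] nrm_eq_0_iff[of \<one>] by (simp add: power2_eq_square)

lemma nrm_one_le: "nrm A \<one> \<le> 1"
  using nrm_one by (cases "\<one> = \<zero>") auto

lemma Metric_space_cdist: "Metric_space (carrier A) (cdist A)"
proof
  show "0 \<le> cdist A x y" for x y
    by (simp add: cdist_def nrm_nonneg)
  show "cdist A x y = cdist A y x" for x y
    by (simp add: cdist_def nrm_diff_commute)
  show "cdist A x y = 0 \<longleftrightarrow> x = y" if "x \<in> carrier A" "y \<in> carrier A" for x y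
    using that nrm_eq_0_iff[of "x \<ominus> y"] by (simp add: cdist_def)
  show "cdist A x z \<le> cdist A x y + cdist A y z"
    if "x \<in> carrier A" "y \<in> carrier A" "z \<in> carrier A" for x y z
    using that nrm_diff_triangle by (simp add: cdist_def)
qed

lemma Cauchy_converges:
  assumes s: "\<And>n. s n \<in> carrier A"
    and C: "\<And>\<epsilon>. \<epsilon> > 0 \<Longrightarrow> \<exists>N. \<forall>n\<ge>N. \<forall>m\<ge>N. nrm A (s n \<ominus> s m) < \<epsilon>"
  obtains x where "x \<in> carrier A" "(\<lambda>n. nrm A (s n \<ominus> x)) \<longlonglongrightarrow> 0"
proof -
  interpret MS: Metric_space "carrier A" "cdist A" by (rule Metric_space_cdist)
  have "MS.MCauchy s"
    unfolding MS.MCauchy_def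
  proof (intro conjI allI impI)
    fix \<epsilon> :: real assume "0 < \<epsilon>"
    then obtain N where "\<forall>n\<ge>N. \<forall>m\<ge>N. nrm A (s n \<ominus> s m) < \<epsilon>" using C by blast
    then show "\<exists>N. \<forall>n n'. N \<le> n \<longrightarrow> N \<le> n' \<longrightarrow> cdist A (s n) (s n') < \<epsilon>"
      using s by (auto simp: cdist_def)
  qed (use s in blast)
  then obtain x where x: "limitin MS.mtopology s x sequentially"
    using nrm_complete MS.mcomplete_def by blast
  then have xc: "x \<in> carrier A" using MS.limitin_mspace by blast
  have "(\<lambda>n. nrm A (s n \<ominus> x)) \<longlonglongrightarrow> 0"
  proof (rule LIMSEQ_I)
    fix r :: real assume "r > 0"
    then have "\<forall>\<^sub>F n in sequentially. s n \<in> carrier A \<and> cdist A (s n) x < r"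
      using x by (simp add: MS.limitin_metric)
    then obtain N where "\<forall>n\<ge>N. cdist A (s n) x < r"
      by (auto simp: eventually_sequentially)
    then show "\<exists>N. \<forall>n\<ge>N. norm (nrm A (s n \<ominus> x) - 0) < r"
      using s xc by (auto simp: cdist_def nrm_nonneg)
  qed
  with xc that show thesis by blast
qed

text \<open>For a \<open>k\<close>-contraction \<open>f\<close> the distance of two points is at most \<open>1/(1 - k)\<close> times the sum
  of their displacements, which shows at once that the orbit of \<open>0\<close> is a Cauchy sequence.\<close>

lemma contraction_has_fixpoint:
  assumes f: "\<And>x. \<lbrakk>x \<in> carrier A; nrm A x \<le> \<rho>\<rbrakk> \<Longrightarrow> f x \<in> carrier A \<and> nrm A (f x) \<le> \<rho>"
    and k: "0 \<le> k" "k < 1" and \<rho>: "0 \<le> \<rho>"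
    and con: "\<And>x y. \<lbrakk>x \<in> carrier A; y \<in> carrier A; nrm A x \<le> \<rho>; nrm A y \<le> \<rho>\<rbrakk>
                \<Longrightarrow> nrm A (f x \<ominus> f y) \<le> k * nrm A (x \<ominus> y)"
  obtains x where "x \<in> carrier A" "nrm A x \<le> \<rho>" "f x = x"
proof -
  define s where "s n = (f ^^ n) \<zero>" for n
  have s: "s n \<in> carrier A \<and> nrm A (s n) \<le> \<rho>" for n
    by (induction n) (auto simp: s_def f \<rho>)
  have s_Suc: "f (s n) = s (Suc n)" for n by (simp add: s_def)
  define c where "c = nrm A (s 1 \<ominus> s 0)"
  have c0: "c \<ge> 0" unfolding c_def using s by (simp add: nrm_nonneg)
  have disp: "nrm A (s (Suc n) \<ominus> s n) \<le> k ^ n * c" for n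
  proof (induction n)
    case (Suc n)
    have "nrm A (s (Suc (Suc n)) \<ominus> s (Suc n)) \<le> k * nrm A (s (Suc n) \<ominus> s n)"
      using con[of "s (Suc n)" "s n"] s by (simp add: s_Suc)
    also have "\<dots> \<le> k * (k ^ n * c)" using Suc k by (simp add: mult_left_mono)
    finally show ?case by (simp add: mult_ac)
  qed (simp add: c_def)
  have dist: "nrm A (s n \<ominus> s m) \<le> (k ^ n + k ^ m) * c / (1 - k)" for n m
  proof -
    have "nrm A (s n \<ominus> s m) \<le> nrm A (s n \<ominus> s (Suc n)) + nrm A (s (Suc n) \<ominus> s m)"
      using s nrm_diff_triangle by simp
    also have "nrm A (s (Suc n) \<ominus> s m) \<le> nrm A (s (Suc n) \<ominus> s (Suc m)) + nrm A (s (Suc m) \<ominus> s m)"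
      using s nrm_diff_triangle by simp
    also have "nrm A (s (Suc n) \<ominus> s (Suc m)) \<le> k * nrm A (s n \<ominus> s m)"
      using con[of "s n" "s m"] s by (simp add: s_Suc)
    finally have "nrm A (s n \<ominus> s m) * (1 - k) \<le> (k ^ n + k ^ m) * c"
      using disp[of n] disp[of m] s by (simp add: nrm_diff_commute[of "s n"] algebra_simps)
    then show ?thesis using k by (simp add: pos_le_divide_eq)
  qed
  have klim: "(\<lambda>n. k ^ n) \<longlonglongrightarrow> 0" using k by (simp add: LIMSEQ_realpow_zero)
  obtain x where x: "x \<in> carrier A" "(\<lambda>n. nrm A (s n \<ominus> x)) \<longlonglongrightarrow> 0"
  proof (rule Cauchy_converges[of s])
    show "s n \<in> carrier A" for n using s by simp
    fix \<epsilon> :: real assume e: "\<epsilon> > 0"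
    have "(\<lambda>n. k ^ n * (2 * c / (1 - k))) \<longlonglongrightarrow> 0 * (2 * c / (1 - k))"
      by (intro tendsto_intros klim)
    then have "\<forall>\<^sub>F n in sequentially. k ^ n * (2 * c / (1 - k)) < \<epsilon>"
      using e order_tendstoD(2) by fastforce
    then obtain N where N: "k ^ N * (2 * c / (1 - k)) < \<epsilon>"
      by (auto simp: eventually_sequentially)
    have "nrm A (s n \<ominus> s m) < \<epsilon>" if "n \<ge> N" "m \<ge> N" for n m
    proof -
      have "k ^ n + k ^ m \<le> 2 * k ^ N"
        using power_decreasing[OF that(1), of k] power_decreasing[OF that(2), of k] k by simp
      then have "(k ^ n + k ^ m) * c / (1 - k) \<le> (2 * k ^ N) * c / (1 - k)"
        using c0 k by (intro divide_right_mono mult_right_mono) auto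
      then show ?thesis using dist[of n m] N by (simp add: mult_ac)
    qed
    then show "\<exists>N. \<forall>n\<ge>N. \<forall>m\<ge>N. nrm A (s n \<ominus> s m) < \<epsilon>" by blast
  qed
  have l1: "(\<lambda>n. \<rho> + nrm A (s n \<ominus> x)) \<longlonglongrightarrow> \<rho> + 0" by (intro tendsto_intros x)
  have l2: "nrm A x \<le> \<rho> + nrm A (s n \<ominus> x)" for n
    using nrm_le_diff[of x "s n"] s[of n] x by (simp add: nrm_diff_commute)
  have xr: "nrm A x \<le> \<rho>"
    using LIMSEQ_le_const[OF l1] l2 by auto
  have fx: "f x \<in> carrier A" using f x xr by blast
  have l3: "(\<lambda>n. nrm A (s (Suc n) \<ominus> x) + k * nrm A (s n \<ominus> x)) \<longlonglongrightarrow> 0 + k * 0"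
    by (intro tendsto_intros LIMSEQ_Suc x)
  have l4: "nrm A (f x \<ominus> x) \<le> nrm A (s (Suc n) \<ominus> x) + k * nrm A (s n \<ominus> x)" for n
    using nrm_diff_triangle[of "f x" "s (Suc n)" x] con[of x "s n"] s[of n] s[of "Suc n"] x xr fx
    by (simp add: s_Suc nrm_diff_commute)
  have "nrm A (f x \<ominus> x) \<le> 0"
    using LIMSEQ_le_const[OF l3] l4 by auto
  then have "nrm A (f x \<ominus> x) = 0"
    using nrm_nonneg[of "f x \<ominus> x"] fx x by force
  then have "f x = x" using nrm_eq_0_iff[of "f x \<ominus> x"] fx x by simp
  then show thesis using that x xr by blast
qed

end

section \<open>Invertible elements\<close>

context unital_cstar_algebra
begin

lemmas unit_closed [simp, intro] = monoid.Units_closed[OF A_monoid]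
lemmas inv_mem [simp, intro] = monoid.Units_inv_closed[OF A_monoid]
lemmas inv_mul [simp] = monoid.Units_l_inv[OF A_monoid]
lemmas mul_inv [simp] = monoid.Units_r_inv[OF A_monoid]
lemmas unit_mul = monoid.Units_m_closed[OF A_monoid]

lemma mul_inv_left [simp]: "\<lbrakk>u \<in> Units A; x \<in> carrier A\<rbrakk> \<Longrightarrow> u \<otimes> (inv u \<otimes> x) = x"
  using mul_assoc[of u "inv u" x] by simp

lemma inv_mul_left [simp]: "\<lbrakk>u \<in> Units A; x \<in> carrier A\<rbrakk> \<Longrightarrow> inv u \<otimes> (u \<otimes> x) = x"
  using mul_assoc[of "inv u" u x] by simp

lemma unit_and_inverse:
  assumes "x \<in> carrier A" "y \<in> carrier A" "x \<otimes> y = \<one>" "y \<otimes> x = \<one>"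
  shows "x \<in> Units A" "inv x = y"
proof -
  show u: "x \<in> Units A" using assms unfolding Units_def by blast
  have "inv x = inv x \<otimes> (x \<otimes> y)" using assms u by simp
  also have "\<dots> = y" using u assms(2) by (rule inv_mul_left)
  finally show "inv x = y" .
qed

lemma one_unit [simp]: "\<one> \<in> Units A"
  by (rule unit_and_inverse(1)[of \<one> \<one>]) auto

lemma unit_mul_inverse:
  assumes "u \<in> Units A" "v \<in> Units A"
  shows "u \<otimes> v \<in> Units A" "inv (u \<otimes> v) = inv v \<otimes> inv u"
  using unit_and_inverse[of "u \<otimes> v" "inv v \<otimes> inv u"] assms by (simp_all add: mul_assoc)

lemma unit_scalar:
  assumes "u \<in> Units A" "c \<noteq> 0"
  shows "c \<odot> u \<in> Units A" "inv (c \<odot> u) = (1 / c) \<odot> inv u"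
  using unit_and_inverse[of "c \<odot> u" "(1 / c) \<odot> inv u"] assms
  by (simp_all add: smult_mult_left smult_mult_right)

lemma unit_star:
  assumes "u \<in> Units A"
  shows "star A u \<in> Units A" "inv (star A u) = star A (inv u)"
  using unit_and_inverse[of "star A u" "star A (inv u)"] assms
  by (simp_all add: star_mult[symmetric])

lemma commuting_factor_unit:
  assumes "a \<in> carrier A" "b \<in> carrier A" "a \<otimes> b = b \<otimes> a" "a \<otimes> b \<in> Units A"
  shows "a \<in> Units A"
proof -
  define w where "w = inv (a \<otimes> b)"
  have w: "w \<in> carrier A" "a \<otimes> b \<otimes> w = \<one>" "w \<otimes> (a \<otimes> b) = \<one>"
    using assms by (auto simp: w_def simp del: mul_closed)
  have r: "a \<otimes> (b \<otimes> w) = \<one>" using assms(1,2) w(1,2) mul_assoc[of a b w] by simp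
  have l: "(w \<otimes> b) \<otimes> a = \<one>" using assms(1-3) w(1,3) mul_assoc[of w b a] by simp
  have "b \<otimes> w = (w \<otimes> b \<otimes> a) \<otimes> (b \<otimes> w)" using assms w l by simp
  also have "\<dots> = (w \<otimes> b) \<otimes> (a \<otimes> (b \<otimes> w))" using assms w(1) by (simp add: mul_assoc)
  also have "\<dots> = w \<otimes> b" using assms w(1) by (simp only: r) simp
  finally show ?thesis
    using unit_and_inverse(1)[of a "w \<otimes> b"] assms w(1) r l by simp
qed

lemma inv_commute:
  assumes "u \<in> Units A" "x \<in> carrier A" "u \<otimes> x = x \<otimes> u"
  shows "inv u \<otimes> x = x \<otimes> inv u"
proof -
  have "inv u \<otimes> x = inv u \<otimes> (x \<otimes> u) \<otimes> inv u" using assms by (simp add: mul_assoc)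
  also have "\<dots> = inv u \<otimes> (u \<otimes> x) \<otimes> inv u" using assms by simp
  also have "\<dots> = x \<otimes> inv u" using assms(1,2) by simp
  finally show ?thesis .
qed

lemma add_cancel_diff: "\<lbrakk>x \<in> carrier A; y \<in> carrier A\<rbrakk> \<Longrightarrow> (x \<oplus> y) \<ominus> y = x"
  by (simp add: a_minus_def add_assoc r_neg)

lemma add_nrm_mult_le:
  assumes "a \<in> carrier A" "y \<in> carrier A"
  shows "nrm A (\<one> \<oplus> a \<otimes> y) \<le> 1 + nrm A a * nrm A y"
    and "nrm A (\<one> \<oplus> y \<otimes> a) \<le> 1 + nrm A a * nrm A y"
  using nrm_triangle[of \<one> "a \<otimes> y"] nrm_triangle[of \<one> "y \<otimes> a"] nrm_one_le
    nrm_mult[of a y] nrm_mult[of y a] assms by (simp_all add: mult.commute)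

text \<open>The right and the left inverse of \<open>1 - a\<close> are the fixed points of \<open>y \<mapsto> 1 + a y\<close> and \<open>y \<mapsto> 1 + y a\<close>; both
maps contract the ball of radius \<open>1 / (1 - \<parallel>a\<parallel>)\<close>.\<close>

lemma one_minus_unit:
  assumes a: "a \<in> carrier A" "nrm A a < 1"
  shows "\<one> \<ominus> a \<in> Units A" "nrm A (inv (\<one> \<ominus> a)) \<le> 1 / (1 - nrm A a)"
proof -
  define r where "r = nrm A a"
  have r: "0 \<le> r" "r < 1" using a nrm_nonneg by (auto simp: r_def)
  define \<rho> where "\<rho> = 1 / (1 - r)"
  have \<rho>: "0 \<le> \<rho>" "1 + r * \<rho> = \<rho>" using r by (auto simp: \<rho>_def field_simps)
  have bound: "1 + r * t \<le> \<rho>" if "t \<le> \<rho>" for t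
    using that \<rho> r mult_left_mono[of t \<rho> r] by simp
  obtain y where y: "y \<in> carrier A" "nrm A y \<le> \<rho>" "\<one> \<oplus> a \<otimes> y = y"
  proof (rule contraction_has_fixpoint[of \<rho> "\<lambda>y. \<one> \<oplus> a \<otimes> y" r])
    show "\<one> \<oplus> a \<otimes> x \<in> carrier A \<and> nrm A (\<one> \<oplus> a \<otimes> x) \<le> \<rho>" if "x \<in> carrier A" "nrm A x \<le> \<rho>" for x
      using a that add_nrm_mult_le(1)[of a x] bound[of "nrm A x"] by (auto simp: r_def)
    show "nrm A (\<one> \<oplus> a \<otimes> x \<ominus> (\<one> \<oplus> a \<otimes> y)) \<le> r * nrm A (x \<ominus> y)"
      if "x \<in> carrier A" "y \<in> carrier A" for x y
    proof -
      have "\<one> \<oplus> a \<otimes> x \<ominus> (\<one> \<oplus> a \<otimes> y) = (a \<otimes> x \<oplus> (-1) \<odot> (a \<otimes> y)) \<oplus> (\<one> \<oplus> (-1) \<odot> \<one>)"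
        using a that by (simp add: alg_simps add_ac)
      also have "\<dots> = a \<otimes> (x \<ominus> y)"
        using a that by (simp add: alg_simps scalar_collect)
      finally show ?thesis using nrm_mult[of a "x \<ominus> y"] a that by (simp add: r_def)
    qed
  qed (use r \<rho> in auto)
  obtain z where z: "z \<in> carrier A" "\<one> \<oplus> z \<otimes> a = z"
  proof (rule contraction_has_fixpoint[of \<rho> "\<lambda>y. \<one> \<oplus> y \<otimes> a" r])
    show "\<one> \<oplus> x \<otimes> a \<in> carrier A \<and> nrm A (\<one> \<oplus> x \<otimes> a) \<le> \<rho>" if "x \<in> carrier A" "nrm A x \<le> \<rho>" for x
      using a that add_nrm_mult_le(2)[of a x] bound[of "nrm A x"] by (auto simp: r_def)
    show "nrm A (\<one> \<oplus> x \<otimes> a \<ominus> (\<one> \<oplus> y \<otimes> a)) \<le> r * nrm A (x \<ominus> y)"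
      if "x \<in> carrier A" "y \<in> carrier A" for x y
    proof -
      have "\<one> \<oplus> x \<otimes> a \<ominus> (\<one> \<oplus> y \<otimes> a) = (x \<otimes> a \<oplus> (-1) \<odot> (y \<otimes> a)) \<oplus> (\<one> \<oplus> (-1) \<odot> \<one>)"
        using a that by (simp add: alg_simps add_ac)
      also have "\<dots> = (x \<ominus> y) \<otimes> a"
        using a that by (simp add: alg_simps scalar_collect)
      finally show ?thesis using nrm_mult[of "x \<ominus> y" a] a that by (simp add: r_def mult.commute)
    qed
  qed (use r \<rho> in auto)
  have "(\<one> \<ominus> a) \<otimes> y = y \<ominus> a \<otimes> y"
    using a y(1) by (simp add: alg_simps)
  also have "\<dots> = (\<one> \<oplus> a \<otimes> y) \<ominus> a \<otimes> y" using y(3) by simp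
  also have "\<dots> = \<one>" using a y(1) add_cancel_diff by simp
  finally have ry: "(\<one> \<ominus> a) \<otimes> y = \<one>" .
  have "z \<otimes> (\<one> \<ominus> a) = z \<ominus> z \<otimes> a"
    using a z(1) by (simp add: alg_simps)
  also have "\<dots> = (\<one> \<oplus> z \<otimes> a) \<ominus> z \<otimes> a" using z(2) by simp
  also have "\<dots> = \<one>" using a z(1) add_cancel_diff by simp
  finally have lz: "z \<otimes> (\<one> \<ominus> a) = \<one>" .
  have "z = z \<otimes> ((\<one> \<ominus> a) \<otimes> y)" using ry z by simp
  also have "\<dots> = (z \<otimes> (\<one> \<ominus> a)) \<otimes> y" using a y(1) z(1) by (subst mul_assoc) auto
  also have "\<dots> = y" using lz y by simp
  finally have "z = y" .
  then show "\<one> \<ominus> a \<in> Units A" "nrm A (inv (\<one> \<ominus> a)) \<le> 1 / (1 - nrm A a)"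
    using unit_and_inverse[of "\<one> \<ominus> a" y] ry lz a y by (auto simp: \<rho>_def r_def)
qed

lemma unit_perturbation:
  assumes u: "u \<in> Units A" and w: "w \<in> carrier A" and small: "nrm A (inv u) * nrm A w < 1"
  shows "u \<ominus> w \<in> Units A"
    and "nrm A (inv (u \<ominus> w)) \<le> nrm A (inv u) / (1 - nrm A (inv u) * nrm A w)"
proof -
  define v where "v = inv u \<otimes> w"
  have v: "v \<in> carrier A" "nrm A v \<le> nrm A (inv u) * nrm A w"
    using u w nrm_mult[of "inv u" w] by (auto simp: v_def)
  have vu: "\<one> \<ominus> v \<in> Units A" "nrm A (inv (\<one> \<ominus> v)) \<le> 1 / (1 - nrm A v)"
    using one_minus_unit[of v] v small by auto
  have eq: "u \<ominus> w = u \<otimes> (\<one> \<ominus> v)"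
    using u w by (simp add: v_def alg_simps)
  show "u \<ominus> w \<in> Units A" using eq unit_mul u vu(1) by simp
  have "nrm A (inv (u \<ominus> w)) \<le> nrm A (inv (\<one> \<ominus> v)) * nrm A (inv u)"
    using eq unit_mul_inverse[OF u vu(1)] nrm_mult[of "inv (\<one> \<ominus> v)" "inv u"] u vu(1) by simp
  also have "\<dots> \<le> 1 / (1 - nrm A (inv u) * nrm A w) * nrm A (inv u)"
  proof (rule mult_right_mono)
    have "1 / (1 - nrm A v) \<le> 1 / (1 - nrm A (inv u) * nrm A w)"
      using v(2) small by (intro divide_left_mono) auto
    then show "nrm A (inv (\<one> \<ominus> v)) \<le> 1 / (1 - nrm A (inv u) * nrm A w)" using vu(2) by simp
  qed (use u nrm_nonneg in auto)
  finally show "nrm A (inv (u \<ominus> w)) \<le> nrm A (inv u) / (1 - nrm A (inv u) * nrm A w)" by simp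
qed

lemma add_scalar_one_unit:
  assumes x: "x \<in> carrier A" and lt: "nrm A x < cmod c"
  shows "x \<oplus> c \<odot> \<one> \<in> Units A"
proof -
  have c: "c \<noteq> 0" using lt nrm_nonneg[OF x] by auto
  define a where "a = (- 1 / c) \<odot> x"
  have a: "a \<in> carrier A" "nrm A a < 1"
    using x lt c by (auto simp: a_def nrm_smult norm_divide field_simps)
  have "x \<oplus> c \<odot> \<one> = c \<odot> (\<one> \<ominus> a)"
    using x c by (simp add: a_def alg_simps add_ac)
  then show ?thesis using unit_scalar(1)[OF one_minus_unit(1)[OF a] c] by simp
qed

text \<open>Arens's trick: the cross terms of \<open>(h + it)\<^sup>*(h + it)\<close> cancel, so that \<open>\<parallel>h + it\<parallel>\<^sup>2 = \<parallel>h\<^sup>2 + t\<^sup>2\<parallel>\<close>. For a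
  suitable real \<open>t\<close> the bound falls below \<open>(\<beta> - t)\<^sup>2\<close>, which makes \<open>h + i\<beta>\<close> invertible.\<close>

lemma nrm_add_imaginary:
  assumes h: "h \<in> carrier A" "star A h = h"
  shows "(nrm A (h \<oplus> (\<i> * complex_of_real t) \<odot> \<one>))\<^sup>2 \<le> (nrm A h)\<^sup>2 + t\<^sup>2"
proof -
  let ?x = "h \<oplus> (\<i> * complex_of_real t) \<odot> \<one>"
  have "\<i> * complex_of_real t * (\<i> * complex_of_real t) = - (complex_of_real t * complex_of_real t)"
    by (simp add: mult.assoc mult.left_commute)
  then have "star A ?x \<otimes> ?x = (h \<otimes> h \<oplus> (complex_of_real (t\<^sup>2)) \<odot> \<one>)
      \<oplus> ((\<i> * complex_of_real t) \<odot> h \<oplus> (- \<i> * complex_of_real t) \<odot> h)"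
    using h by (simp add: star_simps alg_simps add_ac power2_eq_square)
  also have "\<dots> = h \<otimes> h \<oplus> (complex_of_real (t\<^sup>2)) \<odot> \<one>"
    using h(1) by (subst scalar_collect(1)) auto
  finally have "(nrm A ?x)\<^sup>2 = nrm A (h \<otimes> h \<oplus> (complex_of_real (t\<^sup>2)) \<odot> \<one>)"
    using nrm_star_mult[of ?x] h(1) by simp
  also have "\<dots> \<le> nrm A (h \<otimes> h) + nrm A ((complex_of_real (t\<^sup>2)) \<odot> \<one>)"
    using h by (intro nrm_triangle) auto
  also have "nrm A ((complex_of_real (t\<^sup>2)) \<odot> \<one>) \<le> t\<^sup>2"
    using nrm_one_le nrm_smult[of \<one> "complex_of_real (t\<^sup>2)"]
    by (simp add: mult_left_le norm_power)
  finally show ?thesis using h nrm_mult[of h h] by (simp add: power2_eq_square)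
qed

text \<open>The bound on the inverse \<open>w\<close> comes from \<open>w - w\<^sup>* = -2i\<beta> w w\<^sup>*\<close> and \<open>\<parallel>w w\<^sup>*\<parallel> = \<parallel>w\<parallel>\<^sup>2\<close>.\<close>

lemma self_adjoint_imaginary_shift:
  assumes h: "h \<in> carrier A" "star A h = h" and \<beta>: "\<beta> \<noteq> 0"
  shows "h \<oplus> (\<i> * complex_of_real \<beta>) \<odot> \<one> \<in> Units A"
    and "nrm A (inv (h \<oplus> (\<i> * complex_of_real \<beta>) \<odot> \<one>)) \<le> 1 / \<bar>\<beta>\<bar>"
proof -
  define t where "t = - (nrm A h)\<^sup>2 / (2 * \<beta>)"
  let ?u = "h \<oplus> (\<i> * complex_of_real \<beta>) \<odot> \<one>"
  define x where "x = h \<oplus> (\<i> * complex_of_real t) \<odot> \<one>"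
  have x: "x \<in> carrier A" using h by (simp add: x_def)
  have "(nrm A x)\<^sup>2 < (\<beta> - t)\<^sup>2"
  proof -
    have "(\<beta> - t)\<^sup>2 = \<beta>\<^sup>2 + t\<^sup>2 + (nrm A h)\<^sup>2"
    proof -
      have "2 * \<beta> * t = - (nrm A h)\<^sup>2" using \<beta> by (simp add: t_def)
      then show ?thesis by (simp add: power2_diff)
    qed
    moreover have "\<beta>\<^sup>2 > 0" using \<beta> by simp
    ultimately show ?thesis using nrm_add_imaginary[OF h, of t] unfolding x_def by linarith
  qed
  then have "nrm A x < \<bar>\<beta> - t\<bar>"
    using power2_less_imp_less[of "nrm A x" "\<bar>\<beta> - t\<bar>"] by simp
  then have "x \<oplus> (\<i> * complex_of_real (\<beta> - t)) \<odot> \<one> \<in> Units A"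
    using add_scalar_one_unit[OF x, of "\<i> * complex_of_real (\<beta> - t)"]
    by (simp add: norm_mult del: of_real_diff)
  moreover have "x \<oplus> (\<i> * complex_of_real (\<beta> - t)) \<odot> \<one> = ?u"
    using h(1) by (simp add: x_def add_assoc scalar_collect algebra_simps)
  ultimately show u: "?u \<in> Units A" by simp
  define w where "w = inv ?u"
  have w: "w \<in> carrier A" "?u \<otimes> w = \<one>" "w \<otimes> ?u = \<one>" using u by (auto simp: w_def)
  have sw: "star A ?u \<otimes> star A w = \<one>" 
    using w h(1) star_mult[of w ?u] by simp
  have su: "star A ?u = h \<oplus> (- \<i> * complex_of_real \<beta>) \<odot> \<one>"
    using h by (simp add: star_simps)
  have "w \<ominus> star A w = w \<otimes> (star A ?u \<otimes> star A w) \<ominus> (w \<otimes> ?u) \<otimes> star A w"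
    using w sw h by simp
  also have "\<dots> = w \<otimes> ((star A ?u \<ominus> ?u) \<otimes> star A w)"
    using w(1) h(1) by (simp add: alg_simps)
  also have "star A ?u \<ominus> ?u = (h \<oplus> (-1) \<odot> h) \<oplus> ((- \<i> * complex_of_real \<beta>) \<odot> \<one> \<oplus> (- \<i> * complex_of_real \<beta>) \<odot> \<one>)"
    unfolding su using h(1) by (simp add: alg_simps add_ac)
  also have "\<dots> = (- 2 * \<i> * complex_of_real \<beta>) \<odot> \<one>"
    using h(1) by (simp add: scalar_collect mult.assoc)
  also have "w \<otimes> (\<dots> \<otimes> star A w) = (- 2 * \<i> * complex_of_real \<beta>) \<odot> (w \<otimes> star A w)"
    using w(1) by (simp add: alg_simps)
  finally have "nrm A (w \<ominus> star A w) = 2 * \<bar>\<beta>\<bar> * (nrm A w)\<^sup>2"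
    using w(1) nrm_mult_star[of w] by (simp add: nrm_smult norm_mult)
  moreover have "nrm A (w \<ominus> star A w) \<le> 2 * nrm A w"
    using nrm_diff_le[of w "star A w"] w(1) by simp
  ultimately have "\<bar>\<beta>\<bar> * nrm A w * nrm A w \<le> 1 * nrm A w" by (simp add: power2_eq_square)
  then have "\<bar>\<beta>\<bar> * nrm A w \<le> 1 \<or> nrm A w = 0"
    using nrm_nonneg[OF w(1)] by (metis linorder_not_less mult_less_cancel_right_pos order_le_less)
  then show "nrm A (inv ?u) \<le> 1 / \<bar>\<beta>\<bar>"
    using \<beta> by (auto simp: w_def field_simps)
qed

end

section \<open>The norm of a self-adjoint element belongs to the spectrum up to sign\<close>

context unital_cstar_algebra
begin

lemma inverse_diff:
  assumes "u \<in> Units A" "v \<in> Units A"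
  shows "inv v \<ominus> inv u = inv v \<otimes> ((u \<ominus> v) \<otimes> inv u)"
  using assms by (simp add: alg_simps)

text \<open>The partial fraction decomposition of \<open>1 / (1 - b\<^sup>2)\<close>.\<close>

lemma inverse_one_minus_square:
  assumes b: "b \<in> carrier A" and u: "\<one> \<ominus> b \<in> Units A" and v: "\<one> \<oplus> b \<in> Units A"
  shows "\<one> \<ominus> b \<otimes> b \<in> Units A"
    and "inv (\<one> \<ominus> b \<otimes> b) = (1/2) \<odot> (inv (\<one> \<ominus> b) \<oplus> inv (\<one> \<oplus> b))"
proof -
  define u' v' where "u' = inv (\<one> \<ominus> b)" and "v' = inv (\<one> \<oplus> b)"
  have c: "u' \<in> carrier A" "v' \<in> carrier A" using u v by (auto simp: u'_def v'_def)
  have uv: "(\<one> \<ominus> b) \<otimes> (\<one> \<oplus> b) = \<one> \<ominus> b \<otimes> b"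
  proof -
    have "(\<one> \<ominus> b) \<otimes> (\<one> \<oplus> b) = (b \<oplus> (-1) \<odot> b) \<oplus> (\<one> \<oplus> (-1) \<odot> (b \<otimes> b))"
      using b by (simp add: alg_simps add_ac)
    then show ?thesis using b by (simp add: scalar_collect minus_scalar)
  qed
  have vu: "(\<one> \<oplus> b) \<otimes> (\<one> \<ominus> b) = \<one> \<ominus> b \<otimes> b"
  proof -
    have "(\<one> \<oplus> b) \<otimes> (\<one> \<ominus> b) = (b \<oplus> (-1) \<odot> b) \<oplus> (\<one> \<oplus> (-1) \<odot> (b \<otimes> b))"
      using b by (simp add: alg_simps add_ac)
    then show ?thesis using b by (simp add: scalar_collect minus_scalar)
  qed
  have sum: "(\<one> \<oplus> b) \<oplus> (\<one> \<ominus> b) = 2 \<odot> \<one>"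
  proof -
    have "(\<one> \<oplus> b) \<oplus> (\<one> \<ominus> b) = (b \<oplus> (-1) \<odot> b) \<oplus> (\<one> \<oplus> \<one>)"
      using b by (simp add: alg_simps add_ac)
    then show ?thesis using b by (simp add: scalar_collect)
  qed
  have "(\<one> \<ominus> b \<otimes> b) \<otimes> (u' \<oplus> v') = (\<one> \<ominus> b \<otimes> b) \<otimes> u' \<oplus> (\<one> \<ominus> b \<otimes> b) \<otimes> v'"
    using b c by (intro mul_add) auto
  also have "(\<one> \<ominus> b \<otimes> b) \<otimes> u' = \<one> \<oplus> b"
    unfolding vu[symmetric] u'_def using b u v by (subst mul_assoc) auto
  also have "(\<one> \<ominus> b \<otimes> b) \<otimes> v' = \<one> \<ominus> b"
    unfolding uv[symmetric] v'_def using b u v by (subst mul_assoc) auto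
  finally have r: "(\<one> \<ominus> b \<otimes> b) \<otimes> (u' \<oplus> v') = 2 \<odot> \<one>" using sum by simp
  have "(u' \<oplus> v') \<otimes> (\<one> \<ominus> b \<otimes> b) = u' \<otimes> (\<one> \<ominus> b \<otimes> b) \<oplus> v' \<otimes> (\<one> \<ominus> b \<otimes> b)"
    using b c by (intro add_mul) auto
  also have "u' \<otimes> (\<one> \<ominus> b \<otimes> b) = \<one> \<oplus> b"
    unfolding uv[symmetric] u'_def using b u v by (intro inv_mul_left) auto
  also have "v' \<otimes> (\<one> \<ominus> b \<otimes> b) = \<one> \<ominus> b"
    unfolding vu[symmetric] v'_def using b u v by (intro inv_mul_left) auto
  finally have l: "(u' \<oplus> v') \<otimes> (\<one> \<ominus> b \<otimes> b) = 2 \<odot> \<one>" using sum by simp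
  have "(\<one> \<ominus> b \<otimes> b) \<otimes> ((1/2) \<odot> (u' \<oplus> v')) = \<one>" "((1/2) \<odot> (u' \<oplus> v')) \<otimes> (\<one> \<ominus> b \<otimes> b) = \<one>"
    using r l b c by (simp_all add: smult_mult_right smult_mult_left)
  from unit_and_inverse[OF _ _ this]
  show "\<one> \<ominus> b \<otimes> b \<in> Units A"
    "inv (\<one> \<ominus> b \<otimes> b) = (1/2) \<odot> (inv (\<one> \<ominus> b) \<oplus> inv (\<one> \<oplus> b))"
    using b c by (simp_all add: u'_def v'_def)
qed

text \<open>The resolvent of \<open>a\<close>, in the variable \<open>1/z\<close>, takes nearly the same values on the circles of radii \<open>r\<close>
and \<open>s\<close>. The constant \<open>1/4\<close> leaves enough room in the final comparison with the unit.\<close>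

definition resolvents_close :: "'a \<Rightarrow> real \<Rightarrow> real \<Rightarrow> bool" where
  "resolvents_close a r s \<longleftrightarrow> (\<forall>z. cmod z = 1 \<longrightarrow>
     \<one> \<ominus> (complex_of_real r * z) \<odot> a \<in> Units A \<and> \<one> \<ominus> (complex_of_real s * z) \<odot> a \<in> Units A \<and>
     nrm A (inv (\<one> \<ominus> (complex_of_real r * z) \<odot> a) \<ominus> inv (\<one> \<ominus> (complex_of_real s * z) \<odot> a)) \<le> 1/4)"

text \<open>At \<open>z = w\<^sup>2\<close> the resolvent of \<open>a\<^sup>2\<close> is the average of the resolvents of \<open>a\<close> at \<open>w\<close> and \<open>-w\<close>, so the
closeness does not deteriorate.\<close>

lemma resolvents_close_square:
  assumes a: "a \<in> carrier A" and cl: "resolvents_close a r s"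
  shows "resolvents_close (a \<otimes> a) (r\<^sup>2) (s\<^sup>2)"
  unfolding resolvents_close_def
proof (intro allI impI)
  fix z assume z: "cmod z = 1"
  define w where "w = csqrt z"
  have w: "w * w = z" "cmod w = 1"
    using z power2_csqrt[of z] by (auto simp: w_def power2_eq_square norm_csqrt)
  have mw: "cmod (- w) = 1" using w by simp
  have sq: "\<one> \<ominus> (complex_of_real (t\<^sup>2) * z) \<odot> (a \<otimes> a) =
      \<one> \<ominus> ((complex_of_real t * w) \<odot> a) \<otimes> ((complex_of_real t * w) \<odot> a)" for t
    using a by (simp add: smult_mult_left smult_mult_right power2_eq_square w(1)[symmetric] mult_ac)
  have neg: "\<one> \<oplus> (complex_of_real t * w) \<odot> a = \<one> \<ominus> (complex_of_real t * - w) \<odot> a" for t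
    using a by (simp add: minus_scalar)
  define P where "P t = inv (\<one> \<ominus> (complex_of_real t * w) \<odot> a)" for t
  define Q where "Q t = inv (\<one> \<ominus> (complex_of_real t * - w) \<odot> a)" for t
  have un: "\<one> \<ominus> (complex_of_real r * w) \<odot> a \<in> Units A" "\<one> \<ominus> (complex_of_real s * w) \<odot> a \<in> Units A"
     "\<one> \<ominus> (complex_of_real r * - w) \<odot> a \<in> Units A" "\<one> \<ominus> (complex_of_real s * - w) \<odot> a \<in> Units A"
    using cl w(2) mw unfolding resolvents_close_def by blast+
  have d: "nrm A (P r \<ominus> P s) \<le> 1/4" "nrm A (Q r \<ominus> Q s) \<le> 1/4"
    using cl w(2) mw unfolding resolvents_close_def P_def Q_def by blast+
  have c: "P r \<in> carrier A" "P s \<in> carrier A" "Q r \<in> carrier A" "Q s \<in> carrier A"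
    using un unfolding P_def Q_def by blast+
  have R: "\<one> \<ominus> (complex_of_real (r\<^sup>2) * z) \<odot> (a \<otimes> a) \<in> Units A"
      "inv (\<one> \<ominus> (complex_of_real (r\<^sup>2) * z) \<odot> (a \<otimes> a)) = (1/2) \<odot> (P r \<oplus> Q r)"
    unfolding sq P_def Q_def neg[symmetric]
    using un a by (intro inverse_one_minus_square; simp add: neg)+
  have S: "\<one> \<ominus> (complex_of_real (s\<^sup>2) * z) \<odot> (a \<otimes> a) \<in> Units A"
      "inv (\<one> \<ominus> (complex_of_real (s\<^sup>2) * z) \<odot> (a \<otimes> a)) = (1/2) \<odot> (P s \<oplus> Q s)"
    unfolding sq P_def Q_def neg[symmetric]
    using un a by (intro inverse_one_minus_square; simp add: neg)+
  have "(1/2) \<odot> (P r \<oplus> Q r) \<ominus> (1/2) \<odot> (P s \<oplus> Q s) = (1/2) \<odot> ((P r \<ominus> P s) \<oplus> (Q r \<ominus> Q s))"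
    using c by (simp add: alg_simps add_ac)
  then have "nrm A ((1/2) \<odot> (P r \<oplus> Q r) \<ominus> (1/2) \<odot> (P s \<oplus> Q s)) \<le> (1/2) * (1/4 + 1/4)"
    using c d nrm_triangle[of "P r \<ominus> P s" "Q r \<ominus> Q s"] by (simp add: nrm_smult norm_divide)
  then show "\<one> \<ominus> (complex_of_real (r\<^sup>2) * z) \<odot> (a \<otimes> a) \<in> Units A \<and>
      \<one> \<ominus> (complex_of_real (s\<^sup>2) * z) \<odot> (a \<otimes> a) \<in> Units A \<and>
      nrm A (inv (\<one> \<ominus> (complex_of_real (r\<^sup>2) * z) \<odot> (a \<otimes> a))
        \<ominus> inv (\<one> \<ominus> (complex_of_real (s\<^sup>2) * z) \<odot> (a \<otimes> a))) \<le> 1/4"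
    using R S by simp
qed

text \<open>Away from \<open>\<plusminus>1\<close> the inverse is bounded by \<open>1 / \<bar>Im z\<bar>\<close>; near \<open>\<plusminus>1\<close> it is a perturbation of the inverse of
\<open>1 \<mp> h\<close>. The two regimes overlap since a unimodular \<open>z\<close> satisfies \<open>\<bar>z - 1\<bar> \<le> 2 \<bar>Im z\<bar>\<close> or
\<open>\<bar>z + 1\<bar> \<le> 2 \<bar>Im z\<bar>\<close>.\<close>

lemma resolvents_bounded_on_circle:
  assumes h: "h \<in> carrier A" "star A h = h" "nrm A h = 1"
    and u: "\<one> \<ominus> h \<in> Units A" "\<one> \<oplus> h \<in> Units A"
  obtains M where "M \<ge> 1"
    "\<And>z. cmod z = 1 \<Longrightarrow> \<one> \<ominus> z \<odot> h \<in> Units A \<and> nrm A (inv (\<one> \<ominus> z \<odot> h)) \<le> M"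
proof -
  define m where "m = max 1 (max (nrm A (inv (\<one> \<ominus> h))) (nrm A (inv (\<one> \<oplus> h))))"
  have m: "m \<ge> 1" by (simp add: m_def)
  have "\<one> \<ominus> z \<odot> h \<in> Units A \<and> nrm A (inv (\<one> \<ominus> z \<odot> h)) \<le> 4 * m" if z: "cmod z = 1" for z
  proof (cases "\<bar>Im z\<bar> \<ge> 1 / (4 * m)")
    case True
    then have I: "Im z \<noteq> 0" using m by auto
    have z0: "z \<noteq> 0" using z by auto
    define g where "g = h \<oplus> complex_of_real (- Re z) \<odot> \<one>"
    have g: "g \<in> carrier A" "star A g = g" using h by (auto simp: g_def star_simps)
    define v where "v = g \<oplus> (\<i> * complex_of_real (Im z)) \<odot> \<one>"
    have v: "v \<in> Units A" "nrm A (inv v) \<le> 1 / \<bar>Im z\<bar>"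
      unfolding v_def using self_adjoint_imaginary_shift[OF g I] by auto
    have zz: "- z * (complex_of_real (- Re z) + \<i> * complex_of_real (Im z)) = 1"
    proof -
      have "complex_of_real (- Re z) + \<i> * complex_of_real (Im z) = - cnj z"
        by (simp add: complex_eq_iff)
      then show ?thesis using z complex_norm_square[of z] by simp
    qed
    have "v = h \<oplus> (complex_of_real (- Re z) + \<i> * complex_of_real (Im z)) \<odot> \<one>"
      unfolding v_def g_def using h by (simp add: add_assoc scalar_collect)
    then have "(- z) \<odot> v = (- z) \<odot> h \<oplus> (- z * (complex_of_real (- Re z) + \<i> * complex_of_real (Im z))) \<odot> \<one>"
      using h(1) by (simp add: scalar_distr)
    then have eq: "\<one> \<ominus> z \<odot> h = (- z) \<odot> v"
      unfolding zz using h(1) by (simp add: minus_scalar add_comm)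
    have "nrm A (inv (\<one> \<ominus> z \<odot> h)) = nrm A (inv v)"
      unfolding eq using unit_scalar(2)[OF v(1), of "- z"] z z0 v(1) by (simp add: nrm_smult norm_divide)
    also have "\<dots> \<le> 1 / (1 / (4 * m))"
      using v(2) True m I by (smt (verit) divide_left_mono divide_pos_pos mult_pos_pos)
    finally show ?thesis using eq unit_scalar(1)[OF v(1), of "- z"] z0 by simp
  next
    case False
    define s :: real where "s = (if Re z \<ge> 0 then 1 else - 1)"
    have uz: "\<one> \<ominus> complex_of_real s \<odot> h \<in> Units A" "nrm A (inv (\<one> \<ominus> complex_of_real s \<odot> h)) \<le> m"
      using u h(1) by (auto simp: s_def m_def minus_scalar)
    have "(Re z)\<^sup>2 + (Im z)\<^sup>2 = 1" using z cmod_power2[of z] by simp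
    then have R1: "\<bar>Re z\<bar> \<le> 1" "(Im z)\<^sup>2 = 1 - (Re z)\<^sup>2"
      using abs_Re_le_cmod[of z] z by auto
    have "(cmod (z - complex_of_real s))\<^sup>2 = (Re z - s)\<^sup>2 + (Im z)\<^sup>2"
      by (simp only: cmod_power2 minus_complex.sel Re_complex_of_real Im_complex_of_real diff_0_right)
    also have "\<dots> = 2 - 2 * \<bar>Re z\<bar>"
      unfolding R1(2) by (simp add: s_def power2_eq_square algebra_simps)
    also have "\<dots> \<le> (2 * \<bar>Im z\<bar>)\<^sup>2"
    proof -
      have "\<bar>Re z\<bar> * \<bar>Re z\<bar> \<le> 1 * \<bar>Re z\<bar>" using R1(1) by (intro mult_right_mono) auto
      then have "\<bar>Re z\<bar>\<^sup>2 \<le> \<bar>Re z\<bar>" by (simp add: power2_eq_square)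
      then show ?thesis using R1 by (simp add: power_mult_distrib)
    qed
    finally have "cmod (z - complex_of_real s) \<le> 2 * \<bar>Im z\<bar>"
      by (rule power2_le_imp_le) simp
    then have small: "cmod (z - complex_of_real s) < 1 / (2 * m)" using False by simp
    define w where "w = (z - complex_of_real s) \<odot> h"
    have w: "w \<in> carrier A" "nrm A w < 1 / (2 * m)" using h small by (auto simp: w_def nrm_smult)
    define i where "i = nrm A (inv (\<one> \<ominus> complex_of_real s \<odot> h))"
    have i: "0 \<le> i" "i \<le> m" using uz nrm_nonneg by (auto simp: i_def)
    have "i * nrm A w \<le> m * (1 / (2 * m))" 
      using i w m nrm_nonneg[OF w(1)] by (intro mult_mono) auto
    then have half: "i * nrm A w \<le> 1 / 2" using m by simp
    have "complex_of_real s \<odot> h \<oplus> w = z \<odot> h"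
      unfolding w_def using h(1) scalar_add[of h "complex_of_real s" "z - complex_of_real s"] by simp
    then have eq: "\<one> \<ominus> z \<odot> h = (\<one> \<ominus> complex_of_real s \<odot> h) \<ominus> w"
      using h(1) w(1) by (simp add: alg_simps add_ac flip: \<open>complex_of_real s \<odot> h \<oplus> w = z \<odot> h\<close>)
    have "nrm A (inv ((\<one> \<ominus> complex_of_real s \<odot> h) \<ominus> w)) \<le> i / (1 - i * nrm A w)"
      unfolding i_def using unit_perturbation(2)[OF uz(1) w(1)] half by (simp add: i_def)
    also have "\<dots> \<le> m / (1 / 2)" using i half m by (intro frac_le) auto
    finally show ?thesis
      unfolding eq using unit_perturbation(1)[OF uz(1) w(1)] half m by (simp add: i_def)
  qed
  with that[of "4 * m"] m show thesis by simp
qed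

text \<open>This is the spectral radius formula \<open>r(h) = \<parallel>h\<parallel>\<close> for self-adjoint \<open>h\<close>, obtained without
  complex analysis. If both \<open>1 - h\<close> and \<open>1 + h\<close> were invertible, the resolvent would be uniformly
  bounded near the unit circle, hence nearly equal on the circles of radii \<open>1 - \<eta>\<close> and \<open>1 + \<eta>\<close>.
  Averaging over \<open>\<plusminus>z\<close> transports this to the iterated squares of \<open>h\<close>, which have norm one. But for
  a high power \<open>N\<close> one has \<open>(1 - (1 - \<eta>)\<^sup>N h\<^sup>N)\<^sup>-\<^sup>1 \<approx> 1\<close>, so that \<open>1 - (1 + \<eta>)\<^sup>N h\<^sup>N\<close> would be
  bounded.\<close>

lemma norm_one_self_adjoint_spectrum:
  assumes h: "h \<in> carrier A" "star A h = h" "nrm A h = 1"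
    and u: "\<one> \<ominus> h \<in> Units A" "\<one> \<oplus> h \<in> Units A"
  shows False
proof -
  obtain M where M: "M \<ge> 1"
    and bd: "\<And>z. cmod z = 1 \<Longrightarrow> \<one> \<ominus> z \<odot> h \<in> Units A \<and> nrm A (inv (\<one> \<ominus> z \<odot> h)) \<le> M"
    using resolvents_bounded_on_circle[OF h u] by blast
  define \<eta> where "\<eta> = 1 / (16 * M\<^sup>2)"
  have M2: "M\<^sup>2 \<ge> 1" using M by simp
  have \<eta>: "0 < \<eta>" "\<eta> \<le> 1 / 16" "2 * M * (\<eta> * M) = 1 / 8" "M * \<eta> \<le> 1 / 2"
  proof -
    show "0 < \<eta>" "\<eta> \<le> 1 / 16" "2 * M * (\<eta> * M) = 1 / 8"
      using M M2 by (auto simp: \<eta>_def power2_eq_square field_simps)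
    have "M * \<eta> = 1 / (16 * M)" using M by (simp add: \<eta>_def power2_eq_square)
    also have "\<dots> \<le> 1 / 2" using M by (simp add: field_simps)
    finally show "M * \<eta> \<le> 1 / 2" .
  qed
  have near: "\<one> \<ominus> (complex_of_real c * z) \<odot> h \<in> Units A \<and>
      nrm A (inv (\<one> \<ominus> (complex_of_real c * z) \<odot> h) \<ominus> inv (\<one> \<ominus> z \<odot> h)) \<le> 1 / 8"
    if z: "cmod z = 1" and c: "\<bar>c - 1\<bar> = \<eta>" for z c
  proof -
    define v where "v = \<one> \<ominus> z \<odot> h"
    have v: "v \<in> Units A" "nrm A (inv v) \<le> M" using bd[OF z] by (auto simp: v_def)
    have iv: "0 \<le> nrm A (inv v)" using v(1) nrm_nonneg by blast
    define w where "w = (complex_of_real (c - 1) * z) \<odot> h"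
    have nw: "nrm A w = \<eta>" "w \<in> carrier A"
      using h z c by (auto simp: w_def nrm_smult norm_mult simp del: of_real_diff)
    have "z \<odot> h \<oplus> w = (complex_of_real c * z) \<odot> h"
      unfolding w_def using h(1) scalar_add[of h z "complex_of_real (c - 1) * z"] by (simp add: algebra_simps)
    then have eq: "\<one> \<ominus> (complex_of_real c * z) \<odot> h = v \<ominus> w"
      using h(1) nw(2) by (simp add: v_def alg_simps add_ac flip: \<open>z \<odot> h \<oplus> w = (complex_of_real c * z) \<odot> h\<close>)
    have half: "nrm A (inv v) * nrm A w \<le> 1 / 2"
    proof -
      have "nrm A (inv v) * \<eta> \<le> M * \<eta>" using v(2) \<eta> by (intro mult_right_mono) auto
      then show ?thesis unfolding nw using \<eta>(4) by linarith
    qed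
    have vw: "v \<ominus> w \<in> Units A" using unit_perturbation(1)[OF v(1) nw(2)] half by simp
    have "nrm A (inv (v \<ominus> w)) \<le> nrm A (inv v) / (1 - nrm A (inv v) * nrm A w)"
      using unit_perturbation(2)[OF v(1) nw(2)] half by simp
    also have "\<dots> \<le> M / (1 / 2)" using v(2) half M iv by (intro frac_le) auto
    finally have n1: "nrm A (inv (v \<ominus> w)) \<le> 2 * M" by simp
    have "v \<ominus> (v \<ominus> w) = (v \<oplus> (-1) \<odot> v) \<oplus> w"
      using v(1) nw(2) by (simp add: alg_simps add_ac)
    then have "v \<ominus> (v \<ominus> w) = w" using v(1) nw(2) by (simp add: scalar_collect)
    then have "inv (v \<ominus> w) \<ominus> inv v = inv (v \<ominus> w) \<otimes> (w \<otimes> inv v)"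
      using inverse_diff[OF v(1) vw] by simp
    also have "nrm A \<dots> \<le> nrm A (inv (v \<ominus> w)) * nrm A (w \<otimes> inv v)"
      using vw v nw by (intro nrm_mult) auto
    also have "\<dots> \<le> (2 * M) * (\<eta> * M)"
    proof (rule mult_mono[OF n1])
      have "nrm A (w \<otimes> inv v) \<le> nrm A w * nrm A (inv v)" using v(1) nw(2) by (intro nrm_mult) auto
      also have "\<dots> \<le> \<eta> * M" unfolding nw using v(2) \<eta> by simp
      finally show "nrm A (w \<otimes> inv v) \<le> \<eta> * M" .
    qed (use M v(1) nw(2) nrm_nonneg in auto)
    finally have "nrm A (inv (v \<ominus> w) \<ominus> inv v) \<le> 1 / 8" using \<eta>(3) by simp
    then show ?thesis using eq vw by (simp add: v_def)
  qed
  define r s where "r = 1 - \<eta>" and "s = 1 + \<eta>"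
  have rs: "0 \<le> r" "r < 1" "1 < s" using \<eta> by (auto simp: r_def s_def)
  have base: "resolvents_close h r s"
    unfolding resolvents_close_def
  proof (intro allI impI)
    fix z assume z: "cmod z = 1"
    let ?R = "inv (\<one> \<ominus> (complex_of_real r * z) \<odot> h)" and ?S = "inv (\<one> \<ominus> (complex_of_real s * z) \<odot> h)"
      and ?Z = "inv (\<one> \<ominus> z \<odot> h)"
    have R: "\<one> \<ominus> (complex_of_real r * z) \<odot> h \<in> Units A" "nrm A (?R \<ominus> ?Z) \<le> 1 / 8"
      using near[OF z, of r] \<eta> by (auto simp: r_def)
    have S: "\<one> \<ominus> (complex_of_real s * z) \<odot> h \<in> Units A" "nrm A (?S \<ominus> ?Z) \<le> 1 / 8"
      using near[OF z, of s] \<eta> by (auto simp: s_def)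
    have "nrm A (?R \<ominus> ?S) \<le> nrm A (?R \<ominus> ?Z) + nrm A (?Z \<ominus> ?S)"
      using R S bd[OF z] by (intro nrm_diff_triangle) auto
    also have "nrm A (?Z \<ominus> ?S) = nrm A (?S \<ominus> ?Z)"
      using S bd[OF z] by (intro nrm_diff_commute) auto
    finally show "\<one> \<ominus> (complex_of_real r * z) \<odot> h \<in> Units A \<and> \<one> \<ominus> (complex_of_real s * z) \<odot> h \<in> Units A \<and>
        nrm A (?R \<ominus> ?S) \<le> 1 / 4"
      using R S by simp
  qed
  define a where "a n = ((\<lambda>x. x \<otimes> x) ^^ n) h" for n
  have a: "a n \<in> carrier A \<and> star A (a n) = a n \<and> nrm A (a n) = 1 \<and>
      resolvents_close (a n) (r ^ 2 ^ n) (s ^ 2 ^ n)" for n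
  proof (induction n)
    case (Suc n)
    have "nrm A (a n \<otimes> a n) = 1" using Suc nrm_star_mult[of "a n"] by simp
    then show ?case
      using Suc resolvents_close_square[of "a n" "r ^ 2 ^ n" "s ^ 2 ^ n"]
      by (simp add: a_def star_mult power_mult[symmetric] mult.commute)
  qed (use h base in \<open>simp add: a_def\<close>)
  obtain k where k: "r ^ k < 1 / 5" using real_arch_pow_inv[of "1/5" r] rs by auto
  obtain l where l: "3 < s ^ l" using real_arch_pow[of s 3] rs by auto
  define n where "n = max k l"
  have n: "k \<le> 2 ^ n" "l \<le> 2 ^ n"
  proof -
    have "n \<le> 2 ^ n" using less_exp[of n] by simp
    moreover have "k \<le> n" "l \<le> n" by (auto simp: n_def)
    ultimately show "k \<le> 2 ^ n" "l \<le> 2 ^ n" by linarith+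
  qed
  define p q where "p = r ^ 2 ^ n" and "q = s ^ 2 ^ n"
  have p: "0 \<le> p" "p < 1 / 5"
    using k power_decreasing[OF n(1) rs(1) less_imp_le[OF rs(2)]] rs(1) unfolding p_def by auto
  have q: "3 < q" using l power_increasing[OF n(2) less_imp_le[OF rs(3)]] unfolding q_def by linarith
  define P Q where "P = inv (\<one> \<ominus> complex_of_real p \<odot> a n)" and "Q = inv (\<one> \<ominus> complex_of_real q \<odot> a n)"
  have un: "\<one> \<ominus> complex_of_real p \<odot> a n \<in> Units A" "\<one> \<ominus> complex_of_real q \<odot> a n \<in> Units A"
    and PQ: "nrm A (P \<ominus> Q) \<le> 1 / 4"
    using a[of n] unfolding resolvents_close_def P_def Q_def p_def q_def
    by (auto dest: spec[of _ 1])
  have c: "P \<in> carrier A" "Q \<in> carrier A" using un by (auto simp: P_def Q_def)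
  have pa: "complex_of_real p \<odot> a n \<in> carrier A" "nrm A (complex_of_real p \<odot> a n) = p"
    using a[of n] p by (auto simp: nrm_smult)
  have P54: "nrm A P \<le> 5 / 4"
  proof -
    have "nrm A P \<le> 1 / (1 - p)" using one_minus_unit(2)[of "complex_of_real p \<odot> a n"] pa p by (simp add: P_def)
    also have "\<dots> \<le> 1 / (4 / 5)" using p by (intro divide_left_mono) auto
    finally show ?thesis by simp
  qed
  have "P \<ominus> \<one> = P \<ominus> P \<otimes> (\<one> \<ominus> complex_of_real p \<odot> a n)" using un by (simp add: P_def)
  also have "\<dots> = (P \<oplus> (-1) \<odot> P) \<oplus> P \<otimes> (complex_of_real p \<odot> a n)"
    using c pa(1) a[of n] by (simp add: alg_simps add_ac)
  also have "\<dots> = P \<otimes> (complex_of_real p \<odot> a n)" using c pa(1) by (simp add: scalar_collect)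
  finally have "nrm A (P \<ominus> \<one>) \<le> nrm A P * p"
    using nrm_mult[OF c(1) pa(1)] pa(2) by simp
  also have "\<dots> \<le> 5 / 4 * (1 / 5)" using P54 p c nrm_nonneg by (intro mult_mono) auto
  finally have "nrm A (\<one> \<ominus> Q) \<le> 1 / 2"
    using nrm_diff_triangle[of \<one> P Q] PQ c by (simp add: nrm_diff_commute[of \<one> P])
  then have "nrm A (inv (\<one> \<ominus> (\<one> \<ominus> Q))) \<le> 1 / (1 - nrm A (\<one> \<ominus> Q))" "nrm A (\<one> \<ominus> Q) \<le> 1 / 2"
    using one_minus_unit(2)[of "\<one> \<ominus> Q"] c by auto
  moreover have "\<one> \<ominus> (\<one> \<ominus> Q) = Q"
  proof -
    have "\<one> \<ominus> (\<one> \<ominus> Q) = (\<one> \<oplus> (-1) \<odot> \<one>) \<oplus> Q" using c by (simp add: alg_simps add_ac)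
    then show ?thesis using c by (simp add: scalar_collect)
  qed
  moreover have "1 / (1 - nrm A (\<one> \<ominus> Q)) \<le> 1 / (1 / 2)"
    using \<open>nrm A (\<one> \<ominus> Q) \<le> 1 / 2\<close> by (intro divide_left_mono) auto
  moreover have "inv Q = \<one> \<ominus> complex_of_real q \<odot> a n"
    unfolding Q_def using un(2) monoid.Units_inv_inv[OF A_monoid] by blast
  ultimately have "nrm A (\<one> \<ominus> complex_of_real q \<odot> a n) \<le> 2" by simp
  then have "nrm A (complex_of_real q \<odot> a n) \<le> 3"
    using nrm_le_diff[of "complex_of_real q \<odot> a n" \<one>] a[of n] nrm_one_le
    by (simp add: nrm_diff_commute)
  then show False using a[of n] q by (simp add: nrm_smult)
qed

lemma self_adjoint_norm_in_spectrum:
  assumes nontrivial: "\<one> \<noteq> \<zero>" and h: "h \<in> carrier A" "star A h = h"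
    and u: "complex_of_real (nrm A h) \<odot> \<one> \<ominus> h \<in> Units A" "complex_of_real (nrm A h) \<odot> \<one> \<oplus> h \<in> Units A"
  shows False
proof (cases "nrm A h = 0")
  case True
  then have "h = \<zero>" using h nrm_eq_0_iff by blast
  then have "\<zero> \<in> Units A" using u(2) by simp
  then have "\<zero> \<otimes> inv \<zero> = \<one>" by (rule mul_inv)
  moreover have "\<zero> \<otimes> inv \<zero> = \<zero>" using \<open>\<zero> \<in> Units A\<close> ring.ring_simprules(24)[OF A_ring] by blast
  ultimately show False using nontrivial by simp
next
  case False
  define m where "m = nrm A h"
  have m: "m > 0" using False nrm_nonneg[OF h(1)] by (simp add: m_def)
  define g where "g = complex_of_real (1 / m) \<odot> h"
  have g: "g \<in> carrier A" "star A g = g" "nrm A g = 1"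
    using h m by (auto simp: g_def star_simps nrm_smult norm_divide m_def)
  have "\<one> \<ominus> g = complex_of_real (1 / m) \<odot> (complex_of_real m \<odot> \<one> \<ominus> h)"
    "\<one> \<oplus> g = complex_of_real (1 / m) \<odot> (complex_of_real m \<odot> \<one> \<oplus> h)"
    using h m by (simp_all add: g_def alg_simps)
  then have "\<one> \<ominus> g \<in> Units A" "\<one> \<oplus> g \<in> Units A"
    using u m unit_scalar(1)[of _ "complex_of_real (1 / m)"] by (simp_all add: m_def)
  then show False using norm_one_self_adjoint_spectrum[OF g] by simp
qed

end

section \<open>Positive elements\<close>

context unital_cstar_algebra
begin

abbreviation scal :: "real \<Rightarrow> 'a" where "scal t \<equiv> complex_of_real t \<odot> \<one>"

text \<open>The spectrum of a self-adjoint element is real, so it is non-negative once no negative real number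
  belongs to it.\<close>

definition spec_nonneg :: "'a \<Rightarrow> bool" where
  "spec_nonneg h \<longleftrightarrow> h \<in> carrier A \<and> star A h = h \<and> (\<forall>t>0. h \<oplus> scal t \<in> Units A)"

text \<open>If \<open>g = t - h\<close> had norm \<open>m > t\<close>, then \<open>m - g = h + (m - t)\<close> would be invertible by assumption and
\<open>m + g = (m + t) - h\<close> because \<open>m + t > \<parallel>h\<parallel>\<close>.\<close>

lemma spec_nonneg_norm:
  assumes "\<one> \<noteq> \<zero>" and h: "spec_nonneg h" "nrm A h \<le> t"
  shows "nrm A (scal t \<ominus> h) \<le> t"
proof (rule ccontr)
  assume gt: "\<not> nrm A (scal t \<ominus> h) \<le> t"
  define g where "g = scal t \<ominus> h"
  define m where "m = nrm A g"
  have m: "m > t" "m > 0" using gt h(2) nrm_nonneg[of h] h(1) 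
    by (auto simp: m_def g_def spec_nonneg_def)
  have hc: "h \<in> carrier A" "star A h = h" using h by (auto simp: spec_nonneg_def)
  have g: "g \<in> carrier A" "star A g = g" using hc by (auto simp: g_def star_simps)
  have "scal m \<ominus> g = h \<oplus> (scal m \<oplus> (-complex_of_real t) \<odot> \<one>)"
    using hc by (simp add: g_def alg_simps add_ac)
  then have "scal m \<ominus> g = h \<oplus> scal (m - t)"
    by (simp add: scalar_collect)
  moreover have "h \<oplus> scal (m - t) \<in> Units A"
    using h(1) m unfolding spec_nonneg_def by (simp del: of_real_diff)
  ultimately have 1: "scal m \<ominus> g \<in> Units A" by (simp only:)
  have "scal m \<oplus> g = (scal m \<oplus> scal t) \<oplus> (-1) \<odot> h"
    using hc by (simp add: g_def alg_simps add_ac)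
  also have "\<dots> = (-1) \<odot> (h \<oplus> (- complex_of_real (m + t)) \<odot> \<one>)"
    using hc by (simp add: scalar_collect scalar_distr add_comm add.commute)
  finally have "scal m \<oplus> g = (-1) \<odot> (h \<oplus> (- complex_of_real (m + t)) \<odot> \<one>)" .
  moreover have "nrm A h < cmod (- complex_of_real (m + t))"
    unfolding norm_minus_cancel norm_of_real using h(2) m nrm_nonneg[OF hc(1)] by simp
  ultimately have 2: "scal m \<oplus> g \<in> Units A"
    using unit_scalar(1)[OF add_scalar_one_unit[OF hc(1)], of "- complex_of_real (m + t)" "-1"] by simp
  show False
    using self_adjoint_norm_in_spectrum[OF assms(1) g] 1 2 by (simp add: m_def)
qed

lemma spec_nonnegI_norm:
  assumes h: "h \<in> carrier A" "star A h = h" and t: "nrm A (scal t \<ominus> h) \<le> t"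
  shows "spec_nonneg h"
  unfolding spec_nonneg_def
proof (intro conjI allI impI h)
  fix s :: real assume s: "s > 0"
  have t0: "t \<ge> 0" using t nrm_nonneg[of "scal t \<ominus> h"] h by simp
  have "(scal t \<ominus> h) \<oplus> (- complex_of_real (t + s)) \<odot> \<one>
      = (scal t \<oplus> (- complex_of_real (t + s)) \<odot> \<one>) \<oplus> (-1) \<odot> h"
    using h by (simp add: alg_simps add_ac)
  also have "\<dots> = (-1) \<odot> (h \<oplus> scal s)"
    using h by (simp add: scalar_collect scalar_distr add_comm)
  finally have "h \<oplus> scal s = (-1) \<odot> ((scal t \<ominus> h) \<oplus> (- complex_of_real (t + s)) \<odot> \<one>)"
    using h by simp
  moreover have "nrm A (scal t \<ominus> h) < cmod (- complex_of_real (t + s))"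
    unfolding norm_minus_cancel norm_of_real using t s t0 by simp
  ultimately show "h \<oplus> scal s \<in> Units A"
    using unit_scalar(1)[OF add_scalar_one_unit[of "scal t \<ominus> h" "- complex_of_real (t + s)"], of "-1"] h
    by simp
qed

lemma spec_nonneg_carrier: "spec_nonneg h \<Longrightarrow> h \<in> carrier A"
  by (simp add: spec_nonneg_def)

text \<open>The criterion \<open>\<parallel>t - h\<parallel> \<le> t\<close> is visibly stable under sums.\<close>

lemma spec_nonneg_add:
  assumes "\<one> \<noteq> \<zero>" "spec_nonneg h" "spec_nonneg k"
  shows "spec_nonneg (h \<oplus> k)"
proof (rule spec_nonnegI_norm)
  have c: "h \<in> carrier A" "k \<in> carrier A" using assms by (auto simp: spec_nonneg_def)
  show "h \<oplus> k \<in> carrier A" "star A (h \<oplus> k) = h \<oplus> k"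
    using assms by (auto simp: spec_nonneg_def star_simps)
  let ?s = "nrm A h" and ?t = "nrm A k"
  have "scal (?s + ?t) \<ominus> (h \<oplus> k) = (scal ?s \<ominus> h) \<oplus> (scal ?t \<ominus> k)"
    using c by (simp add: alg_simps scalar_add add_ac)
  then show "nrm A (scal (?s + ?t) \<ominus> (h \<oplus> k)) \<le> ?s + ?t"
    using nrm_triangle[of "scal ?s \<ominus> h" "scal ?t \<ominus> k"] c
      spec_nonneg_norm[OF assms(1,2) order_refl] spec_nonneg_norm[OF assms(1,3) order_refl]
    by simp
qed

lemma spec_nonneg_scale:
  assumes "spec_nonneg h" "c > 0"
  shows "spec_nonneg (complex_of_real c \<odot> h)"
  unfolding spec_nonneg_def
proof (intro conjI allI impI)
  fix t :: real assume "t > 0"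
  have "complex_of_real c \<odot> h \<oplus> scal t = complex_of_real c \<odot> (h \<oplus> scal (t / c))"
    using assms by (simp add: spec_nonneg_def scalar_distr)
  moreover have "h \<oplus> scal (t / c) \<in> Units A"
    using assms \<open>t > 0\<close> unfolding spec_nonneg_def by (simp del: of_real_divide)
  ultimately show "complex_of_real c \<odot> h \<oplus> scal t \<in> Units A"
    using unit_scalar(1)[of "h \<oplus> scal (t / c)" "complex_of_real c"] assms(2) by simp
qed (use assms in \<open>auto simp: spec_nonneg_def star_simps\<close>)

lemma spec_nonneg_square:
  assumes u: "u \<in> carrier A" "star A u = u"
  shows "spec_nonneg (u \<otimes> u)"
  unfolding spec_nonneg_def
proof (intro conjI allI impI)
  fix t :: real assume t: "t > 0"
  define c where "c = \<i> * complex_of_real (sqrt t)"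
  have c: "c * c = - complex_of_real t"
  proof -
    have "complex_of_real (sqrt t) * complex_of_real (sqrt t) = complex_of_real t"
      using t by (simp flip: of_real_mult)
    then show ?thesis by (simp add: c_def mult.assoc mult.left_commute)
  qed
  have "(u \<oplus> c \<odot> \<one>) \<otimes> (u \<oplus> (- c) \<odot> \<one>) = (c \<odot> u \<oplus> (- c) \<odot> u) \<oplus> (u \<otimes> u \<oplus> scal t)"
    using u(1) c by (simp add: alg_simps add_ac)
  then have "(u \<oplus> c \<odot> \<one>) \<otimes> (u \<oplus> (- c) \<odot> \<one>) = u \<otimes> u \<oplus> scal t"
    using u(1) by (simp add: scalar_collect)
  moreover have "u \<oplus> c \<odot> \<one> \<in> Units A" "u \<oplus> (- c) \<odot> \<one> \<in> Units A"
    using self_adjoint_imaginary_shift(1)[OF u, of "sqrt t"] self_adjoint_imaginary_shift(1)[OF u, of "- sqrt t"] t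
    by (simp_all add: c_def)
  ultimately show "u \<otimes> u \<oplus> scal t \<in> Units A" using unit_mul by metis
qed (use u in \<open>auto simp: star_simps\<close>)

text \<open>If \<open>w\<close> inverts \<open>x y + c\<close>, then \<open>(1 - y w x) / c\<close> inverts \<open>y x + c\<close>.\<close>

lemma swap_product_unit:
  assumes x: "x \<in> carrier A" and y: "y \<in> carrier A" and c: "c \<noteq> 0"
    and u: "x \<otimes> y \<oplus> c \<odot> \<one> \<in> Units A"
  shows "y \<otimes> x \<oplus> c \<odot> \<one> \<in> Units A"
proof -
  define w where "w = inv (x \<otimes> y \<oplus> c \<odot> \<one>)"
  have w: "w \<in> carrier A" using u by (simp add: w_def)
  have r: "x \<otimes> (y \<otimes> w) \<oplus> c \<odot> w = \<one>"
    using mul_inv[OF u] x y w unfolding w_def[symmetric] by (simp add: alg_simps)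
  have l: "w \<otimes> (x \<otimes> y) \<oplus> c \<odot> w = \<one>"
    using inv_mul[OF u] x y w unfolding w_def[symmetric] by (simp add: alg_simps)
  define z where "z = \<one> \<ominus> y \<otimes> (w \<otimes> x)"
  have z: "z \<in> carrier A" using x y w by (simp add: z_def)
  have "(y \<otimes> x \<oplus> c \<odot> \<one>) \<otimes> z = (y \<otimes> x \<oplus> c \<odot> \<one>) \<ominus> y \<otimes> ((x \<otimes> (y \<otimes> w) \<oplus> c \<odot> w) \<otimes> x)"
    using x y w by (simp add: z_def alg_simps add_ac)
  also have "\<dots> = (y \<otimes> x \<oplus> (-1) \<odot> (y \<otimes> x)) \<oplus> c \<odot> \<one>"
    unfolding r using x y by (simp add: alg_simps add_ac)
  finally have zr: "(y \<otimes> x \<oplus> c \<odot> \<one>) \<otimes> z = c \<odot> \<one>" using x y by (simp add: scalar_collect)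
  have "z \<otimes> (y \<otimes> x \<oplus> c \<odot> \<one>) = (y \<otimes> x \<oplus> c \<odot> \<one>) \<ominus> y \<otimes> ((w \<otimes> (x \<otimes> y) \<oplus> c \<odot> w) \<otimes> x)"
    using x y w by (simp add: z_def alg_simps add_ac)
  also have "\<dots> = (y \<otimes> x \<oplus> (-1) \<odot> (y \<otimes> x)) \<oplus> c \<odot> \<one>"
    unfolding l using x y by (simp add: alg_simps add_ac)
  finally have zl: "z \<otimes> (y \<otimes> x \<oplus> c \<odot> \<one>) = c \<odot> \<one>" using x y by (simp add: scalar_collect)
  show ?thesis
    using unit_and_inverse(1)[of "y \<otimes> x \<oplus> c \<odot> \<one>" "(1 / c) \<odot> z"] zl zr x y z c
    by (simp add: smult_mult_left smult_mult_right)
qed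

lemma one_minus_self: "x \<in> carrier A \<Longrightarrow> scal t \<ominus> (scal t \<ominus> x) = x"
proof -
  assume x: "x \<in> carrier A"
  have "scal t \<ominus> (scal t \<ominus> x) = (scal t \<oplus> (- complex_of_real t) \<odot> \<one>) \<oplus> x"
    using x by (simp add: alg_simps add_ac)
  then show ?thesis using x by (simp add: scalar_collect)
qed

lemma spec_nonneg_norm_minus:
  assumes "h \<in> carrier A" "star A h = h" "nrm A h \<le> t"
  shows "spec_nonneg (scal t \<ominus> h)"
  using assms one_minus_self by (intro spec_nonnegI_norm[of _ t]) (auto simp: star_simps)

text \<open>Twice this element is the sum of the squares of the self-adjoint \<open>x + x\<^sup>*\<close> and \<open>i(x - x\<^sup>*)\<close>.\<close>

lemma real_part_square:
  assumes x: "x \<in> carrier A" and nt: "\<one> \<noteq> \<zero>"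
  shows "spec_nonneg (star A x \<otimes> x \<oplus> x \<otimes> star A x)"
proof -
  define a b where "a = x \<oplus> star A x" and "b = \<i> \<odot> (x \<ominus> star A x)"
  have a: "a \<in> carrier A" "star A a = a" using x by (auto simp: a_def star_simps add_comm)
  have b: "b \<in> carrier A" "star A b = b" using x by (auto simp: b_def star_simps alg_simps add_comm)
  have "a \<otimes> a \<oplus> b \<otimes> b = ((x \<otimes> x \<oplus> (-1) \<odot> (x \<otimes> x)) \<oplus> (star A x \<otimes> star A x \<oplus> (-1) \<odot> (star A x \<otimes> star A x)))
     \<oplus> ((star A x \<otimes> x \<oplus> star A x \<otimes> x) \<oplus> (x \<otimes> star A x \<oplus> x \<otimes> star A x))"
    using x by (simp add: a_def b_def alg_simps add_ac)
  also have "\<dots> = 2 \<odot> (star A x \<otimes> x \<oplus> x \<otimes> star A x)"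
    using x by (simp add: scalar_collect scalar_distr)
  finally have "star A x \<otimes> x \<oplus> x \<otimes> star A x = complex_of_real (1/2) \<odot> (a \<otimes> a \<oplus> b \<otimes> b)"
    using x by simp
  moreover have "spec_nonneg (a \<otimes> a \<oplus> b \<otimes> b)"
    using nt a b by (intro spec_nonneg_add spec_nonneg_square)
  ultimately show ?thesis using spec_nonneg_scale[of "a \<otimes> a \<oplus> b \<otimes> b" "1/2"] by simp
qed

text \<open>The bound \<open>x\<^sup>*x \<le> 1\<close> passes to \<open>x x\<^sup>*\<close>, and \<open>1 + x\<^sup>*x = (x\<^sup>*x + x x\<^sup>*) + (1 - x x\<^sup>*)\<close>.\<close>

lemma spec_nonneg_one_plus:
  assumes x: "x \<in> carrier A" and nt: "\<one> \<noteq> \<zero>" and le: "spec_nonneg (\<one> \<ominus> star A x \<otimes> x)"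
  shows "spec_nonneg (\<one> \<oplus> star A x \<otimes> x)"
proof -
  have "spec_nonneg (\<one> \<ominus> x \<otimes> star A x)"
    unfolding spec_nonneg_def
  proof (intro conjI allI impI)
    fix t :: real assume t: "t > 0"
    have eq: "(\<one> \<ominus> y \<otimes> z) \<oplus> scal t = (-1) \<odot> (y \<otimes> z \<oplus> (- complex_of_real (1 + t)) \<odot> \<one>)"
      if "y \<in> carrier A" "z \<in> carrier A" for y z
      using that scalar_add[of \<one> "complex_of_real t" 1] by (simp add: alg_simps add_ac)
    define c where "c = - complex_of_real (1 + t)"
    have c: "c \<noteq> 0"
      unfolding c_def neg_equal_0_iff_equal of_real_eq_0_iff using t by simp
    have "(-1) \<odot> (star A x \<otimes> x \<oplus> c \<odot> \<one>) \<in> Units A"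
    proof -
      have "(\<one> \<ominus> star A x \<otimes> x) \<oplus> scal t \<in> Units A"
        using le t unfolding spec_nonneg_def by blast
      then show ?thesis using eq[of "star A x" x] x unfolding c_def by (simp only: star_closed)
    qed
    from unit_scalar(1)[OF this, of "-1"] have "star A x \<otimes> x \<oplus> c \<odot> \<one> \<in> Units A" using x by simp
    then have "x \<otimes> star A x \<oplus> c \<odot> \<one> \<in> Units A"
      using swap_product_unit[OF star_closed[OF x] x c] by blast
    from unit_scalar(1)[OF this, of "-1"] show "(\<one> \<ominus> x \<otimes> star A x) \<oplus> scal t \<in> Units A"
      using eq[of x "star A x"] x by (simp add: c_def)
  qed (use x in \<open>auto simp: star_simps\<close>)
  then have "spec_nonneg ((star A x \<otimes> x \<oplus> x \<otimes> star A x) \<oplus> (\<one> \<ominus> x \<otimes> star A x))"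
    using real_part_square[OF x nt] spec_nonneg_add[OF nt] by blast
  moreover have "(star A x \<otimes> x \<oplus> x \<otimes> star A x) \<oplus> (\<one> \<ominus> x \<otimes> star A x)
      = (x \<otimes> star A x \<oplus> (-1) \<odot> (x \<otimes> star A x)) \<oplus> (\<one> \<oplus> star A x \<otimes> x)"
    using x by (simp add: alg_simps add_ac)
  ultimately show ?thesis using x by (simp add: scalar_collect)
qed

text \<open>This is the step that replaces functional calculus. Let \<open>h = x\<^sup>*x\<close>, \<open>s = 1 + \<alpha>\<close> and
\<open>y = 2\<surd>s x (h + s)\<^sup>-\<^sup>1\<close>. Then \<open>1 - y\<^sup>*y\<close> is the square of \<open>(s - h)(h + s)\<^sup>-\<^sup>1\<close>, so \<open>y\<close> satisfies the hypothesis
on \<open>x\<close>, and \<open>y\<^sup>*y + 4s\<alpha> = 4s (h + \<alpha>(h + s)\<^sup>2) (h + s)\<^sup>-\<^sup>2\<close> where \<open>h + \<alpha>\<close> divides \<open>h + \<alpha>(h + s)\<^sup>2\<close>. Since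
\<open>4s\<alpha> > 4\<alpha>\<close>, invertibility above a threshold for all such elements improves the threshold by the
factor \<open>4\<close>.\<close>

lemma star_mult_add_unit:
  assumes nt: "\<one> \<noteq> \<zero>"
  shows "\<lbrakk>x \<in> carrier A; spec_nonneg (\<one> \<ominus> star A x \<otimes> x); \<alpha> > (1/4) ^ n\<rbrakk>
    \<Longrightarrow> star A x \<otimes> x \<oplus> scal \<alpha> \<in> Units A"
proof (induction n arbitrary: x \<alpha>)
  case 0
  have "(\<one> \<oplus> star A x \<otimes> x) \<oplus> scal (\<alpha> - 1) \<in> Units A"
    using spec_nonneg_one_plus[OF 0(1) nt 0(2)] 0(3) by (simp add: spec_nonneg_def del: of_real_diff)
  moreover have "(\<one> \<oplus> star A x \<otimes> x) \<oplus> scal (\<alpha> - 1) = star A x \<otimes> x \<oplus> (\<one> \<oplus> scal (\<alpha> - 1))"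
    using 0(1) by (simp add: add_ac)
  ultimately show ?case by (simp add: scalar_collect)
next
  case (Suc n)
  note x = Suc.prems(1) and \<alpha> = Suc.prems(3)
  have \<alpha>0: "\<alpha> > 0" using \<alpha> by (meson less_trans zero_less_power zero_less_divide_1_iff zero_less_numeral)
  define h where "h = star A x \<otimes> x"
  have h: "h \<in> carrier A" "star A h = h" using x by (auto simp: h_def star_simps)
  define s where "s = 1 + \<alpha>"
  have s: "s > 0" using \<alpha>0 by (simp add: s_def)
  define v where "v = h \<oplus> scal s"
  have vc: "v \<in> carrier A" "star A v = v" using h by (auto simp: v_def star_simps)
  have v: "v \<in> Units A"
  proof -
    have "(\<one> \<oplus> h) \<oplus> scal \<alpha> \<in> Units A"
      using spec_nonneg_one_plus[OF x nt Suc.prems(2)] \<alpha>0 by (simp add: spec_nonneg_def h_def)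
    moreover have "(\<one> \<oplus> h) \<oplus> scal \<alpha> = h \<oplus> (\<one> \<oplus> scal \<alpha>)" using h by (simp add: add_ac)
    ultimately show ?thesis by (simp add: v_def s_def scalar_collect)
  qed
  define w where "w = inv v"
  have w: "w \<in> carrier A" "star A w = w" "v \<otimes> w = \<one>" "w \<otimes> v = \<one>"
    using v vc unit_star(2)[OF v] by (auto simp: w_def)
  have hv: "h \<otimes> v = v \<otimes> h" using h(1) by (simp add: v_def alg_simps)
  have wh: "w \<otimes> h = h \<otimes> w"
    unfolding w_def using inv_commute[OF v h(1)] hv by simp
  define y where "y = complex_of_real (2 * sqrt s) \<odot> (x \<otimes> w)"
  have yc: "y \<in> carrier A" using x w by (simp add: y_def)
  have "complex_of_real (2 * sqrt s) * complex_of_real (2 * sqrt s) = complex_of_real (4 * s)"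
  proof -
    have "(2 * sqrt s) * (2 * sqrt s) = 4 * s" using s by simp
    then show ?thesis by (metis of_real_mult)
  qed
  then have yy: "star A y \<otimes> y = complex_of_real (4 * s) \<odot> (h \<otimes> (w \<otimes> w))"
  proof -
    assume c: "complex_of_real (2 * sqrt s) * complex_of_real (2 * sqrt s) = complex_of_real (4 * s)"
    have "star A y \<otimes> y = complex_of_real (4 * s) \<odot> ((w \<otimes> star A x) \<otimes> (x \<otimes> w))"
      unfolding y_def c[symmetric]
      using x w(1,2) by (simp add: star_simps smult_mult_left smult_mult_right del: of_real_mult)
    also have "(w \<otimes> star A x) \<otimes> (x \<otimes> w) = (w \<otimes> h) \<otimes> w"
      using x w(1) by (simp add: h_def mul_assoc)
    also have "\<dots> = h \<otimes> (w \<otimes> w)" unfolding wh using h w(1) by (simp add: mul_assoc)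
    finally show ?thesis .
  qed
  define u where "u = (scal s \<ominus> h) \<otimes> w"
  have uc: "u \<in> carrier A" using h w by (simp add: u_def)
  have shw: "w \<otimes> (scal s \<ominus> h) = (scal s \<ominus> h) \<otimes> w"
    using h(1) w(1) wh by (simp add: alg_simps)
  have su: "star A u = u" using h w(1,2) shw by (simp add: u_def star_simps)
  have "u \<otimes> u = ((scal s \<ominus> h) \<otimes> (scal s \<ominus> h)) \<otimes> (w \<otimes> w)"
  proof -
    have "u \<otimes> u = (scal s \<ominus> h) \<otimes> ((w \<otimes> (scal s \<ominus> h)) \<otimes> w)"
      unfolding u_def using h(1) w(1) by (simp add: mul_assoc)
    then show ?thesis unfolding shw using h(1) w(1) by (simp add: mul_assoc)
  qed
  also have "(scal s \<ominus> h) \<otimes> (scal s \<ominus> h) = v \<otimes> v \<ominus> complex_of_real (4 * s) \<odot> h"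
  proof -
    have "(scal s \<ominus> h) \<otimes> (scal s \<ominus> h) =
        ((- complex_of_real s) \<odot> h \<oplus> (- complex_of_real s) \<odot> h) \<oplus> (h \<otimes> h \<oplus> scal (s * s))"
      using h(1) by (simp add: alg_simps add_ac)
    also have "\<dots> = (- 2 * complex_of_real s) \<odot> h \<oplus> (h \<otimes> h \<oplus> scal (s * s))"
      using h(1) by (simp add: scalar_collect)
    finally have 1: "(scal s \<ominus> h) \<otimes> (scal s \<ominus> h) = (- 2 * complex_of_real s) \<odot> h \<oplus> (h \<otimes> h \<oplus> scal (s * s))" .
    have "v \<otimes> v \<ominus> complex_of_real (4 * s) \<odot> h
       = ((complex_of_real s \<odot> h \<oplus> complex_of_real s \<odot> h) \<oplus> (- complex_of_real (4 * s)) \<odot> h) \<oplus> (h \<otimes> h \<oplus> scal (s * s))"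
      using h(1) by (simp add: v_def alg_simps add_ac)
    also have "\<dots> = (- 2 * complex_of_real s) \<odot> h \<oplus> (h \<otimes> h \<oplus> scal (s * s))"
      using h(1) by (simp add: scalar_collect)
    finally show ?thesis using 1 by simp
  qed
  also have "(v \<otimes> v \<ominus> complex_of_real (4 * s) \<odot> h) \<otimes> (w \<otimes> w)
      = v \<otimes> ((v \<otimes> w) \<otimes> w) \<ominus> complex_of_real (4 * s) \<odot> (h \<otimes> (w \<otimes> w))"
    using vc(1) w(1) h(1) by (simp add: alg_simps del: of_real_mult)
  also have "\<dots> = \<one> \<ominus> star A y \<otimes> y" using w vc h(1) yy by simp
  finally have "spec_nonneg (\<one> \<ominus> star A y \<otimes> y)"
    using spec_nonneg_square[OF uc su] by simp
  moreover have "4 * s * \<alpha> > (1/4) ^ n"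
  proof -
    have "(1/4) ^ n < 4 * \<alpha>" using \<alpha> by simp
    also have "4 * \<alpha> \<le> 4 * \<alpha> * s" using \<alpha>0 by (simp add: s_def)
    finally show ?thesis by (simp add: mult_ac)
  qed
  ultimately have yu: "star A y \<otimes> y \<oplus> scal (4 * s * \<alpha>) \<in> Units A"
    using Suc.IH yc by blast
  have "scal (4 * s * \<alpha>) = complex_of_real (4 * s * \<alpha>) \<odot> (v \<otimes> ((v \<otimes> w) \<otimes> w))"
    using w vc by simp
  also have "\<dots> = complex_of_real (4 * s * \<alpha>) \<odot> ((v \<otimes> v) \<otimes> (w \<otimes> w))"
    using w(1) vc(1) by (simp add: mul_assoc del: of_real_mult)
  finally have sc: "scal (4 * s * \<alpha>) = complex_of_real (4 * s) \<odot> (complex_of_real \<alpha> \<odot> ((v \<otimes> v) \<otimes> (w \<otimes> w)))"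
    using vc(1) w(1) by simp
  have "star A y \<otimes> y \<oplus> scal (4 * s * \<alpha>) = complex_of_real (4 * s) \<odot> ((h \<oplus> complex_of_real \<alpha> \<odot> (v \<otimes> v)) \<otimes> (w \<otimes> w))"
    unfolding yy sc using h(1) vc(1) w(1)
    by (simp add: add_mul smult_mult_left scalar_distr del: of_real_mult)
  then have "complex_of_real (4 * s) \<odot> ((h \<oplus> complex_of_real \<alpha> \<odot> (v \<otimes> v)) \<otimes> (w \<otimes> w)) \<in> Units A"
    using yu by simp
  from unit_scalar(1)[OF this, of "1 / complex_of_real (4 * s)"]
  have "(h \<oplus> complex_of_real \<alpha> \<odot> (v \<otimes> v)) \<otimes> (w \<otimes> w) \<in> Units A"
    using s h(1) vc(1) w(1) by simp
  then have "((h \<oplus> complex_of_real \<alpha> \<odot> (v \<otimes> v)) \<otimes> (w \<otimes> w)) \<otimes> (v \<otimes> v) \<in> Units A"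
    using v unit_mul by blast
  moreover have "((h \<oplus> complex_of_real \<alpha> \<odot> (v \<otimes> v)) \<otimes> (w \<otimes> w)) \<otimes> (v \<otimes> v) = h \<oplus> complex_of_real \<alpha> \<odot> (v \<otimes> v)"
  proof -
    have "(w \<otimes> w) \<otimes> (v \<otimes> v) = w \<otimes> ((w \<otimes> v) \<otimes> v)"
      using vc(1) w(1) by (simp add: mul_assoc)
    then have "(w \<otimes> w) \<otimes> (v \<otimes> v) = \<one>" using w vc by simp
    then show ?thesis using mul_assoc[of "h \<oplus> complex_of_real \<alpha> \<odot> (v \<otimes> v)" "w \<otimes> w" "v \<otimes> v"] h(1) vc(1) w(1)
      by simp
  qed
  ultimately have un: "h \<oplus> complex_of_real \<alpha> \<odot> (v \<otimes> v) \<in> Units A" by simp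
  \<comment> \<open>With \<open>s = 1 + \<alpha>\<close> the quadratic \<open>h + \<alpha>(h + s)\<^sup>2\<close> has \<open>-\<alpha>\<close> as a root.\<close>
  define k where "k = complex_of_real \<alpha> \<odot> h \<oplus> scal (s * s)"
  have kc: "k \<in> carrier A" using h by (simp add: k_def)
  have quad: "h \<oplus> complex_of_real \<alpha> \<odot> (v \<otimes> v) = complex_of_real \<alpha> \<odot> (h \<otimes> h)
      \<oplus> (complex_of_real (1 + 2 * \<alpha> * s) \<odot> h \<oplus> scal (\<alpha> * s * s))"
  proof -
    have "h \<oplus> complex_of_real \<alpha> \<odot> (v \<otimes> v) = complex_of_real \<alpha> \<odot> (h \<otimes> h)
      \<oplus> ((h \<oplus> (complex_of_real (\<alpha> * s) \<odot> h \<oplus> complex_of_real (\<alpha> * s) \<odot> h)) \<oplus> scal (\<alpha> * s * s))"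
      using h(1) by (simp add: v_def alg_simps add_ac mult_ac)
    then show ?thesis using h(1) by (simp add: scalar_collect mult_ac)
  qed
  have fac: "(h \<oplus> scal \<alpha>) \<otimes> k = complex_of_real \<alpha> \<odot> (h \<otimes> h)
      \<oplus> ((complex_of_real (s * s) \<odot> h \<oplus> complex_of_real (\<alpha> * \<alpha>) \<odot> h) \<oplus> scal (\<alpha> * s * s))"
    using h(1) by (simp add: k_def alg_simps add_ac mult_ac)
  have fac': "k \<otimes> (h \<oplus> scal \<alpha>) = (h \<oplus> scal \<alpha>) \<otimes> k"
    using h(1) by (simp add: k_def alg_simps add_ac mult_ac)
  have "complex_of_real (s * s) + complex_of_real (\<alpha> * \<alpha>) = complex_of_real (1 + 2 * \<alpha> * s)"
    unfolding of_real_add[symmetric] by (simp add: s_def algebra_simps)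
  then have "(h \<oplus> scal \<alpha>) \<otimes> k = h \<oplus> complex_of_real \<alpha> \<odot> (v \<otimes> v)"
    unfolding fac quad using scalar_collect(1)[OF h(1), of "complex_of_real (s * s)" "complex_of_real (\<alpha> * \<alpha>)"] by simp
  then show ?case
    using commuting_factor_unit[of "h \<oplus> scal \<alpha>" k] h(1) kc fac' un by (simp add: h_def)
qed

lemma spec_nonneg_star_mult:
  assumes nt: "\<one> \<noteq> \<zero>" and x: "x \<in> carrier A"
  shows "spec_nonneg (star A x \<otimes> x)"
  unfolding spec_nonneg_def
proof (intro conjI allI impI)
  fix t :: real assume t: "t > 0"
  define c where "c = 1 / (1 + nrm A x)"
  have c: "c > 0" "c * nrm A x \<le> 1" using nrm_nonneg[OF x] by (auto simp: c_def)
  define y where "y = complex_of_real c \<odot> x"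
  have y: "y \<in> carrier A" "nrm A y \<le> 1" using x c by (auto simp: y_def nrm_smult)
  have yy: "star A y \<otimes> y = complex_of_real (c * c) \<odot> (star A x \<otimes> x)"
    using x by (simp add: y_def star_simps smult_mult_left smult_mult_right)
  have "nrm A (star A y \<otimes> y) \<le> 1"
    using y nrm_star_mult[OF y(1)] nrm_nonneg[OF y(1)] by (simp add: power_le_one)
  then have "spec_nonneg (scal 1 \<ominus> star A y \<otimes> y)"
    using y by (intro spec_nonneg_norm_minus) (auto simp: star_simps)
  then have y1: "spec_nonneg (\<one> \<ominus> star A y \<otimes> y)" by simp
  have "0 < c * c * t" using c t by simp
  then obtain n :: nat where "(1/4) ^ n < c * c * t"
    using real_arch_pow_inv[of "c * c * t" "1/4"] by auto
  from star_mult_add_unit[OF nt y(1) y1 this]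
  have "complex_of_real (c * c) \<odot> (star A x \<otimes> x) \<oplus> scal (c * c * t) \<in> Units A" by (simp add: yy)
  moreover have "complex_of_real (c * c) \<odot> (star A x \<otimes> x) \<oplus> scal (c * c * t)
      = complex_of_real (c * c) \<odot> (star A x \<otimes> x \<oplus> scal t)"
    using x by (simp add: scalar_distr)
  ultimately have "complex_of_real (c * c) \<odot> (star A x \<otimes> x \<oplus> scal t) \<in> Units A" by simp
  from unit_scalar(1)[OF this, of "1 / complex_of_real (c * c)"]
  show "star A x \<otimes> x \<oplus> scal t \<in> Units A" using c x by simp
qed (use x in \<open>auto simp: star_simps\<close>)

text \<open>Otherwise \<open>M = \<parallel>b\<^sup>*b\<parallel>\<close> exceeds \<open>m = \<parallel>b\<^sup>*b + k\<parallel>\<close>. Then \<open>M + b\<^sup>*b\<close> is invertible by positivity of \<open>b\<^sup>*b\<close>,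
and \<open>M - b\<^sup>*b = (m - (b\<^sup>*b + k)) + k + (M - m)\<close> by positivity of the first two summands.\<close>

lemma nrm_le_add_spec_nonneg:
  assumes nt: "\<one> \<noteq> \<zero>" and b: "b \<in> carrier A" and k: "spec_nonneg k"
  shows "(nrm A b)\<^sup>2 \<le> nrm A (star A b \<otimes> b \<oplus> k)"
proof (rule ccontr)
  assume lt: "\<not> (nrm A b)\<^sup>2 \<le> nrm A (star A b \<otimes> b \<oplus> k)"
  define h where "h = star A b \<otimes> b"
  have h: "spec_nonneg h" "h \<in> carrier A" "star A h = h"
    using spec_nonneg_star_mult[OF nt b] b by (auto simp: h_def star_simps)
  have kc: "k \<in> carrier A" "star A k = k" using k by (auto simp: spec_nonneg_def)
  define m where "m = nrm A (h \<oplus> k)"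
  define M where "M = nrm A h"
  have M: "M > m" "m \<ge> 0" using lt nrm_star_mult[OF b] nrm_nonneg[of "h \<oplus> k"] h kc
    by (auto simp: M_def m_def h_def)
  have 1: "scal M \<oplus> h \<in> Units A"
    using h M by (simp add: spec_nonneg_def add_comm)
  have "spec_nonneg ((scal m \<ominus> (h \<oplus> k)) \<oplus> k)"
    using h kc k nt by (intro spec_nonneg_add spec_nonneg_norm_minus) (auto simp: m_def star_simps)
  then have "((scal m \<ominus> (h \<oplus> k)) \<oplus> k) \<oplus> scal (M - m) \<in> Units A"
    using M unfolding spec_nonneg_def by (simp del: of_real_diff)
  moreover have "((scal m \<ominus> (h \<oplus> k)) \<oplus> k) \<oplus> scal (M - m)
      = (k \<oplus> (-1) \<odot> k) \<oplus> ((scal m \<oplus> scal (M - m)) \<oplus> (-1) \<odot> h)"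
    using h(2) kc(1) by (simp add: alg_simps add_ac del: of_real_diff)
  moreover have "\<dots> = scal M \<ominus> h"
    using h(2) kc(1) by (simp add: scalar_collect minus_scalar)
  ultimately have 2: "scal M \<ominus> h \<in> Units A" by simp
  show False using self_adjoint_norm_in_spectrum[OF nt h(2,3)] 1 2 by (simp add: M_def)
qed

text \<open>For \<open>g = a / r\<close> the root of \<open>1 - g\<close> is \<open>1 - k\<close>, where \<open>k = (g + k\<^sup>2) / 2\<close>. The map \<open>k \<mapsto> (g + k\<^sup>2) / 2\<close>
contracts the ball of radius \<open>1 - \<surd>(1 - \<parallel>g\<parallel>)\<close>, and uniqueness of its fixed point makes \<open>k\<close>
self-adjoint.\<close>

lemma sqrt_of_scalar_minus:
  assumes a: "a \<in> carrier A" "star A a = a" "nrm A a < r"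
  obtains s where "s \<in> carrier A" "star A s = s" "s \<otimes> s = scal r \<ominus> a"
proof -
  have r: "r > 0" using a nrm_nonneg[OF a(1)] by simp
  define g where "g = complex_of_real (1 / r) \<odot> a"
  define q where "q = nrm A g"
  have g: "g \<in> carrier A" "star A g = g" using a by (auto simp: g_def star_simps)
  have q: "0 \<le> q" "q < 1" using a r nrm_nonneg[OF g(1)] by (auto simp: q_def g_def nrm_smult norm_divide)
  define \<rho> where "\<rho> = 1 - sqrt (1 - q)"
  have \<rho>: "0 \<le> \<rho>" "\<rho> < 1" using q by (auto simp: \<rho>_def)
  have "(sqrt (1 - q))\<^sup>2 = 1 - q" using q by simp
  then have \<rho>q: "q + \<rho>\<^sup>2 = 2 * \<rho>" by (simp add: \<rho>_def power2_eq_square algebra_simps)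
  define f where "f k = (1/2) \<odot> (g \<oplus> k \<otimes> k)" for k
  have fc: "f k \<in> carrier A" if "k \<in> carrier A" for k using that g by (simp add: f_def)
  have con: "nrm A (f k \<ominus> f l) \<le> \<rho> * nrm A (k \<ominus> l)"
    if kl: "k \<in> carrier A" "l \<in> carrier A" "nrm A k \<le> \<rho>" "nrm A l \<le> \<rho>" for k l
  proof -
    have "f k \<ominus> f l = (1/2) \<odot> ((k \<otimes> k \<oplus> (-1) \<odot> (l \<otimes> l)) \<oplus> (g \<oplus> (-1) \<odot> g))"
      using kl g by (simp add: f_def alg_simps add_ac)
    also have "\<dots> = (1/2) \<odot> ((k \<otimes> k \<oplus> (-1) \<odot> (l \<otimes> l)) \<oplus> (k \<otimes> l \<oplus> (-1) \<odot> (k \<otimes> l)))"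
      using kl g by (simp add: scalar_collect)
    also have "\<dots> = (1/2) \<odot> (k \<otimes> (k \<ominus> l) \<oplus> (k \<ominus> l) \<otimes> l)"
      using kl by (simp add: alg_simps add_ac)
    finally have "nrm A (f k \<ominus> f l) \<le> 1 / 2 * (nrm A (k \<otimes> (k \<ominus> l)) + nrm A ((k \<ominus> l) \<otimes> l))"
      using nrm_triangle[of "k \<otimes> (k \<ominus> l)" "(k \<ominus> l) \<otimes> l"] kl by (simp add: nrm_smult norm_divide)
    also have "nrm A (k \<otimes> (k \<ominus> l)) \<le> \<rho> * nrm A (k \<ominus> l)"
      using nrm_mult[of k "k \<ominus> l"] kl(1,2) mult_right_mono[OF kl(3) nrm_nonneg[of "k \<ominus> l"]]
      by simp
    also have "nrm A ((k \<ominus> l) \<otimes> l) \<le> \<rho> * nrm A (k \<ominus> l)"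
      using nrm_mult[of "k \<ominus> l" l] kl(1,2) mult_right_mono[OF kl(4) nrm_nonneg[of "k \<ominus> l"]]
      by (simp add: mult.commute)
    finally show ?thesis by simp
  qed
  \<comment> \<open>The radius \<open>\<rho>\<close> is the smaller root of \<open>(q + \<rho>\<^sup>2) / 2 = \<rho>\<close>, so \<open>f\<close> maps the ball into itself.\<close>
  obtain k where k: "k \<in> carrier A" "nrm A k \<le> \<rho>" "f k = k"
  proof (rule contraction_has_fixpoint[of \<rho> f \<rho>])
    fix k assume k: "k \<in> carrier A" "nrm A k \<le> \<rho>"
    have "nrm A (f k) \<le> 1 / 2 * (q + nrm A (k \<otimes> k))"
      using nrm_triangle[of g "k \<otimes> k"] k g by (simp add: f_def nrm_smult norm_divide q_def)
    also have "nrm A (k \<otimes> k) \<le> \<rho>\<^sup>2"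
      using nrm_mult[of k k] k mult_mono[of "nrm A k" \<rho> "nrm A k" \<rho>] nrm_nonneg[OF k(1)] \<rho>
      by (simp add: power2_eq_square)
    finally show "f k \<in> carrier A \<and> nrm A (f k) \<le> \<rho>" using fc k \<rho>q by simp
  qed (use con \<rho> in auto)
  have "f (star A k) = star A (f k)" using k(1) g by (simp add: f_def star_simps)
  then have "f (star A k) = star A k" using k(3) by simp
  then have "nrm A (k \<ominus> star A k) \<le> \<rho> * nrm A (k \<ominus> star A k)"
    using con[of k "star A k"] k by simp
  then have "(1 - \<rho>) * nrm A (k \<ominus> star A k) \<le> 0" by (simp add: algebra_simps)
  then have "nrm A (k \<ominus> star A k) \<le> 0" using \<rho> by (simp add: mult_le_0_iff)
  then have "nrm A (k \<ominus> star A k) = 0"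
    using nrm_nonneg[of "k \<ominus> star A k"] k(1) by simp
  then have "k \<ominus> star A k = \<zero>" using nrm_eq_0_iff[of "k \<ominus> star A k"] k(1) by simp
  then have sk: "star A k = k" using diff_eq_zeroD[of k "star A k"] k(1) by simp
  have kk: "g \<oplus> k \<otimes> k = 2 \<odot> k"
  proof -
    have "2 \<odot> f k = g \<oplus> k \<otimes> k" using k(1) g by (simp add: f_def)
    then show ?thesis using k(3) by simp
  qed
  have "(\<one> \<ominus> k) \<otimes> (\<one> \<ominus> k) = (\<one> \<oplus> k \<otimes> k) \<oplus> ((-1) \<odot> k \<oplus> (-1) \<odot> k)"
    using k(1) by (simp add: alg_simps add_ac)
  also have "\<dots> = (\<one> \<oplus> k \<otimes> k) \<oplus> (-1) \<odot> (2 \<odot> k)" using k(1) by (simp add: scalar_collect)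
  also have "\<dots> = (k \<otimes> k \<oplus> (-1) \<odot> (k \<otimes> k)) \<oplus> (\<one> \<ominus> g)"
    unfolding kk[symmetric] using k(1) g(1) by (simp add: alg_simps add_ac)
  finally have sq: "(\<one> \<ominus> k) \<otimes> (\<one> \<ominus> k) = \<one> \<ominus> g" using k(1) g(1) by (simp add: scalar_collect)
  define s where "s = complex_of_real (sqrt r) \<odot> (\<one> \<ominus> k)"
  have "complex_of_real (sqrt r) * complex_of_real (sqrt r) = complex_of_real r"
    using r by (simp flip: of_real_mult)
  then have "s \<otimes> s = complex_of_real r \<odot> ((\<one> \<ominus> k) \<otimes> (\<one> \<ominus> k))"
    using k(1) by (simp add: s_def smult_mult_left smult_mult_right)
  also have "\<dots> = scal r \<ominus> a"
    unfolding sq using a r by (simp add: g_def alg_simps)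
  finally have "s \<otimes> s = scal r \<ominus> a" .
  moreover have "s \<in> carrier A" "star A s = s" using k(1) sk by (auto simp: s_def star_simps)
  ultimately show thesis using that by blast
qed

lemma spec_nonneg_scalar:
  assumes nt: "\<one> \<noteq> \<zero>" and "spec_nonneg (scal t)"
  shows "t \<ge> 0"
proof (rule ccontr)
  assume "\<not> t \<ge> 0"
  then have "scal t \<oplus> scal (- t) \<in> Units A" using assms(2) by (simp add: spec_nonneg_def del: of_real_minus)
  then have u: "\<zero> \<in> Units A" by (simp add: scalar_collect)
  have "\<zero> \<otimes> inv \<zero> = \<one>" using u by (rule mul_inv)
  moreover have "\<zero> \<otimes> inv \<zero> = \<zero>" using u ring.ring_simprules(24)[OF A_ring] by blast
  ultimately show False using nt by simp
qed

end

section \<open>Finite sums\<close>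

lemma additive_map_zero:
  assumes "abelian_group G" "abelian_group K" "f \<in> carrier G \<rightarrow> carrier K"
    and add: "\<And>x y. \<lbrakk>x \<in> carrier G; y \<in> carrier G\<rbrakk> \<Longrightarrow> f (x \<oplus>\<^bsub>G\<^esub> y) = f x \<oplus>\<^bsub>K\<^esub> f y"
  shows "f \<zero>\<^bsub>G\<^esub> = \<zero>\<^bsub>K\<^esub>"
proof -
  interpret G: abelian_group G by fact
  interpret K: abelian_group K by fact
  have "f \<zero>\<^bsub>G\<^esub> \<oplus>\<^bsub>K\<^esub> f \<zero>\<^bsub>G\<^esub> = f \<zero>\<^bsub>G\<^esub>" using add[of "\<zero>\<^bsub>G\<^esub>" "\<zero>\<^bsub>G\<^esub>"] by simp
  moreover have "f \<zero>\<^bsub>G\<^esub> \<in> carrier K" using assms(3) by auto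
  ultimately show ?thesis using K.add.l_cancel_one by blast
qed

lemma additive_map_finsum:
  assumes "abelian_group G" "abelian_group K" "f \<in> carrier G \<rightarrow> carrier K"
    and add: "\<And>x y. \<lbrakk>x \<in> carrier G; y \<in> carrier G\<rbrakk> \<Longrightarrow> f (x \<oplus>\<^bsub>G\<^esub> y) = f x \<oplus>\<^bsub>K\<^esub> f y"
    and "finite S" "g \<in> S \<rightarrow> carrier G"
  shows "f (\<Oplus>\<^bsub>G\<^esub>i\<in>S. g i) = (\<Oplus>\<^bsub>K\<^esub>i\<in>S. f (g i))"
proof -
  interpret G: abelian_group G by fact
  interpret K: abelian_group K by fact
  show ?thesis using assms(5,6)
  proof (induction S)
    case empty
    then show ?case using additive_map_zero[OF assms(1-4)] by simp
  next
    case (insert i S)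
    then have "(\<lambda>i. f (g i)) \<in> S \<rightarrow> carrier K" "f (g i) \<in> carrier K" using assms(3) by auto
    then show ?case using insert add by simp
  qed
qed

context unital_cstar_algebra
begin

lemmas fsum_closed = abelian_monoid.finsum_closed[OF A_add_monoid]
lemmas fsum_cong = abelian_monoid.finsum_cong'[OF A_add_monoid]
lemmas fsum_insert = abelian_monoid.finsum_insert[OF A_add_monoid]
lemmas fsum_empty = abelian_monoid.finsum_empty[OF A_add_monoid]

lemma fsum_mem [simp]: "(\<And>i. i \<in> S \<Longrightarrow> f i \<in> carrier A) \<Longrightarrow> (\<Oplus>i\<in>S. f i) \<in> carrier A"
  by (rule fsum_closed) auto

lemma fsum_eq: "\<lbrakk>\<And>i. i \<in> S \<Longrightarrow> f i = g i; \<And>i. i \<in> S \<Longrightarrow> g i \<in> carrier A\<rbrakk>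
    \<Longrightarrow> (\<Oplus>i\<in>S. f i) = (\<Oplus>i\<in>S. g i)"
  by (rule fsum_cong) auto

lemma nrm_fsum_le:
  assumes "finite S" "\<And>i. i \<in> S \<Longrightarrow> f i \<in> carrier A"
  shows "nrm A (\<Oplus>i\<in>S. f i) \<le> (\<Sum>i\<in>S. nrm A (f i))"
  using assms
proof (induction S)
  case (insert i S)
  have "(\<Oplus>i\<in>insert i S. f i) = f i \<oplus> (\<Oplus>i\<in>S. f i)"
    using insert by (intro fsum_insert) auto
  then show ?case using insert nrm_triangle[of "f i" "\<Oplus>i\<in>S. f i"] by simp
qed (simp add: fsum_empty)

lemma fsum_additive:
  assumes "f \<in> carrier A \<rightarrow> carrier A"
    and "\<And>x y. \<lbrakk>x \<in> carrier A; y \<in> carrier A\<rbrakk> \<Longrightarrow> f (x \<oplus> y) = f x \<oplus> f y"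
    and "finite S" "\<And>i. i \<in> S \<Longrightarrow> g i \<in> carrier A"
  shows "f (\<Oplus>i\<in>S. g i) = (\<Oplus>i\<in>S. f (g i))"
  using assms by (intro additive_map_finsum[OF A_group A_group]) auto

lemma fsum_mul:
  assumes "finite S" "\<And>i. i \<in> S \<Longrightarrow> g i \<in> carrier A" "a \<in> carrier A"
  shows "a \<otimes> (\<Oplus>i\<in>S. g i) = (\<Oplus>i\<in>S. a \<otimes> g i)" "(\<Oplus>i\<in>S. g i) \<otimes> a = (\<Oplus>i\<in>S. g i \<otimes> a)"
  using assms by (intro fsum_additive[of "\<lambda>x. a \<otimes> x"] fsum_additive[of "\<lambda>x. x \<otimes> a"]; auto simp: mul_add add_mul)+

lemma fsum_smult:
  assumes "finite S" "\<And>i. i \<in> S \<Longrightarrow> g i \<in> carrier A"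
  shows "c \<odot> (\<Oplus>i\<in>S. g i) = (\<Oplus>i\<in>S. c \<odot> g i)"
  using assms by (intro fsum_additive[of "\<lambda>x. c \<odot> x"]) (auto simp: scalar_distr)

lemma fsum_star:
  assumes "finite S" "\<And>i. i \<in> S \<Longrightarrow> g i \<in> carrier A"
  shows "star A (\<Oplus>i\<in>S. g i) = (\<Oplus>i\<in>S. star A (g i))"
  using assms by (intro fsum_additive[of "star A"]) (auto simp: star_add)

lemma scalar_inject:
  assumes "\<one> \<noteq> \<zero>" "c \<odot> \<one> = d \<odot> \<one>"
  shows "c = d"
proof -
  have "(c - d) \<odot> \<one> = c \<odot> \<one> \<oplus> (- d) \<odot> \<one>" using scalar_add[of \<one> c "- d"] by simp
  also have "\<dots> = \<zero>" unfolding assms(2) by (simp add: scalar_collect)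
  finally have "cmod (c - d) * nrm A \<one> = 0" using nrm_smult[of \<one> "c - d"] by simp
  then show ?thesis using nrm_one[OF assms(1)] by simp
qed

lemma scalar_of_scalar: "\<one> \<noteq> \<zero> \<Longrightarrow> scalar_of A (c \<odot> \<one>) = c"
  unfolding scalar_of_def using scalar_inject by blast

section \<open>The centre of a simple algebra\<close>

context
  fixes D
  assumes D: "subring D A" and D_smult: "\<And>c x. x \<in> D \<Longrightarrow> c \<odot> x \<in> D"
begin

lemma D_mem: "x \<in> D \<Longrightarrow> x \<in> carrier A" using subringE(1)[OF D] by blast

lemma D_ops: "\<lbrakk>x \<in> D; y \<in> D\<rbrakk> \<Longrightarrow> x \<oplus> y \<in> D" "\<lbrakk>x \<in> D; y \<in> D\<rbrakk> \<Longrightarrow> x \<otimes> y \<in> D" "\<one> \<in> D" "\<zero> \<in> D"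
    "x \<in> D \<Longrightarrow> \<ominus> x \<in> D" "\<lbrakk>x \<in> D; y \<in> D\<rbrakk> \<Longrightarrow> x \<ominus> y \<in> D"
  using subringE[OF D] by (auto simp: a_minus_def)

lemma D_is_ring: "ring (A\<lparr>carrier := D\<rparr>)"
  using ring.subring_is_ring[OF A_ring D] .

lemma D_neg: "x \<in> D \<Longrightarrow> \<ominus>\<^bsub>A\<lparr>carrier := D\<rparr>\<^esub> x = \<ominus> x"
  using abelian_group.minus_equality[OF ringE(1)[OF D_is_ring], of "\<ominus> x" x] D_ops D_mem
  by (simp add: l_neg)

lemma D_cdist: "\<lbrakk>x \<in> D; y \<in> D\<rbrakk> \<Longrightarrow> cdist (A\<lparr>carrier := D\<rparr>) x y = nrm A (x \<ominus> y)"
  by (simp add: cdist_def a_minus_def D_neg)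

lemma D_Metric_space: "Metric_space D (cdist (A\<lparr>carrier := D\<rparr>))"
proof
  show "0 \<le> cdist (A\<lparr>carrier := D\<rparr>) x y" for x y
    by (simp add: cdist_def a_minus_def D_neg nrm_nonneg D_mem abelian_group.a_inv_closed[OF A_group])
  show "cdist (A\<lparr>carrier := D\<rparr>) x y = cdist (A\<lparr>carrier := D\<rparr>) y x" for x y
  proof (cases "x \<in> D \<and> y \<in> D")
    case True
    then show ?thesis using D_cdist nrm_diff_commute D_mem by simp
  qed (auto simp: cdist_def)
  show "cdist (A\<lparr>carrier := D\<rparr>) x y = 0 \<longleftrightarrow> x = y" if "x \<in> D" "y \<in> D" for x y
    using that nrm_eq_0_iff[of "x \<ominus> y"] diff_eq_zeroD[of x y] D_mem by (auto simp: D_cdist)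
  show "cdist (A\<lparr>carrier := D\<rparr>) x z \<le> cdist (A\<lparr>carrier := D\<rparr>) x y + cdist (A\<lparr>carrier := D\<rparr>) y z"
    if "x \<in> D" "y \<in> D" "z \<in> D" for x y z
    using that nrm_diff_triangle D_mem by (simp add: D_cdist)
qed

text \<open>The closure of \<open>z D\<close> is a closed ideal. It is proper because an element of \<open>z D\<close> close to the
  unit would be invertible.\<close>

lemma central_nonunit_of_simple:
  assumes simple: "simple_cstar (A\<lparr>carrier := D\<rparr>)"
    and z: "z \<in> D" and central: "\<And>d. d \<in> D \<Longrightarrow> z \<otimes> d = d \<otimes> z" and nu: "z \<notin> Units A"
  shows "z = \<zero>"
proof -
  define I where "I = {x \<in> D. \<forall>\<epsilon>>0. \<exists>y\<in>D. nrm A (x \<ominus> z \<otimes> y) < \<epsilon>}"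
  have zc: "z \<in> carrier A" using z D_mem by blast
  have I_mul: "w \<otimes> x \<in> I" if x: "x \<in> I" and w: "w \<in> D" for x w
  proof -
    have xw: "x \<in> D" "x \<in> carrier A" "w \<in> carrier A" using x w D_mem by (auto simp: I_def)
    have "\<exists>y\<in>D. nrm A (w \<otimes> x \<ominus> z \<otimes> y) < \<epsilon>" if e: "\<epsilon> > 0" for \<epsilon>
    proof -
      have "\<epsilon> / (nrm A w + 1) > 0" using e nrm_nonneg[OF xw(3)] by simp
      then obtain y where y: "y \<in> D" "nrm A (x \<ominus> z \<otimes> y) < \<epsilon> / (nrm A w + 1)"
        using x unfolding I_def by blast
      have yc: "y \<in> carrier A" using y D_mem by blast
      have zw: "z \<otimes> w = w \<otimes> z" using central w by blast
      have "w \<otimes> x \<ominus> z \<otimes> (w \<otimes> y) = w \<otimes> x \<ominus> (z \<otimes> w) \<otimes> y"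
        using xw yc zc by (simp add: mul_assoc)
      also have "\<dots> = w \<otimes> (x \<ominus> z \<otimes> y)"
        unfolding zw using xw yc zc by (simp add: alg_simps)
      finally have "nrm A (w \<otimes> x \<ominus> z \<otimes> (w \<otimes> y)) \<le> nrm A w * nrm A (x \<ominus> z \<otimes> y)"
        using nrm_mult[of w "x \<ominus> z \<otimes> y"] xw yc zc by simp
      also have "\<dots> \<le> (nrm A w + 1) * nrm A (x \<ominus> z \<otimes> y)"
        using nrm_nonneg[of "x \<ominus> z \<otimes> y"] xw yc zc by (intro mult_right_mono) auto
      also have "\<dots> < \<epsilon>" using y(2) nrm_nonneg[OF xw(3)] by (simp add: field_simps)
      finally show ?thesis using D_ops(2)[OF w y(1)] by blast
    qed
    then show ?thesis using D_ops(2)[OF w xw(1)] by (simp add: I_def)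
  qed
  have I_mul': "x \<otimes> w \<in> I" if x: "x \<in> I" and w: "w \<in> D" for x w
  proof -
    have xw: "x \<in> D" "x \<in> carrier A" "w \<in> carrier A" using x w D_mem by (auto simp: I_def)
    have "\<exists>y\<in>D. nrm A (x \<otimes> w \<ominus> z \<otimes> y) < \<epsilon>" if e: "\<epsilon> > 0" for \<epsilon>
    proof -
      have "\<epsilon> / (nrm A w + 1) > 0" using e nrm_nonneg[OF xw(3)] by simp
      then obtain y where y: "y \<in> D" "nrm A (x \<ominus> z \<otimes> y) < \<epsilon> / (nrm A w + 1)"
        using x unfolding I_def by blast
      have yc: "y \<in> carrier A" using y D_mem by blast
      have "x \<otimes> w \<ominus> z \<otimes> (y \<otimes> w) = (x \<ominus> z \<otimes> y) \<otimes> w"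
        using xw yc zc by (simp add: alg_simps)
      then have "nrm A (x \<otimes> w \<ominus> z \<otimes> (y \<otimes> w)) \<le> nrm A (x \<ominus> z \<otimes> y) * nrm A w"
        using nrm_mult[of "x \<ominus> z \<otimes> y" w] xw yc zc by simp
      also have "\<dots> \<le> nrm A (x \<ominus> z \<otimes> y) * (nrm A w + 1)"
        using nrm_nonneg[of "x \<ominus> z \<otimes> y"] xw yc zc by (intro mult_left_mono) auto
      also have "\<dots> < \<epsilon>" using y(2) nrm_nonneg[OF xw(3)] by (simp add: field_simps)
      finally show ?thesis using D_ops(2)[OF y(1) w] by blast
    qed
    then show ?thesis using D_ops(2)[OF xw(1) w] by (simp add: I_def)
  qed
  have I_add: "x \<oplus> x' \<in> I" if x: "x \<in> I" "x' \<in> I" for x x'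
  proof -
    have c: "x \<in> D" "x \<in> carrier A" "x' \<in> D" "x' \<in> carrier A" using x D_mem by (auto simp: I_def)
    have "\<exists>y\<in>D. nrm A (x \<oplus> x' \<ominus> z \<otimes> y) < \<epsilon>" if e: "\<epsilon> > 0" for \<epsilon>
    proof -
      have "\<epsilon> / 2 > 0" using e by simp
      then obtain y y' where y: "y \<in> D" "nrm A (x \<ominus> z \<otimes> y) < \<epsilon> / 2"
          "y' \<in> D" "nrm A (x' \<ominus> z \<otimes> y') < \<epsilon> / 2"
        using x unfolding I_def by blast
      have yc: "y \<in> carrier A" "y' \<in> carrier A" using y D_mem by blast+
      have "x \<oplus> x' \<ominus> z \<otimes> (y \<oplus> y') = (x \<ominus> z \<otimes> y) \<oplus> (x' \<ominus> z \<otimes> y')"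
        using c yc zc by (simp add: alg_simps add_ac)
      then have "nrm A (x \<oplus> x' \<ominus> z \<otimes> (y \<oplus> y')) < \<epsilon>"
        using nrm_triangle[of "x \<ominus> z \<otimes> y" "x' \<ominus> z \<otimes> y'"] y c yc zc by simp
      then show ?thesis using D_ops(1)[OF y(1) y(3)] by blast
    qed
    then show ?thesis using D_ops(1)[OF c(1) c(3)] by (simp add: I_def)
  qed
  have zI: "z \<in> I"
  proof -
    have "nrm A (z \<ominus> z \<otimes> \<one>) = 0" using zc by (simp add: minus_scalar scalar_collect)
    then show ?thesis using z D_ops(3) unfolding I_def by force
  qed
  have zeroI: "\<zero> \<in> I"
  proof -
    have "z \<otimes> \<zero> = \<zero>" using zc ring.ring_simprules(25)[OF A_ring] by blast
    then show ?thesis using I_mul'[OF zI D_ops(4)] by simp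
  qed
  have negI: "\<ominus> x \<in> I" if "x \<in> I" for x
  proof -
    have "x \<in> carrier A" using that D_mem by (auto simp: I_def)
    then have "\<ominus> x = (\<ominus> \<one>) \<otimes> x" by (simp add: neg_scalar smult_mult_left)
    then show ?thesis using I_mul[OF that D_ops(5)[OF D_ops(3)]] by simp
  qed
  interpret DR: ring "A\<lparr>carrier := D\<rparr>" by (rule D_is_ring)
  have "ideal I (A\<lparr>carrier := D\<rparr>)"
  proof (rule idealI[OF D_is_ring])
    show "subgroup I (add_monoid (A\<lparr>carrier := D\<rparr>))"
    proof (rule DR.add.subgroupI)
      show "\<ominus>\<^bsub>A\<lparr>carrier := D\<rparr>\<^esub> a \<in> I" if "a \<in> I" for a
        using D_neg[of a] negI[OF that] that by (simp add: I_def)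
    qed (use zI I_add in \<open>auto simp: I_def\<close>)
  qed (use I_mul I_mul' in auto)
  moreover have "norm_closed (A\<lparr>carrier := D\<rparr>) I"
  proof -
    interpret MS: Metric_space D "cdist (A\<lparr>carrier := D\<rparr>)" by (rule D_Metric_space)
    have "\<exists>r>0. disjnt I (MS.mball x r)" if x: "x \<in> D - I" for x
    proof -
      have xc: "x \<in> carrier A" using x D_mem by blast
      obtain \<epsilon> where e: "\<epsilon> > 0" "\<And>y. y \<in> D \<Longrightarrow> nrm A (x \<ominus> z \<otimes> y) \<ge> \<epsilon>"
        using x unfolding I_def by force
      have "\<not> cdist (A\<lparr>carrier := D\<rparr>) x w < \<epsilon> / 2" if w: "w \<in> I" for w
      proof -
        have wD: "w \<in> D" using w by (simp add: I_def)
        have "\<epsilon> / 2 > 0" using e by simp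
        then obtain y where y: "y \<in> D" "nrm A (w \<ominus> z \<otimes> y) < \<epsilon> / 2" using w unfolding I_def by blast
        have "nrm A (x \<ominus> z \<otimes> y) \<le> nrm A (x \<ominus> w) + nrm A (w \<ominus> z \<otimes> y)"
          using xc wD y zc D_mem by (intro nrm_diff_triangle) auto
        then show ?thesis using e(2)[OF y(1)] y(2) D_cdist[of x w] wD x by simp
      qed
      then show ?thesis using e(1) by (intro exI[of _ "\<epsilon> / 2"]) (auto simp: disjnt_iff)
    qed
    then show ?thesis unfolding norm_closed_def using MS.closedin_metric[of I] by (auto simp: I_def)
  qed
  ultimately have "I = {\<zero>} \<or> I = D"
    using simple unfolding simple_cstar_def by auto
  moreover have "\<one> \<notin> I"
  proof
    assume "\<one> \<in> I"
    then obtain y where y: "y \<in> D" "nrm A (\<one> \<ominus> z \<otimes> y) < 1" unfolding I_def by force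
    have yc: "y \<in> carrier A" using y D_mem by blast
    have "\<one> \<ominus> (\<one> \<ominus> z \<otimes> y) \<in> Units A" using one_minus_unit(1)[of "\<one> \<ominus> z \<otimes> y"] y yc zc by simp
    then have "z \<otimes> y \<in> Units A" using one_minus_self[of "z \<otimes> y" 1] yc zc by simp
    then show False using commuting_factor_unit[OF zc yc central[OF y(1)]] nu by blast
  qed
  ultimately show ?thesis using zI D_ops(3) by blast
qed

text \<open>For a self-adjoint central \<open>h\<close> one of the central elements \<open>\<parallel>h\<parallel> - h\<close> and \<open>\<parallel>h\<parallel> + h\<close> is not invertible,
hence zero.\<close>

lemma centre_of_simple:
  assumes nt: "\<one> \<noteq> \<zero>" and simple: "simple_cstar (A\<lparr>carrier := D\<rparr>)" and D_star: "\<And>x. x \<in> D \<Longrightarrow> star A x \<in> D"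
    and z: "z \<in> D" and central: "\<And>d. d \<in> D \<Longrightarrow> z \<otimes> d = d \<otimes> z"
  obtains c where "z = c \<odot> \<one>"
proof -
  have sa: "\<exists>c. h = c \<odot> \<one>" if h: "h \<in> D" "star A h = h" and c: "\<And>d. d \<in> D \<Longrightarrow> h \<otimes> d = d \<otimes> h" for h
  proof -
    have hc: "h \<in> carrier A" using h D_mem by blast
    define m where "m = nrm A h"
    have mD: "scal m \<ominus> h \<in> D" "scal m \<oplus> h \<in> D"
      using h D_smult D_ops by auto
    have cen: "(scal m \<ominus> h) \<otimes> d = d \<otimes> (scal m \<ominus> h)" "(scal m \<oplus> h) \<otimes> d = d \<otimes> (scal m \<oplus> h)" if "d \<in> D" for d
      using c[OF that] hc D_mem[OF that] by (simp_all add: alg_simps)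
    consider "scal m \<ominus> h \<notin> Units A" | "scal m \<oplus> h \<notin> Units A"
      using self_adjoint_norm_in_spectrum[OF nt hc h(2)] by (auto simp: m_def)
    then show ?thesis
    proof cases
      case 1
      then have "scal m \<ominus> h = \<zero>" using central_nonunit_of_simple[OF simple mD(1) cen(1)] by blast
      then have "scal m = h" by (rule diff_eq_zeroD) (use hc in auto)
      then show ?thesis by blast
    next
      case 2
      then have "scal m \<oplus> h = \<zero>" using central_nonunit_of_simple[OF simple mD(2) cen(2)] by blast
      then have "\<ominus> h = scal m" using abelian_group.minus_equality[OF A_group] hc by blast
      then have "(-1) \<odot> h = scal m" using hc by (simp add: neg_scalar)
      then have "(-1) \<odot> ((-1) \<odot> h) = (-1) \<odot> scal m" by simp
      then show ?thesis using hc by auto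
    qed
  qed
  have zc: "z \<in> carrier A" and zsD: "star A z \<in> D" using z D_mem D_star by auto
  have cs: "star A z \<otimes> d = d \<otimes> star A z" if d: "d \<in> D" for d
  proof -
    have "star A (z \<otimes> star A d) = star A (star A d \<otimes> z)" using central[OF D_star[OF d]] by simp
    then show ?thesis using zc D_mem[OF d] by (simp add: star_mult)
  qed
  define h k where "h = (1/2) \<odot> (z \<oplus> star A z)" and "k = (\<i>/2) \<odot> (z \<ominus> star A z)"
  have "\<exists>c. h = c \<odot> \<one>"
  proof (rule sa)
    show "h \<in> D" using z zsD D_smult D_ops by (simp add: h_def)
    show "star A h = h" using zc by (simp add: h_def star_simps add_comm)
    show "h \<otimes> d = d \<otimes> h" if "d \<in> D" for d
      using central[OF that] cs[OF that] zc D_mem[OF that] by (simp add: h_def alg_simps)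
  qed
  moreover have "\<exists>c. k = c \<odot> \<one>"
  proof (rule sa)
    show "k \<in> D" using z zsD D_smult D_ops by (simp add: k_def)
    show "star A k = k" using zc by (simp add: k_def star_simps alg_simps add_comm)
    show "k \<otimes> d = d \<otimes> k" if "d \<in> D" for d
      using central[OF that] cs[OF that] zc D_mem[OF that] by (simp add: k_def alg_simps)
  qed
  ultimately obtain c d where cd: "h = c \<odot> \<one>" "k = d \<odot> \<one>" by blast
  have "h \<oplus> (- \<i>) \<odot> k = ((1/2) \<odot> z \<oplus> (1/2) \<odot> z) \<oplus> ((1/2) \<odot> star A z \<oplus> (-1/2) \<odot> star A z)"
    using zc by (simp add: h_def k_def alg_simps add_ac)
  also have "\<dots> = z" using zc by (simp add: scalar_collect)
  finally have "z = (c + (- \<i>) * d) \<odot> \<one>" by (simp add: cd scalar_collect)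
  then show thesis using that by blast
qed

end
end

section \<open>Conditional expectations of finite index and their Hilbert modules\<close>

lemma le_of_forall_gt_mult:
  fixes a b c :: real
  assumes "\<And>t. t > a \<Longrightarrow> c \<le> t * b" "0 \<le> b"
  shows "c \<le> a * b"
proof -
  have lim: "(\<lambda>n. (a + inverse (real (Suc n))) * b) \<longlonglongrightarrow> (a + 0) * b"
    by (intro tendsto_intros LIMSEQ_inverse_real_of_nat)
  have "c \<le> (a + inverse (real (Suc n))) * b" for n
    by (rule assms(1)) simp
  then show ?thesis using LIMSEQ_le_const[OF lim, of c] by auto
qed

context unital_cstar_algebra
begin

text \<open>A positive linear map preserves self-adjointness, since \<open>4h = (h + 1)\<^sup>2 - (h - 1)\<^sup>2\<close> for
  self-adjoint \<open>h\<close>.\<close>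

lemma positive_map_star:
  assumes f: "\<And>x. x \<in> carrier A \<Longrightarrow> f x \<in> carrier A"
    and add: "\<And>x y. \<lbrakk>x \<in> carrier A; y \<in> carrier A\<rbrakk> \<Longrightarrow> f (x \<oplus> y) = f x \<oplus> f y"
    and smult: "\<And>c x. x \<in> carrier A \<Longrightarrow> f (c \<odot> x) = c \<odot> f x"
    and pos: "\<And>x. x \<in> carrier A \<Longrightarrow> \<exists>b\<in>carrier A. f (star A x \<otimes> x) = star A b \<otimes> b"
    and x: "x \<in> carrier A"
  shows "f (star A x) = star A (f x)"
proof -
  have sq: "star A (f (star A y \<otimes> y)) = f (star A y \<otimes> y)" if "y \<in> carrier A" for y
    using pos[OF that] by (auto simp: star_mult)
  have sa: "star A (f h) = f h" if h: "h \<in> carrier A" "star A h = h" for h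
  proof -
    let ?p = "star A (h \<oplus> \<one>) \<otimes> (h \<oplus> \<one>)" and ?q = "star A (h \<ominus> \<one>) \<otimes> (h \<ominus> \<one>)"
    have "?p \<ominus> ?q = (((h \<oplus> h) \<oplus> (h \<oplus> h)) \<oplus> (h \<otimes> h \<oplus> (-1) \<odot> (h \<otimes> h))) \<oplus> (\<one> \<oplus> (-1) \<odot> \<one>)"
      using h by (simp add: star_simps alg_simps add_ac)
    also have "\<dots> = 4 \<odot> h" using h by (simp add: scalar_collect)
    finally have h4: "h = (1/4) \<odot> (?p \<oplus> (-1) \<odot> ?q)" using h by (simp add: minus_scalar)
    have fh: "f h = (1/4) \<odot> (f ?p \<oplus> (-1) \<odot> f ?q)"
      by (subst h4) (use h f in \<open>simp add: add smult\<close>)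
    show ?thesis
      unfolding fh using sq[of "h \<oplus> \<one>"] sq[of "h \<ominus> \<one>"] h f by (simp add: star_simps)
  qed
  define h k where "h = (1/2) \<odot> (x \<oplus> star A x)" and "k = (\<i>/2) \<odot> (x \<ominus> star A x)"
  have h: "h \<in> carrier A" "star A h = h" using x by (auto simp: h_def star_simps add_comm)
  have k: "k \<in> carrier A" "star A k = k" using x by (auto simp: k_def star_simps alg_simps add_comm)
  have "h \<oplus> (- \<i>) \<odot> k = ((1/2) \<odot> x \<oplus> (1/2) \<odot> x) \<oplus> ((1/2) \<odot> star A x \<oplus> (-1/2) \<odot> star A x)"
    using x by (simp add: h_def k_def alg_simps add_ac)
  then have x1: "x = h \<oplus> (- \<i>) \<odot> k" using x by (simp add: scalar_collect)
  then have x2: "star A x = h \<oplus> \<i> \<odot> k" using h k by (simp add: star_simps)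
  show ?thesis
    unfolding x2 by (subst x1) (use h k f sa in \<open>simp add: add smult star_simps\<close>)
qed

end

locale finite_index = unital_cstar_algebra A for A :: "'a cstar" (structure) +
  fixes B :: "'a set" and E :: "'a \<Rightarrow> 'a" and \<Lambda> :: "'a set"
  assumes nontrivial: "\<one> \<noteq> \<zero>"
    and B_subring: "subring B A" and B_smult: "b \<in> B \<Longrightarrow> c \<odot> b \<in> B"
    and B_star: "b \<in> B \<Longrightarrow> star A b \<in> B"
    and cond_exp: "cond_exp A B E" and quasi_basis: "quasi_basis A E \<Lambda>"
begin

lemma B_mem [simp]: "b \<in> B \<Longrightarrow> b \<in> carrier A" using subringE(1)[OF B_subring] by blast
lemma B_one [simp]: "\<one> \<in> B" using subringE(3)[OF B_subring] .
lemma B_mul: "\<lbrakk>a \<in> B; b \<in> B\<rbrakk> \<Longrightarrow> a \<otimes> b \<in> B" using subringE(6)[OF B_subring] .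

lemma E_B [simp]: "x \<in> carrier A \<Longrightarrow> E x \<in> B" using cond_exp by (auto simp: cond_exp_def)
lemma E_mem [simp]: "x \<in> carrier A \<Longrightarrow> E x \<in> carrier A" by simp
lemma E_add: "\<lbrakk>x \<in> carrier A; y \<in> carrier A\<rbrakk> \<Longrightarrow> E (x \<oplus> y) = E x \<oplus> E y"
  using cond_exp by (simp add: cond_exp_def linear_map_def)
lemma E_smult: "x \<in> carrier A \<Longrightarrow> E (c \<odot> x) = c \<odot> E x"
  using cond_exp by (simp add: cond_exp_def linear_map_def)
lemma E_id [simp]: "b \<in> B \<Longrightarrow> E b = b" using cond_exp by (simp add: cond_exp_def)
lemma E_nrm: "x \<in> carrier A \<Longrightarrow> nrm A (E x) \<le> nrm A x" using cond_exp by (simp add: cond_exp_def)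
lemma E_bimodule: "\<lbrakk>x \<in> carrier A; a \<in> B; b \<in> B\<rbrakk> \<Longrightarrow> E (a \<otimes> x \<otimes> b) = a \<otimes> E x \<otimes> b"
  using cond_exp by (simp add: cond_exp_def)
lemma E_left: "\<lbrakk>x \<in> carrier A; a \<in> B\<rbrakk> \<Longrightarrow> E (a \<otimes> x) = a \<otimes> E x"
  using E_bimodule[of x a \<one>] by simp
lemma E_right: "\<lbrakk>x \<in> carrier A; a \<in> B\<rbrakk> \<Longrightarrow> E (x \<otimes> a) = E x \<otimes> a"
  using E_bimodule[of x \<one> a] by simp
lemma E_one [simp]: "E \<one> = \<one>" by simp

lemma E_positive:
  assumes "x \<in> carrier A"
  obtains b where "b \<in> B" "E (star A x \<otimes> x) = star A b \<otimes> b"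
proof -
  have "star A x \<otimes> x \<in> positive_elements A" using assms by (auto simp: positive_elements_def)
  then have "E (star A x \<otimes> x) \<in> positive_elements (A\<lparr>carrier := B\<rparr>)"
    using cond_exp unfolding cond_exp_def by blast
  then show thesis using that by (auto simp: positive_elements_def)
qed

lemma E_star: "x \<in> carrier A \<Longrightarrow> E (star A x) = star A (E x)"
proof (rule positive_map_star)
  show "\<exists>b\<in>carrier A. E (star A y \<otimes> y) = star A b \<otimes> b" if "y \<in> carrier A" for y
    using E_positive[OF that] B_mem by metis
qed (use E_add E_smult in auto)

lemma finite_basis [simp]: "finite \<Lambda>" using quasi_basis by (simp add: quasi_basis_def)
lemma basis_mem [simp]: "l \<in> \<Lambda> \<Longrightarrow> l \<in> carrier A" using quasi_basis by (auto simp: quasi_basis_def)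

lemma basis_expansion: "x \<in> carrier A \<Longrightarrow> x = (\<Oplus>l\<in>\<Lambda>. l \<otimes> E (star A l \<otimes> x))"
  using quasi_basis by (simp add: quasi_basis_def)

lemma basis_expansion_right: "x \<in> carrier A \<Longrightarrow> x = (\<Oplus>l\<in>\<Lambda>. E (x \<otimes> l) \<otimes> star A l)"
  using quasi_basis by (simp add: quasi_basis_def)

lemma E_nondegenerate:
  assumes uv: "u \<in> carrier A" "v \<in> carrier A"
    and eq: "\<And>z. z \<in> carrier A \<Longrightarrow> E (star A z \<otimes> u) = E (star A z \<otimes> v)"
  shows "u = v"
proof -
  have "u = (\<Oplus>l\<in>\<Lambda>. l \<otimes> E (star A l \<otimes> u))" using basis_expansion uv by blast
  also have "\<dots> = (\<Oplus>l\<in>\<Lambda>. l \<otimes> E (star A l \<otimes> v))" using uv eq by (intro fsum_eq) auto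
  also have "\<dots> = v" using basis_expansion uv by metis
  finally show ?thesis .
qed

section \<open>The Hilbert module norm\<close>

abbreviation mn :: "'a \<Rightarrow> real" where "mn \<equiv> mod_norm A E"

lemma mn_sq: "x \<in> carrier A \<Longrightarrow> (mn x)\<^sup>2 = nrm A (E (star A x \<otimes> x))"
  by (simp add: mod_norm_def mod_inner_def nrm_nonneg)

lemma mn_nonneg [simp]: "x \<in> carrier A \<Longrightarrow> 0 \<le> mn x"
  by (simp add: mod_norm_def mod_inner_def nrm_nonneg)

text \<open>With \<open>a = E(x\<^sup>*x)\<close>, \<open>b = E(x\<^sup>*y)\<close> and \<open>t > \<parallel>a\<parallel>\<close>, the element \<open>t - a\<close> is a square \<open>s\<^sup>2\<close>, and
  expanding \<open>E(z\<^sup>*z)\<close> for \<open>z = ty - xb\<close> exhibits \<open>t\<^sup>2 E(y\<^sup>*y)\<close> as \<open>t b\<^sup>*b\<close> plus the positive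
  elements \<open>(sb)\<^sup>*(sb)\<close> and \<open>E(z\<^sup>*z)\<close>.\<close>

lemma Cauchy_Schwarz_sq:
  assumes x: "x \<in> carrier A" and y: "y \<in> carrier A"
  shows "(nrm A (E (star A x \<otimes> y)))\<^sup>2 \<le> nrm A (E (star A x \<otimes> x)) * nrm A (E (star A y \<otimes> y))"
proof (rule le_of_forall_gt_mult)
  fix t assume t: "nrm A (E (star A x \<otimes> x)) < t"
  define a b where "a = E (star A x \<otimes> x)" and "b = E (star A x \<otimes> y)"
  have a: "a \<in> carrier A" "star A a = a" using x by (auto simp: a_def star_mult E_star[symmetric])
  have b: "b \<in> B" "b \<in> carrier A" "star A b \<in> B" using x y B_star by (auto simp: b_def)
  have sb: "E (star A y \<otimes> x) = star A b" using x y by (simp add: b_def E_star[symmetric] star_mult)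
  have t0: "t > 0" using t nrm_nonneg[of "E (star A x \<otimes> x)"] x by simp
  obtain s where s: "s \<in> carrier A" "star A s = s" "s \<otimes> s = scal t \<ominus> a"
    using sqrt_of_scalar_minus[OF a, of t] t by (auto simp: a_def)
  define z where "z = complex_of_real t \<odot> y \<ominus> x \<otimes> b"
  have z: "z \<in> carrier A" using x y b by (simp add: z_def)
  obtain p where p: "p \<in> B" "E (star A z \<otimes> z) = star A p \<otimes> p" using E_positive[OF z] by blast
  have zz: "star A z \<otimes> z = complex_of_real (t * t) \<odot> (star A y \<otimes> y) \<oplus>
      ((- complex_of_real t) \<odot> ((star A y \<otimes> x) \<otimes> b) \<oplus>
       ((- complex_of_real t) \<odot> (star A b \<otimes> (star A x \<otimes> y)) \<oplus> star A b \<otimes> ((star A x \<otimes> x) \<otimes> b)))"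
    using x y b(2) by (simp add: z_def star_simps alg_simps add_ac)
  have "E (star A z \<otimes> z) = complex_of_real (t * t) \<odot> E (star A y \<otimes> y) \<oplus>
      ((- complex_of_real t) \<odot> (star A b \<otimes> b) \<oplus>
       ((- complex_of_real t) \<odot> (star A b \<otimes> b) \<oplus> star A b \<otimes> (a \<otimes> b)))"
    unfolding zz using x y b by (simp add: E_add E_smult E_left E_right sb a_def b_def[symmetric])
  moreover have "star A (s \<otimes> b) \<otimes> (s \<otimes> b) = star A b \<otimes> ((s \<otimes> s) \<otimes> b)"
    using s(1,2) b by (simp add: star_mult mul_assoc)
  then have ss: "star A (s \<otimes> b) \<otimes> (s \<otimes> b) = complex_of_real t \<odot> (star A b \<otimes> b) \<oplus> (-1) \<odot> (star A b \<otimes> (a \<otimes> b))"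
    unfolding s(3) using a b by (simp add: alg_simps)
  ultimately have "complex_of_real t \<odot> (star A b \<otimes> b) \<oplus> (star A (s \<otimes> b) \<otimes> (s \<otimes> b) \<oplus> E (star A z \<otimes> z))
     = complex_of_real (t * t) \<odot> E (star A y \<otimes> y) \<oplus>
       ((star A b \<otimes> (a \<otimes> b) \<oplus> (-1) \<odot> (star A b \<otimes> (a \<otimes> b))) \<oplus>
        ((complex_of_real t \<odot> (star A b \<otimes> b) \<oplus> (- complex_of_real t) \<odot> (star A b \<otimes> b)) \<oplus>
        (complex_of_real t \<odot> (star A b \<otimes> b) \<oplus> (- complex_of_real t) \<odot> (star A b \<otimes> b))))"
    unfolding ss using a b y by (simp add: add_ac)
  also have "\<dots> = complex_of_real (t * t) \<odot> E (star A y \<otimes> y)"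
    using a b y by (simp add: scalar_collect)
  finally have eq: "complex_of_real (t * t) \<odot> E (star A y \<otimes> y) =
      complex_of_real t \<odot> (star A b \<otimes> b) \<oplus> (star A (s \<otimes> b) \<otimes> (s \<otimes> b) \<oplus> E (star A z \<otimes> z))" by simp
  have pos: "spec_nonneg (star A (s \<otimes> b) \<otimes> (s \<otimes> b) \<oplus> E (star A z \<otimes> z))"
    unfolding p(2) using p(1) s b nontrivial by (intro spec_nonneg_add spec_nonneg_star_mult) auto
  define d where "d = complex_of_real (sqrt t) \<odot> b"
  have d: "d \<in> carrier A" "star A d \<otimes> d = complex_of_real t \<odot> (star A b \<otimes> b)"
    using b t0 by (auto simp: d_def star_simps smult_mult_left smult_mult_right simp flip: of_real_mult)
  have "(nrm A d)\<^sup>2 \<le> nrm A (complex_of_real (t * t) \<odot> E (star A y \<otimes> y))"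
    unfolding eq d(2)[symmetric] using nrm_le_add_spec_nonneg[OF nontrivial d(1) pos] .
  also have "\<dots> = t * (t * nrm A (E (star A y \<otimes> y)))" using y t0 by (simp add: nrm_smult norm_mult)
  finally have "t * (nrm A b)\<^sup>2 \<le> t * (t * nrm A (E (star A y \<otimes> y)))"
    using b t0 by (simp add: d_def nrm_smult power_mult_distrib)
  then show "(nrm A (E (star A x \<otimes> y)))\<^sup>2 \<le> t * nrm A (E (star A y \<otimes> y))"
    using t0 by (simp add: b_def)
qed (use y nrm_nonneg in auto)

lemma Cauchy_Schwarz:
  assumes "x \<in> carrier A" "y \<in> carrier A"
  shows "nrm A (E (star A x \<otimes> y)) \<le> mn x * mn y"
  by (rule power2_le_imp_le)
    (use Cauchy_Schwarz_sq[OF assms] assms in \<open>simp_all add: power_mult_distrib mn_sq\<close>)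

lemma mn_triangle:
  assumes x: "x \<in> carrier A" and y: "y \<in> carrier A"
  shows "mn (x \<oplus> y) \<le> mn x + mn y"
proof (rule power2_le_imp_le)
  have "E (star A (x \<oplus> y) \<otimes> (x \<oplus> y)) =
      (E (star A x \<otimes> x) \<oplus> E (star A x \<otimes> y)) \<oplus> (E (star A y \<otimes> x) \<oplus> E (star A y \<otimes> y))"
    using x y by (simp add: star_simps alg_simps E_add add_ac)
  then have "(mn (x \<oplus> y))\<^sup>2 \<le> (nrm A (E (star A x \<otimes> x)) + nrm A (E (star A x \<otimes> y))) +
      (nrm A (E (star A y \<otimes> x)) + nrm A (E (star A y \<otimes> y)))"
    using x y nrm_triangle[of "E (star A x \<otimes> x)" "E (star A x \<otimes> y)"]
      nrm_triangle[of "E (star A y \<otimes> x)" "E (star A y \<otimes> y)"]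
      nrm_triangle[of "E (star A x \<otimes> x) \<oplus> E (star A x \<otimes> y)" "E (star A y \<otimes> x) \<oplus> E (star A y \<otimes> y)"]
    by (simp add: mn_sq)
  also have "\<dots> \<le> ((mn x)\<^sup>2 + mn x * mn y) + (mn y * mn x + (mn y)\<^sup>2)"
    using Cauchy_Schwarz[OF x y] Cauchy_Schwarz[OF y x] x y by (intro add_mono) (simp_all add: mn_sq)
  also have "\<dots> = (mn x + mn y)\<^sup>2" by (simp add: power2_eq_square algebra_simps)
  finally show "(mn (x \<oplus> y))\<^sup>2 \<le> (mn x + mn y)\<^sup>2" .
qed (use x y in auto)

lemma mn_smult:
  assumes x: "x \<in> carrier A"
  shows "mn (c \<odot> x) = cmod c * mn x"
proof (rule power2_eq_imp_eq)
  have "(mn (c \<odot> x))\<^sup>2 = cmod c * cmod c * nrm A (E (star A x \<otimes> x))"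
    using x by (simp add: mn_sq star_simps smult_mult_left smult_mult_right E_smult nrm_smult norm_mult)
  then show "(mn (c \<odot> x))\<^sup>2 = (cmod c * mn x)\<^sup>2"
    using x by (simp add: power_mult_distrib mn_sq) (simp add: power2_eq_square)
qed (use x in auto)

lemma mn_zero [simp]: "mn \<zero> = 0"
  using mn_smult[of \<zero> 0] by simp

lemma mn_le_nrm: "x \<in> carrier A \<Longrightarrow> mn x \<le> nrm A x"
  by (rule power2_le_imp_le) (use E_nrm[of "star A x \<otimes> x"] in \<open>simp_all add: mn_sq nrm_star_mult nrm_nonneg\<close>)

lemma mn_right_mult:
  assumes x: "x \<in> carrier A" and b: "b \<in> B"
  shows "mn (x \<otimes> b) \<le> mn x * nrm A b"
proof (rule power2_le_imp_le)
  have eq: "star A (x \<otimes> b) \<otimes> (x \<otimes> b) = star A b \<otimes> ((star A x \<otimes> x) \<otimes> b)"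
    using x b by (simp add: star_mult mul_assoc)
  have "E (star A (x \<otimes> b) \<otimes> (x \<otimes> b)) = star A b \<otimes> (E (star A x \<otimes> x) \<otimes> b)"
    unfolding eq using x b B_star by (simp add: E_left E_right)
  then have "(mn (x \<otimes> b))\<^sup>2 \<le> nrm A (star A b) * nrm A (E (star A x \<otimes> x) \<otimes> b)"
    using x b by (simp add: mn_sq nrm_mult del: nrm_star)
  also have "\<dots> \<le> nrm A b * (nrm A (E (star A x \<otimes> x)) * nrm A b)"
    using x b nrm_mult[of "E (star A x \<otimes> x)" b] nrm_nonneg by (simp add: mult_left_mono)
  finally have "(mn (x \<otimes> b))\<^sup>2 \<le> nrm A b * (nrm A (E (star A x \<otimes> x)) * nrm A b)" .
  then show "(mn (x \<otimes> b))\<^sup>2 \<le> (mn x * nrm A b)\<^sup>2"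
    using x by (simp add: power_mult_distrib mn_sq) (simp add: power2_eq_square mult_ac)
qed (use x b nrm_nonneg in auto)

lemma mn_fsum_le:
  assumes "finite S" "\<And>i. i \<in> S \<Longrightarrow> f i \<in> carrier A"
  shows "mn (\<Oplus>i\<in>S. f i) \<le> (\<Sum>i\<in>S. mn (f i))"
  using assms
proof (induction S)
  case (insert i S)
  have "(\<Oplus>i\<in>insert i S. f i) = f i \<oplus> (\<Oplus>i\<in>S. f i)"
    using insert by (intro fsum_insert) auto
  then show ?case using insert mn_triangle[of "f i" "\<Oplus>i\<in>S. f i"] by simp
qed (simp add: fsum_empty)

text \<open>Together with the contractivity of \<open>E\<close> this makes the module norm equivalent to the norm of \<open>A\<close>.\<close>

lemma nrm_le_mn:
  assumes x: "x \<in> carrier A"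
  shows "nrm A x \<le> (\<Sum>l\<in>\<Lambda>. nrm A l * mn l) * mn x"
proof -
  have "nrm A x = nrm A (\<Oplus>l\<in>\<Lambda>. l \<otimes> E (star A l \<otimes> x))" using basis_expansion[OF x] by simp
  also have "\<dots> \<le> (\<Sum>l\<in>\<Lambda>. nrm A (l \<otimes> E (star A l \<otimes> x)))" using x by (intro nrm_fsum_le) auto
  also have "\<dots> \<le> (\<Sum>l\<in>\<Lambda>. (nrm A l * mn l) * mn x)"
  proof (rule sum_mono)
    fix l assume l: "l \<in> \<Lambda>"
    have "nrm A (l \<otimes> E (star A l \<otimes> x)) \<le> nrm A l * nrm A (E (star A l \<otimes> x))"
      using l x by (intro nrm_mult) auto
    also have "\<dots> \<le> nrm A l * (mn l * mn x)"
      using l x Cauchy_Schwarz[of l x] nrm_nonneg by (intro mult_left_mono) auto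
    finally show "nrm A (l \<otimes> E (star A l \<otimes> x)) \<le> (nrm A l * mn l) * mn x" by (simp add: mult_ac)
  qed
  finally show ?thesis by (simp add: sum_distrib_right)
qed

lemma mn_eq_0: "\<lbrakk>x \<in> carrier A; mn x = 0\<rbrakk> \<Longrightarrow> x = \<zero>"
  using nrm_le_mn[of x] nrm_nonneg[of x] nrm_eq_0_iff[of x] by simp

end

section \<open>The C*-algebra of adjointable maps\<close>

context finite_index
begin

lemma E_fsum:
  assumes "finite S" "\<And>i. i \<in> S \<Longrightarrow> g i \<in> carrier A"
  shows "E (\<Oplus>i\<in>S. g i) = (\<Oplus>i\<in>S. E (g i))"
  using assms by (intro fsum_additive) (auto simp: E_add)

abbreviation L :: "('a \<Rightarrow> 'a) cstar" where "L \<equiv> adjointable_algebra A B E"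

text \<open>A map with an adjoint is linear and right \<open>B\<close>-linear, because the inner product separates points;
so membership in the algebra of adjointable maps and the value of the involution both reduce to
this one relation.\<close>

definition adj :: "('a \<Rightarrow> 'a) \<Rightarrow> ('a \<Rightarrow> 'a) \<Rightarrow> bool" where
  "adj T S \<longleftrightarrow> T \<in> carrier A \<rightarrow>\<^sub>E carrier A \<and> S \<in> carrier A \<rightarrow>\<^sub>E carrier A \<and>
     (\<forall>x\<in>carrier A. \<forall>y\<in>carrier A. E (star A (T x) \<otimes> y) = E (star A x \<otimes> S y))"

lemma adjI:
  assumes "T \<in> carrier A \<rightarrow>\<^sub>E carrier A" "S \<in> carrier A \<rightarrow>\<^sub>E carrier A"
    "\<And>x y. \<lbrakk>x \<in> carrier A; y \<in> carrier A\<rbrakk> \<Longrightarrow> E (star A (T x) \<otimes> y) = E (star A x \<otimes> S y)"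
  shows "adj T S"
  using assms by (simp add: adj_def)

lemma adj_mem: "adj T S \<Longrightarrow> x \<in> carrier A \<Longrightarrow> T x \<in> carrier A" "adj T S \<Longrightarrow> x \<in> carrier A \<Longrightarrow> S x \<in> carrier A"
  by (auto simp: adj_def)

lemma adj_sym: assumes a: "adj T S" shows "adj S T"
  unfolding adj_def
proof (intro conjI ballI)
  fix x y assume xy: "x \<in> carrier A" "y \<in> carrier A"
  have "E (star A (S x) \<otimes> y) = star A (E (star A y \<otimes> S x))"
    using xy adj_mem[OF a] by (simp add: E_star[symmetric] star_mult)
  also have "\<dots> = star A (E (star A (T y) \<otimes> x))" using a xy by (simp add: adj_def)
  also have "\<dots> = E (star A x \<otimes> T y)" using xy adj_mem[OF a] by (simp add: E_star[symmetric] star_mult)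
  finally show "E (star A (S x) \<otimes> y) = E (star A x \<otimes> T y)" .
qed (use a in \<open>auto simp: adj_def\<close>)

lemma adj_right: "\<lbrakk>adj T S; x \<in> carrier A; z \<in> carrier A\<rbrakk> \<Longrightarrow> E (star A z \<otimes> T x) = E (star A (S z) \<otimes> x)"
  using adj_sym[of T S] by (simp add: adj_def)

lemma adj_eqI:
  assumes "adj T S" "u \<in> carrier A" "v \<in> carrier A"
    and "\<And>z. z \<in> carrier A \<Longrightarrow> E (star A (S z) \<otimes> u) = E (star A z \<otimes> v)"
  shows "T u = v"
  by (rule E_nondegenerate) (use assms adj_mem[OF assms(1)] in \<open>simp_all add: adj_right[OF assms(1)]\<close>)

lemma adj_add: assumes "adj T S" "x \<in> carrier A" "y \<in> carrier A" shows "T (x \<oplus> y) = T x \<oplus> T y"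
  using assms adj_mem[OF assms(1)] by (intro adj_eqI[OF assms(1)]) (simp_all add: mul_add E_add adj_right[OF assms(1)])

lemma adj_smult: assumes "adj T S" "x \<in> carrier A" shows "T (c \<odot> x) = c \<odot> T x"
  using assms adj_mem[OF assms(1)]
  by (intro adj_eqI[OF assms(1)]) (simp_all add: smult_mult_right E_smult adj_right[OF assms(1)])

lemma adj_right_mult: assumes "adj T S" "x \<in> carrier A" "b \<in> B" shows "T (x \<otimes> b) = T x \<otimes> b"
  using assms adj_mem[OF assms(1)]
  by (intro adj_eqI[OF assms(1)]) (simp_all add: E_right adj_right[OF assms(1)] flip: mul_assoc)

lemma adj_unique: "adj T S \<Longrightarrow> adj T S' \<Longrightarrow> S = S'"
  unfolding adj_def
  by (elim conjE, rule PiE_ext, assumption, assumption, rule E_nondegenerate) auto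

lemma adj_carrier: assumes "adj T S" shows "T \<in> carrier L" "star L T = S"
proof -
  have m: "is_mod_adjoint A E T S' \<longleftrightarrow> adj T S'" for S'
    using assms by (auto simp: adj_def is_mod_adjoint_def mod_inner_def)
  show "T \<in> carrier L"
    using assms m adj_add[OF assms] adj_smult[OF assms] adj_right_mult[OF assms] adj_mem[OF assms]
    by (auto simp: adjointable_algebra_def adjointable_maps_def linear_map_def adj_def)
  show "star L T = S"
    unfolding adjointable_algebra_def cstar.select_convs m
    using assms adj_unique by (intro the_equality) auto
qed

lemma L_adj: assumes "T \<in> carrier L" shows "adj T (star L T)"
proof -
  obtain S where "adj T S"
    using assms by (auto simp: adjointable_algebra_def adjointable_maps_def adj_def is_mod_adjoint_def mod_inner_def)
  then show ?thesis using adj_carrier(2) by simp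
qed

lemma L_star_closed: "T \<in> carrier L \<Longrightarrow> star L T \<in> carrier L"
  using adj_carrier(1)[OF adj_sym[OF L_adj]] .

lemma L_star_star: "T \<in> carrier L \<Longrightarrow> star L (star L T) = T"
  using adj_carrier(2)[OF adj_sym[OF L_adj]] .

lemma L_mem [simp]: "\<lbrakk>T \<in> carrier L; x \<in> carrier A\<rbrakk> \<Longrightarrow> T x \<in> carrier A"
  using adj_mem(1)[OF L_adj] .
lemma L_lin_add: "\<lbrakk>T \<in> carrier L; x \<in> carrier A; y \<in> carrier A\<rbrakk> \<Longrightarrow> T (x \<oplus> y) = T x \<oplus> T y"
  using adj_add[OF L_adj] .
lemma L_lin_smult: "\<lbrakk>T \<in> carrier L; x \<in> carrier A\<rbrakk> \<Longrightarrow> T (c \<odot> x) = c \<odot> T x"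
  using adj_smult[OF L_adj] .
lemma L_right_mult: "\<lbrakk>T \<in> carrier L; x \<in> carrier A; b \<in> B\<rbrakk> \<Longrightarrow> T (x \<otimes> b) = T x \<otimes> b"
  using adj_right_mult[OF L_adj] .
lemma L_adjoint: "\<lbrakk>T \<in> carrier L; x \<in> carrier A; y \<in> carrier A\<rbrakk>
    \<Longrightarrow> E (star A (T x) \<otimes> y) = E (star A x \<otimes> star L T y)"
  using L_adj by (simp add: adj_def)

lemma L_eqI: "\<lbrakk>S \<in> carrier L; T \<in> carrier L; \<And>x. x \<in> carrier A \<Longrightarrow> S x = T x\<rbrakk> \<Longrightarrow> S = T"
  using L_adj[of S] L_adj[of T] unfolding adj_def by (meson PiE_ext)

lemma L_fsum_additive:
  assumes "T \<in> carrier L" "finite S" "\<And>i. i \<in> S \<Longrightarrow> g i \<in> carrier A"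
  shows "T (\<Oplus>i\<in>S. g i) = (\<Oplus>i\<in>S. T (g i))"
  using assms by (intro fsum_additive) (auto simp: L_lin_add)

lemma L_mul_apply: "x \<in> carrier A \<Longrightarrow> (S \<otimes>\<^bsub>L\<^esub> T) x = S (T x)"
  by (simp add: adjointable_algebra_def compose_def)
lemma L_one_apply: "x \<in> carrier A \<Longrightarrow> \<one>\<^bsub>L\<^esub> x = x"
  by (simp add: adjointable_algebra_def)
lemma L_zero_apply: "x \<in> carrier A \<Longrightarrow> \<zero>\<^bsub>L\<^esub> x = \<zero>"
  by (simp add: adjointable_algebra_def)
lemma L_add_apply: "x \<in> carrier A \<Longrightarrow> (S \<oplus>\<^bsub>L\<^esub> T) x = S x \<oplus> T x"
  by (simp add: adjointable_algebra_def)
lemma L_smult_apply: "x \<in> carrier A \<Longrightarrow> (c \<odot>\<^bsub>L\<^esub> T) x = c \<odot> T x"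
  by (simp add: adjointable_algebra_def)
lemmas L_apply = L_mul_apply L_one_apply L_zero_apply L_add_apply L_smult_apply

lemma L_ext: "S \<otimes>\<^bsub>L\<^esub> T \<in> extensional (carrier A)" "\<one>\<^bsub>L\<^esub> \<in> extensional (carrier A)"
  "\<zero>\<^bsub>L\<^esub> \<in> extensional (carrier A)" "S \<oplus>\<^bsub>L\<^esub> T \<in> extensional (carrier A)"
  "c \<odot>\<^bsub>L\<^esub> T \<in> extensional (carrier A)"
  by (simp_all add: adjointable_algebra_def compose_def)

lemma PiE_mem_iff: "f \<in> carrier A \<rightarrow>\<^sub>E carrier A \<longleftrightarrow> f \<in> extensional (carrier A) \<and> (\<forall>x\<in>carrier A. f x \<in> carrier A)"
  by (auto simp: PiE_def)

lemma adj_mul: assumes "S \<in> carrier L" "T \<in> carrier L"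
  shows "adj (S \<otimes>\<^bsub>L\<^esub> T) (star L T \<otimes>\<^bsub>L\<^esub> star L S)"
  by (rule adjI) (use assms L_star_closed in \<open>simp_all add: PiE_mem_iff L_ext L_apply L_adjoint\<close>)

lemma adj_one: "adj \<one>\<^bsub>L\<^esub> \<one>\<^bsub>L\<^esub>"
  by (rule adjI) (simp_all add: PiE_mem_iff L_ext L_apply)

lemma adj_zero: "adj \<zero>\<^bsub>L\<^esub> \<zero>\<^bsub>L\<^esub>"
proof (rule adjI)
  show "E (star A (\<zero>\<^bsub>L\<^esub> x) \<otimes> y) = E (star A x \<otimes> \<zero>\<^bsub>L\<^esub> y)" if "x \<in> carrier A" "y \<in> carrier A" for x y
    using that ring.ring_simprules(24,25)[OF A_ring] by (simp add: L_apply)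
qed (simp_all add: PiE_mem_iff L_ext L_apply)

lemma adj_plus: assumes "S \<in> carrier L" "T \<in> carrier L"
  shows "adj (S \<oplus>\<^bsub>L\<^esub> T) (star L S \<oplus>\<^bsub>L\<^esub> star L T)"
  by (rule adjI) (use assms L_star_closed in
    \<open>simp_all add: PiE_mem_iff L_ext L_apply star_add add_mul mul_add E_add L_adjoint\<close>)

lemma adj_scale: assumes "T \<in> carrier L"
  shows "adj (c \<odot>\<^bsub>L\<^esub> T) (cnj c \<odot>\<^bsub>L\<^esub> star L T)"
  by (rule adjI) (use assms L_star_closed in
    \<open>simp_all add: PiE_mem_iff L_ext L_apply star_smult smult_mult_left smult_mult_right E_smult L_adjoint\<close>)

lemmas L_closed [simp, intro] = adj_carrier(1)[OF adj_mul] adj_carrier(1)[OF adj_one] adj_carrier(1)[OF adj_zero]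
  adj_carrier(1)[OF adj_plus] adj_carrier(1)[OF adj_scale] L_star_closed
lemmas L_star = adj_carrier(2)[OF adj_mul] adj_carrier(2)[OF adj_one]
  adj_carrier(2)[OF adj_plus] adj_carrier(2)[OF adj_scale]

lemma L_abelian_group: "abelian_group L"
proof (rule abelian_groupI)
  fix x y z assume x: "x \<in> carrier L" and y: "y \<in> carrier L" and z: "z \<in> carrier L"
  show "x \<oplus>\<^bsub>L\<^esub> y \<in> carrier L" using x y by simp
  show "x \<oplus>\<^bsub>L\<^esub> y \<oplus>\<^bsub>L\<^esub> z = x \<oplus>\<^bsub>L\<^esub> (y \<oplus>\<^bsub>L\<^esub> z)"
    by (rule L_eqI) (use x y z in \<open>simp_all add: L_apply add_assoc\<close>)
  show "x \<oplus>\<^bsub>L\<^esub> y = y \<oplus>\<^bsub>L\<^esub> x"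
    by (rule L_eqI) (use x y in \<open>simp_all add: L_apply add_comm\<close>)
  show "\<zero>\<^bsub>L\<^esub> \<oplus>\<^bsub>L\<^esub> x = x"
    by (rule L_eqI) (use x in \<open>simp_all add: L_apply\<close>)
  have "(- 1) \<odot>\<^bsub>L\<^esub> x \<oplus>\<^bsub>L\<^esub> x = \<zero>\<^bsub>L\<^esub>"
    by (rule L_eqI) (use x in \<open>simp_all add: L_apply scalar_collect\<close>)
  then show "\<exists>y\<in>carrier L. y \<oplus>\<^bsub>L\<^esub> x = \<zero>\<^bsub>L\<^esub>" using x by blast
qed simp

lemma L_monoid: "monoid L"
proof (rule monoidI)
  fix x y z assume x: "x \<in> carrier L" and y: "y \<in> carrier L" and z: "z \<in> carrier L"
  show "x \<otimes>\<^bsub>L\<^esub> y \<in> carrier L" using x y by simp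
  show "x \<otimes>\<^bsub>L\<^esub> y \<otimes>\<^bsub>L\<^esub> z = x \<otimes>\<^bsub>L\<^esub> (y \<otimes>\<^bsub>L\<^esub> z)"
    by (rule L_eqI) (use x y z in \<open>simp_all add: L_apply\<close>)
  show "\<one>\<^bsub>L\<^esub> \<otimes>\<^bsub>L\<^esub> x = x" "x \<otimes>\<^bsub>L\<^esub> \<one>\<^bsub>L\<^esub> = x"
    by (rule L_eqI; use x in \<open>simp_all add: L_apply\<close>)+
qed simp

lemma L_ring: "ring L"
proof (rule ringI[OF L_abelian_group L_monoid])
  fix x y z assume x: "x \<in> carrier L" and y: "y \<in> carrier L" and z: "z \<in> carrier L"
  show "(x \<oplus>\<^bsub>L\<^esub> y) \<otimes>\<^bsub>L\<^esub> z = x \<otimes>\<^bsub>L\<^esub> z \<oplus>\<^bsub>L\<^esub> y \<otimes>\<^bsub>L\<^esub> z"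
    by (rule L_eqI) (use x y z in \<open>simp_all add: L_apply\<close>)
  show "z \<otimes>\<^bsub>L\<^esub> (x \<oplus>\<^bsub>L\<^esub> y) = z \<otimes>\<^bsub>L\<^esub> x \<oplus>\<^bsub>L\<^esub> z \<otimes>\<^bsub>L\<^esub> y"
    by (rule L_eqI) (use x y z in \<open>simp_all add: L_apply L_lin_add\<close>)
qed

lemma L_module: "module (ring_of_type_algebra :: complex ring) L"
proof (rule moduleI[OF cring_from_type_algebra L_abelian_group])
  fix a b :: complex and x y assume x: "x \<in> carrier L" and y: "y \<in> carrier L"
  show "a \<odot>\<^bsub>L\<^esub> x \<in> carrier L" using x by simp
  show "(a \<oplus>\<^bsub>ring_of_type_algebra\<^esub> b) \<odot>\<^bsub>L\<^esub> x = a \<odot>\<^bsub>L\<^esub> x \<oplus>\<^bsub>L\<^esub> b \<odot>\<^bsub>L\<^esub> x"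
    by (rule L_eqI) (use x in \<open>simp_all add: L_apply ring_of_type_algebra_def scalar_add\<close>)
  show "a \<odot>\<^bsub>L\<^esub> (x \<oplus>\<^bsub>L\<^esub> y) = a \<odot>\<^bsub>L\<^esub> x \<oplus>\<^bsub>L\<^esub> a \<odot>\<^bsub>L\<^esub> y"
    by (rule L_eqI) (use x y in \<open>simp_all add: L_apply scalar_distr\<close>)
  show "(a \<otimes>\<^bsub>ring_of_type_algebra\<^esub> b) \<odot>\<^bsub>L\<^esub> x = a \<odot>\<^bsub>L\<^esub> (b \<odot>\<^bsub>L\<^esub> x)"
    by (rule L_eqI) (use x in \<open>simp_all add: L_apply ring_of_type_algebra_def\<close>)
  show "\<one>\<^bsub>ring_of_type_algebra\<^esub> \<odot>\<^bsub>L\<^esub> x = x"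
    by (rule L_eqI) (use x in \<open>simp_all add: L_apply ring_of_type_algebra_def\<close>)
qed

lemma L_neg: "T \<in> carrier L \<Longrightarrow> \<ominus>\<^bsub>L\<^esub> T = (- 1) \<odot>\<^bsub>L\<^esub> T"
proof -
  assume T: "T \<in> carrier L"
  have "(- 1) \<odot>\<^bsub>L\<^esub> T \<oplus>\<^bsub>L\<^esub> T = \<zero>\<^bsub>L\<^esub>"
    by (rule L_eqI) (use T in \<open>simp_all add: L_apply scalar_collect\<close>)
  then show ?thesis using abelian_group.minus_equality[OF L_abelian_group] T by blast
qed

lemma L_minus_apply: "\<lbrakk>S \<in> carrier L; T \<in> carrier L; x \<in> carrier A\<rbrakk> \<Longrightarrow> (S \<ominus>\<^bsub>L\<^esub> T) x = S x \<ominus> T x"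
  by (simp add: a_minus_def L_neg L_apply neg_scalar)

lemma L_minus_closed: "\<lbrakk>S \<in> carrier L; T \<in> carrier L\<rbrakk> \<Longrightarrow> S \<ominus>\<^bsub>L\<^esub> T \<in> carrier L"
  by (rule abelian_group.minus_closed[OF L_abelian_group])

section \<open>The operator norm\<close>

lemma L_basis_expansion: "\<lbrakk>T \<in> carrier L; x \<in> carrier A\<rbrakk> \<Longrightarrow> T x = (\<Oplus>l\<in>\<Lambda>. T l \<otimes> E (star A l \<otimes> x))"
proof -
  assume T: "T \<in> carrier L" and x: "x \<in> carrier A"
  have "T x = T (\<Oplus>l\<in>\<Lambda>. l \<otimes> E (star A l \<otimes> x))" using basis_expansion[OF x] by simp
  also have "\<dots> = (\<Oplus>l\<in>\<Lambda>. T (l \<otimes> E (star A l \<otimes> x)))" using T x by (intro L_fsum_additive) auto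
  also have "\<dots> = (\<Oplus>l\<in>\<Lambda>. T l \<otimes> E (star A l \<otimes> x))" using T x by (intro fsum_eq) (auto simp: L_right_mult)
  finally show ?thesis .
qed

lemma basis_map_bound:
  assumes y: "\<And>l. l \<in> \<Lambda> \<Longrightarrow> y l \<in> carrier A" and x: "x \<in> carrier A"
  shows "mn (\<Oplus>l\<in>\<Lambda>. y l \<otimes> E (star A l \<otimes> x)) \<le> (\<Sum>l\<in>\<Lambda>. mn (y l) * mn l) * mn x"
proof -
  have "mn (\<Oplus>l\<in>\<Lambda>. y l \<otimes> E (star A l \<otimes> x)) \<le> (\<Sum>l\<in>\<Lambda>. mn (y l \<otimes> E (star A l \<otimes> x)))"
    using y x by (intro mn_fsum_le) auto
  also have "\<dots> \<le> (\<Sum>l\<in>\<Lambda>. (mn (y l) * mn l) * mn x)"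
  proof (rule sum_mono)
    fix l assume l: "l \<in> \<Lambda>"
    have "mn (y l \<otimes> E (star A l \<otimes> x)) \<le> mn (y l) * nrm A (E (star A l \<otimes> x))"
      using y l x by (intro mn_right_mult) auto
    also have "\<dots> \<le> mn (y l) * (mn l * mn x)"
      using y l x Cauchy_Schwarz[of l x] by (intro mult_left_mono) auto
    finally show "mn (y l \<otimes> E (star A l \<otimes> x)) \<le> (mn (y l) * mn l) * mn x" by (simp add: mult_ac)
  qed
  finally show ?thesis by (simp add: sum_distrib_right)
qed

lemma L_nrm_def: "nrm L T = Sup {mn (T x) |x. x \<in> carrier A \<and> mn x \<le> 1}"
  by (simp add: adjointable_algebra_def)

lemma L_nrm_le:
  assumes "\<And>x. x \<in> carrier A \<Longrightarrow> mn (T x) \<le> C * mn x" "0 \<le> C"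
  shows "nrm L T \<le> C"
  unfolding L_nrm_def
proof (rule cSup_least)
  have "mn \<zero> \<le> 1" by simp
  then show "{mn (T x) |x. x \<in> carrier A \<and> mn x \<le> 1} \<noteq> {}"
    using abelian_monoid.zero_closed[OF A_add_monoid] by blast
  fix v assume "v \<in> {mn (T x) |x. x \<in> carrier A \<and> mn x \<le> 1}"
  then obtain x where x: "v = mn (T x)" "x \<in> carrier A" "mn x \<le> 1" by blast
  have "C * mn x \<le> C * 1" using x assms(2) by (intro mult_left_mono) auto
  then show "v \<le> C" using assms(1)[OF x(2)] x(1) by simp
qed

lemma L_bdd: assumes T: "T \<in> carrier L" shows "bdd_above {mn (T x) |x. x \<in> carrier A \<and> mn x \<le> 1}"
proof (rule bdd_aboveI)
  define C where "C = (\<Sum>l\<in>\<Lambda>. mn (T l) * mn l)"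
  have C: "C \<ge> 0" unfolding C_def using T by (intro sum_nonneg mult_nonneg_nonneg) auto
  fix v assume "v \<in> {mn (T x) |x. x \<in> carrier A \<and> mn x \<le> 1}"
  then obtain x where x: "v = mn (T x)" "x \<in> carrier A" "mn x \<le> 1" by blast
  have "v \<le> C * mn x" using basis_map_bound[of T x] L_basis_expansion[OF T x(2)] T x(1,2) by (simp add: C_def)
  also have "\<dots> \<le> C * 1" using x C by (intro mult_left_mono) auto
  finally show "v \<le> C" by simp
qed

lemma L_nrm_nonneg: "T \<in> carrier L \<Longrightarrow> 0 \<le> nrm L T"
proof -
  assume T: "T \<in> carrier L"
  have "mn (T \<zero>) \<in> {mn (T x) |x. x \<in> carrier A \<and> mn x \<le> 1}"
    using abelian_monoid.zero_closed[OF A_add_monoid] mn_zero by fastforce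
  then have "mn (T \<zero>) \<le> nrm L T" unfolding L_nrm_def using L_bdd[OF T] by (intro cSup_upper)
  moreover have "0 \<le> mn (T \<zero>)" using T abelian_monoid.zero_closed[OF A_add_monoid] by simp
  ultimately show ?thesis by simp
qed

lemma L_nrm_bound:
  assumes T: "T \<in> carrier L" and x: "x \<in> carrier A"
  shows "mn (T x) \<le> nrm L T * mn x"
proof (cases "mn x = 0")
  case True
  then have "x = \<zero>" using mn_eq_0 x by blast
  then have "T x = \<zero>" using L_lin_smult[OF T x, of 0] T x by simp
  then show ?thesis using True by simp
next
  case False
  then have p: "mn x > 0" using mn_nonneg[OF x] by simp
  define y where "y = complex_of_real (1 / mn x) \<odot> x"
  have y: "y \<in> carrier A" "mn y = 1" using x p by (auto simp: y_def mn_smult norm_divide)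
  have "mn (T y) \<in> {mn (T x) |x. x \<in> carrier A \<and> mn x \<le> 1}"
    using y by force
  then have "mn (T y) \<le> nrm L T" unfolding L_nrm_def using L_bdd[OF T] by (intro cSup_upper)
  then have "(1 / mn x) * mn (T x) \<le> nrm L T"
    unfolding y_def using p T x by (simp add: L_lin_smult mn_smult norm_divide)
  then show ?thesis using p by (simp add: field_simps)
qed

lemma L_nrm_mult: "\<lbrakk>S \<in> carrier L; T \<in> carrier L\<rbrakk> \<Longrightarrow> nrm L (S \<otimes>\<^bsub>L\<^esub> T) \<le> nrm L S * nrm L T"
proof (rule L_nrm_le)
  assume S: "S \<in> carrier L" and T: "T \<in> carrier L"
  show "mn ((S \<otimes>\<^bsub>L\<^esub> T) x) \<le> nrm L S * nrm L T * mn x" if x: "x \<in> carrier A" for x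
  proof -
    have "mn (S (T x)) \<le> nrm L S * mn (T x)" using S T x by (intro L_nrm_bound) auto
    also have "\<dots> \<le> nrm L S * (nrm L T * mn x)"
      using S T x L_nrm_bound L_nrm_nonneg by (intro mult_left_mono) auto
    finally show ?thesis using x by (simp add: L_apply mult_ac)
  qed
qed (simp add: L_nrm_nonneg)

lemma L_nrm_star_mult:
  assumes T: "T \<in> carrier L"
  shows "nrm L (star L T \<otimes>\<^bsub>L\<^esub> T) = (nrm L T)\<^sup>2"
proof -
  have le: "(nrm L T)\<^sup>2 \<le> nrm L (star L T \<otimes>\<^bsub>L\<^esub> T)" if T: "T \<in> carrier L" for T
  proof -
    define n where "n = nrm L (star L T \<otimes>\<^bsub>L\<^esub> T)"
    have n: "0 \<le> n" using T by (simp add: n_def L_nrm_nonneg)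
    have "nrm L T \<le> sqrt n"
    proof (rule L_nrm_le)
      fix x assume x: "x \<in> carrier A"
      have "(mn (T x))\<^sup>2 = nrm A (E (star A x \<otimes> (star L T \<otimes>\<^bsub>L\<^esub> T) x))"
        using T x by (simp add: mn_sq L_adjoint L_apply)
      also have "\<dots> \<le> mn x * mn ((star L T \<otimes>\<^bsub>L\<^esub> T) x)" using T x by (intro Cauchy_Schwarz) auto
      also have "\<dots> \<le> mn x * (n * mn x)"
        unfolding n_def using T x by (intro mult_left_mono L_nrm_bound) auto
      also have "\<dots> = (sqrt n * mn x)\<^sup>2" using n by (simp add: power_mult_distrib) (simp add: power2_eq_square)
      finally show "mn (T x) \<le> sqrt n * mn x"
        by (rule power2_le_imp_le) (use n x in simp)
    qed (use n in simp)
    then have "(nrm L T)\<^sup>2 \<le> (sqrt n)\<^sup>2" using L_nrm_nonneg[OF T] by (intro power_mono) auto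
    then show ?thesis using n by (simp add: n_def)
  qed
  have st: "nrm L T \<le> nrm L (star L T)" if T: "T \<in> carrier L" for T
  proof (cases "nrm L T = 0")
    case False
    have "nrm L T * nrm L T \<le> nrm L (star L T) * nrm L T"
      using le[OF T] L_nrm_mult[OF L_star_closed[OF T] T] by (simp add: power2_eq_square)
    then show ?thesis using False L_nrm_nonneg[OF T] by simp
  qed (use that L_nrm_nonneg in simp)
  have "nrm L (star L T) = nrm L T"
    using st[OF T] st[OF L_star_closed[OF T]] L_star_star[OF T] by simp
  then show ?thesis
    using le[OF T] L_nrm_mult[OF L_star_closed[OF T] T] by (simp add: power2_eq_square)
qed

lemma L_nrm_triangle: "\<lbrakk>S \<in> carrier L; T \<in> carrier L\<rbrakk> \<Longrightarrow> nrm L (S \<oplus>\<^bsub>L\<^esub> T) \<le> nrm L S + nrm L T"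
proof (rule L_nrm_le)
  assume S: "S \<in> carrier L" and T: "T \<in> carrier L"
  show "mn ((S \<oplus>\<^bsub>L\<^esub> T) x) \<le> (nrm L S + nrm L T) * mn x" if x: "x \<in> carrier A" for x
    using mn_triangle[of "S x" "T x"] L_nrm_bound[OF S x] L_nrm_bound[OF T x] S T x
    by (simp add: L_apply distrib_right)
qed (simp add: L_nrm_nonneg)

lemma L_nrm_eq_0: assumes T: "T \<in> carrier L" shows "nrm L T = 0 \<longleftrightarrow> T = \<zero>\<^bsub>L\<^esub>"
proof
  assume 0: "nrm L T = 0"
  show "T = \<zero>\<^bsub>L\<^esub>"
  proof (rule L_eqI[OF T])
    fix x assume x: "x \<in> carrier A"
    have "mn (T x) \<le> 0" using L_nrm_bound[OF T x] 0 by simp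
    then have "mn (T x) = 0" using mn_nonneg[OF L_mem[OF T x]] by linarith
    then show "T x = \<zero>\<^bsub>L\<^esub> x" using mn_eq_0 T x by (simp add: L_apply)
  qed simp
next
  assume "T = \<zero>\<^bsub>L\<^esub>"
  then have "nrm L T \<le> 0" by (intro L_nrm_le) (simp_all add: L_apply)
  then show "nrm L T = 0" using L_nrm_nonneg[OF T] by simp
qed

lemma L_nrm_smult: assumes T: "T \<in> carrier L" shows "nrm L (c \<odot>\<^bsub>L\<^esub> T) = cmod c * nrm L T"
proof -
  have le: "nrm L (c \<odot>\<^bsub>L\<^esub> T) \<le> cmod c * nrm L T" if T: "T \<in> carrier L" for c T
  proof (rule L_nrm_le)
    show "mn ((c \<odot>\<^bsub>L\<^esub> T) x) \<le> cmod c * nrm L T * mn x" if x: "x \<in> carrier A" for x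
      using T x mult_left_mono[OF L_nrm_bound[OF T x], of "cmod c"] by (simp add: L_apply mn_smult mult_ac)
  qed (simp add: L_nrm_nonneg T)
  show ?thesis
  proof (cases "c = 0")
    case True
    then show ?thesis using le[OF T, of c] L_nrm_nonneg[of "c \<odot>\<^bsub>L\<^esub> T"] T by simp
  next
    case False
    have "(1 / c) \<odot>\<^bsub>L\<^esub> (c \<odot>\<^bsub>L\<^esub> T) = T"
      by (rule L_eqI) (use T False in \<open>simp_all add: L_apply\<close>)
    then have "nrm L T \<le> cmod (1 / c) * nrm L (c \<odot>\<^bsub>L\<^esub> T)" using le[of "c \<odot>\<^bsub>L\<^esub> T" "1 / c"] T by simp
    then have "cmod c * nrm L T \<le> nrm L (c \<odot>\<^bsub>L\<^esub> T)" using False by (simp add: norm_divide field_simps)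
    then show ?thesis using le[OF T] by (simp add: antisym)
  qed
qed

lemma L_Metric_space: "Metric_space (carrier L) (cdist L)"
proof
  have comm: "nrm L (S \<ominus>\<^bsub>L\<^esub> T) = nrm L (T \<ominus>\<^bsub>L\<^esub> S)" if "S \<in> carrier L" "T \<in> carrier L" for S T
  proof -
    have "S \<ominus>\<^bsub>L\<^esub> T = (- 1) \<odot>\<^bsub>L\<^esub> (T \<ominus>\<^bsub>L\<^esub> S)"
      by (rule L_eqI) (use that in \<open>simp_all add: L_apply L_minus_apply L_minus_closed alg_simps add_comm\<close>)
    then show ?thesis using L_nrm_smult[of "T \<ominus>\<^bsub>L\<^esub> S" "- 1"] that L_minus_closed by simp
  qed
  show "0 \<le> cdist L x y" for x y by (simp add: cdist_def L_nrm_nonneg L_minus_closed)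
  show "cdist L x y = cdist L y x" for x y by (simp add: cdist_def comm)
  show "cdist L x y = 0 \<longleftrightarrow> x = y" if "x \<in> carrier L" "y \<in> carrier L" for x y
    using that ring.r_right_minus_eq[OF L_ring] by (simp add: cdist_def L_nrm_eq_0 L_minus_closed)
  show "cdist L x z \<le> cdist L x y + cdist L y z"
    if "x \<in> carrier L" "y \<in> carrier L" "z \<in> carrier L" for x y z
  proof -
    have "x \<ominus>\<^bsub>L\<^esub> z = (x \<ominus>\<^bsub>L\<^esub> y) \<oplus>\<^bsub>L\<^esub> (y \<ominus>\<^bsub>L\<^esub> z)"
    proof (rule L_eqI)
      fix u assume u: "u \<in> carrier A"
      show "(x \<ominus>\<^bsub>L\<^esub> z) u = ((x \<ominus>\<^bsub>L\<^esub> y) \<oplus>\<^bsub>L\<^esub> (y \<ominus>\<^bsub>L\<^esub> z)) u"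
        using that u diff_split[of "x u" "y u" "z u"] by (simp add: L_apply L_minus_apply)
    qed (use that L_minus_closed in auto)
    then show ?thesis using that L_nrm_triangle[of "x \<ominus>\<^bsub>L\<^esub> y" "y \<ominus>\<^bsub>L\<^esub> z"] L_minus_closed
      by (simp add: cdist_def)
  qed
qed

text \<open>The right \<open>B\<close>-linear map that the quasi-basis expansion forces on prescribed values \<open>y l\<close>.\<close>

definition basis_map :: "('a \<Rightarrow> 'a) \<Rightarrow> 'a \<Rightarrow> 'a" where
  "basis_map y = (\<lambda>x\<in>carrier A. \<Oplus>l\<in>\<Lambda>. y l \<otimes> E (star A l \<otimes> x))"

lemma basis_map_mem:
  assumes y: "\<And>l. l \<in> \<Lambda> \<Longrightarrow> y l \<in> carrier A"
  shows "basis_map y \<in> carrier L"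
proof (rule adj_carrier(1), rule adjI)
  let ?S = "\<lambda>z\<in>carrier A. \<Oplus>l\<in>\<Lambda>. l \<otimes> E (star A (y l) \<otimes> z)"
  show "basis_map y \<in> carrier A \<rightarrow>\<^sub>E carrier A" "?S \<in> carrier A \<rightarrow>\<^sub>E carrier A"
    using y by (auto simp: basis_map_def)
  fix x z assume x: "x \<in> carrier A" and z: "z \<in> carrier A"
  have "E (star A (basis_map y x) \<otimes> z) = (\<Oplus>l\<in>\<Lambda>. E (star A x \<otimes> l) \<otimes> E (star A (y l) \<otimes> z))"
  proof -
    have "star A (basis_map y x) \<otimes> z = (\<Oplus>l\<in>\<Lambda>. star A (y l \<otimes> E (star A l \<otimes> x))) \<otimes> z"
      unfolding basis_map_def using x y by (simp add: fsum_star)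
    also have "\<dots> = (\<Oplus>l\<in>\<Lambda>. star A (y l \<otimes> E (star A l \<otimes> x)) \<otimes> z)"
      using x y z by (intro fsum_mul) auto
    also have "\<dots> = (\<Oplus>l\<in>\<Lambda>. E (star A x \<otimes> l) \<otimes> (star A (y l) \<otimes> z))"
      using x y z by (intro fsum_eq) (auto simp: star_mult E_star[symmetric] mul_assoc)
    finally have "star A (basis_map y x) \<otimes> z = (\<Oplus>l\<in>\<Lambda>. E (star A x \<otimes> l) \<otimes> (star A (y l) \<otimes> z))" .
    then have "E (star A (basis_map y x) \<otimes> z) = (\<Oplus>l\<in>\<Lambda>. E (E (star A x \<otimes> l) \<otimes> (star A (y l) \<otimes> z)))"
      using x y z by (simp add: E_fsum)
    also have "\<dots> = (\<Oplus>l\<in>\<Lambda>. E (star A x \<otimes> l) \<otimes> E (star A (y l) \<otimes> z))"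
      using x y z by (intro fsum_eq) (auto simp: E_left)
    finally show ?thesis .
  qed
  also have "\<dots> = E (star A x \<otimes> ?S z)"
  proof -
    have "star A x \<otimes> ?S z = (\<Oplus>l\<in>\<Lambda>. star A x \<otimes> (l \<otimes> E (star A (y l) \<otimes> z)))"
      using x y z by (simp add: fsum_mul)
    also have "\<dots> = (\<Oplus>l\<in>\<Lambda>. (star A x \<otimes> l) \<otimes> E (star A (y l) \<otimes> z))"
      using x y z by (intro fsum_eq) (auto simp: mul_assoc)
    finally have "E (star A x \<otimes> ?S z) = (\<Oplus>l\<in>\<Lambda>. E ((star A x \<otimes> l) \<otimes> E (star A (y l) \<otimes> z)))"
      using x y z by (simp add: E_fsum)
    also have "\<dots> = (\<Oplus>l\<in>\<Lambda>. E (star A x \<otimes> l) \<otimes> E (star A (y l) \<otimes> z))"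
      using x y z by (intro fsum_eq) (auto simp: E_right)
    finally show ?thesis by simp
  qed
  finally show "E (star A (basis_map y x) \<otimes> z) = E (star A x \<otimes> ?S z)" .
qed

text \<open>An adjointable map is determined by its finitely many values on the quasi-basis, and the
  module norm is equivalent to the norm of \<open>A\<close>; hence a Cauchy sequence of maps converges to the
  map built from the limits of its values.\<close>

lemma L_complete: "Metric_space.mcomplete (carrier L) (cdist L)"
proof -
  interpret MS: Metric_space "carrier L" "cdist L" by (rule L_Metric_space)
  show ?thesis
    unfolding MS.mcomplete_def
  proof (intro allI impI)
    fix \<sigma> assume C: "MS.MCauchy \<sigma>"
    have s: "\<sigma> n \<in> carrier L" for n using C by (auto simp: MS.MCauchy_def)
    have C': "\<exists>N. \<forall>n\<ge>N. \<forall>m\<ge>N. nrm L (\<sigma> n \<ominus>\<^bsub>L\<^esub> \<sigma> m) < \<epsilon>" if "\<epsilon> > 0" for \<epsilon>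
      using C that s unfolding MS.MCauchy_def by (simp add: cdist_def)
    define K where "K = (\<Sum>l\<in>\<Lambda>. nrm A l * mn l)"
    have K: "K \<ge> 0" unfolding K_def using nrm_nonneg by (intro sum_nonneg mult_nonneg_nonneg) auto
    have "\<exists>y. y \<in> carrier A \<and> (\<lambda>n. nrm A (\<sigma> n l \<ominus> y)) \<longlonglongrightarrow> 0" if l: "l \<in> \<Lambda>" for l
    proof -
      have "\<exists>N. \<forall>n\<ge>N. \<forall>m\<ge>N. nrm A (\<sigma> n l \<ominus> \<sigma> m l) < \<epsilon>" if e: "\<epsilon> > 0" for \<epsilon>
      proof -
        have p: "K * mn l + 1 > 0" using K l mn_nonneg[of l] by (simp add: add_nonneg_pos)
        then have "\<epsilon> / (K * mn l + 1) > 0" using e by simp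
        then obtain N where N: "\<forall>n\<ge>N. \<forall>m\<ge>N. nrm L (\<sigma> n \<ominus>\<^bsub>L\<^esub> \<sigma> m) < \<epsilon> / (K * mn l + 1)" using C' by blast
        have "nrm A (\<sigma> n l \<ominus> \<sigma> m l) < \<epsilon>" if nm: "n \<ge> N" "m \<ge> N" for n m
        proof -
          define r where "r = nrm L (\<sigma> n \<ominus>\<^bsub>L\<^esub> \<sigma> m)"
          have r: "0 \<le> r" "r < \<epsilon> / (K * mn l + 1)"
            using N nm s by (auto simp: r_def L_nrm_nonneg L_minus_closed)
          have "nrm A (\<sigma> n l \<ominus> \<sigma> m l) \<le> K * mn (\<sigma> n l \<ominus> \<sigma> m l)"
            using nrm_le_mn[of "\<sigma> n l \<ominus> \<sigma> m l"] s l by (simp add: K_def)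
          also have "\<dots> \<le> K * (r * mn l)"
            using L_nrm_bound[of "\<sigma> n \<ominus>\<^bsub>L\<^esub> \<sigma> m" l] s l K
            by (intro mult_left_mono) (auto simp: L_minus_apply L_minus_closed r_def)
          also have "\<dots> \<le> r * (K * mn l + 1)" using r by (simp add: algebra_simps)
          also have "\<dots> < \<epsilon>" using r p by (simp add: field_simps)
          finally show ?thesis .
        qed
        then show ?thesis by blast
      qed
      then show ?thesis
        using Cauchy_converges[of "\<lambda>n. \<sigma> n l" "\<exists>y. y \<in> carrier A \<and> (\<lambda>n. nrm A (\<sigma> n l \<ominus> y)) \<longlonglongrightarrow> 0"] s l
        by auto
    qed
    then obtain y where y: "\<And>l. l \<in> \<Lambda> \<Longrightarrow> y l \<in> carrier A"
        "\<And>l. l \<in> \<Lambda> \<Longrightarrow> (\<lambda>n. nrm A (\<sigma> n l \<ominus> y l)) \<longlonglongrightarrow> 0" by metis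
    have T: "basis_map y \<in> carrier L" using y by (intro basis_map_mem) auto
    have bound: "nrm L (\<sigma> n \<ominus>\<^bsub>L\<^esub> basis_map y) \<le> (\<Sum>l\<in>\<Lambda>. nrm A (\<sigma> n l \<ominus> y l) * mn l)" for n
    proof (rule L_nrm_le)
      have m: "mn (\<sigma> n l \<ominus> y l) \<le> nrm A (\<sigma> n l \<ominus> y l)" if "l \<in> \<Lambda>" for l
        using that s y by (intro mn_le_nrm) auto
      show "0 \<le> (\<Sum>l\<in>\<Lambda>. nrm A (\<sigma> n l \<ominus> y l) * mn l)"
        using s y nrm_nonneg by (intro sum_nonneg mult_nonneg_nonneg) auto
      fix x assume x: "x \<in> carrier A"
      have "(\<sigma> n \<ominus>\<^bsub>L\<^esub> basis_map y) x = (\<Oplus>l\<in>\<Lambda>. \<sigma> n l \<otimes> E (star A l \<otimes> x)) \<oplus> (-1) \<odot> (\<Oplus>l\<in>\<Lambda>. y l \<otimes> E (star A l \<otimes> x))"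
        using s T x y L_basis_expansion[OF s x] by (simp add: L_minus_apply minus_scalar basis_map_def)
      also have "\<dots> = (\<Oplus>l\<in>\<Lambda>. \<sigma> n l \<otimes> E (star A l \<otimes> x)) \<oplus> (\<Oplus>l\<in>\<Lambda>. (-1) \<odot> (y l \<otimes> E (star A l \<otimes> x)))"
        using x y by (simp add: fsum_smult)
      also have "\<dots> = (\<Oplus>l\<in>\<Lambda>. \<sigma> n l \<otimes> E (star A l \<otimes> x) \<oplus> (-1) \<odot> (y l \<otimes> E (star A l \<otimes> x)))"
        using x y s by (intro abelian_monoid.finsum_addf[OF A_add_monoid, symmetric]) auto
      also have "\<dots> = (\<Oplus>l\<in>\<Lambda>. (\<sigma> n l \<ominus> y l) \<otimes> E (star A l \<otimes> x))"
        using x y s by (intro fsum_eq) (auto simp: alg_simps)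
      finally have "mn ((\<sigma> n \<ominus>\<^bsub>L\<^esub> basis_map y) x) \<le> (\<Sum>l\<in>\<Lambda>. mn (\<sigma> n l \<ominus> y l) * mn l) * mn x"
        using basis_map_bound[of "\<lambda>l. \<sigma> n l \<ominus> y l" x] s y x by simp
      also have "\<dots> \<le> (\<Sum>l\<in>\<Lambda>. nrm A (\<sigma> n l \<ominus> y l) * mn l) * mn x"
        using x m by (intro mult_right_mono sum_mono) auto
      finally show "mn ((\<sigma> n \<ominus>\<^bsub>L\<^esub> basis_map y) x) \<le> (\<Sum>l\<in>\<Lambda>. nrm A (\<sigma> n l \<ominus> y l) * mn l) * mn x" .
    qed
    have "(\<lambda>n. \<Sum>l\<in>\<Lambda>. nrm A (\<sigma> n l \<ominus> y l) * mn l) \<longlonglongrightarrow> (\<Sum>l\<in>\<Lambda>. 0 * mn l)"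
      by (intro tendsto_sum tendsto_mult_right y)
    then have lim: "(\<lambda>n. \<Sum>l\<in>\<Lambda>. nrm A (\<sigma> n l \<ominus> y l) * mn l) \<longlonglongrightarrow> 0" by simp
    have "limitin MS.mtopology \<sigma> (basis_map y) sequentially"
      unfolding MS.limitin_metric
    proof (intro conjI allI impI T)
      fix \<epsilon> :: real assume "\<epsilon> > 0"
      then have "\<forall>\<^sub>F n in sequentially. (\<Sum>l\<in>\<Lambda>. nrm A (\<sigma> n l \<ominus> y l) * mn l) < \<epsilon>"
        using order_tendstoD(2)[OF lim] by blast
      then show "\<forall>\<^sub>F n in sequentially. \<sigma> n \<in> carrier L \<and> cdist L (\<sigma> n) (basis_map y) < \<epsilon>"
        by (rule eventually_mono) (use s T bound in \<open>auto simp: cdist_def intro: le_less_trans\<close>)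
    qed
    then show "\<exists>x. limitin MS.mtopology \<sigma> x sequentially" by blast
  qed
qed

theorem adjointable_algebra_cstar: "unital_cstar_algebra L"
proof (intro unital_cstar_algebra.intro L_ring L_module unital_cstar_algebra_axioms.intro L_complete)
  fix x y :: "'a \<Rightarrow> 'a" and c assume x: "x \<in> carrier L" 
  show "star L x \<in> carrier L" "star L (star L x) = x" using x L_star_star by auto
  show "star L (c \<odot>\<^bsub>L\<^esub> x) = cnj c \<odot>\<^bsub>L\<^esub> star L x" using x by (simp add: L_star)
  show "0 \<le> nrm L x" "(nrm L x = 0) = (x = \<zero>\<^bsub>L\<^esub>)" "nrm L (c \<odot>\<^bsub>L\<^esub> x) = cmod c * nrm L x"
      "nrm L (star L x \<otimes>\<^bsub>L\<^esub> x) = (nrm L x)\<^sup>2"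
    using x by (simp_all add: L_nrm_nonneg L_nrm_eq_0 L_nrm_smult L_nrm_star_mult)
  assume y: "y \<in> carrier L"
  show "(c \<odot>\<^bsub>L\<^esub> x) \<otimes>\<^bsub>L\<^esub> y = c \<odot>\<^bsub>L\<^esub> (x \<otimes>\<^bsub>L\<^esub> y)" "x \<otimes>\<^bsub>L\<^esub> (c \<odot>\<^bsub>L\<^esub> y) = c \<odot>\<^bsub>L\<^esub> (x \<otimes>\<^bsub>L\<^esub> y)"
    by (rule L_eqI; use x y in \<open>simp_all add: L_apply L_lin_smult\<close>)+
  show "star L (x \<oplus>\<^bsub>L\<^esub> y) = star L x \<oplus>\<^bsub>L\<^esub> star L y" "star L (x \<otimes>\<^bsub>L\<^esub> y) = star L y \<otimes>\<^bsub>L\<^esub> star L x"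
    using x y by (simp_all add: L_star)
  show "nrm L (x \<oplus>\<^bsub>L\<^esub> y) \<le> nrm L x + nrm L y" "nrm L (x \<otimes>\<^bsub>L\<^esub> y) \<le> nrm L x * nrm L y"
    using x y by (simp_all add: L_nrm_triangle L_nrm_mult)
qed

end

section \<open>The basic construction\<close>

context unital_cstar_algebra
begin

lemma fsum_swap:
  assumes "finite S" "finite T" "\<And>i j. \<lbrakk>i \<in> S; j \<in> T\<rbrakk> \<Longrightarrow> f i j \<in> carrier A"
  shows "(\<Oplus>i\<in>S. \<Oplus>j\<in>T. f i j) = (\<Oplus>j\<in>T. \<Oplus>i\<in>S. f i j)"
  using assms(1,3)
proof (induction S)
  case empty
  show ?case using abelian_monoid.finsum_zero[OF A_add_monoid] by (simp add: fsum_empty)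
next
  case (insert a S)
  have "(\<Oplus>i\<in>insert a S. \<Oplus>j\<in>T. f i j) = (\<Oplus>j\<in>T. f a j) \<oplus> (\<Oplus>i\<in>S. \<Oplus>j\<in>T. f i j)"
    using insert by (intro fsum_insert) auto
  also have "(\<Oplus>i\<in>S. \<Oplus>j\<in>T. f i j) = (\<Oplus>j\<in>T. \<Oplus>i\<in>S. f i j)" using insert by auto
  also have "(\<Oplus>j\<in>T. f a j) \<oplus> \<dots> = (\<Oplus>j\<in>T. f a j \<oplus> (\<Oplus>i\<in>S. f i j))"
    using insert by (intro abelian_monoid.finsum_addf[OF A_add_monoid, symmetric]) auto
  also have "\<dots> = (\<Oplus>j\<in>T. \<Oplus>i\<in>insert a S. f i j)"
    using insert by (intro fsum_eq fsum_insert[symmetric]) auto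
  finally show ?case .
qed

lemma subring_fsum:
  assumes "subring D A" "finite S" "\<And>i. i \<in> S \<Longrightarrow> f i \<in> D"
  shows "(\<Oplus>i\<in>S. f i) \<in> D"
  using assms(2,3)
proof (induction S)
  case (insert a S)
  have "(\<Oplus>i\<in>insert a S. f i) = f a \<oplus> (\<Oplus>i\<in>S. f i)"
    using insert subringE(1)[OF assms(1)] by (intro fsum_insert) auto
  then show ?case using insert subringE(7)[OF assms(1)] by simp
qed (simp add: fsum_empty subringE(2)[OF assms(1)])

lemma carrier_cstar_subalgebra: "cstar_subalgebra (carrier A) A"
proof -
  interpret MS: Metric_space "carrier A" "cdist A" by (rule Metric_space_cdist)
  show ?thesis
    unfolding cstar_subalgebra_def norm_closed_def
    using ring.carrier_is_subring[OF A_ring] closedin_topspace[of MS.mtopology] by auto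
qed

end

context finite_index
begin

text \<open>Expand each \<open>l\<close> in the other quasi-basis, exchange the sums and contract.\<close>

lemma Ind_unique:
  assumes M: "quasi_basis A E M"
  shows "(\<Oplus>m\<in>M. m \<otimes> star A m) = (\<Oplus>l\<in>\<Lambda>. l \<otimes> star A l)"
proof -
  have M': "finite M" "\<And>m. m \<in> M \<Longrightarrow> m \<in> carrier A"
      "\<And>x. x \<in> carrier A \<Longrightarrow> x = (\<Oplus>m\<in>M. m \<otimes> E (star A m \<otimes> x))"
    using M by (auto simp: quasi_basis_def)
  have "(\<Oplus>l\<in>\<Lambda>. l \<otimes> star A l) = (\<Oplus>l\<in>\<Lambda>. (\<Oplus>m\<in>M. m \<otimes> E (star A m \<otimes> l)) \<otimes> star A l)"
    using M'(3) by (intro fsum_eq) (auto simp flip: M'(3))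
  also have "\<dots> = (\<Oplus>l\<in>\<Lambda>. \<Oplus>m\<in>M. (m \<otimes> E (star A m \<otimes> l)) \<otimes> star A l)"
    using M' by (intro fsum_eq fsum_mul) auto
  also have "\<dots> = (\<Oplus>m\<in>M. \<Oplus>l\<in>\<Lambda>. (m \<otimes> E (star A m \<otimes> l)) \<otimes> star A l)"
    using M' by (intro fsum_swap) auto
  also have "\<dots> = (\<Oplus>m\<in>M. \<Oplus>l\<in>\<Lambda>. m \<otimes> (E (star A m \<otimes> l) \<otimes> star A l))"
    using M' by (intro fsum_eq) (auto simp: mul_assoc)
  also have "\<dots> = (\<Oplus>m\<in>M. m \<otimes> (\<Oplus>l\<in>\<Lambda>. E (star A m \<otimes> l) \<otimes> star A l))"
    using M' by (intro fsum_eq fsum_mul[symmetric]) auto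
  also have "\<dots> = (\<Oplus>m\<in>M. m \<otimes> star A m)"
    using M' basis_expansion_right by (intro fsum_eq) (auto simp flip: basis_expansion_right)
  finally show ?thesis by simp
qed

lemma Ind_eq: "Ind A E = (\<Oplus>l\<in>\<Lambda>. l \<otimes> star A l)"
  unfolding Ind_def
proof (rule the_equality)
  show "\<exists>M. quasi_basis A E M \<and> (\<Oplus>l\<in>\<Lambda>. l \<otimes> star A l) = (\<Oplus>m\<in>M. m \<otimes> star A m)"
    using quasi_basis by blast
qed (use Ind_unique in blast)

text \<open>Writing \<open>a l = \<Sum>\<^sub>j j E(j\<^sup>*a l)\<close> moves \<open>a\<close> through the sum.\<close>

lemma basis_conjugation_commutes:
  assumes "unital_cstar_algebra C"
    and f: "f \<in> carrier A \<rightarrow> carrier C"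
    and f_add: "\<And>x y. \<lbrakk>x \<in> carrier A; y \<in> carrier A\<rbrakk> \<Longrightarrow> f (x \<oplus> y) = f x \<oplus>\<^bsub>C\<^esub> f y"
    and f_mul: "\<And>x y. \<lbrakk>x \<in> carrier A; y \<in> carrier A\<rbrakk> \<Longrightarrow> f (x \<otimes> y) = f x \<otimes>\<^bsub>C\<^esub> f y"
    and z: "z \<in> carrier C" and zB: "\<And>b. b \<in> B \<Longrightarrow> z \<otimes>\<^bsub>C\<^esub> f b = f b \<otimes>\<^bsub>C\<^esub> z"
    and a: "a \<in> carrier A"
  shows "f a \<otimes>\<^bsub>C\<^esub> (\<Oplus>\<^bsub>C\<^esub>l\<in>\<Lambda>. f l \<otimes>\<^bsub>C\<^esub> (z \<otimes>\<^bsub>C\<^esub> f (star A l)))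
    = (\<Oplus>\<^bsub>C\<^esub>l\<in>\<Lambda>. f l \<otimes>\<^bsub>C\<^esub> (z \<otimes>\<^bsub>C\<^esub> f (star A l))) \<otimes>\<^bsub>C\<^esub> f a"
proof -
  interpret C: unital_cstar_algebra C by fact
  have fc [simp]: "f x \<in> carrier C" if "x \<in> carrier A" for x using f that by auto
  have f_sum: "f (\<Oplus>i\<in>S. g i) = (\<Oplus>\<^bsub>C\<^esub>i\<in>S. f (g i))" if "finite S" "\<And>i. i \<in> S \<Longrightarrow> g i \<in> carrier A" for S and g :: "'a \<Rightarrow> 'a"
    using that by (intro additive_map_finsum[OF A_group C.A_group f f_add]) auto
  have comm: "f (E y) \<otimes>\<^bsub>C\<^esub> (z \<otimes>\<^bsub>C\<^esub> w) = z \<otimes>\<^bsub>C\<^esub> (f (E y) \<otimes>\<^bsub>C\<^esub> w)" if "y \<in> carrier A" "w \<in> carrier C" for y w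
  proof -
    have "f (E y) \<otimes>\<^bsub>C\<^esub> (z \<otimes>\<^bsub>C\<^esub> w) = (f (E y) \<otimes>\<^bsub>C\<^esub> z) \<otimes>\<^bsub>C\<^esub> w"
      using that z by (simp add: C.mul_assoc)
    also have "\<dots> = (z \<otimes>\<^bsub>C\<^esub> f (E y)) \<otimes>\<^bsub>C\<^esub> w" using zB[of "E y"] that by simp
    finally show ?thesis using that z by (simp add: C.mul_assoc)
  qed
  have "f a \<otimes>\<^bsub>C\<^esub> (\<Oplus>\<^bsub>C\<^esub>l\<in>\<Lambda>. f l \<otimes>\<^bsub>C\<^esub> (z \<otimes>\<^bsub>C\<^esub> f (star A l)))
      = (\<Oplus>\<^bsub>C\<^esub>l\<in>\<Lambda>. f a \<otimes>\<^bsub>C\<^esub> (f l \<otimes>\<^bsub>C\<^esub> (z \<otimes>\<^bsub>C\<^esub> f (star A l))))"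
    using a z by (intro C.fsum_mul) auto
  also have "\<dots> = (\<Oplus>\<^bsub>C\<^esub>l\<in>\<Lambda>. f (a \<otimes> l) \<otimes>\<^bsub>C\<^esub> (z \<otimes>\<^bsub>C\<^esub> f (star A l)))"
    using a z by (intro C.fsum_eq) (auto simp: f_mul C.mul_assoc)
  also have "\<dots> = (\<Oplus>\<^bsub>C\<^esub>l\<in>\<Lambda>. \<Oplus>\<^bsub>C\<^esub>j\<in>\<Lambda>. f j \<otimes>\<^bsub>C\<^esub> (z \<otimes>\<^bsub>C\<^esub> f (E (star A j \<otimes> a \<otimes> l) \<otimes> star A l)))"
  proof (rule C.fsum_eq)
    fix l assume l: "l \<in> \<Lambda>"
    have "f (a \<otimes> l) = f (\<Oplus>j\<in>\<Lambda>. j \<otimes> E (star A j \<otimes> (a \<otimes> l)))" using basis_expansion[of "a \<otimes> l"] a l by simp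
    also have "\<dots> = (\<Oplus>\<^bsub>C\<^esub>j\<in>\<Lambda>. f (j \<otimes> E (star A j \<otimes> (a \<otimes> l))))" using a l by (intro f_sum) auto
    also have "\<dots> = (\<Oplus>\<^bsub>C\<^esub>j\<in>\<Lambda>. f j \<otimes>\<^bsub>C\<^esub> f (E (star A j \<otimes> a \<otimes> l)))"
      using a l by (intro C.fsum_eq) (auto simp: f_mul mul_assoc)
    finally have "f (a \<otimes> l) \<otimes>\<^bsub>C\<^esub> (z \<otimes>\<^bsub>C\<^esub> f (star A l)) =
      (\<Oplus>\<^bsub>C\<^esub>j\<in>\<Lambda>. (f j \<otimes>\<^bsub>C\<^esub> f (E (star A j \<otimes> a \<otimes> l))) \<otimes>\<^bsub>C\<^esub> (z \<otimes>\<^bsub>C\<^esub> f (star A l)))"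
      using C.fsum_mul(2)[of \<Lambda> "\<lambda>j. f j \<otimes>\<^bsub>C\<^esub> f (E (star A j \<otimes> a \<otimes> l))" "z \<otimes>\<^bsub>C\<^esub> f (star A l)"] a l z by simp
    also have "\<dots> = (\<Oplus>\<^bsub>C\<^esub>j\<in>\<Lambda>. f j \<otimes>\<^bsub>C\<^esub> (z \<otimes>\<^bsub>C\<^esub> f (E (star A j \<otimes> a \<otimes> l) \<otimes> star A l)))"
      using a l z by (intro C.fsum_eq) (auto simp: f_mul C.mul_assoc comm)
    finally show "f (a \<otimes> l) \<otimes>\<^bsub>C\<^esub> (z \<otimes>\<^bsub>C\<^esub> f (star A l)) =
      (\<Oplus>\<^bsub>C\<^esub>j\<in>\<Lambda>. f j \<otimes>\<^bsub>C\<^esub> (z \<otimes>\<^bsub>C\<^esub> f (E (star A j \<otimes> a \<otimes> l) \<otimes> star A l)))" .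
  qed (use a z in auto)
  also have "\<dots> = (\<Oplus>\<^bsub>C\<^esub>j\<in>\<Lambda>. \<Oplus>\<^bsub>C\<^esub>l\<in>\<Lambda>. f j \<otimes>\<^bsub>C\<^esub> (z \<otimes>\<^bsub>C\<^esub> f (E (star A j \<otimes> a \<otimes> l) \<otimes> star A l)))"
    using a z by (intro C.fsum_swap) auto
  also have "\<dots> = (\<Oplus>\<^bsub>C\<^esub>j\<in>\<Lambda>. f j \<otimes>\<^bsub>C\<^esub> (z \<otimes>\<^bsub>C\<^esub> f (star A j \<otimes> a)))"
  proof (rule C.fsum_eq)
    fix j assume j: "j \<in> \<Lambda>"
    have "f (star A j \<otimes> a) = f (\<Oplus>l\<in>\<Lambda>. E (star A j \<otimes> a \<otimes> l) \<otimes> star A l)"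
      using basis_expansion_right[of "star A j \<otimes> a"] a j by simp
    also have "\<dots> = (\<Oplus>\<^bsub>C\<^esub>l\<in>\<Lambda>. f (E (star A j \<otimes> a \<otimes> l) \<otimes> star A l))" using a j by (intro f_sum) auto
    finally show "(\<Oplus>\<^bsub>C\<^esub>l\<in>\<Lambda>. f j \<otimes>\<^bsub>C\<^esub> (z \<otimes>\<^bsub>C\<^esub> f (E (star A j \<otimes> a \<otimes> l) \<otimes> star A l)))
        = f j \<otimes>\<^bsub>C\<^esub> (z \<otimes>\<^bsub>C\<^esub> f (star A j \<otimes> a))"
      using a j z by (simp add: C.fsum_mul)
  qed (use a z in auto)
  also have "\<dots> = (\<Oplus>\<^bsub>C\<^esub>j\<in>\<Lambda>. (f j \<otimes>\<^bsub>C\<^esub> (z \<otimes>\<^bsub>C\<^esub> f (star A j))) \<otimes>\<^bsub>C\<^esub> f a)"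
    using a z by (intro C.fsum_eq) (auto simp: f_mul C.mul_assoc)
  also have "\<dots> = (\<Oplus>\<^bsub>C\<^esub>l\<in>\<Lambda>. f l \<otimes>\<^bsub>C\<^esub> (z \<otimes>\<^bsub>C\<^esub> f (star A l))) \<otimes>\<^bsub>C\<^esub> f a"
    using a z by (intro C.fsum_mul(2)[symmetric]) auto
  finally show ?thesis .
qed

section \<open>The basic construction\<close>

abbreviation \<iota> :: "'a \<Rightarrow> 'a \<Rightarrow> 'a" where "\<iota> \<equiv> lmul A"
abbreviation e :: "'a \<Rightarrow> 'a" where "e \<equiv> jones_proj A E"

lemma \<iota>_apply: "x \<in> carrier A \<Longrightarrow> \<iota> a x = a \<otimes> x" by (simp add: lmul_def)
lemma e_apply: "x \<in> carrier A \<Longrightarrow> e x = E x" by (simp add: jones_proj_def)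

lemma \<iota>_adj: assumes "a \<in> carrier A" shows "adj (\<iota> a) (\<iota> (star A a))"
  by (rule adjI) (use assms in \<open>auto simp: lmul_def star_mult mul_assoc\<close>)

lemma e_adj: "adj e e"
  by (rule adjI) (auto simp: jones_proj_def E_star[symmetric] E_left E_right)

lemma \<iota>_mem [simp]: "a \<in> carrier A \<Longrightarrow> \<iota> a \<in> carrier L" using adj_carrier(1)[OF \<iota>_adj] .
lemma \<iota>_star: "a \<in> carrier A \<Longrightarrow> star L (\<iota> a) = \<iota> (star A a)" using adj_carrier(2)[OF \<iota>_adj] .
lemma e_mem [simp]: "e \<in> carrier L" using adj_carrier(1)[OF e_adj] .
lemma e_star: "star L e = e" using adj_carrier(2)[OF e_adj] .

lemma \<iota>_add: "\<lbrakk>a \<in> carrier A; b \<in> carrier A\<rbrakk> \<Longrightarrow> \<iota> (a \<oplus> b) = \<iota> a \<oplus>\<^bsub>L\<^esub> \<iota> b"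
  by (rule L_eqI) (simp_all add: L_apply \<iota>_apply add_mul)
lemma \<iota>_mul: "\<lbrakk>a \<in> carrier A; b \<in> carrier A\<rbrakk> \<Longrightarrow> \<iota> (a \<otimes> b) = \<iota> a \<otimes>\<^bsub>L\<^esub> \<iota> b"
  by (rule L_eqI) (simp_all add: L_apply \<iota>_apply mul_assoc)
lemma \<iota>_smult: "a \<in> carrier A \<Longrightarrow> \<iota> (c \<odot> a) = c \<odot>\<^bsub>L\<^esub> \<iota> a"
  by (rule L_eqI) (simp_all add: L_apply \<iota>_apply smult_mult_left)
lemma \<iota>_one: "\<iota> \<one> = \<one>\<^bsub>L\<^esub>"
  by (rule L_eqI) (simp_all add: L_apply \<iota>_apply)
lemma \<iota>_inj: "inj_on \<iota> (carrier A)"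
proof (rule inj_onI)
  fix a b assume ab: "a \<in> carrier A" "b \<in> carrier A" and eq: "\<iota> a = \<iota> b"
  have "\<iota> a \<one> = \<iota> b \<one>" unfolding eq ..
  then show "a = b" using ab by (simp add: \<iota>_apply)
qed
lemma \<iota>_inv [simp]: "a \<in> carrier A \<Longrightarrow> lmul_inv A (\<iota> a) = a"
  unfolding lmul_inv_def by (rule the_inv_into_f_f[OF \<iota>_inj])

lemma e_\<iota>_e: "x \<in> carrier A \<Longrightarrow> e \<otimes>\<^bsub>L\<^esub> (\<iota> x \<otimes>\<^bsub>L\<^esub> e) = \<iota> (E x) \<otimes>\<^bsub>L\<^esub> e"
  by (rule L_eqI) (simp_all add: L_apply \<iota>_apply e_apply E_right)
lemma e_idem: "e \<otimes>\<^bsub>L\<^esub> e = e"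
  by (rule L_eqI) (simp_all add: L_apply e_apply)
lemma e_\<iota>_B: "b \<in> B \<Longrightarrow> e \<otimes>\<^bsub>L\<^esub> \<iota> b = \<iota> b \<otimes>\<^bsub>L\<^esub> e"
  by (rule L_eqI) (simp_all add: L_apply \<iota>_apply e_apply E_left)

lemma L_eval_fsum:
  assumes "finite S" "\<And>i. i \<in> S \<Longrightarrow> g i \<in> carrier L" "x \<in> carrier A"
  shows "(\<Oplus>\<^bsub>L\<^esub>i\<in>S. g i) x = (\<Oplus>i\<in>S. g i x)"
  using additive_map_finsum[OF L_abelian_group A_group, of "\<lambda>T. T x" S g] assms by (simp add: L_apply)

text \<open>Apply \<open>T\<close> to the quasi-basis expansion of its argument.\<close>

lemma L_span:
  assumes T: "T \<in> carrier L"
  shows "T = (\<Oplus>\<^bsub>L\<^esub>l\<in>\<Lambda>. \<iota> (T l) \<otimes>\<^bsub>L\<^esub> (e \<otimes>\<^bsub>L\<^esub> \<iota> (star A l)))"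
proof -
  interpret L: unital_cstar_algebra L by (rule adjointable_algebra_cstar)
  show ?thesis
  proof (rule L_eqI[OF T])
    show "(\<Oplus>\<^bsub>L\<^esub>l\<in>\<Lambda>. \<iota> (T l) \<otimes>\<^bsub>L\<^esub> (e \<otimes>\<^bsub>L\<^esub> \<iota> (star A l))) \<in> carrier L" using T by simp
    show "T x = (\<Oplus>\<^bsub>L\<^esub>l\<in>\<Lambda>. \<iota> (T l) \<otimes>\<^bsub>L\<^esub> (e \<otimes>\<^bsub>L\<^esub> \<iota> (star A l))) x" if x: "x \<in> carrier A" for x
    proof -
      have "(\<Oplus>\<^bsub>L\<^esub>l\<in>\<Lambda>. \<iota> (T l) \<otimes>\<^bsub>L\<^esub> (e \<otimes>\<^bsub>L\<^esub> \<iota> (star A l))) x = (\<Oplus>l\<in>\<Lambda>. (\<iota> (T l) \<otimes>\<^bsub>L\<^esub> (e \<otimes>\<^bsub>L\<^esub> \<iota> (star A l))) x)"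
        using T x by (intro L_eval_fsum) auto
      also have "\<dots> = (\<Oplus>l\<in>\<Lambda>. T l \<otimes> E (star A l \<otimes> x))"
        using T x by (intro fsum_eq) (auto simp: L_apply \<iota>_apply e_apply)
      finally show ?thesis using L_basis_expansion[OF T x] by simp
    qed
  qed
qed

text \<open>Every adjointable map is a finite sum of products of the generators, so a C*-subalgebra that
contains the generators contains everything.\<close>

lemma basic_construction_eq: "basic_construction A B E = L"
proof -
  interpret L: unital_cstar_algebra L by (rule adjointable_algebra_cstar)
  have "carrier L \<subseteq> D" if D: "cstar_subalgebra D L" "insert e (\<iota> ` carrier A) \<subseteq> D" for D
  proof
    fix T assume T: "T \<in> carrier L"
    have D': "subring D L" using D by (simp add: cstar_subalgebra_def)
    have "(\<Oplus>\<^bsub>L\<^esub>l\<in>\<Lambda>. \<iota> (T l) \<otimes>\<^bsub>L\<^esub> (e \<otimes>\<^bsub>L\<^esub> \<iota> (star A l))) \<in> D"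
      using D(2) T by (intro L.subring_fsum[OF D'] subringE(6)[OF D']) auto
    then show "T \<in> D" using L_span[OF T] by simp
  qed
  moreover have "insert e (\<iota> ` carrier A) \<subseteq> carrier L" by auto
  ultimately have "cstar_generated L (insert e (\<iota> ` carrier A)) = carrier L"
    unfolding cstar_generated_def using L.carrier_cstar_subalgebra by blast
  then show ?thesis by (simp add: basic_construction_def)
qed

lemma L_nontrivial: "\<one>\<^bsub>L\<^esub> \<noteq> \<zero>\<^bsub>L\<^esub>"
proof
  assume "\<one>\<^bsub>L\<^esub> = \<zero>\<^bsub>L\<^esub>"
  then have "\<one>\<^bsub>L\<^esub> \<one> = \<zero>\<^bsub>L\<^esub> \<one>" by simp
  then show False using nontrivial by (simp add: L_apply)
qed

end

section \<open>Minimal expectations\<close>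

text \<open>The right-hand side is \<open>t + 2\<epsilon>(t a - b) + O(\<epsilon>\<^sup>2)\<close>, uniformly in \<open>p\<close>.\<close>

lemma first_order_condition:
  fixes a b g t P \<delta> :: real
  assumes \<delta>: "\<delta> > 0"
    and ex: "\<And>\<epsilon>. \<bar>\<epsilon>\<bar> \<le> \<delta> \<Longrightarrow> \<exists>p. \<bar>p\<bar> \<le> P \<and> t \<le> (1 + 2 * \<epsilon> * a + \<epsilon>\<^sup>2 * g) * (t - 2 * \<epsilon> * b + \<epsilon>\<^sup>2 * p)"
  shows "b = t * a"
proof -
  define W where "W = \<bar>g * t\<bar> + 4 * \<bar>a * b\<bar> + P + 2 * \<bar>a\<bar> * P + 2 * \<bar>b * g\<bar> + \<bar>g\<bar> * P"
  have P: "P \<ge> 0" using ex[of 0] \<delta> by auto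
  have W: "W \<ge> 0" using P by (simp add: W_def)
  \<comment> \<open>\<open>W\<close> bounds all terms of order at least two.\<close>
  have main: "2 * \<epsilon> * (b - t * a) \<le> \<epsilon>\<^sup>2 * W" if e: "\<bar>\<epsilon>\<bar> \<le> min \<delta> 1" for \<epsilon>
  proof -
    obtain p where p: "\<bar>p\<bar> \<le> P" and le: "t \<le> (1 + 2 * \<epsilon> * a + \<epsilon>\<^sup>2 * g) * (t - 2 * \<epsilon> * b + \<epsilon>\<^sup>2 * p)"
      using ex[of \<epsilon>] e by auto
    define R where "R = g * t - 4 * (a * b) + p + \<epsilon> * (2 * a * p) - \<epsilon> * (2 * b * g) + \<epsilon>\<^sup>2 * (g * p)"
    have "(1 + 2 * \<epsilon> * a + \<epsilon>\<^sup>2 * g) * (t - 2 * \<epsilon> * b + \<epsilon>\<^sup>2 * p) = t - 2 * \<epsilon> * (b - t * a) + \<epsilon>\<^sup>2 * R"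
      by (simp add: R_def power2_eq_square algebra_simps)
    then have "2 * \<epsilon> * (b - t * a) \<le> \<epsilon>\<^sup>2 * R" using le by linarith
    also have "R \<le> W"
    proof -
      have e1: "\<bar>\<epsilon>\<bar> \<le> 1" and e2: "\<bar>\<epsilon>\<^sup>2\<bar> \<le> 1" using e by (auto simp: power_le_one abs_square_le_1)
      have m: "x * y \<le> \<bar>y\<bar>" if "\<bar>x\<bar> \<le> 1" for x y :: real
        using mult_right_mono[OF that, of "\<bar>y\<bar>"] abs_ge_self[of "x * y"] by (simp add: abs_mult)
      have "\<bar>2 * a * p\<bar> \<le> 2 * \<bar>a\<bar> * P" "\<bar>g * p\<bar> \<le> \<bar>g\<bar> * P"
        using p by (auto simp: abs_mult mult_left_mono)
      moreover have "\<epsilon> * (2 * a * p) \<le> \<bar>2 * a * p\<bar>" "- (\<epsilon> * (2 * b * g)) \<le> \<bar>2 * b * g\<bar>" "\<epsilon>\<^sup>2 * (g * p) \<le> \<bar>g * p\<bar>"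
        using m[OF e1, of "2 * a * p"] m[of "- \<epsilon>" "2 * b * g"] m[OF e2, of "g * p"] e1 by auto
      moreover have "\<bar>2 * b * g\<bar> = 2 * \<bar>b * g\<bar>" by (simp add: abs_mult)
      ultimately show ?thesis unfolding R_def W_def using p abs_ge_self[of p] abs_ge_self[of "g * t"] abs_ge_minus_self[of "a * b"]
        by linarith
    qed
    finally show ?thesis by (simp add: mult_left_mono)
  qed
  have "\<bar>b - t * a\<bar> \<le> \<epsilon>" if "\<epsilon> > 0" for \<epsilon>
  proof -
    define s where "s = min (min \<delta> 1) (\<epsilon> / (W + 1))"
    have s: "s > 0" "\<bar>s\<bar> \<le> min \<delta> 1" "\<bar>- s\<bar> \<le> min \<delta> 1" "s * (W + 1) \<le> \<epsilon>"
    proof -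
      show s0: "s > 0" using that \<delta> W by (simp add: s_def)
      have "s \<le> min \<delta> 1" unfolding s_def by (rule min.cobounded1)
      then show "\<bar>s\<bar> \<le> min \<delta> 1" "\<bar>- s\<bar> \<le> min \<delta> 1" using s0 by simp_all
      have "s \<le> \<epsilon> / (W + 1)" unfolding s_def by (rule min.cobounded2)
      then show "s * (W + 1) \<le> \<epsilon>" using W by (simp add: pos_le_divide_eq)
    qed
    have 1: "s * (2 * (b - t * a)) \<le> s * (s * W)" using main[OF s(2)] by (simp add: power2_eq_square mult_ac)
    have 2: "s * (- 2 * (b - t * a)) \<le> s * (s * W)" using main[OF s(3)] by (simp add: power2_eq_square algebra_simps)
    have "2 * (b - t * a) \<le> s * W" "- 2 * (b - t * a) \<le> s * W"
      using mult_le_cancel_left_pos[OF s(1)] 1 2 by blast+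
    moreover have "s * W \<le> s * (W + 1)" using s(1) by simp
    ultimately have "2 * (b - t * a) \<le> \<epsilon>" "- (2 * (b - t * a)) \<le> \<epsilon>" using s(4) by auto
    then show ?thesis using that by (simp add: abs_le_iff)
  qed
  then have "\<bar>b - t * a\<bar> \<le> 0" by (rule field_le_epsilon) simp
  then show ?thesis by simp
qed

context finite_index
begin

text \<open>The map \<open>x \<mapsto> \<Sum> l x l\<^sup>*\<close> sends \<open>B' \<inter> A\<close> into the centre of \<open>A\<close>; its value at \<open>1\<close> is the index.\<close>

definition Phi :: "'a \<Rightarrow> 'a" where "Phi x = (\<Oplus>l\<in>\<Lambda>. l \<otimes> (x \<otimes> star A l))"

lemma Phi_mem [simp]: "x \<in> carrier A \<Longrightarrow> Phi x \<in> carrier A" by (simp add: Phi_def)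

lemma Phi_add: "\<lbrakk>x \<in> carrier A; y \<in> carrier A\<rbrakk> \<Longrightarrow> Phi (x \<oplus> y) = Phi x \<oplus> Phi y"
proof -
  assume xy: "x \<in> carrier A" "y \<in> carrier A"
  have "Phi (x \<oplus> y) = (\<Oplus>l\<in>\<Lambda>. l \<otimes> (x \<otimes> star A l) \<oplus> l \<otimes> (y \<otimes> star A l))"
    unfolding Phi_def using xy by (intro fsum_eq) (auto simp: alg_simps)
  also have "\<dots> = Phi x \<oplus> Phi y"
    unfolding Phi_def using xy by (intro abelian_monoid.finsum_addf[OF A_add_monoid]) auto
  finally show ?thesis .
qed

lemma Phi_smult: "x \<in> carrier A \<Longrightarrow> Phi (c \<odot> x) = c \<odot> Phi x"
  unfolding Phi_def by (subst fsum_smult) (auto intro!: fsum_eq simp: smult_mult_left smult_mult_right)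

lemma Phi_star: "x \<in> carrier A \<Longrightarrow> Phi (star A x) = star A (Phi x)"
  unfolding Phi_def by (subst fsum_star) (auto intro!: fsum_eq simp: star_mult mul_assoc)

lemma Phi_bound: "x \<in> carrier A \<Longrightarrow> nrm A (Phi x) \<le> (\<Sum>l\<in>\<Lambda>. (nrm A l)\<^sup>2) * nrm A x"
proof -
  assume x: "x \<in> carrier A"
  have "nrm A (Phi x) \<le> (\<Sum>l\<in>\<Lambda>. nrm A (l \<otimes> (x \<otimes> star A l)))"
    unfolding Phi_def using x by (intro nrm_fsum_le) auto
  also have "\<dots> \<le> (\<Sum>l\<in>\<Lambda>. (nrm A l)\<^sup>2 * nrm A x)"
  proof (rule sum_mono)
    fix l assume l: "l \<in> \<Lambda>"
    have "nrm A (l \<otimes> (x \<otimes> star A l)) \<le> nrm A l * nrm A (x \<otimes> star A l)"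
      using l x by (intro nrm_mult) auto
    also have "\<dots> \<le> nrm A l * (nrm A x * nrm A l)"
      using nrm_mult[of x "star A l"] l x nrm_nonneg by (intro mult_left_mono) auto
    finally show "nrm A (l \<otimes> (x \<otimes> star A l)) \<le> (nrm A l)\<^sup>2 * nrm A x"
      by (simp add: power2_eq_square mult_ac)
  qed
  finally show ?thesis by (simp add: sum_distrib_right)
qed

lemma Phi_central:
  assumes x: "x \<in> carrier A" "\<And>b. b \<in> B \<Longrightarrow> x \<otimes> b = b \<otimes> x" and a: "a \<in> carrier A"
  shows "Phi x \<otimes> a = a \<otimes> Phi x"
  using basis_conjugation_commutes[OF unital_cstar_algebra_axioms, of "\<lambda>x. x" x a] x a
  by (simp add: Phi_def)

text \<open>The weighted expectations \<open>x \<mapsto> E(k x k) / E(k\<^sup>2)\<close>, with \<open>k\<close> in the relative commutant of \<open>B\<close>.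
  Such a map is contractive by a power trick: \<open>\<parallel>F y\<parallel>\<^sup>2 \<le> \<parallel>F(y\<^sup>*y)\<parallel>\<close>, so a bound \<open>\<parallel>F y\<parallel> \<le> C \<parallel>y\<parallel>\<close>
  improves to \<open>C\<^bsup>1/2\<^esup>\<close>, \<open>C\<^bsup>1/4\<^esup>\<close> and so on.\<close>

lemma weighted_expectation:
  assumes k: "k \<in> Units A" "star A k = k" and kB: "\<And>b. b \<in> B \<Longrightarrow> k \<otimes> b = b \<otimes> k"
    and s: "E (k \<otimes> k) = scal s" "s > 0"
  defines "F \<equiv> \<lambda>x\<in>carrier A. complex_of_real (1 / s) \<odot> E (k \<otimes> (x \<otimes> k))"
  shows "finite_index_exp A B F" "Ind A F = complex_of_real s \<odot> Phi (inv k \<otimes> inv k)"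
proof -
  have kc [simp]: "k \<in> carrier A" using k by simp
  define q where "q = inv k"
  have q [simp]: "q \<in> carrier A" "star A q = q" "k \<otimes> q = \<one>" "q \<otimes> k = \<one>"
    using k unit_star(2)[OF k(1)] by (auto simp: q_def)
  have qB: "q \<otimes> b = b \<otimes> q" if "b \<in> B" for b
    unfolding q_def using inv_commute[OF k(1)] kB that by simp
  have F: "F x = complex_of_real (1 / s) \<odot> E (k \<otimes> (x \<otimes> k))" if "x \<in> carrier A" for x
    using that by (simp add: F_def)
  have FB [simp]: "F x \<in> B" if "x \<in> carrier A" for x using that B_smult by (simp add: F)
  have F_add: "F (x \<oplus> y) = F x \<oplus> F y" if "x \<in> carrier A" "y \<in> carrier A" for x y
    using that by (simp add: F add_mul mul_add E_add scalar_distr)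
  have F_smult: "F (c \<odot> x) = c \<odot> F x" if "x \<in> carrier A" for c x
    using that by (simp add: F smult_mult_left smult_mult_right E_smult mult.commute)
  have F_id: "F b = b" if b: "b \<in> B" for b
  proof -
    have "k \<otimes> (b \<otimes> k) = b \<otimes> (k \<otimes> k)" using kB[OF b] b by (simp flip: mul_assoc)
    then have "F b = complex_of_real (1 / s) \<odot> (b \<otimes> scal s)" using b by (simp add: F E_left s)
    then show ?thesis using b s by (simp add: smult_mult_right)
  qed
  have F_bimod: "F (a \<otimes> x \<otimes> b) = a \<otimes> F x \<otimes> b" if x: "x \<in> carrier A" and ab: "a \<in> B" "b \<in> B" for x a b
  proof -
    have "k \<otimes> ((a \<otimes> x \<otimes> b) \<otimes> k) = (k \<otimes> a) \<otimes> (x \<otimes> (b \<otimes> k))" using x ab by (simp add: mul_assoc)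
    also have "\<dots> = (a \<otimes> k) \<otimes> (x \<otimes> (k \<otimes> b))" using kB ab by simp
    also have "\<dots> = a \<otimes> (k \<otimes> (x \<otimes> k)) \<otimes> b" using x ab by (simp add: mul_assoc)
    finally show ?thesis using x ab by (simp add: F E_bimodule smult_mult_left smult_mult_right)
  qed
  have F_pos: "\<exists>p\<in>B. F (star A x \<otimes> x) = star A p \<otimes> p" if x: "x \<in> carrier A" for x
  proof -
    obtain p where p: "p \<in> B" "E (star A (x \<otimes> k) \<otimes> (x \<otimes> k)) = star A p \<otimes> p"
      using E_positive[of "x \<otimes> k"] x by auto
    have "star A (x \<otimes> k) \<otimes> (x \<otimes> k) = k \<otimes> ((star A x \<otimes> x) \<otimes> k)" using x k by (simp add: star_mult mul_assoc)
    then have "F (star A x \<otimes> x) = complex_of_real (1 / s) \<odot> (star A p \<otimes> p)" using p x by (simp add: F)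
    also have "\<dots> = star A (complex_of_real (sqrt (1 / s)) \<odot> p) \<otimes> (complex_of_real (sqrt (1 / s)) \<odot> p)"
    proof -
      have "complex_of_real (sqrt (1 / s)) * complex_of_real (sqrt (1 / s)) = complex_of_real (1 / s)"
        unfolding of_real_mult[symmetric] using s(2) by simp
      then show ?thesis
        using p(1) by (simp add: star_smult smult_mult_left smult_mult_right del: of_real_divide)
    qed
    finally show ?thesis using B_smult[OF p(1)] by blast
  qed
  have F_star: "F (star A x) = star A (F x)" if "x \<in> carrier A" for x
    using that k by (simp add: F star_smult E_star[symmetric] star_mult mul_assoc)
  have CS: "(nrm A (F y))\<^sup>2 \<le> nrm A (F (star A y \<otimes> y))" if y: "y \<in> carrier A" for y
  proof -
    define b where "b = F y"
    have b: "b \<in> B" "b \<in> carrier A" "star A b \<in> B" using y B_star by (auto simp: b_def)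
    obtain p where p: "p \<in> B" "F (star A (y \<ominus> b) \<otimes> (y \<ominus> b)) = star A p \<otimes> p"
      using F_pos[of "y \<ominus> b"] y b by auto
    have Fl: "F (star A b \<otimes> y) = star A b \<otimes> b" using F_bimod[of y "star A b" \<one>] y b by (simp add: b_def)
    have Fr: "F (star A y \<otimes> b) = star A b \<otimes> b"
      using F_bimod[of "star A y" \<one> b] y b F_star[OF y] by (simp add: b_def)
    have bb: "star A b \<otimes> b \<in> B" using b B_mul by simp
    have "star A (y \<ominus> b) \<otimes> (y \<ominus> b) = (star A y \<otimes> y \<oplus> (-1) \<odot> (star A y \<otimes> b)) \<oplus>
       ((-1) \<odot> (star A b \<otimes> y) \<oplus> star A b \<otimes> b)"
      using y b by (simp add: star_simps alg_simps add_ac)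
    then have "star A p \<otimes> p = (F (star A y \<otimes> y) \<oplus> (-1) \<odot> (star A b \<otimes> b)) \<oplus> ((-1) \<odot> (star A b \<otimes> b) \<oplus> star A b \<otimes> b)"
      using p(2) y b bb by (simp add: F_add F_smult Fl Fr F_id)
    then have "star A b \<otimes> b \<oplus> star A p \<otimes> p =
        F (star A y \<otimes> y) \<oplus> ((star A b \<otimes> b \<oplus> (-1) \<odot> (star A b \<otimes> b)) \<oplus> (star A b \<otimes> b \<oplus> (-1) \<odot> (star A b \<otimes> b)))"
      using y b by (simp add: add_ac)
    then have "star A b \<otimes> b \<oplus> star A p \<otimes> p = F (star A y \<otimes> y)"
      using y b by (simp add: scalar_collect)
    then show ?thesis
      using nrm_le_add_spec_nonneg[OF nontrivial b(2) spec_nonneg_star_mult[OF nontrivial B_mem[OF p(1)]]]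
      by (simp add: b_def)
  qed
  have F_nrm: "nrm A (F x) \<le> nrm A x" if x: "x \<in> carrier A" for x
  proof (rule ccontr)
    assume gt: "\<not> nrm A (F x) \<le> nrm A x"
    define C where "C = nrm A k * nrm A k / s"
    have bound: "nrm A (F y) \<le> C * nrm A y" if y: "y \<in> carrier A" for y
    proof -
      have "nrm A (E (k \<otimes> (y \<otimes> k))) \<le> nrm A (k \<otimes> (y \<otimes> k))" using y by (intro E_nrm) auto
      also have "\<dots> \<le> nrm A k * nrm A (y \<otimes> k)" using y by (intro nrm_mult) auto
      also have "\<dots> \<le> nrm A k * (nrm A y * nrm A k)"
        using y by (intro mult_left_mono nrm_mult nrm_nonneg) auto
      finally have "nrm A (F y) \<le> (1 / s) * (nrm A k * (nrm A y * nrm A k))"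
        using y s(2) by (simp add: F nrm_smult norm_divide divide_right_mono)
      then show ?thesis by (simp add: C_def mult_ac)
    qed
    \<comment> \<open>Iterating \<open>y \<mapsto> y\<^sup>*y\<close> squares both norms each time, against one fixed constant \<open>C\<close>.\<close>
    define y where "y n = ((\<lambda>y. star A y \<otimes> y) ^^ n) x" for n
    have y: "y n \<in> carrier A \<and> nrm A (y n) = nrm A x ^ 2 ^ n \<and> nrm A (F x) ^ 2 ^ n \<le> nrm A (F (y n))" for n
    proof (induction n)
      case (Suc n)
      have "nrm A (F x) ^ 2 ^ Suc n = (nrm A (F x) ^ 2 ^ n)\<^sup>2" by (simp add: power_mult[symmetric] mult.commute)
      also have "\<dots> \<le> (nrm A (F (y n)))\<^sup>2" using Suc x nrm_nonneg by (intro power_mono) auto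
      also have "\<dots> \<le> nrm A (F (y (Suc n)))" using CS[of "y n"] Suc by (simp add: y_def)
      finally have "nrm A (F x) ^ 2 ^ Suc n \<le> nrm A (F (y (Suc n)))" .
      moreover have "nrm A (y (Suc n)) = nrm A x ^ 2 ^ Suc n"
        using Suc nrm_star_mult[of "y n"] by (simp add: y_def power_mult[symmetric] mult.commute)
      ultimately show ?case using Suc by (simp add: y_def)
    qed (use x in \<open>simp add: y_def\<close>)
    have x0: "nrm A x > 0"
    proof (rule ccontr)
      assume "\<not> nrm A x > 0"
      then have "nrm A x = 0" using nrm_nonneg[OF x] by simp
      then show False using gt bound[OF x] nrm_nonneg[OF x] by simp
    qed
    define r where "r = nrm A (F x) / nrm A x"
    have r: "r > 1" using gt x0 by (simp add: r_def)
    have rC: "r ^ 2 ^ n \<le> C" for n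
    proof -
      have "nrm A (F x) ^ 2 ^ n \<le> C * nrm A x ^ 2 ^ n" using y[of n] bound[OF conjunct1[OF y[of n]]] by simp
      then show ?thesis using x0 by (simp add: r_def power_divide divide_le_eq)
    qed
    obtain m where m: "C < r ^ m" using real_arch_pow[OF r] by blast
    have "m \<le> 2 ^ m" using less_exp[of m] by simp
    then have "r ^ m \<le> r ^ 2 ^ m" using r by (intro power_increasing) auto
    then show False using m rC[of m] by linarith
  qed
  have cond: "cond_exp A B F"
    unfolding cond_exp_def linear_map_def
  proof (intro conjI ballI allI)
    show "F \<in> carrier A \<rightarrow>\<^sub>E B" using FB by (auto simp: F_def)
    show "F \<in> carrier A \<rightarrow> carrier (A\<lparr>carrier := B\<rparr>)" using FB by auto
    show "F x \<in> positive_elements (A\<lparr>carrier := B\<rparr>)" if x: "x \<in> positive_elements A" for x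
    proof -
      obtain y where y: "y \<in> carrier A" "x = star A y \<otimes> y" using x unfolding positive_elements_def by blast
      obtain p where "p \<in> B" "F x = star A p \<otimes> p" using F_pos[OF y(1)] y(2) by blast
      then show ?thesis unfolding positive_elements_def by auto
    qed
  qed (use F_add F_smult F_id F_nrm F_bimod in simp_all)
  \<comment> \<open>A quasi-basis of \<open>F\<close> is \<open>\<surd>s l k\<^sup>-\<^sup>1\<close>, because \<open>k\<^sup>-\<^sup>1\<close> commutes with the values of \<open>E\<close>.\<close>
  define M where "M = (\<lambda>l. complex_of_real (sqrt s) \<odot> (l \<otimes> q)) ` \<Lambda>"
  have ss: "complex_of_real (sqrt s) * complex_of_real (sqrt s) = complex_of_real s"
    unfolding of_real_mult[symmetric] using s(2) by simp
  have inj: "inj_on (\<lambda>l. complex_of_real (sqrt s) \<odot> (l \<otimes> q)) \<Lambda>"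
  proof (rule inj_onI)
    fix l m assume lm: "l \<in> \<Lambda>" "m \<in> \<Lambda>" and eq: "complex_of_real (sqrt s) \<odot> (l \<otimes> q) = complex_of_real (sqrt s) \<odot> (m \<otimes> q)"
    have "(complex_of_real (1 / sqrt s) \<odot> (complex_of_real (sqrt s) \<odot> (l \<otimes> q))) \<otimes> k
       = (complex_of_real (1 / sqrt s) \<odot> (complex_of_real (sqrt s) \<odot> (m \<otimes> q))) \<otimes> k"
      unfolding eq ..
    then show "l = m" using lm s by (simp add: mul_assoc)
  qed
  have reindex: "(\<Oplus>m\<in>M. g m) = (\<Oplus>l\<in>\<Lambda>. g (complex_of_real (sqrt s) \<odot> (l \<otimes> q)))"
    if "\<And>l. l \<in> \<Lambda> \<Longrightarrow> g (complex_of_real (sqrt s) \<odot> (l \<otimes> q)) \<in> carrier A" for g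
    unfolding M_def using that inj by (intro abelian_monoid.finsum_reindex[OF A_add_monoid]) auto
  have "quasi_basis A F M"
    unfolding quasi_basis_def
  proof (intro conjI ballI)
    show "finite M" "M \<subseteq> carrier A" by (auto simp: M_def)
    fix x assume x: "x \<in> carrier A"
    let ?c = "complex_of_real (sqrt s)"
    have t1: "(?c \<odot> (l \<otimes> q)) \<otimes> F (star A (?c \<odot> (l \<otimes> q)) \<otimes> x) = (l \<otimes> E (star A l \<otimes> (x \<otimes> k))) \<otimes> q"
      if l: "l \<in> \<Lambda>" for l
    proof -
      have "k \<otimes> ((q \<otimes> star A l \<otimes> x) \<otimes> k) = (k \<otimes> q) \<otimes> (star A l \<otimes> (x \<otimes> k))" using l x by (simp add: mul_assoc del: q(3,4))
      then have "F (star A (?c \<odot> (l \<otimes> q)) \<otimes> x) = (?c * (1 / complex_of_real s)) \<odot> E (star A l \<otimes> (x \<otimes> k))"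
        using l x by (simp add: F star_simps smult_mult_left smult_mult_right E_smult)
      moreover have "?c * (?c * (1 / complex_of_real s)) = 1" using ss s(2) by (simp add: mult.assoc[symmetric])
      ultimately have "(?c \<odot> (l \<otimes> q)) \<otimes> F (star A (?c \<odot> (l \<otimes> q)) \<otimes> x) = l \<otimes> (q \<otimes> E (star A l \<otimes> (x \<otimes> k)))"
        using l x by (simp add: smult_mult_left smult_mult_right mul_assoc)
      also have "\<dots> = l \<otimes> (E (star A l \<otimes> (x \<otimes> k)) \<otimes> q)" using qB l x by simp
      finally show ?thesis using l x by (simp add: mul_assoc)
    qed
    have "(\<Oplus>m\<in>M. m \<otimes> F (star A m \<otimes> x)) = (\<Oplus>l\<in>\<Lambda>. (l \<otimes> E (star A l \<otimes> (x \<otimes> k))) \<otimes> q)"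
      using x by (subst reindex) (auto simp: t1 intro!: fsum_eq)
    also have "\<dots> = (\<Oplus>l\<in>\<Lambda>. l \<otimes> E (star A l \<otimes> (x \<otimes> k))) \<otimes> q"
      using x by (intro fsum_mul(2)[symmetric]) auto
    also have "(\<Oplus>l\<in>\<Lambda>. l \<otimes> E (star A l \<otimes> (x \<otimes> k))) = x \<otimes> k"
      by (rule basis_expansion[symmetric]) (use x in simp)
    finally show "x = (\<Oplus>m\<in>M. m \<otimes> F (star A m \<otimes> x))" using x by (simp add: mul_assoc)
    have t2: "F (x \<otimes> (?c \<odot> (l \<otimes> q))) \<otimes> star A (?c \<odot> (l \<otimes> q)) = q \<otimes> (E ((k \<otimes> x) \<otimes> l) \<otimes> star A l)"
      if l: "l \<in> \<Lambda>" for l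
    proof -
      have "k \<otimes> ((x \<otimes> (l \<otimes> q)) \<otimes> k) = (k \<otimes> x) \<otimes> (l \<otimes> (q \<otimes> k))" using l x by (simp add: mul_assoc del: q(3,4))
      then have "F (x \<otimes> (?c \<odot> (l \<otimes> q))) = (?c * (1 / complex_of_real s)) \<odot> E ((k \<otimes> x) \<otimes> l)"
        using l x by (simp add: F smult_mult_left smult_mult_right E_smult)
      moreover have "?c * (?c * (1 / complex_of_real s)) = 1" using ss s(2) by (simp add: mult.assoc[symmetric])
      ultimately have "F (x \<otimes> (?c \<odot> (l \<otimes> q))) \<otimes> star A (?c \<odot> (l \<otimes> q)) = (E ((k \<otimes> x) \<otimes> l) \<otimes> q) \<otimes> star A l"
        using l x by (simp add: star_simps smult_mult_left smult_mult_right mul_assoc)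
      also have "\<dots> = (q \<otimes> E ((k \<otimes> x) \<otimes> l)) \<otimes> star A l" using qB l x by simp
      finally show ?thesis using l x by (simp add: mul_assoc)
    qed
    have "(\<Oplus>m\<in>M. F (x \<otimes> m) \<otimes> star A m) = (\<Oplus>l\<in>\<Lambda>. q \<otimes> (E ((k \<otimes> x) \<otimes> l) \<otimes> star A l))"
      using x by (subst reindex) (auto simp: t2 intro!: fsum_eq)
    also have "\<dots> = q \<otimes> (\<Oplus>l\<in>\<Lambda>. E ((k \<otimes> x) \<otimes> l) \<otimes> star A l)"
      using x by (intro fsum_mul(1)[symmetric]) auto
    also have "(\<Oplus>l\<in>\<Lambda>. E ((k \<otimes> x) \<otimes> l) \<otimes> star A l) = k \<otimes> x"
      by (rule basis_expansion_right[symmetric]) (use x in simp)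
    finally show "x = (\<Oplus>m\<in>M. F (x \<otimes> m) \<otimes> star A m)" using x by (simp flip: mul_assoc)
  qed
  note qb = this
  then show "finite_index_exp A B F" using cond by (auto simp: finite_index_exp_def)
  interpret Fx: finite_index A B F M
    by (rule finite_index.intro[OF unital_cstar_algebra_axioms
          finite_index_axioms.intro[OF nontrivial B_subring B_smult B_star cond qb]])
  have "Ind A F = (\<Oplus>l\<in>\<Lambda>. (complex_of_real (sqrt s) \<odot> (l \<otimes> q)) \<otimes> star A (complex_of_real (sqrt s) \<odot> (l \<otimes> q)))"
    unfolding Fx.Ind_eq by (subst reindex) auto
  also have "\<dots> = (\<Oplus>l\<in>\<Lambda>. complex_of_real s \<odot> (l \<otimes> ((q \<otimes> q) \<otimes> star A l)))"
    by (intro fsum_eq) (auto simp: star_simps smult_mult_left smult_mult_right mul_assoc ss)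
  also have "\<dots> = complex_of_real s \<odot> Phi (q \<otimes> q)"
    unfolding Phi_def by (intro fsum_smult[symmetric]) auto
  finally show "Ind A F = complex_of_real s \<odot> Phi (inv k \<otimes> inv k)" by (simp add: q_def)
qed

definition commutant :: "'a set" where "commutant = rel_commutant A B"

lemma commutantD: "x \<in> commutant \<Longrightarrow> x \<in> carrier A" "\<lbrakk>x \<in> commutant; b \<in> B\<rbrakk> \<Longrightarrow> x \<otimes> b = b \<otimes> x"
  by (auto simp: commutant_def rel_commutant_def)

lemma commutantI: "\<lbrakk>x \<in> carrier A; \<And>b. b \<in> B \<Longrightarrow> x \<otimes> b = b \<otimes> x\<rbrakk> \<Longrightarrow> x \<in> commutant"
  by (auto simp: commutant_def rel_commutant_def)

lemma commutant_mul: "\<lbrakk>x \<in> commutant; y \<in> commutant\<rbrakk> \<Longrightarrow> x \<otimes> y \<in> commutant"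
proof (rule commutantI)
  fix b assume x: "x \<in> commutant" and y: "y \<in> commutant" and b: "b \<in> B"
  have "x \<otimes> y \<otimes> b = x \<otimes> (b \<otimes> y)" using commutantD(1)[OF x] commutantD[OF y] b by (simp add: mul_assoc)
  also have "\<dots> = (b \<otimes> x) \<otimes> y" using commutantD[OF x] commutantD(1)[OF y] b by (simp flip: mul_assoc)
  finally show "x \<otimes> y \<otimes> b = b \<otimes> (x \<otimes> y)" using commutantD(1)[OF x] commutantD(1)[OF y] b by (simp add: mul_assoc)
qed (use commutantD in auto)

lemma commutant_add: "\<lbrakk>x \<in> commutant; y \<in> commutant\<rbrakk> \<Longrightarrow> x \<oplus> y \<in> commutant"
  by (rule commutantI) (use commutantD in \<open>auto simp: add_mul mul_add\<close>)

lemma commutant_smult: "x \<in> commutant \<Longrightarrow> c \<odot> x \<in> commutant"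
  by (rule commutantI) (use commutantD in \<open>auto simp: smult_mult_left smult_mult_right\<close>)

lemma commutant_one: "\<one> \<in> commutant"
  by (rule commutantI) auto

lemma commutant_star: assumes x: "x \<in> commutant" shows "star A x \<in> commutant"
proof (rule commutantI)
  fix b assume b: "b \<in> B"
  have "star A (x \<otimes> star A b) = star A (star A b \<otimes> x)" using commutantD(2)[OF x B_star[OF b]] by simp
  then show "star A x \<otimes> b = b \<otimes> star A x" using commutantD(1)[OF x] b by (simp add: star_mult)
qed (use commutantD(1)[OF x] in simp)

lemma commutant_E_scalar:
  assumes simple: "simple_cstar (A\<lparr>carrier := B\<rparr>)" and x: "x \<in> commutant"
  obtains c where "E x = c \<odot> \<one>"
proof -
  have "E x \<otimes> b = b \<otimes> E x" if b: "b \<in> B" for b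
    using commutantD[OF x] b by (simp flip: E_left E_right)
  then show thesis
    using centre_of_simple[OF B_subring B_smult nontrivial simple B_star, of "E x"] commutantD(1)[OF x] that
    by (metis E_B)
qed

lemma central_scalar:
  assumes simple: "simple_cstar A" and x: "x \<in> carrier A" and c: "\<And>a. a \<in> carrier A \<Longrightarrow> x \<otimes> a = a \<otimes> x"
  obtains c where "x = c \<odot> \<one>"
proof -
  have "A\<lparr>carrier := carrier A\<rparr> = A" by simp
  then show thesis
    using centre_of_simple[OF ring.carrier_is_subring[OF A_ring] scalar_closed nontrivial _ star_closed x c]
      simple that by metis
qed

lemma commutant_Phi_scalar:
  assumes simple: "simple_cstar A" and x: "x \<in> commutant"
  obtains c where "Phi x = c \<odot> \<one>"
  using central_scalar[OF simple Phi_mem Phi_central] commutantD[OF x] by metis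

lemma real_scalar:
  assumes "x = c \<odot> \<one>" "star A x = x"
  shows "x = scal (Re c)"
proof -
  have "cnj c \<odot> \<one> = c \<odot> \<one>" using assms by (simp add: star_smult)
  then have "cnj c = c" using scalar_inject[OF nontrivial] by blast
  then have "complex_of_real (Re c) = c" by (simp add: complex_eq_iff)
  then show ?thesis using assms(1) by simp
qed

text \<open>For \<open>k = 1 + \<epsilon>h\<close> the weighted expectation has index \<open>E(k\<^sup>2) \<Sum> l k\<^sup>-\<^sup>2 l\<^sup>*\<close>; its derivative at
  \<open>\<epsilon> = 0\<close> must vanish.\<close>

theorem minimal_expectation_Phi:
  assumes simpleA: "simple_cstar A" and simpleB: "simple_cstar (A\<lparr>carrier := B\<rparr>)"
    and minimal: "minimal_exp A B E" and x: "x \<in> commutant"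
  shows "Phi x = complex_of_real (scalar_index A E) \<odot> E x"
proof -
  define t where "t = scalar_index A E"
  have Phi1: "Phi \<one> = scal t"
  proof -
    obtain c where c: "Phi \<one> = c \<odot> \<one>" using commutant_Phi_scalar[OF simpleA commutant_one] by blast
    have r: "Phi \<one> = scal (Re c)" using Phi_star[of \<one>] by (intro real_scalar[OF c]) auto
    have "Ind A E = Phi \<one>" unfolding Ind_eq Phi_def by (intro fsum_eq) auto
    then have "scalar_index A E = Re c"
      unfolding scalar_index_def using r scalar_of_scalar[OF nontrivial] by simp
    then show ?thesis using r by (simp add: t_def)
  qed
  have sa: "Phi h = complex_of_real t \<odot> E h" if h: "h \<in> commutant" "star A h = h" for h
  proof -
    have hc: "h \<in> carrier A" using commutantD(1)[OF h(1)] .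
    have real: "\<exists>r. E y = scal r" "\<exists>r. Phi y = scal r" if y: "y \<in> commutant" "star A y = y" for y
    proof -
      have yc: "y \<in> carrier A" using commutantD(1)[OF y(1)] .
      obtain c where "E y = c \<odot> \<one>" using commutant_E_scalar[OF simpleB y(1)] by blast
      then show "\<exists>r. E y = scal r" using real_scalar E_star[OF yc] y(2) by metis
      obtain c where "Phi y = c \<odot> \<one>" using commutant_Phi_scalar[OF simpleA y(1)] by blast
      then show "\<exists>r. Phi y = scal r" using real_scalar Phi_star[OF yc] y(2) by metis
    qed
    have hh: "h \<otimes> h \<in> commutant" "star A (h \<otimes> h) = h \<otimes> h" using h hc commutant_mul by (auto simp: star_mult)
    obtain a b g where a: "E h = scal a" and b: "Phi h = scal b" and g: "E (h \<otimes> h) = scal g"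
      using real[OF h] real[OF hh] by blast
    define H where "H = nrm A h"
    have H: "H \<ge> 0" unfolding H_def using hc nrm_nonneg by blast
    define K where "K = (\<Sum>l\<in>\<Lambda>. (nrm A l)\<^sup>2)"
    have K: "K \<ge> 0" unfolding K_def by (intro sum_nonneg) auto
    define P where "P = K * (8 * H\<^sup>2)"
    \<comment> \<open>For \<open>\<bar>\<epsilon>\<bar> \<le> \<delta>\<close> the element \<open>1 + \<epsilon>h\<close> is invertible and \<open>E((1 + \<epsilon>h)\<^sup>2)\<close> is positive.\<close>
    define \<delta> where "\<delta> = min (1 / (2 * (H + 1))) (min 1 (1 / (2 * (2 * \<bar>a\<bar> + \<bar>g\<bar> + 1))))"
    have \<delta>: "\<delta> > 0" using H by (auto simp: \<delta>_def add_nonneg_pos)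
    have \<delta>1: "\<delta> \<le> 1" unfolding \<delta>_def by (meson min.cobounded1 min.cobounded2 order_trans)
    have "b = t * a"
    proof (rule first_order_condition[OF \<delta>])
      fix \<epsilon> :: real assume e: "\<bar>\<epsilon>\<bar> \<le> \<delta>"
      have eH: "\<bar>\<epsilon>\<bar> * H \<le> 1 / 2"
      proof -
        have "\<bar>\<epsilon>\<bar> * H \<le> 1 / (2 * (H + 1)) * (H + 1)" using e H by (intro mult_mono) (auto simp: \<delta>_def)
        also have "\<dots> = 1 / 2" using H by simp
        finally show ?thesis .
      qed
      define w where "w = complex_of_real (- \<epsilon>) \<odot> h"
      have w: "w \<in> carrier A" "star A w = w" "nrm A w = \<bar>\<epsilon>\<bar> * H" using h hc by (auto simp: w_def star_smult nrm_smult H_def)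
      have wc: "w \<in> commutant" unfolding w_def using commutant_smult h by blast
      define k where "k = \<one> \<ominus> w"
      have k: "k \<in> Units A" "nrm A (inv k) \<le> 1 / (1 - nrm A w)"
        unfolding k_def using one_minus_unit[OF w(1)] eH w(3) by auto
      have ksa: "star A k = k" using w by (simp add: k_def star_diff)
      have kB: "k \<otimes> y = y \<otimes> k" if "y \<in> B" for y
        using commutantD(2)[OF wc that] that w(1) by (simp add: k_def alg_simps)
      define q where "q = inv k"
      have q: "q \<in> carrier A" "star A q = q" "nrm A q \<le> 2"
      proof -
        show "q \<in> carrier A" "star A q = q" using k ksa unit_star(2)[OF k(1)] by (auto simp: q_def)
        have "1 / (1 - nrm A w) \<le> 1 / (1 / 2)" using eH w(3) by (intro divide_left_mono) auto
        then show "nrm A q \<le> 2" using k(2) by (simp add: q_def)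
      qed
      have qw: "q \<otimes> w = w \<otimes> q"
        unfolding q_def using inv_commute[OF k(1) w(1)] w(1) by (simp add: k_def alg_simps)
      have q1: "q = \<one> \<oplus> w \<otimes> q"
      proof -
        have "\<one> \<oplus> w \<otimes> q = k \<otimes> q \<oplus> w \<otimes> q" using k by (simp add: q_def)
        also have "\<dots> = q \<oplus> (w \<otimes> q \<oplus> (-1) \<odot> (w \<otimes> q))" using w(1) q(1) by (simp add: k_def alg_simps add_ac)
        finally show ?thesis using w(1) q(1) by (simp add: scalar_collect)
      qed
      \<comment> \<open>Second-order expansion of \<open>q\<^sup>2 = (1 - w)\<^sup>-\<^sup>2\<close>.\<close>
      define r where "r = 2 \<odot> (h \<otimes> (h \<otimes> q)) \<oplus> h \<otimes> (h \<otimes> (q \<otimes> q))"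
      have rc: "r \<in> carrier A" using hc q by (simp add: r_def)
      have qq: "q \<otimes> q = (\<one> \<oplus> complex_of_real (- 2 * \<epsilon>) \<odot> h) \<oplus> complex_of_real (\<epsilon>\<^sup>2) \<odot> r"
      proof -
        define u where "u = w \<otimes> q"
        have u: "u \<in> carrier A" "q = \<one> \<oplus> u" using w(1) q(1) q1 by (auto simp: u_def)
        have "q \<otimes> q = (\<one> \<oplus> u) \<otimes> (\<one> \<oplus> u)" using u(2) by simp
        also have "\<dots> = (\<one> \<oplus> (u \<oplus> u)) \<oplus> u \<otimes> u" using u(1) by (simp add: alg_simps add_ac)
        finally have 1: "q \<otimes> q = (\<one> \<oplus> 2 \<odot> u) \<oplus> u \<otimes> u" using u(1) by (simp add: scalar_collect)
        have 2: "u = w \<oplus> w \<otimes> (w \<otimes> q)"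
        proof -
          have "u = w \<otimes> (\<one> \<oplus> w \<otimes> q)" unfolding u_def by (subst q1) simp
          then show ?thesis using w(1) q(1) by (simp add: mul_add)
        qed
        have 3: "u \<otimes> u = w \<otimes> (w \<otimes> (q \<otimes> q))"
        proof -
          have "u \<otimes> u = w \<otimes> ((q \<otimes> w) \<otimes> q)" unfolding u_def using w(1) q(1) by (simp add: mul_assoc)
          then show ?thesis unfolding qw using w(1) q(1) by (simp add: mul_assoc)
        qed
        have ee: "complex_of_real (\<epsilon>\<^sup>2) = complex_of_real \<epsilon> * complex_of_real \<epsilon>" by (simp add: power2_eq_square)
        have "q \<otimes> q = (\<one> \<oplus> 2 \<odot> w) \<oplus> (2 \<odot> (w \<otimes> (w \<otimes> q)) \<oplus> w \<otimes> (w \<otimes> (q \<otimes> q)))"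
        proof -
          have "2 \<odot> u = 2 \<odot> w \<oplus> 2 \<odot> (w \<otimes> (w \<otimes> q))"
            by (subst 2) (use w(1) q(1) in \<open>simp add: scalar_distr\<close>)
          then have "(\<one> \<oplus> 2 \<odot> u) \<oplus> u \<otimes> u = (\<one> \<oplus> (2 \<odot> w \<oplus> 2 \<odot> (w \<otimes> (w \<otimes> q)))) \<oplus> w \<otimes> (w \<otimes> (q \<otimes> q))"
            using 3 by simp
          also have "\<dots> = (\<one> \<oplus> 2 \<odot> w) \<oplus> (2 \<odot> (w \<otimes> (w \<otimes> q)) \<oplus> w \<otimes> (w \<otimes> (q \<otimes> q)))"
            using w(1) q(1) by (simp add: add_assoc)
          finally show ?thesis using 1 by simp
        qed
        then show ?thesis
          unfolding r_def w_def ee using hc q(1)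
          by (simp add: smult_mult_left smult_mult_right scalar_distr mult_ac)
      qed
      have rn: "nrm A r \<le> 8 * H\<^sup>2"
      proof -
        have hx: "nrm A (h \<otimes> y) \<le> H * nrm A y" if "y \<in> carrier A" for y
          unfolding H_def using hc that nrm_mult by blast
        have n1: "nrm A (h \<otimes> (h \<otimes> y)) \<le> H\<^sup>2 * nrm A y" if y: "y \<in> carrier A" for y
        proof -
          have "nrm A (h \<otimes> (h \<otimes> y)) \<le> H * nrm A (h \<otimes> y)" using hc y by (intro hx) auto
          also have "\<dots> \<le> H * (H * nrm A y)" using H hx[OF y] by (intro mult_left_mono)
          finally show ?thesis by (simp add: power2_eq_square mult_ac)
        qed
        have qn: "nrm A (q \<otimes> q) \<le> 4"
          using nrm_mult[of q q] q mult_mono[of "nrm A q" 2 "nrm A q" 2] nrm_nonneg[of q] by simp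
        have "nrm A r \<le> 2 * nrm A (h \<otimes> (h \<otimes> q)) + nrm A (h \<otimes> (h \<otimes> (q \<otimes> q)))"
          using nrm_triangle[of "2 \<odot> (h \<otimes> (h \<otimes> q))" "h \<otimes> (h \<otimes> (q \<otimes> q))"] hc q(1) by (simp add: r_def nrm_smult)
        also have "\<dots> \<le> 2 * (H\<^sup>2 * 2) + H\<^sup>2 * 4"
          using n1[OF q(1)] n1[of "q \<otimes> q"] q qn
            mult_left_mono[OF q(3), of "H\<^sup>2"] mult_left_mono[OF qn, of "H\<^sup>2"] by simp
        finally show ?thesis by simp
      qed
      define s where "s = 1 + 2 * \<epsilon> * a + \<epsilon>\<^sup>2 * g"
      have kk: "E (k \<otimes> k) = scal s"
      proof -
        have "k \<otimes> k = (\<one> \<oplus> (complex_of_real \<epsilon> \<odot> h \<oplus> complex_of_real \<epsilon> \<odot> h)) \<oplus> complex_of_real (\<epsilon>\<^sup>2) \<odot> (h \<otimes> h)"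
          using hc by (simp add: k_def w_def alg_simps add_ac power2_eq_square)
        also have "\<dots> = (\<one> \<oplus> complex_of_real (2 * \<epsilon>) \<odot> h) \<oplus> complex_of_real (\<epsilon>\<^sup>2) \<odot> (h \<otimes> h)"
          using hc by (simp add: scalar_collect)
        finally have "E (k \<otimes> k) = (\<one> \<oplus> complex_of_real (2 * \<epsilon>) \<odot> scal a) \<oplus> complex_of_real (\<epsilon>\<^sup>2) \<odot> scal g"
          using hc by (simp add: E_add E_smult a g)
        then show ?thesis by (simp add: s_def scalar_collect)
      qed
      have s0: "s > 0"
      proof -
        have "\<bar>\<epsilon>\<bar> * (2 * \<bar>a\<bar> + \<bar>g\<bar>) \<le> 1 / (2 * (2 * \<bar>a\<bar> + \<bar>g\<bar> + 1)) * (2 * \<bar>a\<bar> + \<bar>g\<bar> + 1)"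
          using e by (intro mult_mono) (auto simp: \<delta>_def)
        also have "\<dots> = 1 / 2"
        proof -
          have "2 * \<bar>a\<bar> + \<bar>g\<bar> + 1 \<noteq> 0" using abs_ge_zero[of a] abs_ge_zero[of g] by linarith
          then show ?thesis by simp
        qed
        finally have 1: "\<bar>\<epsilon>\<bar> * (2 * \<bar>a\<bar>) + \<bar>\<epsilon>\<bar> * \<bar>g\<bar> \<le> 1 / 2" by (simp add: distrib_left)
        have "\<epsilon>\<^sup>2 * \<bar>g\<bar> \<le> \<bar>\<epsilon>\<bar> * \<bar>g\<bar>"
        proof (rule mult_right_mono)
          have "\<bar>\<epsilon>\<bar> * \<bar>\<epsilon>\<bar> \<le> \<bar>\<epsilon>\<bar> * 1" using e \<delta>1 by (intro mult_left_mono) auto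
          then show "\<epsilon>\<^sup>2 \<le> \<bar>\<epsilon>\<bar>" by (simp add: power2_eq_square)
        qed simp
        moreover have "\<bar>2 * \<epsilon> * a\<bar> = \<bar>\<epsilon>\<bar> * (2 * \<bar>a\<bar>)" "\<bar>\<epsilon>\<^sup>2 * g\<bar> = \<epsilon>\<^sup>2 * \<bar>g\<bar>" by (simp_all add: abs_mult)
        ultimately show ?thesis unfolding s_def using 1 by linarith
      qed
      define F where "F = (\<lambda>x\<in>carrier A. complex_of_real (1 / s) \<odot> E (k \<otimes> (x \<otimes> k)))"
      have FI: "finite_index_exp A B F" "Ind A F = complex_of_real s \<odot> Phi (q \<otimes> q)"
        using weighted_expectation[OF k(1) ksa kB kk s0] by (auto simp: F_def q_def)
      have "r \<in> commutant"
      proof -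
        have "q \<in> commutant"
          using q(1) inv_commute[OF k(1)] kB by (intro commutantI) (auto simp: q_def)
        then show ?thesis unfolding r_def using h by (intro commutant_add commutant_smult commutant_mul)
      qed
      then obtain c where c: "Phi r = c \<odot> \<one>" using commutant_Phi_scalar[OF simpleA] by blast
      have "nrm A (Phi r) = cmod c" unfolding c using nrm_one[OF nontrivial] by (simp add: nrm_smult)
      then have "cmod c \<le> K * nrm A r" using Phi_bound[OF rc] by (simp add: K_def)
      also have "\<dots> \<le> P" unfolding P_def using K rn by (intro mult_left_mono)
      finally have cP: "\<bar>Re c\<bar> \<le> P" using abs_Re_le_cmod[of c] by simp
      have "Phi (q \<otimes> q) = (scal t \<oplus> complex_of_real (- 2 * \<epsilon>) \<odot> scal b) \<oplus> complex_of_real (\<epsilon>\<^sup>2) \<odot> (c \<odot> \<one>)"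
        unfolding qq using hc rc by (simp add: Phi_add Phi_smult Phi1 b c)
      then have "Phi (q \<otimes> q) = (complex_of_real (t - 2 * \<epsilon> * b) + complex_of_real (\<epsilon>\<^sup>2) * c) \<odot> \<one>"
        by (simp add: scalar_collect)
      then have "Ind A F = (complex_of_real s * (complex_of_real (t - 2 * \<epsilon> * b) + complex_of_real (\<epsilon>\<^sup>2) * c)) \<odot> \<one>"
        using FI(2) by simp
      then have "scalar_index A F = Re (complex_of_real s * (complex_of_real (t - 2 * \<epsilon> * b) + complex_of_real (\<epsilon>\<^sup>2) * c))"
        unfolding scalar_index_def using scalar_of_scalar[OF nontrivial] by simp
      also have "\<dots> = s * (t - 2 * \<epsilon> * b + \<epsilon>\<^sup>2 * Re c)"
        by (simp only: Re_complex_of_real Im_complex_of_real times_complex.sel plus_complex.sel) simp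
      finally have "scalar_index A F = s * (t - 2 * \<epsilon> * b + \<epsilon>\<^sup>2 * Re c)" .
      moreover have "t \<le> scalar_index A F" using minimal FI(1) by (auto simp: minimal_exp_def t_def)
      ultimately show "\<exists>p. \<bar>p\<bar> \<le> P \<and> t \<le> (1 + 2 * \<epsilon> * a + \<epsilon>\<^sup>2 * g) * (t - 2 * \<epsilon> * b + \<epsilon>\<^sup>2 * p)"
        using cP unfolding s_def by metis
    qed
    then show ?thesis by (simp add: a b)
  qed
  have xc: "x \<in> carrier A" "star A x \<in> commutant" using commutantD(1)[OF x] commutant_star[OF x] by auto
  define h where "h = (1/2) \<odot> (x \<oplus> star A x)"
  define k where "k = (\<i>/2) \<odot> (x \<oplus> (-1) \<odot> star A x)"
  have h: "h \<in> commutant" "star A h = h" "h \<in> carrier A"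
    using x xc commutant_add commutant_smult by (auto simp: h_def star_simps add_comm)
  have k: "k \<in> commutant" "star A k = k" "k \<in> carrier A"
    using x xc commutant_add commutant_smult by (auto simp: k_def star_simps alg_simps add_comm)
  have "h \<oplus> (- \<i>) \<odot> k = ((1/2) \<odot> x \<oplus> (1/2) \<odot> x) \<oplus> ((1/2) \<odot> star A x \<oplus> (-1/2) \<odot> star A x)"
    using xc by (simp add: h_def k_def alg_simps add_ac)
  then have xhk: "x = h \<oplus> (- \<i>) \<odot> k" using xc by (simp add: scalar_collect)
  have "Phi x = Phi h \<oplus> (- \<i>) \<odot> Phi k" unfolding xhk using h k by (simp add: Phi_add Phi_smult)
  also have "\<dots> = complex_of_real t \<odot> (E h \<oplus> (- \<i>) \<odot> E k)"
    unfolding sa[OF h(1,2)] sa[OF k(1,2)] using h k by (simp add: scalar_distr mult.commute)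
  also have "\<dots> = complex_of_real t \<odot> E x" unfolding xhk using h k by (simp add: E_add E_smult)
  finally show ?thesis by (simp add: t_def)
qed

end

section \<open>The dual expectation\<close>

context unital_cstar_algebra
begin

lemma spec_nonneg_zero: "spec_nonneg \<zero>"
  unfolding spec_nonneg_def using unit_scalar(1)[OF one_unit] by auto

lemma spec_nonneg_fsum:
  assumes "\<one> \<noteq> \<zero>" "finite S" "\<And>i. i \<in> S \<Longrightarrow> spec_nonneg (f i)"
  shows "spec_nonneg (\<Oplus>i\<in>S. f i)"
  using assms(2,3)
proof (induction S)
  case (insert a S)
  have "(\<Oplus>i\<in>insert a S. f i) = f a \<oplus> (\<Oplus>i\<in>S. f i)"
    using insert spec_nonneg_carrier by (intro fsum_insert) auto
  then show ?case using insert spec_nonneg_add[OF assms(1)] by simp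
qed (simp add: fsum_empty spec_nonneg_zero)

end

locale dual_index = finite_index A B E \<Lambda> for A :: "'a cstar" (structure) and B E \<Lambda> +
  fixes E' :: "('a \<Rightarrow> 'a) \<Rightarrow> ('a \<Rightarrow> 'a)"
  assumes dual: "dual_exp A B E E'"
begin

sublocale L: unital_cstar_algebra "adjointable_algebra A B E"
  by (rule adjointable_algebra_cstar)

abbreviation D :: "('a \<Rightarrow> 'a) set" where "D \<equiv> \<iota> ` carrier A"

definition \<tau> :: real where "\<tau> = 1 / scalar_index A E"

lemma E'_cond_exp: "cond_exp L D E'"
  using dual by (simp add: dual_exp_def Let_def basic_construction_eq)

lemma E'_e: "\<lbrakk>x \<in> carrier A; y \<in> carrier A\<rbrakk> \<Longrightarrow>
    E' (\<iota> x \<otimes>\<^bsub>L\<^esub> e \<otimes>\<^bsub>L\<^esub> \<iota> y) = \<iota> (complex_of_real \<tau> \<odot> (x \<otimes> y))"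
  using dual by (simp add: dual_exp_def Let_def basic_construction_eq \<tau>_def)

lemma \<iota>_neg: "a \<in> carrier A \<Longrightarrow> \<ominus>\<^bsub>L\<^esub> (\<iota> a) = \<iota> (\<ominus> a)"
  by (simp add: L.neg_scalar neg_scalar \<iota>_smult)

lemma D_subring: "subring D L"
proof (rule ring.subringI[OF L.A_ring])
  show "D \<subseteq> carrier L" by auto
  show "\<one>\<^bsub>L\<^esub> \<in> D" using \<iota>_one[symmetric] by auto
  show "\<ominus>\<^bsub>L\<^esub> h \<in> D" if "h \<in> D" for h
    using that \<iota>_neg abelian_group.a_inv_closed[OF A_group] by auto
  show "h1 \<otimes>\<^bsub>L\<^esub> h2 \<in> D" if "h1 \<in> D" "h2 \<in> D" for h1 h2
    using that by (auto simp flip: \<iota>_mul)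
  show "h1 \<oplus>\<^bsub>L\<^esub> h2 \<in> D" if "h1 \<in> D" "h2 \<in> D" for h1 h2
    using that by (auto simp flip: \<iota>_add)
qed

lemma D_smult: "d \<in> D \<Longrightarrow> c \<odot>\<^bsub>L\<^esub> d \<in> D"
  by (auto simp flip: \<iota>_smult)

lemma D_star: "d \<in> D \<Longrightarrow> star L d \<in> D"
  by (auto simp: \<iota>_star)

section \<open>The dual expectation as a map into \<open>A\<close>\<close>

text \<open>The dual expectation followed by the identification of \<open>\<iota> A\<close> with \<open>A\<close>.\<close>

definition p :: "('a \<Rightarrow> 'a) \<Rightarrow> 'a" where "p z = lmul_inv A (E' z)"

lemma E'_D: "z \<in> carrier L \<Longrightarrow> E' z \<in> D"
  using E'_cond_exp by (auto simp: cond_exp_def)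

lemma E'_p: "z \<in> carrier L \<Longrightarrow> E' z = \<iota> (p z)"
  using E'_D[of z] by (auto simp: p_def)

lemma p_mem [simp]: "z \<in> carrier L \<Longrightarrow> p z \<in> carrier A"
  using E'_D[of z] by (auto simp: p_def)

lemma p_eqI: "\<lbrakk>z \<in> carrier L; a \<in> carrier A; E' z = \<iota> a\<rbrakk> \<Longrightarrow> p z = a"
  by (simp add: p_def)

lemma p_add: "\<lbrakk>x \<in> carrier L; y \<in> carrier L\<rbrakk> \<Longrightarrow> p (x \<oplus>\<^bsub>L\<^esub> y) = p x \<oplus> p y"
  using E'_cond_exp by (intro p_eqI) (auto simp: cond_exp_def linear_map_def E'_p \<iota>_add)

lemma p_smult: "x \<in> carrier L \<Longrightarrow> p (c \<odot>\<^bsub>L\<^esub> x) = c \<odot> p x"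
  using E'_cond_exp by (intro p_eqI) (auto simp: cond_exp_def linear_map_def E'_p \<iota>_smult)

lemma p_\<iota> [simp]: "a \<in> carrier A \<Longrightarrow> p (\<iota> a) = a"
  using E'_cond_exp by (intro p_eqI) (auto simp: cond_exp_def)

lemma p_bimodule: "\<lbrakk>x \<in> carrier L; a \<in> carrier A; b \<in> carrier A\<rbrakk>
    \<Longrightarrow> p (\<iota> a \<otimes>\<^bsub>L\<^esub> x \<otimes>\<^bsub>L\<^esub> \<iota> b) = a \<otimes> p x \<otimes> b"
  using E'_cond_exp by (intro p_eqI) (auto simp: cond_exp_def E'_p \<iota>_mul)

lemma p_left: "\<lbrakk>x \<in> carrier L; a \<in> carrier A\<rbrakk> \<Longrightarrow> p (\<iota> a \<otimes>\<^bsub>L\<^esub> x) = a \<otimes> p x"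
  using p_bimodule[of x a \<one>] by (simp add: \<iota>_one)

lemma p_right: "\<lbrakk>x \<in> carrier L; a \<in> carrier A\<rbrakk> \<Longrightarrow> p (x \<otimes>\<^bsub>L\<^esub> \<iota> a) = p x \<otimes> a"
  using p_bimodule[of x \<one> a] by (simp add: \<iota>_one)

lemma p_positive:
  assumes z: "z \<in> carrier L"
  obtains a where "a \<in> carrier A" "p (star L z \<otimes>\<^bsub>L\<^esub> z) = star A a \<otimes> a"
proof -
  have "star L z \<otimes>\<^bsub>L\<^esub> z \<in> positive_elements L" using z by (auto simp: positive_elements_def)
  then have "E' (star L z \<otimes>\<^bsub>L\<^esub> z) \<in> positive_elements (L\<lparr>carrier := D\<rparr>)"
    using E'_cond_exp unfolding cond_exp_def by blast
  then obtain a where a: "a \<in> carrier A" "E' (star L z \<otimes>\<^bsub>L\<^esub> z) = star L (\<iota> a) \<otimes>\<^bsub>L\<^esub> \<iota> a"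
    by (auto simp: positive_elements_def)
  then have "p (star L z \<otimes>\<^bsub>L\<^esub> z) = star A a \<otimes> a"
    using z by (intro p_eqI) (auto simp: \<iota>_star \<iota>_mul)
  then show thesis using that a by blast
qed

lemma p_e: "\<lbrakk>x \<in> carrier A; y \<in> carrier A\<rbrakk> \<Longrightarrow> p (\<iota> x \<otimes>\<^bsub>L\<^esub> (e \<otimes>\<^bsub>L\<^esub> \<iota> y)) = complex_of_real \<tau> \<odot> (x \<otimes> y)"
  using E'_e by (intro p_eqI) (auto simp: L.mul_assoc)

lemma p_of_e: "p e = scal \<tau>"
  using p_e[of \<one> \<one>] by (simp add: \<iota>_one)

lemma p_fsum:
  assumes "finite S" "\<And>i. i \<in> S \<Longrightarrow> g i \<in> carrier L"
  shows "p (\<Oplus>\<^bsub>L\<^esub>i\<in>S. g i) = (\<Oplus>i\<in>S. p (g i))"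
  using assms by (intro additive_map_finsum[OF L_abelian_group A_group]) (auto simp: p_add)

lemma unit_expansion: "\<one>\<^bsub>L\<^esub> = (\<Oplus>\<^bsub>L\<^esub>l\<in>\<Lambda>. \<iota> l \<otimes>\<^bsub>L\<^esub> (e \<otimes>\<^bsub>L\<^esub> \<iota> (star A l)))"
  by (subst L_span[OF L.one_unit[THEN L.unit_closed]]) (intro L.fsum_eq; simp add: L_one_apply)

text \<open>Apply the dual expectation to the expansion of the unit.\<close>

lemma \<tau>_index: "complex_of_real \<tau> \<odot> (\<Oplus>l\<in>\<Lambda>. l \<otimes> star A l) = \<one>"
proof -
  have "p \<one>\<^bsub>L\<^esub> = (\<Oplus>l\<in>\<Lambda>. p (\<iota> l \<otimes>\<^bsub>L\<^esub> (e \<otimes>\<^bsub>L\<^esub> \<iota> (star A l))))"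
    unfolding unit_expansion by (intro p_fsum) auto
  also have "\<dots> = (\<Oplus>l\<in>\<Lambda>. complex_of_real \<tau> \<odot> (l \<otimes> star A l))"
    by (intro fsum_eq) (auto simp: p_e)
  also have "\<dots> = complex_of_real \<tau> \<odot> (\<Oplus>l\<in>\<Lambda>. l \<otimes> star A l)"
    by (intro fsum_smult[symmetric]) auto
  finally show ?thesis using p_\<iota>[of \<one>] by (simp add: \<iota>_one)
qed

lemma \<tau>_pos: "\<tau> > 0"
proof -
  have nz: "\<tau> \<noteq> 0"
  proof
    assume "\<tau> = 0"
    then show False using \<tau>_index nontrivial by simp
  qed
  have "complex_of_real (1 / \<tau>) \<odot> (complex_of_real \<tau> \<odot> (\<Oplus>l\<in>\<Lambda>. l \<otimes> star A l)) = scal (1 / \<tau>)"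
    using \<tau>_index by simp
  then have "(\<Oplus>l\<in>\<Lambda>. l \<otimes> star A l) = scal (1 / \<tau>)" using nz by simp
  moreover have "spec_nonneg (\<Oplus>l\<in>\<Lambda>. l \<otimes> star A l)"
  proof (rule spec_nonneg_fsum[OF nontrivial])
    show "spec_nonneg (l \<otimes> star A l)" if "l \<in> \<Lambda>" for l
      using spec_nonneg_star_mult[OF nontrivial, of "star A l"] that by simp
  qed simp
  ultimately have "1 / \<tau> \<ge> 0" using spec_nonneg_scalar[OF nontrivial, of "1 / \<tau>"] by simp
  then show ?thesis using nz by simp
qed

text \<open>Additive maps on the basic construction are compared on the spanning elements \<open>a e b\<close>.\<close>

lemma span_eqI:
  assumes K: "abelian_group K" and f: "f \<in> carrier L \<rightarrow> carrier K" and g: "g \<in> carrier L \<rightarrow> carrier K"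
    and f_add: "\<And>x y. \<lbrakk>x \<in> carrier L; y \<in> carrier L\<rbrakk> \<Longrightarrow> f (x \<oplus>\<^bsub>L\<^esub> y) = f x \<oplus>\<^bsub>K\<^esub> f y"
    and g_add: "\<And>x y. \<lbrakk>x \<in> carrier L; y \<in> carrier L\<rbrakk> \<Longrightarrow> g (x \<oplus>\<^bsub>L\<^esub> y) = g x \<oplus>\<^bsub>K\<^esub> g y"
    and eq: "\<And>a b. \<lbrakk>a \<in> carrier A; b \<in> carrier A\<rbrakk> \<Longrightarrow>
       f (\<iota> a \<otimes>\<^bsub>L\<^esub> (e \<otimes>\<^bsub>L\<^esub> \<iota> b)) = g (\<iota> a \<otimes>\<^bsub>L\<^esub> (e \<otimes>\<^bsub>L\<^esub> \<iota> b))"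
    and z: "z \<in> carrier L"
  shows "f z = g z"
proof -
  let ?t = "\<lambda>l. \<iota> (z l) \<otimes>\<^bsub>L\<^esub> (e \<otimes>\<^bsub>L\<^esub> \<iota> (star A l))"
  have t: "?t \<in> \<Lambda> \<rightarrow> carrier L" using z by auto
  have "f z = f (\<Oplus>\<^bsub>L\<^esub>l\<in>\<Lambda>. ?t l)" using L_span[OF z] by simp
  also have "\<dots> = (\<Oplus>\<^bsub>K\<^esub>l\<in>\<Lambda>. f (?t l))"
    by (rule additive_map_finsum[OF L_abelian_group K f f_add finite_basis t])
  also have "\<dots> = (\<Oplus>\<^bsub>K\<^esub>l\<in>\<Lambda>. g (?t l))"
  proof (rule abelian_monoid.finsum_cong'[OF abelian_group.axioms(1)[OF K] refl])
    show "(\<lambda>l. g (?t l)) \<in> \<Lambda> \<rightarrow> carrier K" using g t by auto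
    show "f (?t l) = g (?t l)" if "l \<in> \<Lambda>" for l using eq[of "z l" "star A l"] that z by simp
  qed
  also have "\<dots> = g (\<Oplus>\<^bsub>L\<^esub>l\<in>\<Lambda>. ?t l)"
    by (rule additive_map_finsum[OF L_abelian_group K g g_add finite_basis t, symmetric])
  also have "\<dots> = g z" using L_span[OF z] by simp
  finally show ?thesis .
qed

lemma e_\<iota>_e_left: "\<lbrakk>x \<in> carrier A; y \<in> carrier L\<rbrakk> \<Longrightarrow> e \<otimes>\<^bsub>L\<^esub> (\<iota> x \<otimes>\<^bsub>L\<^esub> (e \<otimes>\<^bsub>L\<^esub> y)) = \<iota> (E x) \<otimes>\<^bsub>L\<^esub> (e \<otimes>\<^bsub>L\<^esub> y)"
  using arg_cong[OF e_\<iota>_e[of x], of "\<lambda>u. u \<otimes>\<^bsub>L\<^esub> y"] by (simp add: L.mul_assoc)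

text \<open>By linearity only \<open>z = a e b\<close> matters, where \<open>e z = E(a) e b\<close>.\<close>

lemma pushdown_left:
  assumes "z \<in> carrier L"
  shows "e \<otimes>\<^bsub>L\<^esub> \<iota> (p (e \<otimes>\<^bsub>L\<^esub> z)) = complex_of_real \<tau> \<odot>\<^bsub>L\<^esub> (e \<otimes>\<^bsub>L\<^esub> z)"
  using L_abelian_group _ _ _ _ _ assms
proof (rule span_eqI)
  fix a b assume ab: "a \<in> carrier A" "b \<in> carrier A"
  have "e \<otimes>\<^bsub>L\<^esub> (\<iota> a \<otimes>\<^bsub>L\<^esub> (e \<otimes>\<^bsub>L\<^esub> \<iota> b)) = \<iota> (E a) \<otimes>\<^bsub>L\<^esub> (e \<otimes>\<^bsub>L\<^esub> \<iota> b)"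
    using ab by (intro e_\<iota>_e_left) auto
  moreover have "e \<otimes>\<^bsub>L\<^esub> \<iota> (E a \<otimes> b) = \<iota> (E a) \<otimes>\<^bsub>L\<^esub> (e \<otimes>\<^bsub>L\<^esub> \<iota> b)"
    using ab e_\<iota>_B[of "E a"] by (simp add: \<iota>_mul flip: L.mul_assoc)
  ultimately show "e \<otimes>\<^bsub>L\<^esub> \<iota> (p (e \<otimes>\<^bsub>L\<^esub> (\<iota> a \<otimes>\<^bsub>L\<^esub> (e \<otimes>\<^bsub>L\<^esub> \<iota> b)))) = complex_of_real \<tau> \<odot>\<^bsub>L\<^esub> (e \<otimes>\<^bsub>L\<^esub> (\<iota> a \<otimes>\<^bsub>L\<^esub> (e \<otimes>\<^bsub>L\<^esub> \<iota> b)))"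
    using ab by (simp add: p_e \<iota>_smult L.smult_mult_right)
qed (auto simp: L.mul_add p_add \<iota>_add L.scalar_distr)

lemma pushdown_right:
  assumes "z \<in> carrier L"
  shows "\<iota> (p (z \<otimes>\<^bsub>L\<^esub> e)) \<otimes>\<^bsub>L\<^esub> e = complex_of_real \<tau> \<odot>\<^bsub>L\<^esub> (z \<otimes>\<^bsub>L\<^esub> e)"
  using L_abelian_group _ _ _ _ _ assms
proof (rule span_eqI)
  fix a b assume ab: "a \<in> carrier A" "b \<in> carrier A"
  have eq: "\<iota> a \<otimes>\<^bsub>L\<^esub> (e \<otimes>\<^bsub>L\<^esub> \<iota> b) \<otimes>\<^bsub>L\<^esub> e = \<iota> (a \<otimes> E b) \<otimes>\<^bsub>L\<^esub> (e \<otimes>\<^bsub>L\<^esub> \<iota> \<one>)"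
    using ab by (simp add: L.mul_assoc e_\<iota>_e \<iota>_mul \<iota>_one)
  show "\<iota> (p (\<iota> a \<otimes>\<^bsub>L\<^esub> (e \<otimes>\<^bsub>L\<^esub> \<iota> b) \<otimes>\<^bsub>L\<^esub> e)) \<otimes>\<^bsub>L\<^esub> e = complex_of_real \<tau> \<odot>\<^bsub>L\<^esub> (\<iota> a \<otimes>\<^bsub>L\<^esub> (e \<otimes>\<^bsub>L\<^esub> \<iota> b) \<otimes>\<^bsub>L\<^esub> e)"
    unfolding eq using ab p_e[of "a \<otimes> E b" \<one>] by (simp add: \<iota>_smult L.smult_mult_left \<iota>_one)
qed (auto simp: L.add_mul p_add \<iota>_add L.scalar_distr)

text \<open>The Jones projection lies in the centralizer of \<open>E \<circ> E'\<close>: at \<open>z = a e b\<close> both sides are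
  \<open>\<tau> E(a) E(b)\<close>.\<close>

lemma E_p_commute:
  assumes "z \<in> carrier L"
  shows "E (p (e \<otimes>\<^bsub>L\<^esub> z)) = E (p (z \<otimes>\<^bsub>L\<^esub> e))"
  using A_group _ _ _ _ _ assms
proof (rule span_eqI)
  fix a b assume ab: "a \<in> carrier A" "b \<in> carrier A"
  have 1: "e \<otimes>\<^bsub>L\<^esub> (\<iota> a \<otimes>\<^bsub>L\<^esub> (e \<otimes>\<^bsub>L\<^esub> \<iota> b)) = \<iota> (E a) \<otimes>\<^bsub>L\<^esub> (e \<otimes>\<^bsub>L\<^esub> \<iota> b)"
    using ab by (intro e_\<iota>_e_left) auto
  have 2: "\<iota> a \<otimes>\<^bsub>L\<^esub> (e \<otimes>\<^bsub>L\<^esub> \<iota> b) \<otimes>\<^bsub>L\<^esub> e = \<iota> (a \<otimes> E b) \<otimes>\<^bsub>L\<^esub> (e \<otimes>\<^bsub>L\<^esub> \<iota> \<one>)"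
    using ab by (simp add: L.mul_assoc e_\<iota>_e \<iota>_mul \<iota>_one)
  show "E (p (e \<otimes>\<^bsub>L\<^esub> (\<iota> a \<otimes>\<^bsub>L\<^esub> (e \<otimes>\<^bsub>L\<^esub> \<iota> b)))) = E (p (\<iota> a \<otimes>\<^bsub>L\<^esub> (e \<otimes>\<^bsub>L\<^esub> \<iota> b) \<otimes>\<^bsub>L\<^esub> e))"
    unfolding 1 2 using ab by (simp add: p_e E_smult E_left E_right)
qed (auto simp: L.add_mul L.mul_add p_add E_add)

text \<open>By the push-down identities the elements \<open>\<tau>\<^bsup>-1/2\<^esup> l e\<close> form a quasi-basis of the dual expectation.\<close>

definition dual_basis :: "('a \<Rightarrow> 'a) set" where
  "dual_basis = (\<lambda>l. complex_of_real (1 / sqrt \<tau>) \<odot>\<^bsub>L\<^esub> (\<iota> l \<otimes>\<^bsub>L\<^esub> e)) ` \<Lambda>"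

lemma dual_basis_sum:
  assumes "\<And>l. l \<in> \<Lambda> \<Longrightarrow> g (complex_of_real (1 / sqrt \<tau>) \<odot>\<^bsub>L\<^esub> (\<iota> l \<otimes>\<^bsub>L\<^esub> e)) \<in> carrier L"
  shows "(\<Oplus>\<^bsub>L\<^esub>m\<in>dual_basis. g m) = (\<Oplus>\<^bsub>L\<^esub>l\<in>\<Lambda>. g (complex_of_real (1 / sqrt \<tau>) \<odot>\<^bsub>L\<^esub> (\<iota> l \<otimes>\<^bsub>L\<^esub> e)))"
  unfolding dual_basis_def
proof (rule abelian_monoid.finsum_reindex[OF L.A_add_monoid])
  show "inj_on (\<lambda>l. complex_of_real (1 / sqrt \<tau>) \<odot>\<^bsub>L\<^esub> (\<iota> l \<otimes>\<^bsub>L\<^esub> e)) \<Lambda>"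
  proof (rule inj_onI)
    fix l m assume lm: "l \<in> \<Lambda>" "m \<in> \<Lambda>"
      and eq: "complex_of_real (1 / sqrt \<tau>) \<odot>\<^bsub>L\<^esub> (\<iota> l \<otimes>\<^bsub>L\<^esub> e) = complex_of_real (1 / sqrt \<tau>) \<odot>\<^bsub>L\<^esub> (\<iota> m \<otimes>\<^bsub>L\<^esub> e)"
    have "complex_of_real (sqrt \<tau>) \<odot>\<^bsub>L\<^esub> (complex_of_real (1 / sqrt \<tau>) \<odot>\<^bsub>L\<^esub> (\<iota> l \<otimes>\<^bsub>L\<^esub> e))
        = complex_of_real (sqrt \<tau>) \<odot>\<^bsub>L\<^esub> (complex_of_real (1 / sqrt \<tau>) \<odot>\<^bsub>L\<^esub> (\<iota> m \<otimes>\<^bsub>L\<^esub> e))"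
      unfolding eq ..
    then have "\<iota> l \<otimes>\<^bsub>L\<^esub> e = \<iota> m \<otimes>\<^bsub>L\<^esub> e" using lm \<tau>_pos by simp
    then have "(\<iota> l \<otimes>\<^bsub>L\<^esub> e) \<one> = (\<iota> m \<otimes>\<^bsub>L\<^esub> e) \<one>" by simp
    then show "l = m" using lm by (simp add: L_apply \<iota>_apply e_apply)
  qed
qed (use assms in auto)

lemma sqrt_\<tau>: "complex_of_real (1 / sqrt \<tau>) * complex_of_real (1 / sqrt \<tau>) = complex_of_real (1 / \<tau>)"
  unfolding of_real_mult[symmetric] using \<tau>_pos by simp

lemma dual_quasi_basis: "quasi_basis L E' dual_basis"
  unfolding quasi_basis_def
proof (intro conjI ballI)
  show "finite dual_basis" "dual_basis \<subseteq> carrier L" by (auto simp: dual_basis_def)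
  fix x assume x: "x \<in> carrier L"
  let ?c = "complex_of_real (1 / sqrt \<tau>)"
  have ct: "?c * (complex_of_real \<tau> * ?c) = 1" "?c * ?c * complex_of_real \<tau> = 1"
    using sqrt_\<tau> \<tau>_pos by (simp_all add: mult_ac)
  have cc: "cnj ?c = ?c" by simp
  have t1: "(?c \<odot>\<^bsub>L\<^esub> (\<iota> l \<otimes>\<^bsub>L\<^esub> e)) \<otimes>\<^bsub>L\<^esub> E' (star L (?c \<odot>\<^bsub>L\<^esub> (\<iota> l \<otimes>\<^bsub>L\<^esub> e)) \<otimes>\<^bsub>L\<^esub> x) = \<iota> l \<otimes>\<^bsub>L\<^esub> (e \<otimes>\<^bsub>L\<^esub> \<iota> (star A l)) \<otimes>\<^bsub>L\<^esub> x"
    if l: "l \<in> \<Lambda>" for l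
  proof -
    define y where "y = \<iota> (star A l) \<otimes>\<^bsub>L\<^esub> x"
    have y: "y \<in> carrier L" using l x by (simp add: y_def)
    have "star L (?c \<odot>\<^bsub>L\<^esub> (\<iota> l \<otimes>\<^bsub>L\<^esub> e)) \<otimes>\<^bsub>L\<^esub> x = ?c \<odot>\<^bsub>L\<^esub> (e \<otimes>\<^bsub>L\<^esub> y)"
      using l x by (simp add: L.star_simps \<iota>_star e_star L.smult_mult_left y_def L.mul_assoc)
    then have "E' (star L (?c \<odot>\<^bsub>L\<^esub> (\<iota> l \<otimes>\<^bsub>L\<^esub> e)) \<otimes>\<^bsub>L\<^esub> x) = ?c \<odot>\<^bsub>L\<^esub> \<iota> (p (e \<otimes>\<^bsub>L\<^esub> y))"
      using y by (simp add: E'_p p_smult \<iota>_smult)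
    then have "(?c \<odot>\<^bsub>L\<^esub> (\<iota> l \<otimes>\<^bsub>L\<^esub> e)) \<otimes>\<^bsub>L\<^esub> E' (star L (?c \<odot>\<^bsub>L\<^esub> (\<iota> l \<otimes>\<^bsub>L\<^esub> e)) \<otimes>\<^bsub>L\<^esub> x)
      = (?c * ?c) \<odot>\<^bsub>L\<^esub> (\<iota> l \<otimes>\<^bsub>L\<^esub> (e \<otimes>\<^bsub>L\<^esub> \<iota> (p (e \<otimes>\<^bsub>L\<^esub> y))))"
      using l y by (simp add: L.smult_mult_left L.smult_mult_right L.mul_assoc)
    also have "\<dots> = (?c * ?c * complex_of_real \<tau>) \<odot>\<^bsub>L\<^esub> (\<iota> l \<otimes>\<^bsub>L\<^esub> (e \<otimes>\<^bsub>L\<^esub> y))"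
      unfolding pushdown_left[OF y] using l y by (simp add: L.smult_mult_right)
    also have "\<dots> = \<iota> l \<otimes>\<^bsub>L\<^esub> (e \<otimes>\<^bsub>L\<^esub> y)" unfolding ct using l y by simp
    finally show ?thesis using l x by (simp add: y_def L.mul_assoc)
  qed
  have "(\<Oplus>\<^bsub>L\<^esub>m\<in>dual_basis. m \<otimes>\<^bsub>L\<^esub> E' (star L m \<otimes>\<^bsub>L\<^esub> x)) = (\<Oplus>\<^bsub>L\<^esub>l\<in>\<Lambda>. \<iota> l \<otimes>\<^bsub>L\<^esub> (e \<otimes>\<^bsub>L\<^esub> \<iota> (star A l)) \<otimes>\<^bsub>L\<^esub> x)"
    using x by (subst dual_basis_sum) (auto simp: t1 simp del: of_real_divide intro!: L.fsum_eq)
  also have "\<dots> = \<one>\<^bsub>L\<^esub> \<otimes>\<^bsub>L\<^esub> x"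
    unfolding unit_expansion using x by (intro L.fsum_mul(2)[symmetric]) auto
  finally show "x = (\<Oplus>\<^bsub>L\<^esub>m\<in>dual_basis. m \<otimes>\<^bsub>L\<^esub> E' (star L m \<otimes>\<^bsub>L\<^esub> x))" using x by simp
  have t2: "E' (x \<otimes>\<^bsub>L\<^esub> (?c \<odot>\<^bsub>L\<^esub> (\<iota> l \<otimes>\<^bsub>L\<^esub> e))) \<otimes>\<^bsub>L\<^esub> star L (?c \<odot>\<^bsub>L\<^esub> (\<iota> l \<otimes>\<^bsub>L\<^esub> e)) = x \<otimes>\<^bsub>L\<^esub> (\<iota> l \<otimes>\<^bsub>L\<^esub> (e \<otimes>\<^bsub>L\<^esub> \<iota> (star A l)))"
    if l: "l \<in> \<Lambda>" for l
  proof -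
    define y where "y = x \<otimes>\<^bsub>L\<^esub> \<iota> l"
    have y: "y \<in> carrier L" using l x by (simp add: y_def)
    have "x \<otimes>\<^bsub>L\<^esub> (?c \<odot>\<^bsub>L\<^esub> (\<iota> l \<otimes>\<^bsub>L\<^esub> e)) = ?c \<odot>\<^bsub>L\<^esub> (y \<otimes>\<^bsub>L\<^esub> e)"
      using l x by (simp add: L.smult_mult_right y_def L.mul_assoc)
    then have "E' (x \<otimes>\<^bsub>L\<^esub> (?c \<odot>\<^bsub>L\<^esub> (\<iota> l \<otimes>\<^bsub>L\<^esub> e))) = ?c \<odot>\<^bsub>L\<^esub> \<iota> (p (y \<otimes>\<^bsub>L\<^esub> e))"
      using y by (simp add: E'_p p_smult \<iota>_smult)
    moreover have "star L (?c \<odot>\<^bsub>L\<^esub> (\<iota> l \<otimes>\<^bsub>L\<^esub> e)) = ?c \<odot>\<^bsub>L\<^esub> (e \<otimes>\<^bsub>L\<^esub> \<iota> (star A l))"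
      using l by (simp add: L.star_simps \<iota>_star e_star)
    ultimately have "E' (x \<otimes>\<^bsub>L\<^esub> (?c \<odot>\<^bsub>L\<^esub> (\<iota> l \<otimes>\<^bsub>L\<^esub> e))) \<otimes>\<^bsub>L\<^esub> star L (?c \<odot>\<^bsub>L\<^esub> (\<iota> l \<otimes>\<^bsub>L\<^esub> e))
      = (?c * ?c) \<odot>\<^bsub>L\<^esub> ((\<iota> (p (y \<otimes>\<^bsub>L\<^esub> e)) \<otimes>\<^bsub>L\<^esub> e) \<otimes>\<^bsub>L\<^esub> \<iota> (star A l))"
      using l y by (simp add: L.smult_mult_left L.smult_mult_right L.mul_assoc)
    also have "\<dots> = (?c * ?c * complex_of_real \<tau>) \<odot>\<^bsub>L\<^esub> ((y \<otimes>\<^bsub>L\<^esub> e) \<otimes>\<^bsub>L\<^esub> \<iota> (star A l))"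
      unfolding pushdown_right[OF y] using l y by (simp add: L.smult_mult_left)
    also have "\<dots> = (y \<otimes>\<^bsub>L\<^esub> e) \<otimes>\<^bsub>L\<^esub> \<iota> (star A l)" unfolding ct using l y by simp
    finally show ?thesis using l x by (simp add: y_def L.mul_assoc)
  qed
  have "(\<Oplus>\<^bsub>L\<^esub>m\<in>dual_basis. E' (x \<otimes>\<^bsub>L\<^esub> m) \<otimes>\<^bsub>L\<^esub> star L m) = (\<Oplus>\<^bsub>L\<^esub>l\<in>\<Lambda>. x \<otimes>\<^bsub>L\<^esub> (\<iota> l \<otimes>\<^bsub>L\<^esub> (e \<otimes>\<^bsub>L\<^esub> \<iota> (star A l))))"
    using x by (subst dual_basis_sum) (auto simp: t2 simp del: of_real_divide intro!: L.fsum_eq)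
  also have "\<dots> = x \<otimes>\<^bsub>L\<^esub> \<one>\<^bsub>L\<^esub>"
    unfolding unit_expansion using x by (intro L.fsum_mul(1)[symmetric]) auto
  finally show "x = (\<Oplus>\<^bsub>L\<^esub>m\<in>dual_basis. E' (x \<otimes>\<^bsub>L\<^esub> m) \<otimes>\<^bsub>L\<^esub> star L m)" using x by simp
qed

theorem dual_finite_index: "finite_index L D E' dual_basis"
  by (rule finite_index.intro[OF adjointable_algebra_cstar
      finite_index_axioms.intro[OF L_nontrivial D_subring D_smult D_star E'_cond_exp dual_quasi_basis]])

text \<open>The index element is \<open>\<tau>\<^sup>-\<^sup>1 \<Sum> l e l\<^sup>*\<close>, a multiple of the unit; thus the second step of the tower has the
same index as the first.\<close>

lemma dual_scalar_index: "scalar_index L E' = 1 / \<tau>"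
proof -
  interpret dual: finite_index L D E' dual_basis by (rule dual_finite_index)
  let ?c = "complex_of_real (1 / sqrt \<tau>)"
  have "Ind L E' = (\<Oplus>\<^bsub>L\<^esub>l\<in>\<Lambda>. (?c \<odot>\<^bsub>L\<^esub> (\<iota> l \<otimes>\<^bsub>L\<^esub> e)) \<otimes>\<^bsub>L\<^esub> star L (?c \<odot>\<^bsub>L\<^esub> (\<iota> l \<otimes>\<^bsub>L\<^esub> e)))"
    unfolding dual.Ind_eq by (rule dual_basis_sum) simp
  also have "\<dots> = (\<Oplus>\<^bsub>L\<^esub>l\<in>\<Lambda>. complex_of_real (1 / \<tau>) \<odot>\<^bsub>L\<^esub> (\<iota> l \<otimes>\<^bsub>L\<^esub> (e \<otimes>\<^bsub>L\<^esub> \<iota> (star A l))))"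
  proof (rule L.fsum_eq)
    fix l assume l: "l \<in> \<Lambda>"
    have "(\<iota> l \<otimes>\<^bsub>L\<^esub> e) \<otimes>\<^bsub>L\<^esub> star L (\<iota> l \<otimes>\<^bsub>L\<^esub> e) = \<iota> l \<otimes>\<^bsub>L\<^esub> ((e \<otimes>\<^bsub>L\<^esub> e) \<otimes>\<^bsub>L\<^esub> \<iota> (star A l))"
      using l by (simp add: L.star_simps \<iota>_star e_star L.mul_assoc)
    then show "(?c \<odot>\<^bsub>L\<^esub> (\<iota> l \<otimes>\<^bsub>L\<^esub> e)) \<otimes>\<^bsub>L\<^esub> star L (?c \<odot>\<^bsub>L\<^esub> (\<iota> l \<otimes>\<^bsub>L\<^esub> e))
        = complex_of_real (1 / \<tau>) \<odot>\<^bsub>L\<^esub> (\<iota> l \<otimes>\<^bsub>L\<^esub> (e \<otimes>\<^bsub>L\<^esub> \<iota> (star A l)))"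
      using l sqrt_\<tau> by (simp add: L.star_smult L.smult_mult_left L.smult_mult_right e_idem)
  qed simp
  also have "\<dots> = complex_of_real (1 / \<tau>) \<odot>\<^bsub>L\<^esub> \<one>\<^bsub>L\<^esub>"
    unfolding unit_expansion by (intro L.fsum_smult[symmetric]) auto
  finally show ?thesis
    unfolding scalar_index_def using L.scalar_of_scalar[OF L_nontrivial] by simp
qed

end

section \<open>Two steps of the tower\<close>

locale jones_tower = dual_index A B E \<Lambda> E1 for A :: "'a cstar" (structure) and B E \<Lambda> E1 +
  fixes E2 :: "(('a \<Rightarrow> 'a) \<Rightarrow> ('a \<Rightarrow> 'a)) \<Rightarrow> (('a \<Rightarrow> 'a) \<Rightarrow> ('a \<Rightarrow> 'a))"
  assumes simple_A: "simple_cstar A" and simple_B: "simple_cstar (A\<lparr>carrier := B\<rparr>)"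
    and minimal: "minimal_exp A B E"
    and dual2: "dual_exp (adjointable_algebra A B E) (lmul A ` carrier A) E1 E2"
begin

sublocale two: dual_index "adjointable_algebra A B E" "lmul A ` carrier A" E1 dual_basis E2
  by (intro dual_index.intro dual_finite_index dual_index_axioms.intro dual2)

text \<open>In \<open>A\<^sub>2\<close>, the elements \<open>f1\<close> and \<open>f2\<close> are the two Jones projections and \<open>j\<close> is the embedding of \<open>A\<close>.\<close>

abbreviation R :: "(('a \<Rightarrow> 'a) \<Rightarrow> ('a \<Rightarrow> 'a)) cstar" where "R \<equiv> two.L"
abbreviation f1 :: "('a \<Rightarrow> 'a) \<Rightarrow> ('a \<Rightarrow> 'a)" where "f1 \<equiv> two.\<iota> e"
abbreviation f2 :: "('a \<Rightarrow> 'a) \<Rightarrow> ('a \<Rightarrow> 'a)" where "f2 \<equiv> two.e"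
abbreviation j :: "'a \<Rightarrow> (('a \<Rightarrow> 'a) \<Rightarrow> ('a \<Rightarrow> 'a))" where "j a \<equiv> two.\<iota> (\<iota> a)"

text \<open>The trace of \<open>B' \<inter> A\<^sub>2\<close>, extended to a \<open>B\<close>-valued map on all of \<open>A\<^sub>2\<close>.\<close>

definition \<phi> :: "(('a \<Rightarrow> 'a) \<Rightarrow> ('a \<Rightarrow> 'a)) \<Rightarrow> 'a" where "\<phi> w = E (p (two.p w))"

lemma two_\<tau>: "two.\<tau> = \<tau>"
  unfolding two.\<tau>_def dual_scalar_index using \<tau>_pos by simp

lemma j_mem [simp]: "a \<in> carrier A \<Longrightarrow> j a \<in> carrier R" by simp
lemma j_mul: "\<lbrakk>a \<in> carrier A; b \<in> carrier A\<rbrakk> \<Longrightarrow> j (a \<otimes> b) = j a \<otimes>\<^bsub>R\<^esub> j b"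
  by (simp add: \<iota>_mul two.\<iota>_mul)
lemma j_add: "\<lbrakk>a \<in> carrier A; b \<in> carrier A\<rbrakk> \<Longrightarrow> j (a \<oplus> b) = j a \<oplus>\<^bsub>R\<^esub> j b"
  by (simp add: \<iota>_add two.\<iota>_add)
lemma j_star: "a \<in> carrier A \<Longrightarrow> star R (j a) = j (star A a)"
  by (simp add: \<iota>_star two.\<iota>_star)

lemma \<phi>_B [simp]: "w \<in> carrier R \<Longrightarrow> \<phi> w \<in> B" by (simp add: \<phi>_def)
lemma \<phi>_add: "\<lbrakk>v \<in> carrier R; w \<in> carrier R\<rbrakk> \<Longrightarrow> \<phi> (v \<oplus>\<^bsub>R\<^esub> w) = \<phi> v \<oplus> \<phi> w"
  by (simp add: \<phi>_def two.p_add p_add E_add)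
lemma \<phi>_smult: "w \<in> carrier R \<Longrightarrow> \<phi> (c \<odot>\<^bsub>R\<^esub> w) = c \<odot> \<phi> w"
  by (simp add: \<phi>_def two.p_smult p_smult E_smult)
lemma \<phi>_left: "\<lbrakk>w \<in> carrier R; b \<in> B\<rbrakk> \<Longrightarrow> \<phi> (j b \<otimes>\<^bsub>R\<^esub> w) = b \<otimes> \<phi> w"
  by (simp add: \<phi>_def two.p_left p_left E_left)
lemma \<phi>_right: "\<lbrakk>w \<in> carrier R; b \<in> B\<rbrakk> \<Longrightarrow> \<phi> (w \<otimes>\<^bsub>R\<^esub> j b) = \<phi> w \<otimes> b"
  by (simp add: \<phi>_def two.p_right p_right E_right)

lemma \<phi>_positive:
  assumes "w \<in> carrier R"
  obtains b where "b \<in> B" "\<phi> (star R w \<otimes>\<^bsub>R\<^esub> w) = star A b \<otimes> b"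
proof -
  obtain z where z: "z \<in> carrier L" "two.p (star R w \<otimes>\<^bsub>R\<^esub> w) = star L z \<otimes>\<^bsub>L\<^esub> z"
    using two.p_positive[OF assms] by blast
  obtain a where a: "a \<in> carrier A" "p (star L z \<otimes>\<^bsub>L\<^esub> z) = star A a \<otimes> a"
    using p_positive[OF z(1)] by blast
  obtain b where "b \<in> B" "E (star A a \<otimes> a) = star A b \<otimes> b" using E_positive[OF a(1)] by blast
  then show thesis using that z(2) a(2) by (simp add: \<phi>_def)
qed

lemma \<phi>_f1: "w \<in> carrier R \<Longrightarrow> \<phi> (f1 \<otimes>\<^bsub>R\<^esub> w) = \<phi> (w \<otimes>\<^bsub>R\<^esub> f1)"
  using E_p_commute[of "two.p w"] by (simp add: \<phi>_def two.p_left two.p_right)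

lemma \<phi>_f2: "w \<in> carrier R \<Longrightarrow> \<phi> (f2 \<otimes>\<^bsub>R\<^esub> w) = \<phi> (w \<otimes>\<^bsub>R\<^esub> f2)"
proof -
  assume w: "w \<in> carrier R"
  have "p (two.p (f2 \<otimes>\<^bsub>R\<^esub> w)) = p (two.p (w \<otimes>\<^bsub>R\<^esub> f2))"
    unfolding p_def using two.E_p_commute[OF w] by simp
  then show ?thesis by (simp add: \<phi>_def)
qed

lemma f2_f1_f2: "f2 \<otimes>\<^bsub>R\<^esub> (f1 \<otimes>\<^bsub>R\<^esub> f2) = complex_of_real \<tau> \<odot>\<^bsub>R\<^esub> f2"
proof -
  have "f2 \<otimes>\<^bsub>R\<^esub> (f1 \<otimes>\<^bsub>R\<^esub> f2) = two.\<iota> (E1 e) \<otimes>\<^bsub>R\<^esub> f2" by (rule two.e_\<iota>_e) simp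
  also have "E1 e = complex_of_real \<tau> \<odot>\<^bsub>L\<^esub> \<one>\<^bsub>L\<^esub>" by (simp add: E'_p p_of_e \<iota>_smult \<iota>_one)
  finally show ?thesis by (simp add: two.\<iota>_smult two.\<iota>_one two.L.smult_mult_left)
qed

text \<open>As an operator on \<open>A\<^sub>1\<close> the left-hand side is \<open>z \<mapsto> e\<^sub>1 E\<^sub>1(e\<^sub>1 z)\<close>, so this is the push-down identity one
level lower.\<close>

lemma f1_f2_f1: "f1 \<otimes>\<^bsub>R\<^esub> (f2 \<otimes>\<^bsub>R\<^esub> f1) = complex_of_real \<tau> \<odot>\<^bsub>R\<^esub> f1"
proof (rule two.L_eqI)
  fix z assume z: "z \<in> carrier L"
  have "(f1 \<otimes>\<^bsub>R\<^esub> (f2 \<otimes>\<^bsub>R\<^esub> f1)) z = e \<otimes>\<^bsub>L\<^esub> \<iota> (p (e \<otimes>\<^bsub>L\<^esub> z))"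
    using z by (simp add: two.L_apply two.\<iota>_apply two.e_apply E'_p)
  also have "\<dots> = complex_of_real \<tau> \<odot>\<^bsub>L\<^esub> (e \<otimes>\<^bsub>L\<^esub> z)" by (rule pushdown_left[OF z])
  also have "\<dots> = (complex_of_real \<tau> \<odot>\<^bsub>R\<^esub> f1) z" using z by (simp add: two.L_apply two.\<iota>_apply)
  finally show "(f1 \<otimes>\<^bsub>R\<^esub> (f2 \<otimes>\<^bsub>R\<^esub> f1)) z = (complex_of_real \<tau> \<odot>\<^bsub>R\<^esub> f1) z" .
qed simp_all

lemma f2_j: "a \<in> carrier A \<Longrightarrow> f2 \<otimes>\<^bsub>R\<^esub> j a = j a \<otimes>\<^bsub>R\<^esub> f2"
  by (rule two.e_\<iota>_B) simp

lemma f1_j: "b \<in> B \<Longrightarrow> f1 \<otimes>\<^bsub>R\<^esub> j b = j b \<otimes>\<^bsub>R\<^esub> f1"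
  using e_\<iota>_B[of b] by (simp flip: two.\<iota>_mul)

section \<open>Faithfulness\<close>

lemma dual_two: "finite_index R two.D E2 two.dual_basis"
  by (rule two.dual_finite_index)

text \<open>Multiplying \<open>v\<close> on the right by elements of \<open>A\<close> and then of \<open>A\<^sub>1\<close> peels off the three expectations
one after the other.\<close>

lemma \<phi>_nondegenerate:
  assumes w: "w \<in> carrier R" and 0: "\<And>v. v \<in> carrier R \<Longrightarrow> \<phi> (star R w \<otimes>\<^bsub>R\<^esub> v) = \<zero>"
  shows "w = \<zero>\<^bsub>R\<^esub>"
proof -
  interpret three: finite_index R two.D E2 two.dual_basis by (rule dual_two)
  have 1: "p (two.p (star R w \<otimes>\<^bsub>R\<^esub> v)) = \<zero>" if v: "v \<in> carrier R" for v
  proof -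
    define u where "u = p (two.p (star R w \<otimes>\<^bsub>R\<^esub> v))"
    have u: "u \<in> carrier A" using v w by (simp add: u_def)
    have "E (u \<otimes> a) = \<zero>" if a: "a \<in> carrier A" for a
    proof -
      have "\<phi> (star R w \<otimes>\<^bsub>R\<^esub> (v \<otimes>\<^bsub>R\<^esub> j a)) = \<zero>" using 0 v a by simp
      moreover have "two.p (star R w \<otimes>\<^bsub>R\<^esub> (v \<otimes>\<^bsub>R\<^esub> j a)) = two.p (star R w \<otimes>\<^bsub>R\<^esub> v) \<otimes>\<^bsub>L\<^esub> \<iota> a"
        using w v a by (simp add: two.p_right flip: two.L.mul_assoc)
      ultimately show ?thesis using w v a by (simp add: \<phi>_def p_right u_def)
    qed
    then have "E (star A z \<otimes> star A u) = E (star A z \<otimes> \<zero>)" if "z \<in> carrier A" for z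
      using that u E_star[of "u \<otimes> z"] E_smult[of \<zero> 0] ring.ring_simprules(25)[OF A_ring] by (simp add: star_mult)
    then have "star A u = \<zero>" by (rule E_nondegenerate[rotated 2]) (use u in auto)
    then have "star A (star A u) = \<zero>" by simp
    then show ?thesis using u by (simp add: u_def)
  qed
  have 2: "two.p (star R w \<otimes>\<^bsub>R\<^esub> v) = \<zero>\<^bsub>L\<^esub>" if v: "v \<in> carrier R" for v
  proof -
    define u where "u = two.p (star R w \<otimes>\<^bsub>R\<^esub> v)"
    have u: "u \<in> carrier L" using v w by (simp add: u_def)
    have "E1 (u \<otimes>\<^bsub>L\<^esub> a) = \<zero>\<^bsub>L\<^esub>" if a: "a \<in> carrier L" for a
    proof -
      have "two.p (star R w \<otimes>\<^bsub>R\<^esub> (v \<otimes>\<^bsub>R\<^esub> two.\<iota> a)) = u \<otimes>\<^bsub>L\<^esub> a"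
        using w v a by (simp add: two.p_right u_def flip: two.L.mul_assoc)
      then have "p (u \<otimes>\<^bsub>L\<^esub> a) = \<zero>" using 1[of "v \<otimes>\<^bsub>R\<^esub> two.\<iota> a"] v a by simp
      then show ?thesis using u a \<iota>_smult[of \<zero> 0] by (simp add: E'_p)
    qed
    then have "E1 (star L z \<otimes>\<^bsub>L\<^esub> star L u) = E1 (star L z \<otimes>\<^bsub>L\<^esub> \<zero>\<^bsub>L\<^esub>)" if "z \<in> carrier L" for z
      using that u two.E_star[of "u \<otimes>\<^bsub>L\<^esub> z"] ring.ring_simprules(25)[OF L_ring] two.E_smult[of "\<zero>\<^bsub>L\<^esub>" 0]
      by (simp add: L.star_mult)
    then have "star L u = \<zero>\<^bsub>L\<^esub>" by (rule two.E_nondegenerate[rotated 2]) (use u in auto)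
    then have "star L (star L u) = \<zero>\<^bsub>L\<^esub>" by simp
    then show ?thesis using u by (simp add: u_def)
  qed
  have "E2 (star R z \<otimes>\<^bsub>R\<^esub> w) = E2 (star R z \<otimes>\<^bsub>R\<^esub> \<zero>\<^bsub>R\<^esub>)" if z: "z \<in> carrier R" for z
  proof -
    have "E2 (star R w \<otimes>\<^bsub>R\<^esub> z) = \<zero>\<^bsub>R\<^esub>"
      using 2[OF z] w z two.\<iota>_smult[of "\<zero>\<^bsub>L\<^esub>" 0] by (simp add: two.E'_p)
    then have "star R (E2 (star R w \<otimes>\<^bsub>R\<^esub> z)) = \<zero>\<^bsub>R\<^esub>" by simp
    then show ?thesis
      using w z three.E_star[of "star R w \<otimes>\<^bsub>R\<^esub> z"] ring.ring_simprules(25)[OF two.L_ring] three.E_smult[of "\<zero>\<^bsub>R\<^esub>" 0]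
      by (simp add: two.L.star_mult)
  qed
  then show ?thesis by (rule three.E_nondegenerate[rotated 2]) (use w in auto)
qed

text \<open>If \<open>\<phi>(w\<^sup>*w) = 0\<close> and \<open>\<beta> = \<phi>(w\<^sup>*v)\<close>, then positivity of \<open>\<phi>\<close> at \<open>w - s v \<beta>\<^sup>*\<close> gives
  \<open>2 \<beta>\<beta>\<^sup>* \<le> s \<gamma>\<close> for all \<open>s > 0\<close>, with \<open>\<gamma>\<close> fixed.\<close>

lemma \<phi>_faithful:
  assumes w: "w \<in> carrier R" and 0: "\<phi> (star R w \<otimes>\<^bsub>R\<^esub> w) = \<zero>"
  shows "w = \<zero>\<^bsub>R\<^esub>"
proof (rule \<phi>_nondegenerate[OF w])
  fix v assume v: "v \<in> carrier R"
  define \<beta> where "\<beta> = \<phi> (star R w \<otimes>\<^bsub>R\<^esub> v)"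
  have \<beta>: "\<beta> \<in> B" "\<beta> \<in> carrier A" "star A \<beta> \<in> B" using w v B_star by (auto simp: \<beta>_def)
  have \<phi>_star: "\<phi> (star R u) = star A (\<phi> u)" if "u \<in> carrier R" for u
  proof -
    interpret three: finite_index R two.D E2 two.dual_basis by (rule dual_two)
    have "two.\<iota> (two.p (star R u)) = two.\<iota> (star L (two.p u))"
      using three.E_star[OF that] that by (simp add: two.E'_p two.\<iota>_star)
    then have 1: "two.p (star R u) = star L (two.p u)"
      using two.\<iota>_inj that by (simp add: inj_on_eq_iff)
    have "\<iota> (p (star L y)) = \<iota> (star A (p y))" if "y \<in> carrier L" for y
      using two.E_star[OF that] that by (simp add: E'_p \<iota>_star)
    then have "p (star L (two.p u)) = star A (p (two.p u))"
      using \<iota>_inj that by (simp add: inj_on_eq_iff)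
    then show ?thesis using that by (simp add: \<phi>_def 1 E_star)
  qed
  define y where "y = v \<otimes>\<^bsub>R\<^esub> j (star A \<beta>)"
  have y: "y \<in> carrier R" using v \<beta> by (simp add: y_def)
  have wy: "\<phi> (star R w \<otimes>\<^bsub>R\<^esub> y) = \<beta> \<otimes> star A \<beta>"
    using \<phi>_right[of "star R w \<otimes>\<^bsub>R\<^esub> v" "star A \<beta>"] w v \<beta> by (simp add: y_def \<beta>_def two.L.mul_assoc)
  have yw: "\<phi> (star R y \<otimes>\<^bsub>R\<^esub> w) = \<beta> \<otimes> star A \<beta>"
    using \<phi>_star[of "star R w \<otimes>\<^bsub>R\<^esub> y"] w y wy \<beta> by (simp add: two.L.star_mult star_mult)
  define \<gamma> where "\<gamma> = \<phi> (star R y \<otimes>\<^bsub>R\<^esub> y)"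
  have \<gamma>: "\<gamma> \<in> carrier A" using y by (simp add: \<gamma>_def)
  have bound: "(nrm A \<beta>)\<^sup>2 \<le> s / 2 * nrm A \<gamma>" if s: "s > 0" for s
  proof -
    define u where "u = w \<oplus>\<^bsub>R\<^esub> (- complex_of_real s) \<odot>\<^bsub>R\<^esub> y"
    have u: "u \<in> carrier R" using w y by (simp add: u_def)
    have "star R u \<otimes>\<^bsub>R\<^esub> u = (star R w \<otimes>\<^bsub>R\<^esub> w \<oplus>\<^bsub>R\<^esub> (- complex_of_real s) \<odot>\<^bsub>R\<^esub> (star R w \<otimes>\<^bsub>R\<^esub> y)) \<oplus>\<^bsub>R\<^esub>
       ((- complex_of_real s) \<odot>\<^bsub>R\<^esub> (star R y \<otimes>\<^bsub>R\<^esub> w) \<oplus>\<^bsub>R\<^esub> complex_of_real (s * s) \<odot>\<^bsub>R\<^esub> (star R y \<otimes>\<^bsub>R\<^esub> y))"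
      using w y by (simp add: u_def two.L.star_simps two.L.alg_simps two.L.add_ac)
    then have "\<phi> (star R u \<otimes>\<^bsub>R\<^esub> u) = (\<zero> \<oplus> (- complex_of_real s) \<odot> (\<beta> \<otimes> star A \<beta>)) \<oplus>
       ((- complex_of_real s) \<odot> (\<beta> \<otimes> star A \<beta>) \<oplus> complex_of_real (s * s) \<odot> \<gamma>)"
      using w y by (simp add: \<phi>_add \<phi>_smult 0 wy yw \<gamma>_def)
    also have "\<dots> = ((- complex_of_real s) \<odot> (\<beta> \<otimes> star A \<beta>) \<oplus> (- complex_of_real s) \<odot> (\<beta> \<otimes> star A \<beta>)) \<oplus> complex_of_real (s * s) \<odot> \<gamma>"
      using \<beta> \<gamma> by (simp add: add_assoc)
    also have "\<dots> = (- 2 * complex_of_real s) \<odot> (\<beta> \<otimes> star A \<beta>) \<oplus> complex_of_real (s * s) \<odot> \<gamma>"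
      using \<beta> \<gamma> by (simp add: scalar_collect)
    finally have eq: "\<phi> (star R u \<otimes>\<^bsub>R\<^esub> u) = (- 2 * complex_of_real s) \<odot> (\<beta> \<otimes> star A \<beta>) \<oplus> complex_of_real (s * s) \<odot> \<gamma>" .
    obtain b where b: "b \<in> B" "\<phi> (star R u \<otimes>\<^bsub>R\<^esub> u) = star A b \<otimes> b" using \<phi>_positive[OF u] by blast
    have "spec_nonneg (\<phi> (star R u \<otimes>\<^bsub>R\<^esub> u))"
      unfolding b(2) using b(1) by (intro spec_nonneg_star_mult nontrivial) auto
    then have pos: "spec_nonneg (complex_of_real (1 / (2 * s)) \<odot> \<phi> (star R u \<otimes>\<^bsub>R\<^esub> u))"
      using s by (intro spec_nonneg_scale) auto
    have "star A (star A \<beta>) \<otimes> star A \<beta> \<oplus> complex_of_real (1 / (2 * s)) \<odot> \<phi> (star R u \<otimes>\<^bsub>R\<^esub> u)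
        = (\<beta> \<otimes> star A \<beta> \<oplus> (- 1) \<odot> (\<beta> \<otimes> star A \<beta>)) \<oplus> complex_of_real (s / 2) \<odot> \<gamma>"
      unfolding eq using \<beta> \<gamma> s by (simp add: scalar_distr add_assoc)
    also have "\<dots> = complex_of_real (s / 2) \<odot> \<gamma>" using \<beta> \<gamma> by (simp add: scalar_collect)
    finally show ?thesis
      using nrm_le_add_spec_nonneg[OF nontrivial _ pos, of "star A \<beta>"] \<beta> \<gamma> s by (simp add: nrm_smult norm_divide)
  qed
  have "(nrm A \<beta>)\<^sup>2 \<le> 0 * nrm A \<gamma>"
  proof (rule le_of_forall_gt_mult)
    show "(nrm A \<beta>)\<^sup>2 \<le> t * nrm A \<gamma>" if "t > 0" for t using bound[of "2 * t"] that by simp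
  qed (use \<gamma> nrm_nonneg in auto)
  then have "nrm A \<beta> = 0" by simp
  then show "\<phi> (star R w \<otimes>\<^bsub>R\<^esub> v) = \<zero>" using \<beta>(2) nrm_eq_0_iff by (simp add: \<beta>_def)
qed

section \<open>The relative commutants\<close>

abbreviation P1 :: "('a \<Rightarrow> 'a) set" where "P1 \<equiv> rel_commutant L (\<iota> ` B)"
abbreviation P2 :: "(('a \<Rightarrow> 'a) \<Rightarrow> ('a \<Rightarrow> 'a)) set" where "P2 \<equiv> rel_commutant R (two.\<iota> ` \<iota> ` B)"
abbreviation Q2 :: "(('a \<Rightarrow> 'a) \<Rightarrow> ('a \<Rightarrow> 'a)) set" where "Q2 \<equiv> rel_commutant R (two.\<iota> ` \<iota> ` carrier A)"

lemma P1D: "x \<in> P1 \<Longrightarrow> x \<in> carrier L" "\<lbrakk>x \<in> P1; b \<in> B\<rbrakk> \<Longrightarrow> x \<otimes>\<^bsub>L\<^esub> \<iota> b = \<iota> b \<otimes>\<^bsub>L\<^esub> x"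
  by (auto simp: rel_commutant_def)
lemma P1I: "\<lbrakk>x \<in> carrier L; \<And>b. b \<in> B \<Longrightarrow> x \<otimes>\<^bsub>L\<^esub> \<iota> b = \<iota> b \<otimes>\<^bsub>L\<^esub> x\<rbrakk> \<Longrightarrow> x \<in> P1"
  by (auto simp: rel_commutant_def)
lemma P2D: "x \<in> P2 \<Longrightarrow> x \<in> carrier R" "\<lbrakk>x \<in> P2; b \<in> B\<rbrakk> \<Longrightarrow> x \<otimes>\<^bsub>R\<^esub> j b = j b \<otimes>\<^bsub>R\<^esub> x"
  by (auto simp: rel_commutant_def)
lemma P2I: "\<lbrakk>x \<in> carrier R; \<And>b. b \<in> B \<Longrightarrow> x \<otimes>\<^bsub>R\<^esub> j b = j b \<otimes>\<^bsub>R\<^esub> x\<rbrakk> \<Longrightarrow> x \<in> P2"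
  by (auto simp: rel_commutant_def)
lemma Q2D: "x \<in> Q2 \<Longrightarrow> x \<in> carrier R" "\<lbrakk>x \<in> Q2; a \<in> carrier A\<rbrakk> \<Longrightarrow> x \<otimes>\<^bsub>R\<^esub> j a = j a \<otimes>\<^bsub>R\<^esub> x"
  by (auto simp: rel_commutant_def)
lemma Q2I: "\<lbrakk>x \<in> carrier R; \<And>a. a \<in> carrier A \<Longrightarrow> x \<otimes>\<^bsub>R\<^esub> j a = j a \<otimes>\<^bsub>R\<^esub> x\<rbrakk> \<Longrightarrow> x \<in> Q2"
  by (auto simp: rel_commutant_def)
lemma Q2_P2: "x \<in> Q2 \<Longrightarrow> x \<in> P2"
  by (rule P2I) (use Q2D in auto)

lemma commuting_mult:
  assumes C: "unital_cstar_algebra C" and c: "x \<in> carrier C" "y \<in> carrier C" "z \<in> carrier C"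
    and "x \<otimes>\<^bsub>C\<^esub> z = z \<otimes>\<^bsub>C\<^esub> x" "y \<otimes>\<^bsub>C\<^esub> z = z \<otimes>\<^bsub>C\<^esub> y"
  shows "(x \<otimes>\<^bsub>C\<^esub> y) \<otimes>\<^bsub>C\<^esub> z = z \<otimes>\<^bsub>C\<^esub> (x \<otimes>\<^bsub>C\<^esub> y)"
proof -
  interpret C: unital_cstar_algebra C by fact
  have "(x \<otimes>\<^bsub>C\<^esub> y) \<otimes>\<^bsub>C\<^esub> z = x \<otimes>\<^bsub>C\<^esub> (z \<otimes>\<^bsub>C\<^esub> y)" using assms by (simp add: C.mul_assoc)
  also have "\<dots> = (z \<otimes>\<^bsub>C\<^esub> x) \<otimes>\<^bsub>C\<^esub> y" using assms by (simp flip: C.mul_assoc)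
  finally show ?thesis using c by (simp add: C.mul_assoc)
qed

lemma P2_mult: "\<lbrakk>x \<in> P2; y \<in> P2\<rbrakk> \<Longrightarrow> x \<otimes>\<^bsub>R\<^esub> y \<in> P2"
  by (rule P2I) (use P2D commuting_mult[OF two.adjointable_algebra_cstar] in auto)
lemma Q2_mult: "\<lbrakk>x \<in> Q2; y \<in> Q2\<rbrakk> \<Longrightarrow> x \<otimes>\<^bsub>R\<^esub> y \<in> Q2"
  by (rule Q2I) (use Q2D commuting_mult[OF two.adjointable_algebra_cstar] in auto)
lemma Q2_add: "\<lbrakk>x \<in> Q2; y \<in> Q2\<rbrakk> \<Longrightarrow> x \<oplus>\<^bsub>R\<^esub> y \<in> Q2"
  by (rule Q2I) (use Q2D in \<open>auto simp: two.L.add_mul two.L.mul_add\<close>)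
lemma Q2_smult: "x \<in> Q2 \<Longrightarrow> c \<odot>\<^bsub>R\<^esub> x \<in> Q2"
  by (rule Q2I) (use Q2D in \<open>auto simp: two.L.smult_mult_left two.L.smult_mult_right\<close>)
lemma Q2_one: "\<one>\<^bsub>R\<^esub> \<in> Q2"
  by (rule Q2I) auto
lemma Q2_star: assumes x: "x \<in> Q2" shows "star R x \<in> Q2"
proof (rule Q2I)
  fix a assume a: "a \<in> carrier A"
  have "star R (x \<otimes>\<^bsub>R\<^esub> j (star A a)) = star R (j (star A a) \<otimes>\<^bsub>R\<^esub> x)" using Q2D(2)[OF x] a by simp
  then show "star R x \<otimes>\<^bsub>R\<^esub> j a = j a \<otimes>\<^bsub>R\<^esub> star R x" using Q2D(1)[OF x] a by (simp add: two.L.star_mult j_star)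
qed (use Q2D(1)[OF x] in simp)

lemma f1_P2: "f1 \<in> P2" by (rule P2I) (simp_all add: f1_j)
lemma f2_P2: "f2 \<in> P2" by (rule P2I) (simp_all add: f2_j)
lemma P1_P2: "x \<in> P1 \<Longrightarrow> two.\<iota> x \<in> P2"
  by (rule P2I) (use P1D in \<open>auto simp flip: two.\<iota>_mul\<close>)

lemma \<phi>_P2_scalar:
  assumes z: "z \<in> P2"
  obtains c where "\<phi> z = c \<odot> \<one>"
proof -
  have "\<phi> z \<otimes> b = b \<otimes> \<phi> z" if b: "b \<in> B" for b
    using P2D[OF z] b by (simp flip: \<phi>_left \<phi>_right)
  then show thesis
    using centre_of_simple[OF B_subring B_smult nontrivial simple_B B_star, of "\<phi> z"] P2D(1)[OF z] that
    by (metis \<phi>_B)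
qed

text \<open>Minimality enters here. With \<open>d = E\<^sub>2(c)\<close> and \<open>x = E\<^sub>1(d e\<^sub>1)\<close>, the expansion of the unit gives
  \<open>E\<^sub>1(d) = \<Sum> l x l\<^sup>*\<close>, which is \<open>\<tau>\<^sup>-\<^sup>1 E(x)\<close>.\<close>

lemma \<phi>_mult_f1:
  assumes c: "c \<in> Q2"
  shows "\<phi> (c \<otimes>\<^bsub>R\<^esub> f1) = complex_of_real \<tau> \<odot> \<phi> c"
proof -
  have cR: "c \<in> carrier R" using Q2D(1)[OF c] .
  define d where "d = two.p c"
  have d: "d \<in> carrier L" using cR by (simp add: d_def)
  have dA: "d \<otimes>\<^bsub>L\<^esub> \<iota> a = \<iota> a \<otimes>\<^bsub>L\<^esub> d" if "a \<in> carrier A" for a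
    using Q2D(2)[OF c that] that cR by (simp add: d_def flip: two.p_left two.p_right)
  define x where "x = p (d \<otimes>\<^bsub>L\<^esub> e)"
  have xc: "x \<in> carrier A" using d by (simp add: x_def)
  have "x \<in> commutant"
  proof (rule commutantI[OF xc])
    fix b assume b: "b \<in> B"
    have "(d \<otimes>\<^bsub>L\<^esub> e) \<otimes>\<^bsub>L\<^esub> \<iota> b = \<iota> b \<otimes>\<^bsub>L\<^esub> (d \<otimes>\<^bsub>L\<^esub> e)"
      using commuting_mult[OF adjointable_algebra_cstar d e_mem, of "\<iota> b"] dA b e_\<iota>_B by simp
    then show "x \<otimes> b = b \<otimes> x" unfolding x_def using d b by (simp flip: p_left p_right)
  qed
  then have "Phi x = complex_of_real (scalar_index A E) \<odot> E x"
    using minimal_expectation_Phi[OF simple_A simple_B minimal] by blast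
  moreover have "Phi x = p d"
  proof -
    have "Phi x = (\<Oplus>l\<in>\<Lambda>. p (d \<otimes>\<^bsub>L\<^esub> (\<iota> l \<otimes>\<^bsub>L\<^esub> (e \<otimes>\<^bsub>L\<^esub> \<iota> (star A l)))))"
      unfolding Phi_def
    proof (rule fsum_eq)
      fix l assume l: "l \<in> \<Lambda>"
      have "d \<otimes>\<^bsub>L\<^esub> (\<iota> l \<otimes>\<^bsub>L\<^esub> (e \<otimes>\<^bsub>L\<^esub> \<iota> (star A l))) = (d \<otimes>\<^bsub>L\<^esub> \<iota> l) \<otimes>\<^bsub>L\<^esub> (e \<otimes>\<^bsub>L\<^esub> \<iota> (star A l))"
        using d l by (simp add: L.mul_assoc)
      also have "\<dots> = \<iota> l \<otimes>\<^bsub>L\<^esub> ((d \<otimes>\<^bsub>L\<^esub> e) \<otimes>\<^bsub>L\<^esub> \<iota> (star A l))"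
        using dA[of l] d l by (simp add: L.mul_assoc)
      finally show "l \<otimes> (x \<otimes> star A l) = p (d \<otimes>\<^bsub>L\<^esub> (\<iota> l \<otimes>\<^bsub>L\<^esub> (e \<otimes>\<^bsub>L\<^esub> \<iota> (star A l))))"
        using d l by (simp add: p_left p_right x_def)
    qed (use d in simp)
    also have "\<dots> = p (\<Oplus>\<^bsub>L\<^esub>l\<in>\<Lambda>. d \<otimes>\<^bsub>L\<^esub> (\<iota> l \<otimes>\<^bsub>L\<^esub> (e \<otimes>\<^bsub>L\<^esub> \<iota> (star A l))))"
      using d by (intro p_fsum[symmetric]) auto
    also have "(\<Oplus>\<^bsub>L\<^esub>l\<in>\<Lambda>. d \<otimes>\<^bsub>L\<^esub> (\<iota> l \<otimes>\<^bsub>L\<^esub> (e \<otimes>\<^bsub>L\<^esub> \<iota> (star A l)))) = d \<otimes>\<^bsub>L\<^esub> \<one>\<^bsub>L\<^esub>"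
      unfolding unit_expansion using d by (intro L.fsum_mul(1)[symmetric]) auto
    finally show ?thesis using d by simp
  qed
  ultimately have pd: "p d = complex_of_real (1 / \<tau>) \<odot> E x" by (simp add: \<tau>_def)
  have "\<phi> c = complex_of_real (1 / \<tau>) \<odot> E x"
    using xc by (simp add: \<phi>_def d_def[symmetric] pd E_smult)
  moreover have "\<phi> (c \<otimes>\<^bsub>R\<^esub> f1) = E x"
    using cR by (simp add: \<phi>_def two.p_right x_def d_def)
  ultimately show ?thesis using xc \<tau>_pos by simp
qed

section \<open>The Fourier transform\<close>

text \<open>The inverse Fourier transform without its scalar factor.\<close>

definition raw_inverse :: "(('a \<Rightarrow> 'a) \<Rightarrow> ('a \<Rightarrow> 'a)) \<Rightarrow> ('a \<Rightarrow> 'a)" where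
  "raw_inverse w = two.p (w \<otimes>\<^bsub>R\<^esub> f1 \<otimes>\<^bsub>R\<^esub> f2)"

lemma raw_inverse_P1: assumes w: "w \<in> Q2" shows "raw_inverse w \<in> P1"
proof (rule P1I)
  have wc: "w \<in> carrier R" using Q2D(1)[OF w] .
  then show "raw_inverse w \<in> carrier L" by (simp add: raw_inverse_def)
  fix b assume b: "b \<in> B"
  have "w \<otimes>\<^bsub>R\<^esub> f1 \<otimes>\<^bsub>R\<^esub> f2 \<in> P2" using P2_mult[OF P2_mult[OF Q2_P2[OF w] f1_P2] f2_P2] .
  from P2D(2)[OF this b] show "raw_inverse w \<otimes>\<^bsub>L\<^esub> \<iota> b = \<iota> b \<otimes>\<^bsub>L\<^esub> raw_inverse w"
    unfolding raw_inverse_def using wc b by (simp flip: two.p_left two.p_right)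
qed

lemma raw_inverse_f2: "w \<in> carrier R \<Longrightarrow> two.\<iota> (raw_inverse w) \<otimes>\<^bsub>R\<^esub> f2 = complex_of_real \<tau> \<odot>\<^bsub>R\<^esub> (w \<otimes>\<^bsub>R\<^esub> f1 \<otimes>\<^bsub>R\<^esub> f2)"
  unfolding raw_inverse_def using two.pushdown_right[of "w \<otimes>\<^bsub>R\<^esub> f1"] by (simp add: two_\<tau>)

lemma raw_inverse_f2_f1: assumes w: "w \<in> carrier R"
  shows "two.\<iota> (raw_inverse w) \<otimes>\<^bsub>R\<^esub> f2 \<otimes>\<^bsub>R\<^esub> f1 = complex_of_real (\<tau> * \<tau>) \<odot>\<^bsub>R\<^esub> (w \<otimes>\<^bsub>R\<^esub> f1)"
proof -
  have "two.\<iota> (raw_inverse w) \<otimes>\<^bsub>R\<^esub> f2 \<otimes>\<^bsub>R\<^esub> f1 = complex_of_real \<tau> \<odot>\<^bsub>R\<^esub> (w \<otimes>\<^bsub>R\<^esub> (f1 \<otimes>\<^bsub>R\<^esub> (f2 \<otimes>\<^bsub>R\<^esub> f1)))"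
    unfolding raw_inverse_f2[OF w] using w by (simp add: two.L.smult_mult_left two.L.mul_assoc)
  then show ?thesis unfolding f1_f2_f1 using w by (simp add: two.L.smult_mult_right)
qed

text \<open>With \<open>g\<close> the transform of \<open>w\<close> and \<open>u = w e\<^sub>1\<close>, push-down gives \<open>g e\<^sub>2 = \<tau> u e\<^sub>2\<close>. Comparing
\<open>e\<^sub>2 g\<^sup>*g e\<^sub>2 = E\<^sub>1(g\<^sup>*g) e\<^sub>2\<close> with \<open>\<tau>\<^sup>2 e\<^sub>2 u\<^sup>*u e\<^sub>2\<close> and moving \<open>e\<^sub>2\<close> and \<open>e\<^sub>1\<close> around under \<open>\<phi>\<close> leaves three
factors \<open>\<tau>\<close>.\<close>

lemma raw_inverse_norm:
  assumes w: "w \<in> Q2"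
  shows "E (p (star L (raw_inverse w) \<otimes>\<^bsub>L\<^esub> raw_inverse w)) = complex_of_real (\<tau> ^ 3) \<odot> \<phi> (star R w \<otimes>\<^bsub>R\<^esub> w)"
proof -
  have wc: "w \<in> carrier R" using Q2D(1)[OF w] .
  define g where "g = raw_inverse w"
  have g: "g \<in> carrier L" using wc by (simp add: g_def raw_inverse_def)
  define u where "u = w \<otimes>\<^bsub>R\<^esub> f1"
  have u: "u \<in> carrier R" using wc by (simp add: u_def)
  define y where "y = star R u \<otimes>\<^bsub>R\<^esub> u"
  have y: "y \<in> carrier R" using u by (simp add: y_def)
  have gf: "two.\<iota> g \<otimes>\<^bsub>R\<^esub> f2 = complex_of_real \<tau> \<odot>\<^bsub>R\<^esub> (u \<otimes>\<^bsub>R\<^esub> f2)"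
    unfolding g_def u_def by (rule raw_inverse_f2[OF wc])
  have "star R (two.\<iota> g \<otimes>\<^bsub>R\<^esub> f2) \<otimes>\<^bsub>R\<^esub> (two.\<iota> g \<otimes>\<^bsub>R\<^esub> f2) = f2 \<otimes>\<^bsub>R\<^esub> (two.\<iota> (star L g \<otimes>\<^bsub>L\<^esub> g) \<otimes>\<^bsub>R\<^esub> f2)"
    using g by (simp add: two.L.star_mult two.e_star two.\<iota>_star two.\<iota>_mul two.L.mul_assoc)
  also have "\<dots> = two.\<iota> (E1 (star L g \<otimes>\<^bsub>L\<^esub> g)) \<otimes>\<^bsub>R\<^esub> f2" using g by (intro two.e_\<iota>_e) simp
  also have "E1 (star L g \<otimes>\<^bsub>L\<^esub> g) = \<iota> (p (star L g \<otimes>\<^bsub>L\<^esub> g))" using g by (intro E'_p) simp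
  finally have 1: "star R (two.\<iota> g \<otimes>\<^bsub>R\<^esub> f2) \<otimes>\<^bsub>R\<^esub> (two.\<iota> g \<otimes>\<^bsub>R\<^esub> f2) = j (p (star L g \<otimes>\<^bsub>L\<^esub> g)) \<otimes>\<^bsub>R\<^esub> f2" .
  have 2: "star R (two.\<iota> g \<otimes>\<^bsub>R\<^esub> f2) \<otimes>\<^bsub>R\<^esub> (two.\<iota> g \<otimes>\<^bsub>R\<^esub> f2) = complex_of_real (\<tau> * \<tau>) \<odot>\<^bsub>R\<^esub> (f2 \<otimes>\<^bsub>R\<^esub> (y \<otimes>\<^bsub>R\<^esub> f2))"
    unfolding gf y_def using u
    by (simp add: two.L.star_simps two.e_star two.L.smult_mult_left two.L.smult_mult_right two.L.mul_assoc)
  define a where "a = p (star L g \<otimes>\<^bsub>L\<^esub> g)"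
  have a: "a \<in> carrier A" using g by (simp add: a_def)
  have "\<phi> (j a \<otimes>\<^bsub>R\<^esub> f2) = complex_of_real \<tau> \<odot> E a"
    using a by (simp add: \<phi>_def two.p_left two.p_of_e two_\<tau> L.smult_mult_right p_smult E_smult)
  then have "complex_of_real \<tau> \<odot> E a = complex_of_real (\<tau> * \<tau>) \<odot> \<phi> (f2 \<otimes>\<^bsub>R\<^esub> (y \<otimes>\<^bsub>R\<^esub> f2))"
  proof -
    have "complex_of_real \<tau> \<odot> E a = \<phi> (complex_of_real (\<tau> * \<tau>) \<odot>\<^bsub>R\<^esub> (f2 \<otimes>\<^bsub>R\<^esub> (y \<otimes>\<^bsub>R\<^esub> f2)))"
      using \<open>\<phi> (j a \<otimes>\<^bsub>R\<^esub> f2) = complex_of_real \<tau> \<odot> E a\<close> unfolding a_def 1[symmetric] 2 by (rule sym)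
    also have "\<dots> = complex_of_real (\<tau> * \<tau>) \<odot> \<phi> (f2 \<otimes>\<^bsub>R\<^esub> (y \<otimes>\<^bsub>R\<^esub> f2))"
      using y by (intro \<phi>_smult) simp
    finally show ?thesis .
  qed
  then have "complex_of_real (1 / \<tau>) \<odot> (complex_of_real \<tau> \<odot> E a) = complex_of_real (1 / \<tau>) \<odot> (complex_of_real (\<tau> * \<tau>) \<odot> \<phi> (f2 \<otimes>\<^bsub>R\<^esub> (y \<otimes>\<^bsub>R\<^esub> f2)))"
    by simp
  then have Ea: "E a = complex_of_real \<tau> \<odot> \<phi> (f2 \<otimes>\<^bsub>R\<^esub> (y \<otimes>\<^bsub>R\<^esub> f2))" using a y \<tau>_pos by simp
  define c where "c = star R w \<otimes>\<^bsub>R\<^esub> w"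
  have cQ: "c \<in> Q2" unfolding c_def using w Q2_star Q2_mult by blast
  have c: "c \<in> carrier R" using Q2D(1)[OF cQ] .
  have "\<phi> (f2 \<otimes>\<^bsub>R\<^esub> (y \<otimes>\<^bsub>R\<^esub> f2)) = \<phi> (y \<otimes>\<^bsub>R\<^esub> f2 \<otimes>\<^bsub>R\<^esub> f2)" using y by (intro \<phi>_f2) simp
  also have "y \<otimes>\<^bsub>R\<^esub> f2 \<otimes>\<^bsub>R\<^esub> f2 = f1 \<otimes>\<^bsub>R\<^esub> (c \<otimes>\<^bsub>R\<^esub> (f1 \<otimes>\<^bsub>R\<^esub> f2))"
    using wc by (simp add: y_def u_def c_def two.L.star_mult two.\<iota>_star e_star two.L.mul_assoc two.e_idem)
  also have "\<phi> \<dots> = \<phi> (c \<otimes>\<^bsub>R\<^esub> (f1 \<otimes>\<^bsub>R\<^esub> f2) \<otimes>\<^bsub>R\<^esub> f1)" using c by (intro \<phi>_f1) simp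
  also have "c \<otimes>\<^bsub>R\<^esub> (f1 \<otimes>\<^bsub>R\<^esub> f2) \<otimes>\<^bsub>R\<^esub> f1 = complex_of_real \<tau> \<odot>\<^bsub>R\<^esub> (c \<otimes>\<^bsub>R\<^esub> f1)"
    using c f1_f2_f1 by (simp add: two.L.mul_assoc two.L.smult_mult_right)
  also have "\<phi> \<dots> = complex_of_real (\<tau> * \<tau>) \<odot> \<phi> c" using c cQ by (simp add: \<phi>_smult \<phi>_mult_f1)
  finally have "E a = complex_of_real (\<tau> ^ 3) \<odot> \<phi> c" unfolding Ea using c by (simp add: power3_eq_cube mult_ac)
  then show ?thesis by (simp add: a_def g_def c_def)
qed

text \<open>A preimage of \<open>x\<close> under the inverse transform is, up to a scalar, \<open>\<Sum> l x e\<^sub>2 e\<^sub>1 l\<^sup>*\<close>.\<close>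

lemma raw_inverse_onto:
  assumes x: "x \<in> P1"
  obtains w where "w \<in> Q2" "raw_inverse w = x"
proof -
  have xc: "x \<in> carrier L" using P1D(1)[OF x] .
  define z where "z = two.\<iota> x \<otimes>\<^bsub>R\<^esub> (f2 \<otimes>\<^bsub>R\<^esub> f1)"
  have zP: "z \<in> P2" unfolding z_def using x by (intro P2_mult P1_P2 f1_P2 f2_P2)
  have z: "z \<in> carrier R" using P2D(1)[OF zP] .
  define w where "w = (\<Oplus>\<^bsub>R\<^esub>l\<in>\<Lambda>. j l \<otimes>\<^bsub>R\<^esub> (z \<otimes>\<^bsub>R\<^esub> j (star A l)))"
  have w: "w \<in> carrier R" using z by (simp add: w_def)
  have wQ: "w \<in> Q2"
  proof (rule Q2I[OF w])
    fix a assume a: "a \<in> carrier A"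
    show "w \<otimes>\<^bsub>R\<^esub> j a = j a \<otimes>\<^bsub>R\<^esub> w"
      unfolding w_def
      by (rule basis_conjugation_commutes[OF two.adjointable_algebra_cstar _ j_add j_mul z P2D(2)[OF zP] a, symmetric]) auto
  qed
  have "w \<otimes>\<^bsub>R\<^esub> f1 \<otimes>\<^bsub>R\<^esub> f2 = (\<Oplus>\<^bsub>R\<^esub>l\<in>\<Lambda>. (j l \<otimes>\<^bsub>R\<^esub> (z \<otimes>\<^bsub>R\<^esub> j (star A l))) \<otimes>\<^bsub>R\<^esub> (f1 \<otimes>\<^bsub>R\<^esub> f2))"
  proof -
    have "w \<otimes>\<^bsub>R\<^esub> f1 \<otimes>\<^bsub>R\<^esub> f2 = w \<otimes>\<^bsub>R\<^esub> (f1 \<otimes>\<^bsub>R\<^esub> f2)" using w by (simp add: two.L.mul_assoc)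
    also have "\<dots> = (\<Oplus>\<^bsub>R\<^esub>l\<in>\<Lambda>. (j l \<otimes>\<^bsub>R\<^esub> (z \<otimes>\<^bsub>R\<^esub> j (star A l))) \<otimes>\<^bsub>R\<^esub> (f1 \<otimes>\<^bsub>R\<^esub> f2))"
      unfolding w_def using z by (intro two.L.fsum_mul(2)) auto
    finally show ?thesis .
  qed
  also have "\<dots> = (\<Oplus>\<^bsub>R\<^esub>l\<in>\<Lambda>. complex_of_real \<tau> \<odot>\<^bsub>R\<^esub> (two.\<iota> (\<iota> (l \<otimes> E (star A l)) \<otimes>\<^bsub>L\<^esub> x) \<otimes>\<^bsub>R\<^esub> f2))"
  proof (rule two.L.fsum_eq)
    fix l assume l: "l \<in> \<Lambda>"
    have f: "f1 \<otimes>\<^bsub>R\<^esub> (j (star A l) \<otimes>\<^bsub>R\<^esub> f1) = j (E (star A l)) \<otimes>\<^bsub>R\<^esub> f1"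
      using l e_\<iota>_e[of "star A l"] by (simp flip: two.\<iota>_mul)
    have "(j l \<otimes>\<^bsub>R\<^esub> (z \<otimes>\<^bsub>R\<^esub> j (star A l))) \<otimes>\<^bsub>R\<^esub> (f1 \<otimes>\<^bsub>R\<^esub> f2)
        = j l \<otimes>\<^bsub>R\<^esub> (two.\<iota> x \<otimes>\<^bsub>R\<^esub> (f2 \<otimes>\<^bsub>R\<^esub> ((f1 \<otimes>\<^bsub>R\<^esub> (j (star A l) \<otimes>\<^bsub>R\<^esub> f1)) \<otimes>\<^bsub>R\<^esub> f2)))"
      using l xc by (simp add: z_def two.L.mul_assoc)
    also have "\<dots> = j l \<otimes>\<^bsub>R\<^esub> (two.\<iota> x \<otimes>\<^bsub>R\<^esub> ((f2 \<otimes>\<^bsub>R\<^esub> j (E (star A l))) \<otimes>\<^bsub>R\<^esub> (f1 \<otimes>\<^bsub>R\<^esub> f2)))"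
      unfolding f using l xc by (simp add: two.L.mul_assoc)
    also have "\<dots> = j l \<otimes>\<^bsub>R\<^esub> ((two.\<iota> x \<otimes>\<^bsub>R\<^esub> j (E (star A l))) \<otimes>\<^bsub>R\<^esub> (f2 \<otimes>\<^bsub>R\<^esub> (f1 \<otimes>\<^bsub>R\<^esub> f2)))"
      using f2_j[of "E (star A l)"] l xc by (simp add: two.L.mul_assoc)
    also have "two.\<iota> x \<otimes>\<^bsub>R\<^esub> j (E (star A l)) = j (E (star A l)) \<otimes>\<^bsub>R\<^esub> two.\<iota> x"
      using P2D(2)[OF P1_P2[OF x], of "E (star A l)"] l by simp
    finally show "(j l \<otimes>\<^bsub>R\<^esub> (z \<otimes>\<^bsub>R\<^esub> j (star A l))) \<otimes>\<^bsub>R\<^esub> (f1 \<otimes>\<^bsub>R\<^esub> f2)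
       = complex_of_real \<tau> \<odot>\<^bsub>R\<^esub> (two.\<iota> (\<iota> (l \<otimes> E (star A l)) \<otimes>\<^bsub>L\<^esub> x) \<otimes>\<^bsub>R\<^esub> f2)"
      using l xc by (simp add: f2_f1_f2 two.L.smult_mult_right two.\<iota>_mul \<iota>_mul two.L.mul_assoc)
  qed (use xc in simp)
  finally have "raw_inverse w = (\<Oplus>\<^bsub>L\<^esub>l\<in>\<Lambda>. two.p (complex_of_real \<tau> \<odot>\<^bsub>R\<^esub> (two.\<iota> (\<iota> (l \<otimes> E (star A l)) \<otimes>\<^bsub>L\<^esub> x) \<otimes>\<^bsub>R\<^esub> f2)))"
    unfolding raw_inverse_def using xc two.p_fsum[of \<Lambda>] by simp
  also have "\<dots> = (\<Oplus>\<^bsub>L\<^esub>l\<in>\<Lambda>. complex_of_real (\<tau> * \<tau>) \<odot>\<^bsub>L\<^esub> (\<iota> (l \<otimes> E (star A l)) \<otimes>\<^bsub>L\<^esub> x))"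
    using xc by (intro L.fsum_eq) (auto simp: two.p_smult two.p_left two.p_of_e two_\<tau> L.smult_mult_right)
  also have "\<dots> = complex_of_real (\<tau> * \<tau>) \<odot>\<^bsub>L\<^esub> (\<Oplus>\<^bsub>L\<^esub>l\<in>\<Lambda>. \<iota> (l \<otimes> E (star A l)) \<otimes>\<^bsub>L\<^esub> x)"
    using xc by (intro L.fsum_smult[symmetric]) auto
  also have "(\<Oplus>\<^bsub>L\<^esub>l\<in>\<Lambda>. \<iota> (l \<otimes> E (star A l)) \<otimes>\<^bsub>L\<^esub> x) = (\<Oplus>\<^bsub>L\<^esub>l\<in>\<Lambda>. \<iota> (l \<otimes> E (star A l))) \<otimes>\<^bsub>L\<^esub> x"
    using xc by (intro L.fsum_mul(2)[symmetric]) auto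
  also have "(\<Oplus>\<^bsub>L\<^esub>l\<in>\<Lambda>. \<iota> (l \<otimes> E (star A l))) = \<iota> (\<Oplus>l\<in>\<Lambda>. l \<otimes> E (star A l))"
    by (rule additive_map_finsum[OF A_group L_abelian_group, symmetric]) (auto simp: \<iota>_add)
  also have "(\<Oplus>l\<in>\<Lambda>. l \<otimes> E (star A l)) = \<one>" using basis_expansion[of \<one>] by (simp cong: fsum_eq)
  finally have Gw: "raw_inverse w = complex_of_real (\<tau> * \<tau>) \<odot>\<^bsub>L\<^esub> x" using xc by (simp add: \<iota>_one)
  define v where "v = complex_of_real (1 / (\<tau> * \<tau>)) \<odot>\<^bsub>R\<^esub> w"
  have "raw_inverse v = complex_of_real (1 / (\<tau> * \<tau>)) \<odot>\<^bsub>L\<^esub> raw_inverse w"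
    unfolding v_def raw_inverse_def using w by (simp add: two.L.smult_mult_left two.p_smult)
  then have "raw_inverse v = x" unfolding Gw using xc \<tau>_pos by simp
  then show thesis using that Q2_smult[OF wQ] by (auto simp: v_def)
qed

end

theorem theorem3p5:
  fixes A :: "'a cstar" and B :: "'a set" and E0 :: "'a \<Rightarrow> 'a" and \<tau> :: real
    and A1 :: "('a \<Rightarrow> 'a) cstar" and e1 :: "'a \<Rightarrow> 'a"
    and E1 :: "('a \<Rightarrow> 'a) \<Rightarrow> ('a \<Rightarrow> 'a)"
    and A2 :: "(('a \<Rightarrow> 'a) \<Rightarrow> ('a \<Rightarrow> 'a)) cstar" and e2 :: "('a \<Rightarrow> 'a) \<Rightarrow> ('a \<Rightarrow> 'a)"
    and E2 :: "(('a \<Rightarrow> 'a) \<Rightarrow> ('a \<Rightarrow> 'a)) \<Rightarrow> (('a \<Rightarrow> 'a) \<Rightarrow> ('a \<Rightarrow> 'a))"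
    and EC :: "(('a \<Rightarrow> 'a) \<Rightarrow> ('a \<Rightarrow> 'a)) \<Rightarrow> (('a \<Rightarrow> 'a) \<Rightarrow> ('a \<Rightarrow> 'a))"
    and tr1 :: "('a \<Rightarrow> 'a) \<Rightarrow> complex"
    and tr2 :: "(('a \<Rightarrow> 'a) \<Rightarrow> ('a \<Rightarrow> 'a)) \<Rightarrow> complex"
    and BA1 :: "('a \<Rightarrow> 'a) cstar" and BA2 AA2 :: "(('a \<Rightarrow> 'a) \<Rightarrow> ('a \<Rightarrow> 'a)) cstar"
    and F :: "('a \<Rightarrow> 'a) \<Rightarrow> (('a \<Rightarrow> 'a) \<Rightarrow> ('a \<Rightarrow> 'a))"
    and G :: "(('a \<Rightarrow> 'a) \<Rightarrow> ('a \<Rightarrow> 'a)) \<Rightarrow> ('a \<Rightarrow> 'a)"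
  assumes "unital_cstar_algebra A"
    and "cstar_subalgebra B A"
    and "simple_cstar A"
    and "simple_cstar (A\<lparr>carrier := B\<rparr>)"
    and "\<exists>E. finite_index_exp A B E"
    and "minimal_exp A B E0"
    and "\<tau> = 1 / scalar_index A E0"
    and "A1 = basic_construction A B E0"
    and "e1 = jones_proj A E0"
    and "dual_exp A B E0 E1"
    and "A2 = basic_construction A1 (lmul A ` carrier A) E1"
    and "e2 = jones_proj A1 E1"
    and "dual_exp A1 (lmul A ` carrier A) E1 E2"
    and "BA1 = A1\<lparr>carrier := rel_commutant A1 (lmul A ` B)\<rparr>"
    and "BA2 = A2\<lparr>carrier := rel_commutant A2 (lmul A1 ` lmul A ` B)\<rparr>"
    and "AA2 = A2\<lparr>carrier := rel_commutant A2 (lmul A1 ` lmul A ` carrier A)\<rparr>"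
    and "tr1 = (\<lambda>x. scalar_of A (E0 (lmul_inv A (E1 x))))"
    and "tr2 = (\<lambda>x. tr1 (lmul_inv A1 (E2 x)))"
    and "trace_preserving_exp BA2 (carrier AA2) tr2 EC"
    and "F = (\<lambda>x. complex_of_real (\<tau> powr (-3/2)) \<odot>\<^bsub>A2\<^esub>
               EC (lmul A1 x \<otimes>\<^bsub>A2\<^esub> e2 \<otimes>\<^bsub>A2\<^esub> lmul A1 e1))"
    and "G = (\<lambda>y. complex_of_real (\<tau> powr (-3/2)) \<odot>\<^bsub>A1\<^esub>
               lmul_inv A1 (E2 (y \<otimes>\<^bsub>A2\<^esub> lmul A1 e1 \<otimes>\<^bsub>A2\<^esub> e2)))"
  shows "linear_isometry BA1 (trace_norm A1 tr1) AA2 (trace_norm A2 tr2) F \<and>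
         linear_isometry AA2 (trace_norm A2 tr2) BA1 (trace_norm A1 tr1) G \<and>
         (\<forall>x\<in>carrier BA1. G (F x) = x) \<and> (\<forall>y\<in>carrier AA2. F (G y) = y)"
proof -
  interpret unital_cstar_algebra A by fact
  have "cond_exp A B E0" and qb: "\<exists>\<Lambda>. quasi_basis A E0 \<Lambda>"
    using \<open>minimal_exp A B E0\<close> by (auto simp: minimal_exp_def finite_index_exp_def)
  from qb obtain \<Lambda> where \<Lambda>: "quasi_basis A E0 \<Lambda>" ..
  have nt: "\<one>\<^bsub>A\<^esub> \<noteq> \<zero>\<^bsub>A\<^esub>"
  proof
    assume eq: "\<one>\<^bsub>A\<^esub> = \<zero>\<^bsub>A\<^esub>"
    have "x = \<zero>\<^bsub>A\<^esub>" if "x \<in> carrier A" for x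
    proof -
      have "x = \<one>\<^bsub>A\<^esub> \<otimes>\<^bsub>A\<^esub> x" using that by simp
      also have "\<dots> = \<zero>\<^bsub>A\<^esub>" unfolding eq using that ring.ring_simprules(24)[OF A_ring] by blast
      finally show ?thesis .
    qed
    then have "carrier A = {\<zero>\<^bsub>A\<^esub>}" using abelian_monoid.zero_closed[OF A_add_monoid] by blast
    then show False using \<open>simple_cstar A\<close> by (simp add: simple_cstar_def)
  qed
  have Bsub: "subring B A" "\<And>b c. b \<in> B \<Longrightarrow> c \<odot>\<^bsub>A\<^esub> b \<in> B" "\<And>b. b \<in> B \<Longrightarrow> star A b \<in> B"
    using \<open>cstar_subalgebra B A\<close> by (auto simp: cstar_subalgebra_def)
  have fi: "finite_index A B E0 \<Lambda>"
    by (rule finite_index.intro[OF unital_cstar_algebra_axioms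
          finite_index_axioms.intro[OF nt Bsub \<open>cond_exp A B E0\<close> \<Lambda>]])
  have A1: "A1 = adjointable_algebra A B E0"
    using finite_index.basic_construction_eq[OF fi] \<open>A1 = basic_construction A B E0\<close> by simp
  have di: "dual_index A B E0 \<Lambda> E1"
    by (rule dual_index.intro[OF fi dual_index_axioms.intro[OF \<open>dual_exp A B E0 E1\<close>]])
  have jt: "jones_tower A B E0 \<Lambda> E1 E2"
    using \<open>dual_exp A1 (lmul A ` carrier A) E1 E2\<close> unfolding A1
    by (intro jones_tower.intro[OF di] jones_tower_axioms.intro \<open>simple_cstar A\<close>
        \<open>simple_cstar (A\<lparr>carrier := B\<rparr>)\<close> \<open>minimal_exp A B E0\<close>)
  interpret T: jones_tower A B E0 \<Lambda> E1 E2 by (rule jt)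
  have A2: "A2 = T.R"
    using \<open>A2 = basic_construction A1 (lmul A ` carrier A) E1\<close> T.two.basic_construction_eq unfolding A1 by simp
  have e12: "e1 = T.e" "e2 = T.f2"
    using \<open>e1 = jones_proj A E0\<close> \<open>e2 = jones_proj A1 E1\<close> unfolding A1 by auto
  have \<tau>: "\<tau> = T.\<tau>" using \<open>\<tau> = 1 / scalar_index A E0\<close> by (simp add: T.\<tau>_def)
  have \<tau>0: "T.\<tau> > 0" by (rule T.\<tau>_pos)
  define k where "k = complex_of_real (T.\<tau> powr (-3/2))"
  have kk: "k * k = complex_of_real (1 / T.\<tau> ^ 3)"
  proof -
    have "T.\<tau> powr (-3/2) * T.\<tau> powr (-3/2) = T.\<tau> powr (- 3)" by (simp flip: powr_add)
    also have "\<dots> = 1 / T.\<tau> ^ 3" using \<tau>0 powr_realpow[of T.\<tau> 3] by (simp add: powr_minus divide_inverse)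
    finally show ?thesis unfolding k_def of_real_mult[symmetric] by simp
  qed
  have BA1: "BA1 = A1\<lparr>carrier := T.P1\<rparr>" and BA2: "BA2 = A2\<lparr>carrier := T.P2\<rparr>" and AA2: "AA2 = A2\<lparr>carrier := T.Q2\<rparr>"
    using assms(14-16) unfolding A1 A2 by auto
  have tr1: "tr1 x = scalar_of A (E0 (T.p x))" for x using assms(17) by (simp add: T.p_def)
  have tr2: "tr2 x = scalar_of A (T.\<phi> x)" for x using assms(18) tr1 unfolding A1 by (simp add: T.\<phi>_def T.two.p_def)
  have F: "F x = k \<odot>\<^bsub>T.R\<^esub> EC (T.two.\<iota> x \<otimes>\<^bsub>T.R\<^esub> T.f2 \<otimes>\<^bsub>T.R\<^esub> T.f1)" for x
    using assms(20) unfolding A1 A2 e12 \<tau> k_def by simp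
  have G: "G y = k \<odot>\<^bsub>T.L\<^esub> T.raw_inverse y" for y
    using assms(21) unfolding A1 A2 e12 \<tau> k_def T.raw_inverse_def T.two.p_def by simp
  have EC: "cond_exp (T.R\<lparr>carrier := T.P2\<rparr>) T.Q2 EC" "\<And>x. x \<in> T.P2 \<Longrightarrow> tr2 (EC x) = tr2 x"
    using assms(19) unfolding trace_preserving_exp_def BA2 AA2 A2 by auto
  have EC_Q: "EC x \<in> T.Q2" if "x \<in> T.P2" for x
    using EC(1) that by (auto simp: cond_exp_def)
  have EC_add: "EC (x \<oplus>\<^bsub>T.R\<^esub> y) = EC x \<oplus>\<^bsub>T.R\<^esub> EC y" if "x \<in> T.P2" "y \<in> T.P2" for x y
    using EC(1) that by (simp add: cond_exp_def linear_map_def)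
  have EC_smult: "EC (c \<odot>\<^bsub>T.R\<^esub> x) = c \<odot>\<^bsub>T.R\<^esub> EC x" if "x \<in> T.P2" for c x
    using EC(1) that by (simp add: cond_exp_def linear_map_def)
  have EC_left: "EC (a \<otimes>\<^bsub>T.R\<^esub> x) = a \<otimes>\<^bsub>T.R\<^esub> EC x" if x: "x \<in> T.P2" and a: "a \<in> T.Q2" for a x
  proof -
    have "EC (a \<otimes>\<^bsub>T.R\<^esub> x \<otimes>\<^bsub>T.R\<^esub> \<one>\<^bsub>T.R\<^esub>) = a \<otimes>\<^bsub>T.R\<^esub> EC x \<otimes>\<^bsub>T.R\<^esub> \<one>\<^bsub>T.R\<^esub>"
      using EC(1) x a T.Q2_one by (simp add: cond_exp_def)
    then show ?thesis using T.P2D(1)[OF x] T.Q2D(1)[OF a] T.Q2D(1)[OF EC_Q[OF x]] by simp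
  qed
  have \<phi>_EC: "T.\<phi> (EC x) = T.\<phi> x" if x: "x \<in> T.P2" for x
  proof -
    obtain c d where c: "T.\<phi> (EC x) = c \<odot>\<^bsub>A\<^esub> \<one>\<^bsub>A\<^esub>" and d: "T.\<phi> x = d \<odot>\<^bsub>A\<^esub> \<one>\<^bsub>A\<^esub>"
      using T.\<phi>_P2_scalar[OF x] T.\<phi>_P2_scalar[OF T.Q2_P2[OF EC_Q[OF x]]] by metis
    show ?thesis using EC(2)[OF x] scalar_of_scalar[OF nt] unfolding tr2 c d by simp
  qed
  \<comment> \<open>The difference \<open>c\<close> satisfies \<open>\<phi>(c\<^sup>*c) = \<phi>(EC(c\<^sup>*e\<^sub>1)) - \<tau> \<phi>(c\<^sup>*) = 0\<close>.\<close>
  have EC_f1: "EC T.f1 = complex_of_real T.\<tau> \<odot>\<^bsub>T.R\<^esub> \<one>\<^bsub>T.R\<^esub>"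
  proof -
    define c where "c = EC T.f1 \<oplus>\<^bsub>T.R\<^esub> (- complex_of_real T.\<tau>) \<odot>\<^bsub>T.R\<^esub> \<one>\<^bsub>T.R\<^esub>"
    have cQ: "c \<in> T.Q2" unfolding c_def by (intro T.Q2_add T.Q2_smult T.Q2_one EC_Q T.f1_P2)
    have E1c: "EC T.f1 \<in> carrier T.R" using T.Q2D(1)[OF EC_Q[OF T.f1_P2]] .
    have c: "c \<in> carrier T.R" "star T.R c \<in> T.Q2" "star T.R c \<in> carrier T.R"
      using T.Q2D(1)[OF cQ] T.Q2_star[OF cQ] by auto
    have "star T.R c \<otimes>\<^bsub>T.R\<^esub> c = EC (star T.R c \<otimes>\<^bsub>T.R\<^esub> T.f1) \<oplus>\<^bsub>T.R\<^esub> (- complex_of_real T.\<tau>) \<odot>\<^bsub>T.R\<^esub> star T.R c"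
      unfolding EC_left[OF T.f1_P2 c(2)] using c(3) E1c
      by (subst (2) c_def) (simp add: T.two.L.mul_add T.two.L.smult_mult_right)
    moreover have "T.\<phi> (EC (star T.R c \<otimes>\<^bsub>T.R\<^esub> T.f1)) = complex_of_real T.\<tau> \<odot>\<^bsub>A\<^esub> T.\<phi> (star T.R c)"
      using \<phi>_EC[OF T.P2_mult[OF T.Q2_P2[OF c(2)] T.f1_P2]] T.\<phi>_mult_f1[OF c(2)] by simp
    ultimately have "T.\<phi> (star T.R c \<otimes>\<^bsub>T.R\<^esub> c) = complex_of_real T.\<tau> \<odot>\<^bsub>A\<^esub> T.\<phi> (star T.R c)
        \<oplus>\<^bsub>A\<^esub> (- complex_of_real T.\<tau>) \<odot>\<^bsub>A\<^esub> T.\<phi> (star T.R c)"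
      using c(3) T.Q2D(1)[OF EC_Q[OF T.P2_mult[OF T.Q2_P2[OF c(2)] T.f1_P2]]] by (simp add: T.\<phi>_add T.\<phi>_smult)
    then have "T.\<phi> (star T.R c \<otimes>\<^bsub>T.R\<^esub> c) = \<zero>\<^bsub>A\<^esub>" using c(3) by (simp add: scalar_collect)
    then have "c = \<zero>\<^bsub>T.R\<^esub>" by (rule T.\<phi>_faithful[OF c(1)])
    then have "EC T.f1 \<ominus>\<^bsub>T.R\<^esub> complex_of_real T.\<tau> \<odot>\<^bsub>T.R\<^esub> \<one>\<^bsub>T.R\<^esub> = \<zero>\<^bsub>T.R\<^esub>"
      using E1c by (simp add: c_def T.two.L.minus_scalar)
    then show ?thesis by (rule T.two.L.diff_eq_zeroD) (use E1c in auto)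
  qed
  have F_Q: "F x \<in> T.Q2" if x: "x \<in> T.P1" for x
    unfolding F by (intro T.Q2_smult EC_Q T.P2_mult T.P1_P2 x T.f1_P2 T.f2_P2)
  have P1_smult: "c \<odot>\<^bsub>T.L\<^esub> x \<in> T.P1" if "x \<in> T.P1" for c x
    by (rule T.P1I) (use T.P1D[OF that] in \<open>auto simp: T.L.smult_mult_left T.L.smult_mult_right\<close>)
  have G_P: "G w \<in> T.P1" if "w \<in> T.Q2" for w
    unfolding G using P1_smult T.raw_inverse_P1[OF that] by blast
  have FG: "F (G w) = w" if w: "w \<in> T.Q2" for w
  proof -
    have wc: "w \<in> carrier T.R" using T.Q2D(1)[OF w] .
    have g: "T.raw_inverse w \<in> carrier T.L" using T.P1D(1)[OF T.raw_inverse_P1[OF w]] .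
    have wf: "w \<otimes>\<^bsub>T.R\<^esub> T.f1 \<in> T.P2" using T.P2_mult[OF T.Q2_P2[OF w] T.f1_P2] .
    have "T.two.\<iota> (G w) \<otimes>\<^bsub>T.R\<^esub> T.f2 \<otimes>\<^bsub>T.R\<^esub> T.f1 = k \<odot>\<^bsub>T.R\<^esub> (T.two.\<iota> (T.raw_inverse w) \<otimes>\<^bsub>T.R\<^esub> T.f2 \<otimes>\<^bsub>T.R\<^esub> T.f1)"
      unfolding G using g by (simp add: T.two.\<iota>_smult T.two.L.smult_mult_left)
    also have "\<dots> = (k * complex_of_real (T.\<tau> * T.\<tau>)) \<odot>\<^bsub>T.R\<^esub> (w \<otimes>\<^bsub>T.R\<^esub> T.f1)"
      unfolding T.raw_inverse_f2_f1[OF wc] using wc by simp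
    finally have "F (G w) = (k * k * complex_of_real (T.\<tau> * T.\<tau>)) \<odot>\<^bsub>T.R\<^esub> EC (w \<otimes>\<^bsub>T.R\<^esub> T.f1)"
      unfolding F using EC_smult[OF wf] T.Q2D(1)[OF EC_Q[OF wf]] by (simp add: mult.assoc)
    also have "EC (w \<otimes>\<^bsub>T.R\<^esub> T.f1) = complex_of_real T.\<tau> \<odot>\<^bsub>T.R\<^esub> w"
      unfolding EC_left[OF T.f1_P2 w] EC_f1 using wc by (simp add: T.two.L.smult_mult_right)
    also have "(k * k * complex_of_real (T.\<tau> * T.\<tau>)) \<odot>\<^bsub>T.R\<^esub> (complex_of_real T.\<tau> \<odot>\<^bsub>T.R\<^esub> w) = w"
      unfolding kk using wc \<tau>0 by (simp add: power3_eq_cube)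
    finally show ?thesis .
  qed
  have onto: "\<exists>w\<in>T.Q2. G w = x" if x: "x \<in> T.P1" for x
  proof -
    obtain w where w: "w \<in> T.Q2" "T.raw_inverse w = x" using T.raw_inverse_onto[OF x] by blast
    have k0: "k \<noteq> 0" using \<tau>0 by (simp add: k_def)
    have wc: "w \<in> carrier T.R" using T.Q2D(1)[OF w(1)] .
    have "T.raw_inverse ((1 / k) \<odot>\<^bsub>T.R\<^esub> w) = (1 / k) \<odot>\<^bsub>T.L\<^esub> T.raw_inverse w"
      unfolding T.raw_inverse_def using wc by (simp add: T.two.L.smult_mult_left T.two.p_smult)
    then have "G ((1 / k) \<odot>\<^bsub>T.R\<^esub> w) = x" unfolding G w(2) using T.P1D(1)[OF x] k0 by simp
    then show ?thesis using T.Q2_smult[OF w(1)] by blast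
  qed
  have GF: "G (F x) = x" if x: "x \<in> T.P1" for x
    using onto[OF x] FG by metis
  have G_norm: "trace_norm A1 tr1 (G w) = trace_norm A2 tr2 w" if w: "w \<in> T.Q2" for w
  proof -
    have g: "T.raw_inverse w \<in> carrier T.L" using T.P1D(1)[OF T.raw_inverse_P1[OF w]] .
    have wc: "w \<in> carrier T.R" using T.Q2D(1)[OF w] .
    have "cnj k = k" by (simp add: k_def)
    then have "star T.L (G w) \<otimes>\<^bsub>T.L\<^esub> G w = (k * k) \<odot>\<^bsub>T.L\<^esub> (star T.L (T.raw_inverse w) \<otimes>\<^bsub>T.L\<^esub> T.raw_inverse w)"
      unfolding G using g by (simp add: T.L.star_smult T.L.smult_mult_left T.L.smult_mult_right)
    then have "E0 (T.p (star T.L (G w) \<otimes>\<^bsub>T.L\<^esub> G w)) = (k * k) \<odot>\<^bsub>A\<^esub> E0 (T.p (star T.L (T.raw_inverse w) \<otimes>\<^bsub>T.L\<^esub> T.raw_inverse w))"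
      using g by (simp add: T.p_smult T.E_smult)
    also have "\<dots> = T.\<phi> (star T.R w \<otimes>\<^bsub>T.R\<^esub> w)"
      unfolding T.raw_inverse_norm[OF w] kk using wc \<tau>0 by simp
    finally show ?thesis unfolding trace_norm_def A1 A2 tr1 tr2 by simp
  qed
  have "linear_map AA2 BA1 G"
    unfolding linear_map_def AA2 BA1 A1 A2
    using G_P T.Q2D(1) by (auto simp: G T.raw_inverse_def T.two.L.add_mul T.two.L.smult_mult_left T.two.p_add T.two.p_smult
        T.L.scalar_distr mult.commute)
  moreover have "linear_map BA1 AA2 F"
  proof -
    have m: "T.two.\<iota> x \<otimes>\<^bsub>T.R\<^esub> T.f2 \<otimes>\<^bsub>T.R\<^esub> T.f1 \<in> T.P2" if "x \<in> T.P1" for x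
      by (intro T.P2_mult T.P1_P2 that T.f1_P2 T.f2_P2)
    have add: "F (x \<oplus>\<^bsub>T.L\<^esub> y) = F x \<oplus>\<^bsub>T.R\<^esub> F y" if xy: "x \<in> T.P1" "y \<in> T.P1" for x y
      using EC_add[OF m[OF xy(1)] m[OF xy(2)]] T.P1D(1)[OF xy(1)] T.P1D(1)[OF xy(2)]
        T.Q2D(1)[OF EC_Q[OF m[OF xy(1)]]] T.Q2D(1)[OF EC_Q[OF m[OF xy(2)]]]
      by (simp add: F T.two.\<iota>_add T.two.L.add_mul T.two.L.scalar_distr)
    have smult: "F (c \<odot>\<^bsub>T.L\<^esub> x) = c \<odot>\<^bsub>T.R\<^esub> F x" if x: "x \<in> T.P1" for c x
      using EC_smult[OF m[OF x], of c] T.P1D(1)[OF x] T.Q2D(1)[OF EC_Q[OF m[OF x]]]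
      by (simp add: F T.two.\<iota>_smult T.two.L.smult_mult_left mult.commute)
    show ?thesis unfolding linear_map_def AA2 BA1 A1 A2 using F_Q add smult by auto
  qed
  moreover have "trace_norm A2 tr2 (F x) = trace_norm A1 tr1 x" if "x \<in> T.P1" for x
    using G_norm[OF F_Q[OF that]] GF[OF that] by simp
  ultimately show ?thesis
    unfolding linear_isometry_def using G_norm GF FG by (simp add: AA2 BA1)
qed

end
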